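(* Let $\mathbf{k}$ be a commutative ring, $\delta\in\mathbf{k}$, $B=B^{\mathbf{k},\delta}$ the Brauer category, and let $r\ge 0$ be an integer. Then the following conditions are equivalent. (1) $\delta$ is non-singular at ranks $\preceq r$. (2) The pair $(B^+_{\preceq r},B^-_{\preceq r})$ gives a Morita equivalence between $B_{\preceq r}$ and $\mathbb{S}_{\preceq r}$. (3) The restriction $L_{\preceq r}:B_{\preceq r}\to mB_{\preceq r}$ of the linear functor $L:B\to mB$ is an isomorphism. Moreover, if $\mathbf{k}$ is a field of characteristic $0$, then (1), (2) and (3) are equivalent to: (4) $B_{\preceq r}$ and $\mathbb{S}_{\preceq r}$ are Morita equivalent.
   Context: **Brauer diagrams.** For integers $p,q\ge0$, a $(p,q)$-Brauer diagram is a partition of $[p]^+\sqcup[q]^-=\{1^+,\dots,p^+\}\sqcup\{1^-,\dots,q^-\}$ into unordered pairs ($i^+$ are top points, $i^-$ bottom points); $\mathbb{B}(p,q)$ is the set of these. A diagram is upward if it contains no pair of two top points, downward if it contains no pair of two bottom points, level if both; it is monotone if $(i-k)(j-l)>0$ for any two distinct pairs $\{i^+,j^-\},\{k^+,l^-\}$ in it. $\mathbb{B}^+,\mathbb{B}^-,\mathbb{B}^0$ denote the sets of upward, downward, level diagrams, and $\mathbb{B}^{\pm,m}$ the monotone ones in $\mathbb{B}^\pm$. For $f\in\mathbb{B}(p,q)$, $\overline f\in\mathbb{B}(q,p)$ is obtained by exchanging $i^\pm\leftrightarrow i^\mp$. Write $p\preceq q$ iff $p\le q$ and $q-p$ is even.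 **Brauer category $B=B^{\mathbf{k},\delta}$.** Objects: non-negative integers; $B(p,q)$ is the free $\mathbf{k}$-module on $\mathbb{B}(p,q)$. For $f\in\mathbb{B}(q,r)$, $g\in\mathbb{B}(p,q)$, place $g$ above $f$, identify the bottom points of $g$ with the top points of $f$; let $l(f,g)$ be the number of closed loops and $f\hat\circ g\in\mathbb{B}(p,r)$ the diagram after deleting loops; $f\circ g=\delta^{l(f,g)}f\hat\circ g$. $B^\pm$ is the wide subcategory with hom-spaces spanned by $\mathbb{B}^\pm(p,q)$. $\mathbb{S}$ is the wide subcategory with $\mathbb{S}(p,q)=0$ for $p\ne q$ and $\mathbb{S}(p,p)=\mathbb{S}_p=\mathbf{k}[\mathfrak{S}_p]$ spanned by $\mathbb{B}^0(p,p)$ ($\sigma\in\mathfrak{S}_p$ corresponds to $\{\{i^+,\sigma(i)^-\}\}_i$). Composition gives an isomorphism $\bigoplus_s B^+(s,q)\otimes_{\mathbb{S}_s}B^-(p,s)\cong B(p,q)$, and every Brauer diagram is uniquely $f^+\hat\circ f^0\hat\circ f^-$ with $f^+\in\mathbb{B}^{+,m}(t,q)$, $f^0\in\mathbb{B}^0(t,t)$, $f^-\in\mathbb{B}^{-,m}(p,t)$ for some $t$. **Truncations.** The subscript $\preceq r$ denotes restriction to the objects $q$ with $q\preceq r$ (full subcategory for $B$, $mB$, $\mathbb{S}$; similarly $B^\pm_{\preceq r}$). **Matrix Brauer category $mB$.** Same objects and same hom-modules as $B$; composition of $f=f^+f^0f^-$ ($f^-\in\mathbb{B}^{-,m}(q,t)$)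 and $g=g^+g^0g^-$ ($g^+\in\mathbb{B}^{+,m}(s,q)$) is $f^+(f^0g^0)g^-$ if $t=s$ and $\overline{f^-}=g^+$, and $0$ otherwise; the identity of $p$ is $\sum_{s\preceq p}\sum_{f\in\mathbb{B}^{+,m}(s,p)}f\,\overline f$. **Functor $L$.** $L:B\to mB$ is the identity on objects and for $g\in B(q,q')$, $L(g)=\sum_{p\preceq q'}\sum_{h\in\mathbb{B}^{+,m}(p,q')}h\circ\pi^-(\overline h\circ g)$ (compositions in $B$), where $\pi^-:B(q,p)\to B^-(q,p)$ is the projection killing non-downward diagrams. **Non-singularity.** For $p\preceq q$, the pairing $b_{p,q}:B^-(q,p)\otimes_{\mathbb{S}_q}B^+(p,q)\to\mathbb{S}_p$ sends $g\otimes f$ (diagrams) to $g\circ f$ if $g\hat\circ f$ is level and to $0$ otherwise. Working over $\mathbb{Z}[x]$ with parameter $x$, let $A_{p,q}=(b_{p,q}(\overline f\otimes g))_{f,g\in\mathbb{B}^{+,m}(p,q)}\in M_n(\mathbb{Z}[x][\mathfrak{S}_p])$, $n=|\mathbb{B}^{+,m}(p,q)|$, let $\iota:M_n(\mathbb{Z}[x][\mathfrak{S}_p])\hookrightarrow M_{n\,p!}(\mathbb{Z}[x])$ be induced by the left regular representation, and $f_{p,q}(x)=\det\iota(A_{p,q})\in\mathbb{Z}[x]$. $\delta\in\mathbf{k}$ is non-singular at rank $(p,q)$ if $f_{p,q}(\delta)$ is invertible in $\mathbf{k}$, and non-singular at ranks $\preceq r$ if this holds for all $p\preceq q\preceq r$.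 **Morita equivalence.** In (2): $B^+_{\preceq r}$ is a left $B_{\preceq r}$-module, $g\in B(q,q')$ acting on $f\in B^+(p,q)$ by the projection of $g\circ f$ to $B^+(p,q')$ killing non-upward diagrams; $B^-_{\preceq r}$ is a right $B_{\preceq r}$-module, $f\in B^-(q,s)$ acted on by $g\in B(p,q)$ being the projection of $f\circ g$ to $B^-(p,s)$ killing non-downward diagrams. "The pair gives a Morita equivalence" means $B^+_{\preceq r}\otimes_{\mathbb{S}_{\preceq r}}B^-_{\preceq r}\cong B_{\preceq r}$ as $B_{\preceq r}$-bimodules and $B^-_{\preceq r}\otimes_{B_{\preceq r}}B^+_{\preceq r}\cong\mathbb{S}_{\preceq r}$ as $\mathbb{S}_{\preceq r}$-bimodules (tensor products over linear categories, using these actions). In (4): two linear categories are Morita equivalent if their categories of modules (linear functors to $\mathbf{k}$-modules) are equivalent as linear categories. *)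

theory Defs
  imports
    "HOL-Library.Disjoint_Sets"
    "HOL-Library.FuncSet"
    "HOL-Algebra.Module"
    "HOL-Algebra.AbelCoset"
    "Jordan_Normal_Form.Determinant"
begin

section \<open>Modules over a commutative ring\<close>

text \<open>
  The ground ring is a type of class \<^class>\<open>comm_ring_1\<close>, turned into a ring record so that modules
  over it are those of \<^theory>\<open>HOL-Algebra.Module\<close>.  The multiplicative components of a module
  record play no role.
\<close>

definition ground_ring :: "'k::comm_ring_1 ring" where
  "ground_ring = \<lparr>carrier = UNIV, monoid.mult = (*), one = 1, zero = 0, add = (+)\<rparr>"

abbreviation is_module :: "('k::comm_ring_1, 'a) module \<Rightarrow> bool" where
  "is_module M \<equiv> Module.module (ground_ring :: 'k ring) M"

definition linear_maps :: "('k::comm_ring_1, 'a) module \<Rightarrow> ('k, 'b) module \<Rightarrow> ('a \<Rightarrow> 'b) set" where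
  "linear_maps M N = {f. f \<in> carrier M \<rightarrow> carrier N \<and>
     (\<forall>x\<in>carrier M. \<forall>y\<in>carrier M. f (x \<oplus>\<^bsub>M\<^esub> y) = f x \<oplus>\<^bsub>N\<^esub> f y) \<and>
     (\<forall>c. \<forall>x\<in>carrier M. f (c \<odot>\<^bsub>M\<^esub> x) = c \<odot>\<^bsub>N\<^esub> f x)}"

definition supp :: "('x \<Rightarrow> 'k::zero) \<Rightarrow> 'x set" where
  "supp F = {x. F x \<noteq> 0}"

definition free_module :: "'x set \<Rightarrow> ('k::comm_ring_1, 'x \<Rightarrow> 'k) module" where
  "free_module X = \<lparr>carrier = {F. finite (supp F) \<and> supp F \<subseteq> X},
     monoid.mult = undefined, one = undefined,
     zero = (\<lambda>_. 0), add = (\<lambda>F G x. F x + G x), module.smult = (\<lambda>c F x. c * F x)\<rparr>"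

definition basis_vec :: "'x \<Rightarrow> 'x \<Rightarrow> 'k::comm_ring_1" where
  "basis_vec x = (\<lambda>y. if y = x then 1 else 0)"

text \<open>The linear map of free modules induced by a map of bases.\<close>

definition push :: "('x \<Rightarrow> 'y) \<Rightarrow> ('x \<Rightarrow> 'k::comm_ring_1) \<Rightarrow> 'y \<Rightarrow> 'k" where
  "push \<phi> F = (\<lambda>y. \<Sum>x | x \<in> supp F \<and> \<phi> x = y. F x)"

definition submodule_span :: "('k::comm_ring_1, 'a) module \<Rightarrow> 'a set \<Rightarrow> 'a set" where
  "submodule_span M X = \<Inter>{H. submodule H (ground_ring :: 'k ring) M \<and> X \<subseteq> H}"

definition quotient_module :: "('k::comm_ring_1, 'a) module \<Rightarrow> 'a set \<Rightarrow> ('k, 'a set) module" where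
  "quotient_module M H = \<lparr>carrier = a_rcosets\<^bsub>M\<^esub> H,
     monoid.mult = undefined, one = undefined,
     zero = H, add = (\<lambda>A B. A <+>\<^bsub>M\<^esub> B),
     module.smult = (\<lambda>c A. \<Union>x\<in>A. H +>\<^bsub>M\<^esub> (c \<odot>\<^bsub>M\<^esub> x))\<rparr>"


section \<open>Linear categories\<close>

text \<open>\<open>Comp C x y z g f\<close> is the composite of \<open>f : x \<rightarrow> y\<close> followed by \<open>g : y \<rightarrow> z\<close>.\<close>

record ('o, 'a, 'k) lincat =
  Obj :: "'o set"
  Hom :: "'o \<Rightarrow> 'o \<Rightarrow> ('k, 'a) module"
  Comp :: "'o \<Rightarrow> 'o \<Rightarrow> 'o \<Rightarrow> 'a \<Rightarrow> 'a \<Rightarrow> 'a"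
  Ident :: "'o \<Rightarrow> 'a"

abbreviation Arr :: "('o, 'a, 'k) lincat \<Rightarrow> 'o \<Rightarrow> 'o \<Rightarrow> 'a set" where
  "Arr C x y \<equiv> carrier (Hom C x y)"

locale linear_category =
  fixes C :: "('o, 'a, 'k::comm_ring_1) lincat"
  assumes Hom_module: "\<lbrakk>x \<in> Obj C; y \<in> Obj C\<rbrakk> \<Longrightarrow> is_module (Hom C x y)"
    and Ident_in: "x \<in> Obj C \<Longrightarrow> Ident C x \<in> Arr C x x"
    and Comp_linear_right:
      "\<lbrakk>x \<in> Obj C; y \<in> Obj C; z \<in> Obj C; g \<in> Arr C y z\<rbrakk>
        \<Longrightarrow> (\<lambda>f. Comp C x y z g f) \<in> linear_maps (Hom C x y) (Hom C x z)"
    and Comp_linear_left: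
      "\<lbrakk>x \<in> Obj C; y \<in> Obj C; z \<in> Obj C; f \<in> Arr C x y\<rbrakk>
        \<Longrightarrow> (\<lambda>g. Comp C x y z g f) \<in> linear_maps (Hom C y z) (Hom C x z)"
    and Comp_assoc:
      "\<lbrakk>w \<in> Obj C; x \<in> Obj C; y \<in> Obj C; z \<in> Obj C;
        f \<in> Arr C w x; g \<in> Arr C x y; h \<in> Arr C y z\<rbrakk>
        \<Longrightarrow> Comp C w y z h (Comp C w x y g f) = Comp C w x z (Comp C x y z h g) f"
    and Comp_Ident_left:
      "\<lbrakk>x \<in> Obj C; y \<in> Obj C; f \<in> Arr C x y\<rbrakk> \<Longrightarrow> Comp C x y y (Ident C y) f = f"
    and Comp_Ident_right:
      "\<lbrakk>x \<in> Obj C; y \<in> Obj C; f \<in> Arr C x y\<rbrakk> \<Longrightarrow> Comp C x x y f (Ident C x) = f"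

definition full_subcategory :: "'o set \<Rightarrow> ('o, 'a, 'k) lincat \<Rightarrow> ('o, 'a, 'k) lincat" where
  "full_subcategory X C = C\<lparr>Obj := Obj C \<inter> X\<rparr>"

record ('o, 'a, 'p, 'b) linfun =
  Fobj :: "'o \<Rightarrow> 'p"
  Fmap :: "'o \<Rightarrow> 'o \<Rightarrow> 'a \<Rightarrow> 'b"

locale linear_functor = C: linear_category C + D: linear_category D
  for C :: "('o, 'a, 'k::comm_ring_1) lincat" and D :: "('p, 'b, 'k) lincat" +
  fixes F :: "('o, 'a, 'p, 'b) linfun"
  assumes Fobj_in: "x \<in> Obj C \<Longrightarrow> Fobj F x \<in> Obj D"
    and Fmap_linear:
      "\<lbrakk>x \<in> Obj C; y \<in> Obj C\<rbrakk>
        \<Longrightarrow> Fmap F x y \<in> linear_maps (Hom C x y) (Hom D (Fobj F x) (Fobj F y))"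
    and Fmap_Ident: "x \<in> Obj C \<Longrightarrow> Fmap F x x (Ident C x) = Ident D (Fobj F x)"
    and Fmap_Comp:
      "\<lbrakk>x \<in> Obj C; y \<in> Obj C; z \<in> Obj C; f \<in> Arr C x y; g \<in> Arr C y z\<rbrakk>
        \<Longrightarrow> Fmap F x z (Comp C x y z g f) =
            Comp D (Fobj F x) (Fobj F y) (Fobj F z) (Fmap F y z g) (Fmap F x y f)"

definition id_functor :: "('o, 'a, 'o, 'a) linfun" where
  "id_functor = \<lparr>Fobj = (\<lambda>x. x), Fmap = (\<lambda>x y f. f)\<rparr>"

definition comp_functor ::
  "('p, 'b, 'q, 'c) linfun \<Rightarrow> ('o, 'a, 'p, 'b) linfun \<Rightarrow> ('o, 'a, 'q, 'c) linfun" where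
  "comp_functor G F = \<lparr>Fobj = (\<lambda>x. Fobj G (Fobj F x)),
     Fmap = (\<lambda>x y f. Fmap G (Fobj F x) (Fobj F y) (Fmap F x y f))\<rparr>"

definition functor_eq_on ::
  "('o, 'a, 'k) lincat \<Rightarrow> ('o, 'a, 'p, 'b) linfun \<Rightarrow> ('o, 'a, 'p, 'b) linfun \<Rightarrow> bool" where
  "functor_eq_on C F G \<longleftrightarrow>
     (\<forall>x\<in>Obj C. Fobj F x = Fobj G x) \<and>
     (\<forall>x\<in>Obj C. \<forall>y\<in>Obj C. \<forall>f\<in>Arr C x y. Fmap F x y f = Fmap G x y f)"

definition category_isomorphism ::
  "('o, 'a, 'k::comm_ring_1) lincat \<Rightarrow> ('p, 'b, 'k) lincat \<Rightarrow> ('o, 'a, 'p, 'b) linfun \<Rightarrow> bool" where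
  "category_isomorphism C D F \<longleftrightarrow> linear_functor C D F \<and>
     (\<exists>G. linear_functor D C G \<and>
       functor_eq_on C (comp_functor G F) id_functor \<and>
       functor_eq_on D (comp_functor F G) id_functor)"

text \<open>
  Components of a natural transformation are fixed to be \<^const>\<open>undefined\<close> off \<^term>\<open>Obj C\<close>,
  so that equality of natural transformations is equality of functions.
\<close>

definition nat_trans ::
  "('o, 'a, 'k) lincat \<Rightarrow> ('p, 'b, 'k) lincat \<Rightarrow> ('o, 'a, 'p, 'b) linfun \<Rightarrow>
   ('o, 'a, 'p, 'b) linfun \<Rightarrow> ('o \<Rightarrow> 'b) set" where
  "nat_trans C D F G = {\<eta> \<in> (\<Pi>\<^sub>E x\<in>Obj C. Arr D (Fobj F x) (Fobj G x)).
     \<forall>x\<in>Obj C. \<forall>y\<in>Obj C. \<forall>f\<in>Arr C x y.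
       Comp D (Fobj F x) (Fobj F y) (Fobj G y) (\<eta> y) (Fmap F x y f) =
       Comp D (Fobj F x) (Fobj G x) (Fobj G y) (Fmap G x y f) (\<eta> x)}"

definition iso_arrow :: "('o, 'a, 'k) lincat \<Rightarrow> 'o \<Rightarrow> 'o \<Rightarrow> 'a \<Rightarrow> bool" where
  "iso_arrow C x y f \<longleftrightarrow> f \<in> Arr C x y \<and>
     (\<exists>g\<in>Arr C y x. Comp C x y x g f = Ident C x \<and> Comp C y x y f g = Ident C y)"

definition nat_isomorphic ::
  "('o, 'a, 'k) lincat \<Rightarrow> ('p, 'b, 'k) lincat \<Rightarrow> ('o, 'a, 'p, 'b) linfun \<Rightarrow>
   ('o, 'a, 'p, 'b) linfun \<Rightarrow> bool" where
  "nat_isomorphic C D F G \<longleftrightarrow>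
     (\<exists>\<eta>\<in>nat_trans C D F G. \<forall>x\<in>Obj C. iso_arrow D (Fobj F x) (Fobj G x) (\<eta> x))"

definition linearly_equivalent ::
  "('o, 'a, 'k::comm_ring_1) lincat \<Rightarrow> ('p, 'b, 'k) lincat \<Rightarrow> bool" where
  "linearly_equivalent C D \<longleftrightarrow> (\<exists>F G. linear_functor C D F \<and> linear_functor D C G \<and>
     nat_isomorphic C C (comp_functor G F) id_functor \<and>
     nat_isomorphic D D (comp_functor F G) id_functor)"

text \<open>
  Two functors that agree on \<open>C\<close> but are distinct as records are distinct objects here; they
  are naturally isomorphic through identities.
\<close>

definition functor_category ::
  "('o, 'a, 'k::comm_ring_1) lincat \<Rightarrow> ('p, 'b, 'k) lincat \<Rightarrow>
   (('o, 'a, 'p, 'b) linfun, 'o \<Rightarrow> 'b, 'k) lincat" where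
  "functor_category C D = \<lparr>
     Obj = {F. linear_functor C D F},
     Hom = (\<lambda>F G. \<lparr>carrier = nat_trans C D F G,
       monoid.mult = undefined, one = undefined,
       zero = (\<lambda>x\<in>Obj C. \<zero>\<^bsub>Hom D (Fobj F x) (Fobj G x)\<^esub>),
       add = (\<lambda>\<eta> \<theta>. \<lambda>x\<in>Obj C. \<eta> x \<oplus>\<^bsub>Hom D (Fobj F x) (Fobj G x)\<^esub> \<theta> x),
       module.smult = (\<lambda>c \<eta>. \<lambda>x\<in>Obj C. c \<odot>\<^bsub>Hom D (Fobj F x) (Fobj G x)\<^esub> \<eta> x)\<rparr>),
     Comp = (\<lambda>F G H \<theta> \<eta>. \<lambda>x\<in>Obj C. Comp D (Fobj F x) (Fobj G x) (Fobj H x) (\<theta> x) (\<eta> x)),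
     Ident = (\<lambda>F. \<lambda>x\<in>Obj C. Ident D (Fobj F x))\<rparr>"

text \<open>The linear category of modules whose carriers are subsets of the type \<^typ>\<open>'u\<close>.\<close>

definition module_category :: "(('k::comm_ring_1, 'u) module, 'u \<Rightarrow> 'u, 'k) lincat" where
  "module_category = \<lparr>
     Obj = {M. is_module M},
     Hom = (\<lambda>M N. \<lparr>carrier = linear_maps M N \<inter> extensional (carrier M),
       monoid.mult = undefined, one = undefined,
       zero = (\<lambda>x\<in>carrier M. \<zero>\<^bsub>N\<^esub>),
       add = (\<lambda>f g. \<lambda>x\<in>carrier M. f x \<oplus>\<^bsub>N\<^esub> g x),
       module.smult = (\<lambda>c f. \<lambda>x\<in>carrier M. c \<odot>\<^bsub>N\<^esub> f x)\<rparr>),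
     Comp = (\<lambda>L M N g f. compose (carrier L) g f),
     Ident = (\<lambda>M. \<lambda>x\<in>carrier M. x)\<rparr>"

text \<open>
  Morita equivalence, with the type \<^typ>\<open>'u\<close> as the universe in which the values of modules over
  the linear categories live.
\<close>

definition morita_equivalent ::
  "'u itself \<Rightarrow> ('o, 'a, 'k::comm_ring_1) lincat \<Rightarrow> ('p, 'b, 'k) lincat \<Rightarrow> bool" where
  "morita_equivalent _ C D \<longleftrightarrow>
     linearly_equivalent
       (functor_category C (module_category :: (('k, 'u) module, 'u \<Rightarrow> 'u, 'k) lincat))
       (functor_category D (module_category :: (('k, 'u) module, 'u \<Rightarrow> 'u, 'k) lincat))"


section \<open>Bimodules and their tensor products\<close>

text \<open>
  A \<open>C\<close>-\<open>D\<close>-bimodule has values \<open>BMod M x y\<close> for \<open>x\<close> in \<open>D\<close> and \<open>y\<close> in \<open>C\<close>; an arrow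
  \<open>g : y \<rightarrow> y'\<close> of \<open>C\<close> acts on the left by
  \<open>Lact M x y y' g : BMod M x y \<rightarrow> BMod M x y'\<close>, and an arrow \<open>h : x' \<rightarrow> x\<close> of \<open>D\<close> acts on
  the right by \<open>\<lambda>m. Ract M x' x y m h : BMod M x y \<rightarrow> BMod M x' y\<close>.
\<close>

record ('o, 'a, 'p, 'b, 'k, 'm) bimod =
  BMod :: "'p \<Rightarrow> 'o \<Rightarrow> ('k, 'm) module"
  Lact :: "'p \<Rightarrow> 'o \<Rightarrow> 'o \<Rightarrow> 'a \<Rightarrow> 'm \<Rightarrow> 'm"
  Ract :: "'p \<Rightarrow> 'p \<Rightarrow> 'o \<Rightarrow> 'm \<Rightarrow> 'b \<Rightarrow> 'm"

locale bimodule = C: linear_category C + D: linear_category D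
  for C :: "('o, 'a, 'k::comm_ring_1) lincat" and D :: "('p, 'b, 'k) lincat" +
  fixes M :: "('o, 'a, 'p, 'b, 'k, 'm) bimod"
  assumes BMod_module: "\<lbrakk>x \<in> Obj D; y \<in> Obj C\<rbrakk> \<Longrightarrow> is_module (BMod M x y)"
    and Lact_linear_right:
      "\<lbrakk>x \<in> Obj D; y \<in> Obj C; y' \<in> Obj C; g \<in> Arr C y y'\<rbrakk>
        \<Longrightarrow> (\<lambda>m. Lact M x y y' g m) \<in> linear_maps (BMod M x y) (BMod M x y')"
    and Lact_linear_left:
      "\<lbrakk>x \<in> Obj D; y \<in> Obj C; y' \<in> Obj C; m \<in> carrier (BMod M x y)\<rbrakk>
        \<Longrightarrow> (\<lambda>g. Lact M x y y' g m) \<in> linear_maps (Hom C y y') (BMod M x y')"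
    and Ract_linear_left:
      "\<lbrakk>x \<in> Obj D; x' \<in> Obj D; y \<in> Obj C; h \<in> Arr D x' x\<rbrakk>
        \<Longrightarrow> (\<lambda>m. Ract M x' x y m h) \<in> linear_maps (BMod M x y) (BMod M x' y)"
    and Ract_linear_right:
      "\<lbrakk>x \<in> Obj D; x' \<in> Obj D; y \<in> Obj C; m \<in> carrier (BMod M x y)\<rbrakk>
        \<Longrightarrow> (\<lambda>h. Ract M x' x y m h) \<in> linear_maps (Hom D x' x) (BMod M x' y)"
    and Lact_Ident:
      "\<lbrakk>x \<in> Obj D; y \<in> Obj C; m \<in> carrier (BMod M x y)\<rbrakk>
        \<Longrightarrow> Lact M x y y (Ident C y) m = m"
    and Ract_Ident:
      "\<lbrakk>x \<in> Obj D; y \<in> Obj C; m \<in> carrier (BMod M x y)\<rbrakk>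
        \<Longrightarrow> Ract M x x y m (Ident D x) = m"
    and Lact_Comp:
      "\<lbrakk>x \<in> Obj D; y \<in> Obj C; y' \<in> Obj C; y'' \<in> Obj C;
        g \<in> Arr C y y'; g' \<in> Arr C y' y''; m \<in> carrier (BMod M x y)\<rbrakk>
        \<Longrightarrow> Lact M x y y'' (Comp C y y' y'' g' g) m = Lact M x y' y'' g' (Lact M x y y' g m)"
    and Ract_Comp:
      "\<lbrakk>x \<in> Obj D; x' \<in> Obj D; x'' \<in> Obj D; y \<in> Obj C;
        h \<in> Arr D x' x; h' \<in> Arr D x'' x'; m \<in> carrier (BMod M x y)\<rbrakk>
        \<Longrightarrow> Ract M x'' x y m (Comp D x'' x' x h h') = Ract M x'' x' y (Ract M x' x y m h) h'"
    and Lact_Ract: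
      "\<lbrakk>x \<in> Obj D; x' \<in> Obj D; y \<in> Obj C; y' \<in> Obj C;
        g \<in> Arr C y y'; h \<in> Arr D x' x; m \<in> carrier (BMod M x y)\<rbrakk>
        \<Longrightarrow> Ract M x' x y' (Lact M x y y' g m) h = Lact M x' y y' g (Ract M x' x y m h)"

definition regular_bimodule :: "('o, 'a, 'k) lincat \<Rightarrow> ('o, 'a, 'o, 'a, 'k, 'a) bimod" where
  "regular_bimodule C = \<lparr>BMod = Hom C,
     Lact = (\<lambda>x y y' g m. Comp C x y y' g m),
     Ract = (\<lambda>x' x y m h. Comp C x' x y m h)\<rparr>"

text \<open>
  The value at \<open>(x, z)\<close> of \<open>M \<otimes>\<^sub>D N\<close>, for a \<open>C\<close>-\<open>D\<close>-bimodule \<open>M\<close> and a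
  \<open>D\<close>-\<open>E\<close>-bimodule \<open>N\<close>, is the quotient of the free module on all symbols \<open>(y, m, n)\<close>
  (standing for \<open>m \<otimes> n\<close> with \<open>m \<in> M(y, z)\<close>, \<open>n \<in> N(x, y)\<close>) by bilinearity and
  \<open>m g \<otimes> n = m \<otimes> g n\<close>.
\<close>

definition tensor_symbols ::
  "('p, 'b, 'k) lincat \<Rightarrow> ('o, 'a, 'p, 'b, 'k, 'm) bimod \<Rightarrow> ('p, 'b, 'q, 'c, 'k, 'n) bimod \<Rightarrow>
   'q \<Rightarrow> 'o \<Rightarrow> ('p \<times> 'm \<times> 'n) set" where
  "tensor_symbols D M N x z =
     {(y, m, n). y \<in> Obj D \<and> m \<in> carrier (BMod M y z) \<and> n \<in> carrier (BMod N x y)}"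

definition tensor_relations ::
  "('p, 'b, 'k::comm_ring_1) lincat \<Rightarrow> ('o, 'a, 'p, 'b, 'k, 'm) bimod \<Rightarrow>
   ('p, 'b, 'q, 'c, 'k, 'n) bimod \<Rightarrow> 'q \<Rightarrow> 'o \<Rightarrow> ('p \<times> 'm \<times> 'n \<Rightarrow> 'k) set" where
  "tensor_relations D M N x z =
     {(\<lambda>i. basis_vec (y, m \<oplus>\<^bsub>BMod M y z\<^esub> m', n) i - basis_vec (y, m, n) i - basis_vec (y, m', n) i)
        | y m m' n. y \<in> Obj D \<and> m \<in> carrier (BMod M y z) \<and> m' \<in> carrier (BMod M y z) \<and>
            n \<in> carrier (BMod N x y)} \<union>
     {(\<lambda>i. basis_vec (y, m, n \<oplus>\<^bsub>BMod N x y\<^esub> n') i - basis_vec (y, m, n) i - basis_vec (y, m, n') i)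
        | y m n n'. y \<in> Obj D \<and> m \<in> carrier (BMod M y z) \<and> n \<in> carrier (BMod N x y) \<and>
            n' \<in> carrier (BMod N x y)} \<union>
     {(\<lambda>i. basis_vec (y, c \<odot>\<^bsub>BMod M y z\<^esub> m, n) i - c * basis_vec (y, m, n) i)
        | y c m n. y \<in> Obj D \<and> m \<in> carrier (BMod M y z) \<and> n \<in> carrier (BMod N x y)} \<union>
     {(\<lambda>i. basis_vec (y, m, c \<odot>\<^bsub>BMod N x y\<^esub> n) i - c * basis_vec (y, m, n) i)
        | y c m n. y \<in> Obj D \<and> m \<in> carrier (BMod M y z) \<and> n \<in> carrier (BMod N x y)} \<union>
     {(\<lambda>i. basis_vec (y, Ract M y y' z m g, n) i - basis_vec (y', m, Lact N x y y' g n) i)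
        | y y' g m n. y \<in> Obj D \<and> y' \<in> Obj D \<and> g \<in> Arr D y y' \<and>
            m \<in> carrier (BMod M y' z) \<and> n \<in> carrier (BMod N x y)}"

definition tensor_kernel ::
  "('p, 'b, 'k::comm_ring_1) lincat \<Rightarrow> ('o, 'a, 'p, 'b, 'k, 'm) bimod \<Rightarrow>
   ('p, 'b, 'q, 'c, 'k, 'n) bimod \<Rightarrow> 'q \<Rightarrow> 'o \<Rightarrow> ('p \<times> 'm \<times> 'n \<Rightarrow> 'k) set" where
  "tensor_kernel D M N x z =
     submodule_span (free_module (tensor_symbols D M N x z)) (tensor_relations D M N x z)"

text \<open>On cosets, \<open>g (m \<otimes> n) h = g m \<otimes> n h\<close>.\<close>

definition tensor_bimodule ::
  "('p, 'b, 'k::comm_ring_1) lincat \<Rightarrow> ('o, 'a, 'p, 'b, 'k, 'm) bimod \<Rightarrow>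
   ('p, 'b, 'q, 'c, 'k, 'n) bimod \<Rightarrow> ('o, 'a, 'q, 'c, 'k, ('p \<times> 'm \<times> 'n \<Rightarrow> 'k) set) bimod" where
  "tensor_bimodule D M N = \<lparr>
     BMod = (\<lambda>x z. quotient_module (free_module (tensor_symbols D M N x z)) (tensor_kernel D M N x z)),
     Lact = (\<lambda>x z z' g A. \<Union>F\<in>A. tensor_kernel D M N x z'
       +>\<^bsub>free_module (tensor_symbols D M N x z')\<^esub> push (\<lambda>(y, m, n). (y, Lact M y z z' g m, n)) F),
     Ract = (\<lambda>x' x z A h. \<Union>F\<in>A. tensor_kernel D M N x' z
       +>\<^bsub>free_module (tensor_symbols D M N x' z)\<^esub> push (\<lambda>(y, m, n). (y, m, Ract N x' x y n h)) F)\<rparr>"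

definition bimodule_isomorphic ::
  "('o, 'a, 'k::comm_ring_1) lincat \<Rightarrow> ('p, 'b, 'k) lincat \<Rightarrow> ('o, 'a, 'p, 'b, 'k, 'm) bimod \<Rightarrow>
   ('o, 'a, 'p, 'b, 'k, 'n) bimod \<Rightarrow> bool" where
  "bimodule_isomorphic C D M N \<longleftrightarrow> (\<exists>\<Phi>.
     (\<forall>x\<in>Obj D. \<forall>y\<in>Obj C. \<Phi> x y \<in> linear_maps (BMod M x y) (BMod N x y) \<and>
        bij_betw (\<Phi> x y) (carrier (BMod M x y)) (carrier (BMod N x y))) \<and>
     (\<forall>x\<in>Obj D. \<forall>y\<in>Obj C. \<forall>y'\<in>Obj C. \<forall>g\<in>Arr C y y'. \<forall>m\<in>carrier (BMod M x y).
        \<Phi> x y' (Lact M x y y' g m) = Lact N x y y' g (\<Phi> x y m)) \<and>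
     (\<forall>x\<in>Obj D. \<forall>x'\<in>Obj D. \<forall>y\<in>Obj C. \<forall>h\<in>Arr D x' x. \<forall>m\<in>carrier (BMod M x y).
        \<Phi> x' y (Ract M x' x y m h) = Ract N x' x y (\<Phi> x y m) h))"

definition gives_morita_equivalence ::
  "('o, 'a, 'k::comm_ring_1) lincat \<Rightarrow> ('p, 'b, 'k) lincat \<Rightarrow> ('o, 'a, 'p, 'b, 'k, 'm) bimod \<Rightarrow>
   ('p, 'b, 'o, 'a, 'k, 'n) bimod \<Rightarrow> bool" where
  "gives_morita_equivalence C D M N \<longleftrightarrow> bimodule C D M \<and> bimodule D C N \<and>
     bimodule_isomorphic C C (tensor_bimodule D M N) (regular_bimodule C) \<and>
     bimodule_isomorphic D D (tensor_bimodule C N M) (regular_bimodule D)"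


section \<open>Brauer diagrams\<close>

datatype point = Top nat | Bot nat

type_synonym diagram = "point set set"

definition brauer :: "nat \<Rightarrow> nat \<Rightarrow> diagram set" where
  "brauer p q = {d. partition_on (Top ` {1..p} \<union> Bot ` {1..q}) d \<and> (\<forall>e\<in>d. card e = 2)}"

definition upward :: "diagram \<Rightarrow> bool" where
  "upward d \<longleftrightarrow> (\<forall>i j. {Top i, Top j} \<notin> d)"

definition downward :: "diagram \<Rightarrow> bool" where
  "downward d \<longleftrightarrow> (\<forall>i j. {Bot i, Bot j} \<notin> d)"

definition monotone_diagram :: "diagram \<Rightarrow> bool" where
  "monotone_diagram d \<longleftrightarrow>
     (\<forall>i j k l. {Top i, Bot j} \<in> d \<and> {Top k, Bot l} \<in> d \<and> {Top i, Bot j} \<noteq> {Top k, Bot l} \<longrightarrow>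
        (int i - int k) * (int j - int l) > 0)"

definition brauer_up :: "nat \<Rightarrow> nat \<Rightarrow> diagram set" where
  "brauer_up p q = {d \<in> brauer p q. upward d}"

definition brauer_down :: "nat \<Rightarrow> nat \<Rightarrow> diagram set" where
  "brauer_down p q = {d \<in> brauer p q. downward d}"

definition brauer_level :: "nat \<Rightarrow> nat \<Rightarrow> diagram set" where
  "brauer_level p q = {d \<in> brauer p q. upward d \<and> downward d}"

definition brauer_up_mono :: "nat \<Rightarrow> nat \<Rightarrow> diagram set" where
  "brauer_up_mono p q = {d \<in> brauer_up p q. monotone_diagram d}"

definition brauer_down_mono :: "nat \<Rightarrow> nat \<Rightarrow> diagram set" where
  "brauer_down_mono p q = {d \<in> brauer_down p q. monotone_diagram d}"

fun flip_point :: "point \<Rightarrow> point" where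
  "flip_point (Top i) = Bot i"
| "flip_point (Bot i) = Top i"

definition flip :: "diagram \<Rightarrow> diagram" where
  "flip d = (\<lambda>e. flip_point ` e) ` d"

definition id_diagram :: "nat \<Rightarrow> diagram" where
  "id_diagram p = {{Top i, Bot i} | i. i \<in> {1..p}}"

definition parity_le :: "nat \<Rightarrow> nat \<Rightarrow> bool" (infix "\<preceq>" 50) where
  "p \<preceq> q \<longleftrightarrow> p \<le> q \<and> even (q - p)"

text \<open>
  To compose \<open>f\<close> after \<open>g\<close>, \<open>g\<close> is placed on the levels \<open>Upper\<close>, \<open>Middle\<close> and \<open>f\<close> on the
  levels \<open>Middle\<close>, \<open>Lower\<close> of a graph.  A connected component of that graph either joins two
  outer points, giving a pair of the composite, or is a closed loop in the middle level.
\<close>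

datatype glued_point = Upper nat | Middle nat | Lower nat

fun upper_half :: "point \<Rightarrow> glued_point" where
  "upper_half (Top i) = Upper i"
| "upper_half (Bot i) = Middle i"

fun lower_half :: "point \<Rightarrow> glued_point" where
  "lower_half (Top i) = Middle i"
| "lower_half (Bot i) = Lower i"

fun outer :: "point \<Rightarrow> glued_point" where
  "outer (Top i) = Upper i"
| "outer (Bot i) = Lower i"

definition glue :: "diagram \<Rightarrow> diagram \<Rightarrow> glued_point set set" where
  "glue f g = (\<lambda>e. upper_half ` e) ` g \<union> (\<lambda>e. lower_half ` e) ` f"

definition components :: "diagram \<Rightarrow> diagram \<Rightarrow> glued_point set set" where
  "components f g = \<Union>(glue f g) // {(x, y). {x, y} \<in> glue f g}\<^sup>*"

definition dcomp :: "diagram \<Rightarrow> diagram \<Rightarrow> diagram" where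
  "dcomp f g = {outer -` X | X. X \<in> components f g \<and> outer -` X \<noteq> {}}"

definition loops :: "diagram \<Rightarrow> diagram \<Rightarrow> nat" where
  "loops f g = card {X \<in> components f g. outer -` X = {}}"


section \<open>The Brauer category and its relatives\<close>

definition bcomp ::
  "'k::comm_ring_1 \<Rightarrow> nat \<Rightarrow> nat \<Rightarrow> nat \<Rightarrow> (diagram \<Rightarrow> 'k) \<Rightarrow> (diagram \<Rightarrow> 'k) \<Rightarrow> diagram \<Rightarrow> 'k" where
  "bcomp \<delta> p q r f g = (\<lambda>d. \<Sum>a\<in>brauer q r. \<Sum>b\<in>brauer p q.
     f a * g b * (\<delta> ^ loops a b * basis_vec (dcomp a b) d))"

definition brauer_category :: "'k::comm_ring_1 \<Rightarrow> (nat, diagram \<Rightarrow> 'k, 'k) lincat" where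
  "brauer_category \<delta> = \<lparr>
     Obj = UNIV,
     Hom = (\<lambda>p q. free_module (brauer p q)),
     Comp = bcomp \<delta>,
     Ident = (\<lambda>p. basis_vec (id_diagram p))\<rparr>"

text \<open>
  Level diagrams compose without loops, so as a linear category this does not depend on the
  parameter \<open>\<delta>\<close> of the ambient Brauer category.
\<close>

definition symmetric_category :: "'k::comm_ring_1 \<Rightarrow> (nat, diagram \<Rightarrow> 'k, 'k) lincat" where
  "symmetric_category \<delta> = (brauer_category \<delta>)
     \<lparr>Hom := (\<lambda>p q. free_module (if p = q then brauer_level p p else {}))\<rparr>"

text \<open>The unique factorisation of a diagram, together with the number of its through strands.\<close>

definition factorization :: "nat \<Rightarrow> nat \<Rightarrow> diagram \<Rightarrow> nat \<times> diagram \<times> diagram \<times> diagram" where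
  "factorization p q f = The (\<lambda>(t, f_up, f_level, f_down).
     f_up \<in> brauer_up_mono t q \<and> f_level \<in> brauer_level t t \<and> f_down \<in> brauer_down_mono p t \<and>
     f = dcomp f_up (dcomp f_level f_down))"

definition matrix_dcomp ::
  "nat \<Rightarrow> nat \<Rightarrow> nat \<Rightarrow> diagram \<Rightarrow> diagram \<Rightarrow> diagram \<Rightarrow> 'k::comm_ring_1" where
  "matrix_dcomp p q r f g =
     (case factorization q r f of (t, f_up, f_level, f_down) \<Rightarrow>
      case factorization p q g of (s, g_up, g_level, g_down) \<Rightarrow>
        if t = s \<and> flip f_down = g_up
        then basis_vec (dcomp f_up (dcomp (dcomp f_level g_level) g_down))
        else (\<lambda>d. 0))"

definition matrix_brauer_category :: "(nat, diagram \<Rightarrow> 'k, 'k::comm_ring_1) lincat" where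
  "matrix_brauer_category = \<lparr>
     Obj = UNIV,
     Hom = (\<lambda>p q. free_module (brauer p q)),
     Comp = (\<lambda>p q r f g d. \<Sum>a\<in>brauer q r. \<Sum>b\<in>brauer p q. f a * g b * matrix_dcomp p q r a b d),
     Ident = (\<lambda>p d. \<Sum>s | s \<preceq> p. \<Sum>f\<in>brauer_up_mono s p. basis_vec (dcomp f (flip f)) d)\<rparr>"

definition truncate :: "nat \<Rightarrow> (nat, 'a, 'k) lincat \<Rightarrow> (nat, 'a, 'k) lincat" where
  "truncate r C = full_subcategory {q. q \<preceq> r} C"

definition project :: "diagram set \<Rightarrow> (diagram \<Rightarrow> 'k::comm_ring_1) \<Rightarrow> diagram \<Rightarrow> 'k" where
  "project X f = (\<lambda>d. if d \<in> X then f d else 0)"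

definition L_functor :: "'k::comm_ring_1 \<Rightarrow> (nat, diagram \<Rightarrow> 'k, nat, diagram \<Rightarrow> 'k) linfun" where
  "L_functor \<delta> = \<lparr>
     Fobj = (\<lambda>q. q),
     Fmap = (\<lambda>q q' g d. \<Sum>p | p \<preceq> q'. \<Sum>h\<in>brauer_up_mono p q'.
       bcomp \<delta> q p q' (basis_vec h)
         (project (brauer_down q p) (bcomp \<delta> q q' p (basis_vec (flip h)) g)) d)\<rparr>"

text \<open>\<open>B\<^sup>+\<close> as a bimodule with \<open>B\<close> acting on the left and \<open>S\<close> on the right, and \<open>B\<^sup>-\<close> the
  other way around.\<close>

definition up_bimodule ::
  "'k::comm_ring_1 \<Rightarrow> (nat, diagram \<Rightarrow> 'k, nat, diagram \<Rightarrow> 'k, 'k, diagram \<Rightarrow> 'k) bimod" where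
  "up_bimodule \<delta> = \<lparr>
     BMod = (\<lambda>p q. free_module (brauer_up p q)),
     Lact = (\<lambda>p q q' g f. project (brauer_up p q') (bcomp \<delta> p q q' g f)),
     Ract = (\<lambda>p' p q f \<sigma>. bcomp \<delta> p' p q f \<sigma>)\<rparr>"

definition down_bimodule ::
  "'k::comm_ring_1 \<Rightarrow> (nat, diagram \<Rightarrow> 'k, nat, diagram \<Rightarrow> 'k, 'k, diagram \<Rightarrow> 'k) bimod" where
  "down_bimodule \<delta> = \<lparr>
     BMod = (\<lambda>q s. free_module (brauer_down q s)),
     Lact = (\<lambda>q s s' \<sigma> f. bcomp \<delta> q s s' \<sigma> f),
     Ract = (\<lambda>p q s f g. project (brauer_down p s) (bcomp \<delta> p q s f g))\<rparr>"


section \<open>Non-singular parameters\<close>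

definition level_pairing ::
  "'k::comm_ring_1 \<Rightarrow> nat \<Rightarrow> diagram \<Rightarrow> diagram \<Rightarrow> diagram \<Rightarrow> 'k" where
  "level_pairing \<delta> p g f =
     (if dcomp g f \<in> brauer_level p p then (\<lambda>d. \<delta> ^ loops g f * basis_vec (dcomp g f) d)
      else (\<lambda>d. 0))"

text \<open>
  The matrix of the pairing over the group ring, with each entry replaced by the matrix of left
  multiplication by it on the basis of permutations: rows and columns are indexed by pairs
  \<open>(f, \<sigma>)\<close>, and the entry at \<open>((f, \<sigma>), (g, \<tau>))\<close> is the coefficient of \<open>\<sigma>\<close> in \<open>b(flip f, g) \<tau>\<close>.
  The determinant does not depend on the enumeration of the index set.
\<close>

definition gram_index :: "nat \<Rightarrow> nat \<Rightarrow> (diagram \<times> diagram) set" where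
  "gram_index p q = brauer_up_mono p q \<times> brauer_level p p"

definition gram_entry :: "nat \<Rightarrow> nat \<Rightarrow> diagram \<times> diagram \<Rightarrow> diagram \<times> diagram \<Rightarrow> int poly" where
  "gram_entry p q = (\<lambda>(f, \<sigma>) (g, \<tau>).
     bcomp (monom 1 1) p p p (level_pairing (monom 1 1) p (flip f) g) (basis_vec \<tau>) \<sigma>)"

definition gram_polynomial :: "nat \<Rightarrow> nat \<Rightarrow> int poly" where
  "gram_polynomial p q =
     (let n = card (gram_index p q);
          enum = (SOME enum. bij_betw enum {0..<n} (gram_index p q))
      in Determinant.det (mat n n (\<lambda>(i, j). gram_entry p q (enum i) (enum j))))"

definition non_singular_at :: "'k::comm_ring_1 \<Rightarrow> nat \<Rightarrow> nat \<Rightarrow> bool" where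
  "non_singular_at \<delta> p q \<longleftrightarrow> poly (map_poly of_int (gram_polynomial p q)) \<delta> dvd 1"

definition non_singular_upto :: "'k::comm_ring_1 \<Rightarrow> nat \<Rightarrow> bool" where
  "non_singular_upto \<delta> r \<longleftrightarrow> (\<forall>p q. p \<preceq> q \<and> q \<preceq> r \<longrightarrow> non_singular_at \<delta> p q)"

end

theory Submission
  imports Defs
begin

text \<open>
  If the parameter is non-singular, the pairing provides dual bases \<open>f\<^sup>h\<close> of \<open>B\<^sup>+(p, q)\<close>, indexed by the
  monotone upward diagrams \<open>h\<close>.  The elements \<open>e\<^sub>p = id\<^sub>p - \<Sum> f\<^sup>h e\<^sub>s h\<^sup>*\<close> (sum over \<open>s < p\<close> and \<open>h\<close>) commute
  with permutations and kill non-downward diagrams on their right and non-upward ones on their left, and the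
  products \<open>f\<^sup>h e\<^sub>s h\<^sup>*\<close> resolve the identity of every object.  This inverts \<open>L\<close> and the multiplication
  \<open>B\<^sup>+ \<otimes> B\<^sup>- \<rightarrow> B\<close>, and makes taking fixed points of the \<open>e\<^sub>p\<close> an equivalence from modules over \<open>B\<close> to modules
  over the symmetric groups.  Conversely, surjectivity of \<open>L\<close>, or the preimage of an identity in
  \<open>B\<^sup>+ \<otimes> B\<^sup>-\<close>, yields a right inverse of each Gram matrix.  In characteristic 0 every morphism of modules over
  the symmetric groups has a pseudo-inverse (Maschke), a property preserved by equivalences; so the radical of
  the pairing is a direct summand of \<open>B\<^sup>+(p, -)\<close>, which is generated by \<open>id\<^sub>p\<close>, and the radical vanishes at \<open>p\<close>.
\<close>

text \<open>Under \<open>L\<close> the element \<open>e_p\<close> becomes the diagram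
  \<open>id_p\<close>, an idempotent matrix unit of \<open>mB\<close>, and the product of
  \<open>f^h\<close>, \<open>e_s\<close> and \<open>flip h\<close> becomes the unit
  \<open>h (flip h)\<close>. So resolving the identity of \<open>B\<close> means lifting that of
  \<open>mB\<close>, and an identity in \<open>B\<close> can be checked through the right action on
  \<open>B^-\<close>, whose values are the rows of \<open>L\<close>. Determinants replace them: a
  square matrix with a one-sided inverse has unit determinant, so surjectivity gives injectivity. In
  (2) the bimodule isomorphism is arbitrary and need not come from composition, so the converse can
  use only its compatibility with the actions. The isomorphism built in the other direction is
  \<open>m \<otimes> n -> m e_y n\<close>, as plain composition need not respect the truncated
  actions. In (4) modules take values in a fixed type \<open>'u\<close>, so every module constructed
  has to be encoded there: coinduced modules, whose elements are given by finitely many values, and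
  the spaces \<open>B^+(p, s)\<close>, through the injection of the field.\<close>

abbreviation (input) module_add ("_ +[_] _" [65, 0, 66] 65) where "x +[M] y \<equiv> x \<oplus>\<^bsub>M\<^esub> y"
abbreviation (input) module_scale ("_ *[_] _" [70, 0, 71] 70) where "c *[M] x \<equiv> c \<odot>\<^bsub>M\<^esub> x"
abbreviation (input) module_zero ("0[_]") where "0[M] \<equiv> \<zero>\<^bsub>M\<^esub>"
abbreviation (input) "bv \<equiv> basis_vec"
abbreviation (input) "Up \<equiv> brauer_up"
abbreviation (input) "Dn \<equiv> brauer_down"
abbreviation (input) "Um \<equiv> brauer_up_mono"
abbreviation (input) "pu p q \<equiv> project (Up p q)"
abbreviation (input) "pd p q \<equiv> project (Dn p q)"
abbreviation (input) "Md \<equiv> module_category"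
abbreviation (input) "car M p \<equiv> carrier (Fobj M p)"

section \<open>Connected components\<close>

text \<open>Edges may have any size and join all their points, because contracting a graph turns
  traces of whole components into single edges. The closure is reflexive on the entire type;
  \<open>cc\<close> keeps only the classes of points that lie on an edge.\<close>

definition conn :: "'v set set => ('v \<times> 'v) set" where
 "conn E = {(x, y). \<exists>e\<in>E. x \<in> e & y \<in> e}\<^sup>*"

definition cc :: "'v set set => 'v set set" where
 "cc E = (\<lambda>x. conn E `` {x}) ` \<Union>E"

lemma conn_refl [simp]: "(x, x) \<in> conn E"
 by (simp add: conn_def)

lemma conn_edge: "e \<in> E ==> x \<in> e ==> y \<in> e ==> (x, y) \<in> conn E"
 unfolding conn_def by (rule r_into_rtrancl) auto

lemma conn_trans: "(x, y) \<in> conn E ==> (y, z) \<in> conn E ==> (x, z) \<in> conn E"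
 unfolding conn_def by (rule rtrancl_trans)

lemma conn_sym: "(x, y) \<in> conn E ==> (y, x) \<in> conn E"
proof -
 have "sym {(x, y). \<exists>e\<in>E. x \<in> e & y \<in> e}"
  by (auto simp: sym_def)
 then show "(x, y) \<in> conn E ==> (y, x) \<in> conn E"
  unfolding conn_def by (meson sym_rtrancl symD)
qed

lemma conn_induct [consumes 1, case_names refl step]:
 assumes "(x, y) \<in> conn E" "P x"
  and "\<And>y z e. (x, y) \<in> conn E ==> P y ==> e \<in> E ==> y \<in> e ==> z \<in> e ==> P z"
 shows "P y"
 using assms(1) unfolding conn_def
proof (induction rule: rtrancl_induct)
 case base
 then show ?case by (rule assms(2))
next
 case (step y z)
 then show ?case using assms(3)[of y _ z] unfolding conn_def by blast
qed

lemma conn_mono: "E \<subseteq> E' ==> (x, y) \<in> conn E ==> (x, y) \<in> conn E'"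
 unfolding conn_def by (rule rtrancl_mono[THEN subsetD]) auto

lemma conn_field: "(x, y) \<in> conn E ==> x = y \<or> x \<in> \<Union>E & y \<in> \<Union>E"
 by (induction rule: conn_induct) auto

lemma conn_Image_eq: "(x, y) \<in> conn E ==> conn E `` {x} = conn E `` {y}"
 by (auto intro: conn_trans conn_sym)

lemma cc_memD: "X \<in> cc E ==> x \<in> X ==> X = conn E `` {x}"
 unfolding cc_def by (auto intro: conn_trans conn_sym)

lemma cc_I: "x \<in> \<Union>E ==> conn E `` {x} \<in> cc E"
 unfolding cc_def by blast

lemma cc_subset: "X \<in> cc E ==> X \<subseteq> \<Union>E"
 unfolding cc_def using conn_field by fastforce

lemma cc_nonempty: "X \<in> cc E ==> X ~= {}"
 unfolding cc_def using conn_refl by fastforce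

lemma cc_disjoint: "X \<in> cc E ==> Y \<in> cc E ==> X \<inter> Y ~= {} ==> X = Y"
 using cc_memD[of X E] cc_memD[of Y E] by blast

lemma partition_on_cc: "partition_on (\<Union>E) (cc E)"
proof (rule partition_onI)
 show "\<Union>(cc E) = \<Union>E"
 proof
  show "\<Union>(cc E) \<subseteq> \<Union>E" using cc_subset by blast
  show "\<Union>E \<subseteq> \<Union>(cc E)"
  proof
   fix x assume "x \<in> \<Union>E"
   then have "conn E `` {x} \<in> cc E" "x \<in> conn E `` {x}" using cc_I by simp_all
   then show "x \<in> \<Union>(cc E)" by (rule UnionI)
  qed
 qed
 show "disjnt X Y" if "X \<in> cc E" "Y \<in> cc E" "X ~= Y" for X Y
  using cc_disjoint[OF that(1,2)] that(3) unfolding disjnt_def by blast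
 show "{} \<notin> cc E"
  using cc_nonempty by blast
qed

lemma finite_cc: "finite (\<Union>E) ==> finite (cc E)"
 by (simp add: cc_def)

text \<open>A partition that no edge crosses is coarser than the components, and connected blocks
  make it finer. With this certificate the components of a glued picture can be written down
  explicitly, as in \<open>dcomp_up\<close>.\<close>

lemma cc_eqI:
 assumes part: "partition_on (\<Union>E) P"
  and sub: "\<And>e. e \<in> E ==> \<exists>X\<in>P. e \<subseteq> X"
  and con: "\<And>X x y. X \<in> P ==> x \<in> X ==> y \<in> X ==> (x, y) \<in> conn E"
 shows "cc E = P"
proof -
 have cl: "y \<in> X" if "X \<in> P" "x \<in> X" "(x, y) \<in> conn E" for X x y
  using that(3)
 proof (induction rule: conn_induct)
  case refl
  then show ?case by (rule that(2))
 next
  case (step y z e)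
  obtain Y where Y: "Y \<in> P" "e \<subseteq> Y" using sub step by blast
  then have "Y = X"
   using partition_onD2[OF part] that(1) step unfolding disjoint_def by blast
  then show ?case using Y step by blast
 qed
 have eq: "conn E `` {x} = X" if "X \<in> P" "x \<in> X" for X x
  using con cl that by blast
 have U: "\<Union>E = \<Union>P" using partition_onD1[OF part] .
 show ?thesis
 proof
  show "cc E \<subseteq> P" unfolding cc_def using U eq by auto
  show "P \<subseteq> cc E"
  proof
   fix X assume X: "X \<in> P"
   then obtain x where "x \<in> X" using partition_onD3[OF part] by (metis all_not_in_conv)
   then have "x \<in> \<Union>E" "X = conn E `` {x}" using X eq[of X x] unfolding U by auto
   then show "X \<in> cc E" using cc_I by simp
  qed
 qed
qed

text \<open>The two relations differ only on the diagonal, which the reflexive closure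
  supplies.\<close>

lemma conn_pairs:
 assumes "\<And>e. e \<in> E ==> card e = 2"
 shows "{(x, y). {x, y} \<in> E}\<^sup>* = conn E"
 unfolding conn_def
proof (rule rtrancl_subset[symmetric])
 show "{(x, y). {x, y} \<in> E} \<subseteq> {(x, y). \<exists>e\<in>E. x \<in> e & y \<in> e}" by blast
 show "{(x, y). \<exists>e\<in>E. x \<in> e & y \<in> e} \<subseteq> {(x, y). {x, y} \<in> E}\<^sup>*"
 proof safe
  fix x y e assume e: "e \<in> E" "x \<in> e" "y \<in> e"
  obtain a b where ab: "e = {a, b}" "a ~= b" using assms[OF e(1)] by (meson card_2_iff)
  show "(x, y) \<in> {(x, y). {x, y} \<in> E}\<^sup>*"
  proof (cases "x = y")
   case False
   then have "{x, y} = e" using ab e by auto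
   then show ?thesis using e by (intro r_into_rtrancl) simp
  qed simp
 qed
qed

lemma conn_image:
 assumes "inj \<phi>"
 shows "conn ((`) \<phi> ` E) `` {\<phi> x} = \<phi> ` (conn E `` {x})"
proof (intro equalityI subsetI)
 fix z assume "z \<in> conn ((`) \<phi> ` E) `` {\<phi> x}"
 then have "(\<phi> x, z) \<in> conn ((`) \<phi> ` E)" by simp
 then show "z \<in> \<phi> ` (conn E `` {x})"
 proof (induction rule: conn_induct)
  case (step y z e)
  then obtain y' d where yz: "y = \<phi> y'" "(x, y') \<in> conn E" "d \<in> E" "e = \<phi> ` d" by auto
  then obtain z' where z': "z = \<phi> z'" "z' \<in> d" using step by auto
  have "y' \<in> d" using yz step assms by (auto simp: inj_def)
  then have "(x, z') \<in> conn E" using yz z' conn_trans[OF yz(2) conn_edge] by blast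
  then show ?case using z' by auto
 qed auto
next
 fix z assume "z \<in> \<phi> ` (conn E `` {x})"
 then obtain y where y: "(x, y) \<in> conn E" "z = \<phi> y" by auto
 from y(1) have "(\<phi> x, \<phi> y) \<in> conn ((`) \<phi> ` E)"
 proof (induction rule: conn_induct)
  case (step y z e)
  then show ?case using conn_trans conn_edge by (metis image_eqI)
 qed simp
 then show "z \<in> conn ((`) \<phi> ` E) `` {\<phi> x}" using y by simp
qed

lemma cc_image: "inj \<phi> ==> cc ((`) \<phi> ` E) = (`) \<phi> ` cc E"
 unfolding cc_def by (fastforce simp: conn_image image_iff)

text \<open>Replacing one part \<open>E1\<close> of a graph by the traces of its components on a set \<open>K\<close> containing
 the interface with the other part.\<close>

locale contraction =
 fixes E1 E2 :: "'v set set" and K :: "'v set"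
 assumes interface: "\<Union>E1 \<inter> \<Union>E2 \<subseteq> K" and K_sub: "K \<subseteq> \<Union>E1"
begin

definition trace :: "'v set set" where
 "trace = {X \<inter> K | X. X \<in> cc E1 & X \<inter> K ~= {}}"

definition verts :: "'v set" where
 "verts = K \<union> \<Union>E2"

lemma trace_edge: "x \<in> K ==> y \<in> K ==> (x, y) \<in> conn E1 ==> \<exists>e\<in>trace. x \<in> e & y \<in> e"
 unfolding trace_def using K_sub
 by (intro bexI[of _ "conn E1 `` {x} \<inter> K"]) (auto intro!: exI[of _ "conn E1 `` {x}"] cc_I)

lemma Union_trace: "\<Union>(trace \<union> E2) = verts"
 unfolding verts_def using trace_edge[OF _ _ conn_refl] by (auto simp: trace_def)

text \<open>A path in the large graph is cut at its excursions through \<open>E1\<close>. An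
  excursion between visible points enters and leaves through \<open>K\<close>, so a single trace
  edge can replace it.\<close>

lemma conn_trace_iff:
 assumes "x \<in> verts" "y \<in> verts"
 shows "(x, y) \<in> conn (trace \<union> E2) \<longleftrightarrow> (x, y) \<in> conn (E1 \<union> E2)"
proof
 assume "(x, y) \<in> conn (trace \<union> E2)"
 then show "(x, y) \<in> conn (E1 \<union> E2)"
 proof (induction rule: conn_induct)
  case (step y z e)
  have "(y, z) \<in> conn (E1 \<union> E2)"
  proof (cases "e \<in> E2")
   case True
   then show ?thesis using step conn_edge by (metis UnI2)
  next
   case False
   then obtain X where "X \<in> cc E1" "e = X \<inter> K" using step unfolding trace_def by auto
   then have "(y, z) \<in> conn E1" using step cc_memD by (metis Image_singleton_iff IntD1)
   then show ?thesis by (rule conn_mono[rotated]) simp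
  qed
  then show ?case using step conn_trans by metis
 qed simp
next
 assume c: "(x, y) \<in> conn (E1 \<union> E2)"
 have key: "(x, z) \<in> conn (trace \<union> E2)"
  if "(x, w) \<in> conn (trace \<union> E2)" "(w, z) \<in> conn E1" "w \<in> K \<or> w = z" "z \<in> verts" for w z
 proof (cases "w = z")
  case True
  then show ?thesis using that by simp
 next
  case False
  then have "z \<in> \<Union>E1" using conn_field[OF that(2)] by auto
  then have "z \<in> K" using that(4) interface unfolding verts_def by blast
  then have "(w, z) \<in> conn (trace \<union> E2)"
   using trace_edge[of w z] that False by (meson UnI1 conn_edge)
  then show ?thesis using that conn_trans by metis
 qed
 \<comment> \<open>\<open>w\<close> is the point where the current run of \<open>E1\<close>-edges
   began; it lies in \<open>K\<close> unless that run is still empty.\<close>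
 from c have "\<exists>w. (x, w) \<in> conn (trace \<union> E2) & (w, y) \<in> conn E1 & (w \<in> K \<or> w = y)"
 proof (induction rule: conn_induct)
  case refl
  show ?case by (rule exI[of _ x]) simp
 next
  case (step y z e)
  then obtain w where w: "(x, w) \<in> conn (trace \<union> E2)" "(w, y) \<in> conn E1" "w \<in> K \<or> w = y"
   by blast
  show ?case
  proof (cases "e \<in> E2")
   case True
   then have "y \<in> verts" using step unfolding verts_def by auto
   then have "(x, y) \<in> conn (trace \<union> E2)" using key w by blast
   moreover have "(y, z) \<in> conn (trace \<union> E2)" using True step conn_edge by (metis UnI2)
   ultimately show ?thesis using conn_trans conn_refl by metis
  next
   case False
   then have e: "e \<in> E1" using step by auto
   have yz: "(y, z) \<in> conn E1" using e step conn_edge by metis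
   have "w \<in> K"
   proof (cases "w = y")
    case True
    have "w \<in> verts" using conn_field[OF w(1)] assms(1) Union_trace by auto
    then show ?thesis using True e step interface unfolding verts_def by blast
   qed (use w in simp)
   then show ?thesis using w yz conn_trans by metis
  qed
 qed
 then show "(x, y) \<in> conn (trace \<union> E2)" using key assms(2) by blast
qed

lemma cc_trace: "cc (trace \<union> E2) = {X \<inter> verts | X. X \<in> cc (E1 \<union> E2) & X \<inter> verts ~= {}}"
proof -
 have eq: "conn (trace \<union> E2) `` {x} = conn (E1 \<union> E2) `` {x} \<inter> verts" if "x \<in> verts" for x
 proof -
  have "y \<in> verts" if "(x, y) \<in> conn (trace \<union> E2)" for y
   using conn_field[OF that] \<open>x \<in> verts\<close> Union_trace by metis
  then show ?thesis using conn_trace_iff[OF that] by blast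
 qed
 have sub: "verts \<subseteq> \<Union>(E1 \<union> E2)" unfolding verts_def using K_sub by auto
 show ?thesis
 proof (intro equalityI subsetI)
  fix Y assume "Y \<in> cc (trace \<union> E2)"
  then obtain x where x: "x \<in> verts" "Y = conn (trace \<union> E2) `` {x}"
   unfolding cc_def Union_trace by auto
  moreover have "conn (E1 \<union> E2) `` {x} \<in> cc (E1 \<union> E2)" using x sub by (intro cc_I) auto
  moreover have "x \<in> conn (E1 \<union> E2) `` {x} \<inter> verts" using x by simp
  then have "conn (E1 \<union> E2) `` {x} \<inter> verts ~= {}" by (metis empty_iff)
  ultimately show "Y \<in> {X \<inter> verts | X. X \<in> cc (E1 \<union> E2) & X \<inter> verts ~= {}}"
   unfolding x(2) eq[OF x(1)] mem_Collect_eq by (intro exI[of _ "conn (E1 \<union> E2) `` {x}"] conjI refl)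
 next
  fix Y assume "Y \<in> {X \<inter> verts | X. X \<in> cc (E1 \<union> E2) & X \<inter> verts ~= {}}"
  then obtain X x where X: "X \<in> cc (E1 \<union> E2)" "x \<in> X" "x \<in> verts" "Y = X \<inter> verts" by auto
  then have "Y = conn (trace \<union> E2) `` {x}" using cc_memD eq by metis
  then show "Y \<in> cc (trace \<union> E2)" using X Union_trace cc_I by metis
 qed
qed

text \<open>A component of \<open>E1\<close> that avoids \<open>K\<close> meets no edge of
  \<open>E2\<close>, because the interface lies in \<open>K\<close>; it therefore stays a component
  of the union. For glued diagrams these are the loops closed by the first composition.\<close>

lemma cc_hidden: "{X \<in> cc (E1 \<union> E2). X \<inter> verts = {}} = {X \<in> cc E1. X \<inter> K = {}}"
proof -
 have stay: "conn E1 `` {x} = conn (E1 \<union> E2) `` {x}"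
  if "conn E1 `` {x} \<inter> K = {}" "x \<in> \<Union>E1" for x
 proof -
  have "(x, y) \<in> conn E1" if "(x, y) \<in> conn (E1 \<union> E2)" for y
   using that
  proof (induction rule: conn_induct)
   case (step y z e)
   have "y \<in> \<Union>E1" "y \<notin> K"
    using conn_field[OF step.IH] \<open>x \<in> \<Union>E1\<close> \<open>conn E1 `` {x} \<inter> K = {}\<close> step.IH by auto
   then have "e \<notin> E2" using interface step by blast
   then show ?case using step conn_trans conn_edge by (metis UnE)
  qed simp
  then show ?thesis by (auto intro: conn_mono[rotated])
 qed
 show ?thesis
 proof (intro equalityI subsetI)
  fix X assume X: "X \<in> {X \<in> cc (E1 \<union> E2). X \<inter> verts = {}}"
  then obtain x where x: "x \<in> \<Union>(E1 \<union> E2)" "X = conn (E1 \<union> E2) `` {x}" unfolding cc_def by auto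
  have "x \<in> X" using x by simp
  then have "x \<in> \<Union>E1" using x(1) X unfolding verts_def by blast
  moreover have "conn E1 `` {x} \<subseteq> X" using x by (auto intro: conn_mono[rotated])
  then have "conn E1 `` {x} \<inter> K = {}" using X unfolding verts_def by blast
  ultimately show "X \<in> {X \<in> cc E1. X \<inter> K = {}}"
   using stay[of x] x cc_I by fastforce
 next
  fix X assume X: "X \<in> {X \<in> cc E1. X \<inter> K = {}}"
  then obtain x where x: "x \<in> \<Union>E1" "X = conn E1 `` {x}" unfolding cc_def by auto
  have "X \<inter> \<Union>E2 = {}" using X cc_subset[of X E1] interface by blast
  moreover have "X = conn (E1 \<union> E2) `` {x}" using stay x X by blast
  moreover have "conn (E1 \<union> E2) `` {x} \<in> cc (E1 \<union> E2)" using x by (intro cc_I) auto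
  ultimately show "X \<in> {X \<in> cc (E1 \<union> E2). X \<inter> verts = {}}" using X unfolding verts_def by auto
 qed
qed

lemma traces_outer:
 assumes "\<Union>(E1 \<union> E2) \<inter> Out \<subseteq> verts"
 shows "{X \<inter> Out | X. X \<in> cc (trace \<union> E2) & X \<inter> Out ~= {}}
    = {X \<inter> Out | X. X \<in> cc (E1 \<union> E2) & X \<inter> Out ~= {}}"
proof -
 have "X \<inter> verts \<inter> Out = X \<inter> Out" if "X \<in> cc (E1 \<union> E2)" for X
  using cc_subset[OF that] assms by blast
 then have "X \<inter> verts ~= {} & X \<inter> verts \<inter> Out ~= {} \<longleftrightarrow> X \<inter> Out ~= {}"
  and "X \<inter> verts \<inter> Out = X \<inter> Out" if "X \<in> cc (E1 \<union> E2)" for X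
  using that by auto
 then show ?thesis unfolding cc_trace by (smt (verit) Collect_cong mem_Collect_eq)
qed

text \<open>Components without outer points are counted in two stages, those that vanish in the
  contraction and those still visible after it. This is the source of the additivity of loop
  numbers.\<close>

lemma card_hidden:
 assumes "\<Union>(E1 \<union> E2) \<inter> Out \<subseteq> verts" "finite (\<Union>(E1 \<union> E2))"
 shows "card {X \<in> cc E1. X \<inter> K = {}} + card {X \<in> cc (trace \<union> E2). X \<inter> Out = {}}
    = card {X \<in> cc (E1 \<union> E2). X \<inter> Out = {}}"
proof -
 let ?H = "{X \<in> cc (E1 \<union> E2). X \<inter> verts = {}}"
 let ?J = "{X \<in> cc (E1 \<union> E2). X \<inter> verts ~= {} & X \<inter> Out = {}}"
 have fin: "finite (cc (E1 \<union> E2))" using assms(2) by (rule finite_cc)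
 have out: "X \<inter> verts \<inter> Out = X \<inter> Out" if "X \<in> cc (E1 \<union> E2)" for X
  using cc_subset[OF that] assms by blast
 have "{X \<in> cc (E1 \<union> E2). X \<inter> Out = {}} = ?H \<union> ?J" using out by blast
 then have "card {X \<in> cc (E1 \<union> E2). X \<inter> Out = {}} = card ?H + card ?J"
  using fin by (simp add: card_Un_disjoint disjoint_iff)
 moreover have "bij_betw (\<lambda>X. X \<inter> verts) ?J {X \<in> cc (trace \<union> E2). X \<inter> Out = {}}"
 proof (rule bij_betw_imageI)
  show "inj_on (\<lambda>X. X \<inter> verts) ?J"
  proof (rule inj_onI)
   fix X Y assume XY: "X \<in> ?J" "Y \<in> ?J" "X \<inter> verts = Y \<inter> verts"
   then have "X \<inter> Y ~= {}" by blast
   then show "X = Y" using XY(1,2) cc_disjoint[of X "E1 \<union> E2" Y] by simp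
  qed
  have "{X \<in> cc (trace \<union> E2). X \<inter> Out = {}} = (\<lambda>X. X \<inter> verts) ` {X \<in> cc (E1 \<union> E2). X \<inter> verts ~= {} & X \<inter> verts \<inter> Out = {}}"
   unfolding cc_trace by blast
  moreover have "{X \<in> cc (E1 \<union> E2). X \<inter> verts ~= {} & X \<inter> verts \<inter> Out = {}} = ?J"
   using out by (metis (no_types, lifting))
  ultimately show "(\<lambda>X. X \<inter> verts) ` ?J = {X \<in> cc (trace \<union> E2). X \<inter> Out = {}}" by simp
 qed
 ultimately show ?thesis using cc_hidden bij_betw_same_card by fastforce
qed

end

section \<open>Weights of components\<close>

text \<open>A matching \<open>F\<close> is added to a graph edge by edge, each edge lowering the weights of its two end
 points by one: two distinct components of weight 2 merge into one of weight 2, and an edge inside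
 a component of weight 2 leaves weight 0.\<close>

lemma conn_insert_edge:
 "conn (insert {u, v} E) `` {x} =
  (if (x, u) \<in> conn E \<or> (x, v) \<in> conn E then conn E `` {u} \<union> conn E `` {v} else conn E `` {x})"
proof -
 have uv: "(u, v) \<in> conn (insert {u, v} E)" by (rule conn_edge[of "{u, v}"]) auto
 have up: "(y, z) \<in> conn E ==> (y, z) \<in> conn (insert {u, v} E)" for y z
  by (rule conn_mono[rotated]) auto
 have 1: "(x, y) \<in> conn (insert {u, v} E)"
  if "(x, u) \<in> conn E \<or> (x, v) \<in> conn E" "(u, y) \<in> conn E \<or> (v, y) \<in> conn E" for y
  using that uv up conn_trans conn_sym by metis
 have 2: "if (x, u) \<in> conn E \<or> (x, v) \<in> conn E then (u, y) \<in> conn E \<or> (v, y) \<in> conn E else (x, y) \<in> conn E"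
  if "(x, y) \<in> conn (insert {u, v} E)" for y
  using that
 proof (induction rule: conn_induct)
  case refl
  then show ?case using conn_sym[of x u E] conn_sym[of x v E] by auto
 next
  case (step y z e)
  then consider "e \<in> E" | "e = {u, v}" by blast
  then show ?case
  proof cases
   case 1
   then have "(y, z) \<in> conn E" using step conn_edge by metis
   then show ?thesis using step conn_trans by (smt (verit))
  next
   case 2
   then show ?thesis using step conn_sym conn_trans by (smt (verit) conn_refl empty_iff insert_iff)
  qed
 qed
 show ?thesis
 proof (cases "(x, u) \<in> conn E \<or> (x, v) \<in> conn E")
  case True
  then have "(x, y) \<in> conn (insert {u, v} E) \<longleftrightarrow> (u, y) \<in> conn E \<or> (v, y) \<in> conn E" for y
   using 1[OF True] 2[of y] by auto
  then show ?thesis using True by auto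
 next
  case False
  then have "(x, y) \<in> conn (insert {u, v} E) \<longleftrightarrow> (x, y) \<in> conn E" for y
   using 2[of y] up[of x y] by auto
  then show ?thesis using False by auto
 qed
qed

lemma matching_weights:
 fixes D :: "'v => int"
 assumes "finite V" "finite F" and "\<And>e. e \<in> F ==> card e = 2 & e \<subseteq> V" and "disjoint F"
  and "\<And>e. e \<in> E ==> e \<subseteq> V"
  and "\<And>x. x \<in> V ==> sum D (conn E `` {x}) \<in> {0, 2}"
  and "\<And>x. x \<in> V ==> D x \<ge> 0" and "\<And>x. x \<in> \<Union>F ==> D x \<ge> 1"
 shows "x \<in> V ==> sum (\<lambda>y. D y - (if y \<in> \<Union>F then 1 else 0)) (conn (E \<union> F) `` {x}) \<in> {0, 2}"
 using assms(2,3,4,8)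
proof (induction F arbitrary: x rule: finite_induct)
 case empty
 then show ?case using assms(6) by simp
next
 case (insert e F)
 obtain u v where e: "e = {u, v}" "u ~= v" using insert.prems(2)[of e] by (auto simp: card_2_iff)
 let ?D = "\<lambda>y. D y - (if y \<in> \<Union>F then 1 else 0)"
 let ?I = "\<lambda>y. if y \<in> {u, v} then 1 else (0::int)"
 let ?E = "E \<union> F"
 have dj: "e \<inter> \<Union>F = {}" using insert.prems(3) insert.hyps
  unfolding disjoint_def by (metis Int_commute Sup_inf_eq_bot_iff insert_iff)
 have dF: "disjoint F" using insert.prems(3) unfolding disjoint_def by simp
 have IH: "sum ?D (conn ?E `` {x}) \<in> {0, 2}" if "x \<in> V" for x
  by (rule insert.IH[OF that]) (use insert.prems dF in auto)
 have D_eq: "(\<lambda>y. D y - (if y \<in> \<Union>(insert e F) then 1 else 0)) = (\<lambda>y. ?D y - ?I y)"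
  using dj e by auto
 have uV: "u \<in> V" "v \<in> V" using insert.prems(2)[of e] e by auto
 have sub: "conn ?E `` {y} \<subseteq> V" if "y \<in> V" for y
 proof
  fix z assume "z \<in> conn ?E `` {y}"
  then show "z \<in> V" using conn_field[of y z ?E] that assms(5) insert.prems(2) by blast
 qed
 have fin: "finite (conn ?E `` {y})" if "y \<in> V" for y
  using sub[OF that] assms(1) finite_subset by blast
 have D0: "?D y \<ge> 0" if "y \<in> V" for y
  using that assms(7)[OF that] insert.prems(4)[of y] by auto
 have D1: "?D u \<ge> 1" "?D v \<ge> 1" using insert.prems(4)[of u] insert.prems(4)[of v] dj e by auto
 have ge: "sum ?D (conn ?E `` {u}) \<ge> sum ?D S" if "S \<subseteq> conn ?E `` {u}" for S
  by (rule sum_mono2[OF fin[OF uV(1)] that]) (use D0 sub[OF uV(1)] in blast)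
 have ge': "sum ?D (conn ?E `` {v}) \<ge> sum ?D S" if "S \<subseteq> conn ?E `` {v}" for S
  by (rule sum_mono2[OF fin[OF uV(2)] that]) (use D0 sub[OF uV(2)] in blast)
 \<comment> \<open>The weight is 0 or 2, all weights are nonnegative and \<open>u\<close> alone
   contributes at least 1, which excludes 0.\<close>
 have su: "sum ?D (conn ?E `` {u}) = 2" using IH[OF uV(1)] ge[of "{u}"] D1 by auto
 have sv: "sum ?D (conn ?E `` {v}) = 2" using IH[OF uV(2)] ge'[of "{v}"] D1 by auto
 have sI: "sum ?I S = int (card (S \<inter> {u, v}))" if "finite S" for S
  unfolding sum.inter_restrict[OF that, symmetric] by simp
 have step: "E \<union> insert e F = insert {u, v} ?E" using e by auto
 show ?case
 proof (cases "(x, u) \<in> conn ?E \<or> (x, v) \<in> conn ?E")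
  case False
  then have "conn ?E `` {x} \<inter> {u, v} = {}" by auto
  then have "sum ?I (conn ?E `` {x}) = 0" using fin[OF insert.prems(1)] sI by simp
  then show ?thesis
   unfolding D_eq step conn_insert_edge using False IH[OF insert.prems(1)] by (simp add: sum_subtractf)
 next
  case True
  let ?S = "conn ?E `` {u} \<union> conn ?E `` {v}"
  have fS: "finite ?S" using fin uV by simp
  have "?S \<inter> {u, v} = {u, v}" by auto
  then have I2: "sum ?I ?S = 2" using sI[OF fS] e by simp
  \<comment> \<open>Either one component of weight 2 or two of them; taking 1 from each end of the
    new edge leaves 0 or 2.\<close>
  have "sum ?D ?S \<in> {2, 4}"
  proof (cases "(u, v) \<in> conn ?E")
   case True
   then have "?S = conn ?E `` {u}" using conn_Image_eq[of u v ?E] by simp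
   then show ?thesis using su by simp
  next
   case False
   have "conn ?E `` {u} \<inter> conn ?E `` {v} = {}"
   proof (rule equals0I)
    fix y assume "y \<in> conn ?E `` {u} \<inter> conn ?E `` {v}"
    then have "(u, y) \<in> conn ?E" "(y, v) \<in> conn ?E" using conn_sym[of v y ?E] by simp_all
    then show False using False conn_trans[of u y ?E v] by simp
   qed
   then have "sum ?D ?S = sum ?D (conn ?E `` {u}) + sum ?D (conn ?E `` {v})"
    using fin uV by (intro sum.union_disjoint)
   then show ?thesis using su sv by simp
  qed
  then show ?thesis
   unfolding D_eq step conn_insert_edge using True I2 by (auto simp add: sum_subtractf)
 qed
qed

section \<open>Composition of diagrams\<close>

definition pts :: "nat => nat => point set" where
 "pts p q = Top ` {1..p} \<union> Bot ` {1..q}"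

lemma pts_simps [simp]: "Top i \<in> pts p q \<longleftrightarrow> i \<in> {1..p}" "Bot i \<in> pts p q \<longleftrightarrow> i \<in> {1..q}"
 by (auto simp: pts_def)

lemma brauer_iff:
 "d \<in> brauer p q \<longleftrightarrow> \<Union>d = pts p q & disjoint d & (\<forall>e\<in>d. card e = 2)"
 unfolding brauer_def partition_on_def pts_def by auto

lemma brauer_card: "d \<in> brauer p q ==> e \<in> d ==> card e = 2"
 by (simp add: brauer_iff)

lemma brauer_Union: "d \<in> brauer p q ==> \<Union>d = pts p q"
 by (simp add: brauer_iff)

lemma brauer_mem: "d \<in> brauer p q ==> e \<in> d ==> x \<in> e ==> x \<in> pts p q"
 by (auto simp: brauer_iff)

lemma brauer_ex: "d \<in> brauer p q ==> x \<in> pts p q ==> \<exists>e\<in>d. x \<in> e"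
 using brauer_Union by blast

lemma brauer_unique: "d \<in> brauer p q ==> e \<in> d ==> e' \<in> d ==> x \<in> e ==> x \<in> e' ==> e = e'"
 unfolding brauer_iff disjoint_def by blast

lemma finite_pts [simp]: "finite (pts p q)"
 by (simp add: pts_def)

lemma finite_brauer [simp]: "finite (brauer p q)"
proof (rule finite_subset)
 show "brauer p q \<subseteq> Pow (Pow (pts p q))"
 proof
  fix d assume "d \<in> brauer p q"
  then have "\<Union>d = pts p q" by (rule brauer_Union)
  then show "d \<in> Pow (Pow (pts p q))" by blast
 qed
qed simp

lemma finite_diagram: "d \<in> brauer p q ==> finite d"
 by (metis brauer_Union finite_UnionD finite_pts)

subsection \<open>Associativity\<close>

text \<open>Diagrams are drawn between numbered levels, so that two or three of them become edge
  sets of one common graph; \<open>glued_point\<close> has room for two only.\<close>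

definition lv :: "nat => nat => point => nat \<times> nat" where
 "lv i j x = (case x of Top n => (i, n) | Bot n => (j, n))"

definition gl :: "nat => nat => nat => glued_point => nat \<times> nat" where
 "gl i j k x = (case x of Upper n => (i, n) | Middle n => (j, n) | Lower n => (k, n))"

abbreviation edges :: "diagram => nat => nat => (nat \<times> nat) set set" where
 "edges d i j \<equiv> (`) (lv i j) ` d"

lemma inj_gl: "i ~= j ==> j ~= k ==> i ~= k ==> inj (gl i j k)"
 by (auto simp: inj_def gl_def split: glued_point.splits)

lemma gl_halves: "gl i j k (upper_half x) = lv i j x" "gl i j k (lower_half x) = lv j k x"
 "gl i j k (outer x) = lv i k x"
 by (cases x; simp add: gl_def lv_def)+

lemma inj_halves: "inj upper_half" "inj lower_half" "inj outer"
 unfolding inj_def by (metis point.exhaust upper_half.simps glued_point.distinct(1) glued_point.inject,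
  metis point.exhaust lower_half.simps glued_point.distinct(5) glued_point.inject,
  metis point.exhaust outer.simps glued_point.distinct(3) glued_point.inject)

lemma range_lv: "range (lv i j) = {i, j} \<times> UNIV"
proof
 show "range (lv i j) \<subseteq> {i, j} \<times> UNIV" by (auto simp: lv_def split: point.splits)
 have "(i, n) = lv i j (Top n)" "(j, n) = lv i j (Bot n)" for n by (simp_all add: lv_def)
 then show "{i, j} \<times> UNIV \<subseteq> range (lv i j)" by (metis insertE mem_Sigma_iff empty_iff rangeI subrelI)
qed

lemma glue_levels: "(`) (gl i j k) ` glue f g = edges g i j \<union> edges f j k"
 unfolding glue_def by (simp add: image_Un image_image gl_halves)

lemma glue_card:
 assumes "\<forall>e\<in>f \<union> g. card e = 2" "e \<in> glue f g"
 shows "card e = 2"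
 using assms inj_halves[THEN inj_on_subset[OF _ subset_UNIV]] unfolding glue_def
 by (auto simp: card_image)

lemma components_eq:
 assumes "\<forall>e\<in>f \<union> g. card e = 2"
 shows "components f g = cc (glue f g)"
proof -
 have "{(x, y). {x, y} \<in> glue f g}\<^sup>* = conn (glue f g)"
  by (rule conn_pairs) (rule glue_card[OF assms])
 then show ?thesis unfolding components_def cc_def quotient_def by auto
qed

lemma components_levels:
 assumes "i ~= j" "j ~= k" "i ~= k" "\<forall>e\<in>f \<union> g. card e = 2"
 shows "cc (edges g i j \<union> edges f j k) = (`) (gl i j k) ` components f g"
proof -
 have "components f g = cc (glue f g)" by (rule components_eq) (rule assms(4))
 then show ?thesis
  unfolding glue_levels[symmetric] by (simp add: cc_image[OF inj_gl[OF assms(1-3)]])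
qed

lemma lv_vimage_gl: "i ~= j ==> j ~= k ==> i ~= k ==> lv i k -` (gl i j k ` X) = outer -` X"
 by (simp add: set_eq_iff gl_halves(3)[symmetric, of i k _ j] inj_image_mem_iff[OF inj_gl])

lemma dcomp_levels:
 assumes "i ~= j" "j ~= k" "i ~= k" "\<forall>e\<in>f \<union> g. card e = 2"
 shows "dcomp f g = (\<lambda>Y. lv i k -` Y) ` {X \<inter> range (lv i k) | X.
   X \<in> cc (edges g i j \<union> edges f j k) & X \<inter> range (lv i k) ~= {}}"
proof -
 have 1: "lv i k -` (X \<inter> range (lv i k)) = lv i k -` X" for X by auto
 have 2: "X \<inter> range (lv i k) ~= {} \<longleftrightarrow> lv i k -` X ~= {}" for X by blast
 have "(\<lambda>Y. lv i k -` Y) ` {X \<inter> range (lv i k) | X.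
   X \<in> cc (edges g i j \<union> edges f j k) & X \<inter> range (lv i k) ~= {}} =
  {lv i k -` X | X. X \<in> cc (edges g i j \<union> edges f j k) & lv i k -` X ~= {}}"
  unfolding 2 setcompr_eq_image image_image 1 by (rule refl)
 also have "... = dcomp f g"
 proof -
  have "cc (edges g i j \<union> edges f j k) = (`) (gl i j k) ` components f g"
   by (rule components_levels[OF assms])
  moreover have "{v X | X. X \<in> h ` C & v X ~= {}} = {v (h X) | X. X \<in> C & v (h X) ~= {}}"
   for C :: "glued_point set set" and v :: "(nat \<times> nat) set => point set" and h
   by blast
  ultimately show ?thesis unfolding dcomp_def by (simp only: lv_vimage_gl[OF assms(1-3)])
 qed
 finally show ?thesis by simp
qed

lemma loops_levels:
 assumes "i ~= j" "j ~= k" "i ~= k" "\<forall>e\<in>f \<union> g. card e = 2"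
 shows "loops f g = card {X \<in> cc (edges g i j \<union> edges f j k). X \<inter> range (lv i k) = {}}"
proof -
 have "{X \<in> cc (edges g i j \<union> edges f j k). X \<inter> range (lv i k) = {}}
   = {X \<in> cc (edges g i j \<union> edges f j k). lv i k -` X = {}}" by blast
 also have "... = (`) (gl i j k) ` {X \<in> components f g. outer -` X = {}}"
 proof -
  have "cc (edges g i j \<union> edges f j k) = (`) (gl i j k) ` components f g"
   by (rule components_levels[OF assms])
  moreover have "{X \<in> h ` C. v X = {}} = h ` {X \<in> C. v (h X) = {}}"
   for C :: "glued_point set set" and v :: "(nat \<times> nat) set => point set" and h
   by blast
  ultimately show ?thesis by (simp only: lv_vimage_gl[OF assms(1-3)])
 qed
 also have "card ... = loops f g"
  unfolding loops_def
  by (rule card_image) (use inj_gl[OF assms(1-3)] in \<open>auto simp: inj_on_def inj_image_eq_iff\<close>)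
 finally show ?thesis ..
qed

lemma edges_dcomp:
 assumes "i ~= j" "j ~= k" "i ~= k" "\<forall>e\<in>f \<union> g. card e = 2"
 shows "edges (dcomp f g) i k = {X \<inter> range (lv i k) | X.
   X \<in> cc (edges g i j \<union> edges f j k) & X \<inter> range (lv i k) ~= {}}"
proof -
 have d: "dcomp f g = (\<lambda>Y. lv i k -` Y) ` {X \<inter> range (lv i k) | X.
   X \<in> cc (edges g i j \<union> edges f j k) & X \<inter> range (lv i k) ~= {}}" (is "_ = _ ` ?S")
  by (rule dcomp_levels[OF assms])
 have "edges (dcomp f g) i k = (\<lambda>Y. Y) ` ?S"
  unfolding d image_image image_vimage_eq by (rule image_cong) blast+
 then show ?thesis by simp
qed

text \<open>Composition is contraction: the edges of the composite are the traces, on the two outer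
  levels, of the graph formed by the factors. \<open>E2\<close> stands for a third diagram still to
  be glued on.\<close>

lemma dcomp_contract:
 fixes ge fe :: "(nat \<times> nat) set set"
 assumes ij: "i ~= j" "j ~= k" "i ~= k" and card: "\<forall>e\<in>f \<union> g. card e = 2"
  and E1: "E1 = edges g i j \<union> edges f j k" and int: "\<Union>E1 \<inter> \<Union>E2 \<subseteq> range (lv i k)"
  and Out: "\<Union>(E1 \<union> E2) \<inter> Out \<subseteq> range (lv i k) \<union> \<Union>E2" and fin: "finite (\<Union>(E1 \<union> E2))"
 shows "{X \<inter> Out | X. X \<in> cc (edges (dcomp f g) i k \<union> E2) & X \<inter> Out ~= {}}
    = {X \<inter> Out | X. X \<in> cc (E1 \<union> E2) & X \<inter> Out ~= {}}"
  and "loops f g + card {X \<in> cc (edges (dcomp f g) i k \<union> E2). X \<inter> Out = {}}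
    = card {X \<in> cc (E1 \<union> E2). X \<inter> Out = {}}"
proof -
 let ?K = "range (lv i k) \<inter> \<Union>E1"
 interpret contraction E1 E2 ?K by unfold_locales (use int in auto)
 have K: "X \<inter> ?K = X \<inter> range (lv i k)" if "X \<in> cc E1" for X
  using cc_subset[OF that] by blast
 have tr: "edges (dcomp f g) i k = trace"
 proof -
  have "edges (dcomp f g) i k = {X \<inter> range (lv i k) |X. X \<in> cc E1 & X \<inter> range (lv i k) ~= {}}"
   unfolding E1 by (rule edges_dcomp[OF ij card])
  also have "... = trace" unfolding trace_def using K by (smt (verit) Collect_cong)
  finally show ?thesis .
 qed
 have O: "\<Union>(E1 \<union> E2) \<inter> Out \<subseteq> verts" using Out unfolding verts_def by blast
 have "loops f g = card {X \<in> cc E1. X \<inter> range (lv i k) = {}}"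
  unfolding E1 by (rule loops_levels[OF ij card])
 also have "{X \<in> cc E1. X \<inter> range (lv i k) = {}} = {X \<in> cc E1. X \<inter> ?K = {}}"
  using K by (smt (verit) Collect_cong)
 finally have "loops f g = card {X \<in> cc E1. X \<inter> ?K = {}}" .
 then show "{X \<inter> Out | X. X \<in> cc (edges (dcomp f g) i k \<union> E2) & X \<inter> Out ~= {}}
    = {X \<inter> Out | X. X \<in> cc (E1 \<union> E2) & X \<inter> Out ~= {}}"
  and "loops f g + card {X \<in> cc (edges (dcomp f g) i k \<union> E2). X \<inter> Out = {}}
    = card {X \<in> cc (E1 \<union> E2). X \<inter> Out = {}}"
  unfolding tr using traces_outer[OF O] card_hidden[OF O fin] by simp_all
qed

subsection \<open>Composites of diagrams are diagrams\<close>

lemma Union_glue: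
 assumes "f \<in> brauer q r" "g \<in> brauer p q"
 shows "\<Union>(glue f g) = Upper ` {1..p} \<union> Middle ` {1..q} \<union> Lower ` {1..r}"
proof -
 have "\<Union>(glue f g) = upper_half ` \<Union>g \<union> lower_half ` \<Union>f" unfolding glue_def by auto
 also have "... = Upper ` {1..p} \<union> Middle ` {1..q} \<union> Lower ` {1..r}"
  unfolding brauer_Union[OF assms(1)] brauer_Union[OF assms(2)] pts_def
  by (simp add: image_Un image_image) blast
 finally show ?thesis .
qed

lemma brauer_cards: "f \<in> brauer q r ==> g \<in> brauer p q ==> \<forall>e\<in>f \<union> g. card e = 2"
 by (auto simp: brauer_card)

lemma conn_disjoint: "disjoint E ==> e \<in> E ==> x \<in> e ==> conn E `` {x} = e"
proof (intro equalityI subsetI)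
 fix y assume a: "disjoint E" "e \<in> E" "x \<in> e" "y \<in> conn E `` {x}"
 from a(4) have "(x, y) \<in> conn E" by simp
 then show "y \<in> e"
  by (induction rule: conn_induct) (use a in \<open>auto simp: disjoint_def\<close>)
qed (auto intro: conn_edge)

lemma disjoint_inj_image: "inj \<phi> ==> disjoint E ==> disjoint ((`) \<phi> ` E)"
 by (rule disjoint_image[OF inj_on_subset]) auto

text \<open>Upper and middle points get weight 1, lower points weight 2. In the graph of
  \<open>g\<close> alone every component then weighs 2, an isolated lower point included. Adding the
  matching \<open>f\<close> takes 1 from each of its end points, after which exactly the outer
  points still weigh 1.\<close>

lemma card_components:
 assumes f: "f \<in> brauer q r" and g: "g \<in> brauer p q" and X: "X \<in> cc (glue f g)"
 shows "card (outer -` X) \<in> {0, 2}"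
proof -
 let ?V = "Upper ` {1..p} \<union> Middle ` {1..q} \<union> Lower ` {1..r}"
 let ?E = "(\<lambda>e. upper_half ` e) ` g" and ?F = "(\<lambda>e. lower_half ` e) ` f"
 define D :: "glued_point => int" where "D x = (case x of Lower n => 2 | _ => 1)" for x
 have UE: "\<Union>?E = Upper ` {1..p} \<union> Middle ` {1..q}"
  using brauer_Union[OF g] unfolding image_Union[symmetric] pts_def by (simp add: image_Un image_image)
 have UF: "\<Union>?F = Middle ` {1..q} \<union> Lower ` {1..r}"
  using brauer_Union[OF f] unfolding image_Union[symmetric] pts_def by (simp add: image_Un image_image)
 have dE: "disjoint ?E" and dF: "disjoint ?F"
  using f g inj_halves disjoint_inj_image by (auto simp: brauer_iff)
 have cE: "card e = 2" if "e \<in> ?E" for e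
  using that g inj_halves(1) by (auto simp: brauer_card card_image inj_on_subset)
 have cF: "card e = 2" if "e \<in> ?F" for e
  using that f inj_halves(2) by (auto simp: brauer_card card_image inj_on_subset)
 obtain x where x: "x \<in> ?V" "X = conn (?E \<union> ?F) `` {x}"
  using X unfolding cc_def Union_glue[OF f g] by (auto simp: glue_def)
 have XV: "X \<subseteq> ?V" using cc_subset[OF X] Union_glue[OF f g] by simp
 have finX: "finite X" using XV finite_subset by blast
 have "sum (\<lambda>y. D y - (if y \<in> \<Union>?F then 1 else 0)) (conn (?E \<union> ?F) `` {x}) \<in> {0, 2}"
 proof (rule matching_weights[of ?V])
  show "finite ?F" using finite_diagram[OF f] by simp
  show "card e = 2 & e \<subseteq> ?V" if "e \<in> ?F" for e
   using cF[OF that] UF that by blast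
  show "e \<subseteq> ?V" if "e \<in> ?E" for e using UE that by blast
  fix z assume z: "z \<in> ?V"
  show "sum D (conn ?E `` {z}) \<in> {0, 2}"
  proof (cases "z \<in> \<Union>?E")
   case True
   then obtain e where e: "e \<in> ?E" "z \<in> e" by blast
   then have "conn ?E `` {z} = e" using conn_disjoint[OF dE] by blast
   moreover have "sum D e = sum (\<lambda>_. 1) e"
   proof (rule sum.cong)
    fix y assume "y \<in> e"
    then have "y \<in> Upper ` {1..p} \<union> Middle ` {1..q}" using e UE by blast
    then show "D y = 1" unfolding D_def by auto
   qed simp
   ultimately show ?thesis using cE[OF e(1)] by simp
  next
   case False
   have "conn ?E `` {z} \<subseteq> {z}"
   proof
    fix y assume "y \<in> conn ?E `` {z}"
    then have "(z, y) \<in> conn ?E" by simp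
    from conn_field[OF this] False show "y \<in> {z}" by (elim disjE conjE) simp_all
   qed
   then have "conn ?E `` {z} = {z}" by (intro equalityI) simp_all
   have "z \<in> C" if "z \<in> A \<union> B \<union> C" "z \<notin> A \<union> B" for A B C :: "glued_point set"
    using that by blast
   from this[OF z False[unfolded UE]] obtain n where "z = Lower n" by (rule imageE)
   then have "D z = 2" by (simp add: D_def)
   with \<open>conn ?E `` {z} = {z}\<close> show ?thesis by simp
  qed
  show "0 \<le> D z" by (simp add: D_def split: glued_point.split)
 next
  show "1 \<le> D z" for z by (simp add: D_def split: glued_point.split)
 qed (simp, fact dF, fact x(1))
 also have "sum (\<lambda>y. D y - (if y \<in> \<Union>?F then 1 else 0)) (conn (?E \<union> ?F) `` {x})
  = sum (\<lambda>y. if y \<in> range outer then 1 else 0) X"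
 proof (rule sum.cong)
  fix y assume "y \<in> X"
  then consider n where "y = Upper n" | n where "y = Middle n" "n \<in> {1..q}" | n where "y = Lower n" "n \<in> {1..r}"
   using XV by blast
  then show "D y - (if y \<in> \<Union>?F then 1 else 0) = (if y \<in> range outer then 1 else 0)"
  proof cases
   case 1
   then have "y \<in> range outer" using rangeI[of outer "Top n"] by simp
   then show ?thesis using 1 unfolding UF D_def by auto
  next
   case 2
   have "Middle n ~= outer w" for w by (cases w) simp_all
   then have "y \<notin> range outer" using 2 by auto
   then show ?thesis using 2 unfolding UF D_def by auto
  next
   case 3
   then have "y \<in> range outer" using rangeI[of outer "Bot n"] by simp
   then show ?thesis using 3 unfolding UF D_def by auto
  qed
 qed (simp only: x(2))
 also have "... = int (card (X \<inter> range outer))"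
  using finX by (simp add: sum.inter_restrict[symmetric])
 also have "card (X \<inter> range outer) = card (outer -` X)"
  using card_vimage_inj_on_le card_image[of outer "outer -` X"] inj_halves(3)
  by (metis image_vimage_eq inj_on_subset subset_UNIV)
 finally show ?thesis by auto
qed

lemma dcomp_brauer:
 assumes f: "f \<in> brauer q r" and g: "g \<in> brauer p q"
 shows "dcomp f g \<in> brauer p r"
proof -
 note comp = components_eq[of f g, OF brauer_cards[OF f g], simplified]
 have "\<Union>(dcomp f g) = outer -` \<Union>(glue f g)"
  unfolding dcomp_def comp partition_onD1[OF partition_on_cc, of "glue f g"] by auto
 also have "... = pts p r"
  unfolding Union_glue[OF f g] pts_def by (auto elim!: outer.elims)
 finally have "\<Union>(dcomp f g) = pts p r" .
 moreover have "disjoint (dcomp f g)"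
  unfolding dcomp_def comp disjoint_def using cc_disjoint[of _ "glue f g"] by blast
 moreover have "card e = 2" if e: "e \<in> dcomp f g" for e
 proof -
  obtain X where X: "X \<in> cc (glue f g)" "e = outer -` X" "e ~= {}"
   using e unfolding dcomp_def comp by auto
  have "e \<subseteq> pts p r" using e \<open>\<Union>(dcomp f g) = pts p r\<close> by auto
  then have "finite e" using finite_subset finite_pts by blast
  then show ?thesis using card_components[OF f g X(1)] X by auto
 qed
 ultimately show ?thesis by (simp add: brauer_iff)
qed

lemma finite_edges: "f \<in> brauer p q ==> finite (\<Union>(edges f i j))"
 by (simp add: brauer_Union image_Union[symmetric])

lemma edges_sub: "\<Union>(edges f i j) \<subseteq> {i, j} \<times> UNIV"
 using range_lv[of i j] by auto

text \<open>On four levels the three diagrams form a single graph. Contracting level 2 first or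
  level 1 first gives the two bracketings, and both keep the traces on levels 0 and 3 and the total
  number of loops.\<close>

lemma dcomp_assoc_loops:
 assumes h: "h \<in> brauer p q" and g: "g \<in> brauer q r" and f: "f \<in> brauer r s"
 shows "dcomp (dcomp f g) h = dcomp f (dcomp g h)"
  and "loops f g + loops (dcomp f g) h = loops g h + loops f (dcomp g h)"
proof -
 let ?G = "edges h 0 1 \<union> edges g 1 2 \<union> edges f 2 3" and ?O = "range (lv 0 3)"
 have fin: "finite (\<Union>(edges h 0 1))" "finite (\<Union>(edges g 1 2))" "finite (\<Union>(edges f 2 3))"
  using finite_edges h g f by blast+
 note sub = edges_sub[of 0 1 h] edges_sub[of 1 2 g] edges_sub[of 2 3 f]
 have c1: "\<forall>e\<in>f \<union> g. card e = 2" and c2: "\<forall>e\<in>g \<union> h. card e = 2"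
  and c3: "\<forall>e\<in>dcomp f g \<union> h. card e = 2" and c4: "\<forall>e\<in>f \<union> dcomp g h. card e = 2"
  using brauer_card f g h dcomp_brauer[OF f g] dcomp_brauer[OF g h] by blast+
 have G1: "(edges g 1 2 \<union> edges f 2 3) \<union> edges h 0 1 = ?G" by blast
 have 1: "\<Union>(edges g 1 2 \<union> edges f 2 3) \<inter> \<Union>(edges h 0 1) \<subseteq> range (lv 1 3)"
 proof -
  have "\<Union>(edges g 1 2 \<union> edges f 2 3) \<subseteq> {1,2} \<times> UNIV \<union> {2,3} \<times> UNIV"
   using sub(2,3) unfolding Union_Un_distrib by (rule Un_mono)
  then have "\<Union>(edges g 1 2 \<union> edges f 2 3) \<inter> \<Union>(edges h 0 1)
    \<subseteq> ({1,2} \<times> UNIV \<union> {2,3} \<times> UNIV) \<inter> ({0,1} \<times> UNIV)"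
   using sub(1) by (rule Int_mono)
  then show ?thesis unfolding range_lv by (rule subset_trans) auto
 qed
 have 2: "\<Union>?G \<inter> ?O \<subseteq> range (lv 1 3) \<union> \<Union>(edges h 0 1)"
 proof
  fix z assume z: "z \<in> \<Union>?G \<inter> ?O"
  then have "z \<in> {0, 3} \<times> UNIV" unfolding range_lv by (rule IntD2)
  then have "fst z = 0 \<or> fst z = 3" by (cases z) simp
  moreover have "z \<in> \<Union>(edges h 0 1)" if "fst z = 0"
  proof -
   have "z \<notin> {1,2} \<times> UNIV" "z \<notin> {2,3} \<times> UNIV" using that by auto
   then have "z \<notin> \<Union>(edges g 1 2)" "z \<notin> \<Union>(edges f 2 3)"
    by - (rule contra_subsetD[OF sub(2)], assumption, rule contra_subsetD[OF sub(3)], assumption)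
   then show ?thesis using IntD1[OF z] unfolding Union_Un_distrib by simp
  qed
  ultimately show "z \<in> range (lv 1 3) \<union> \<Union>(edges h 0 1)" unfolding range_lv by (cases z) auto
 qed
 have 3: "\<Union>(edges h 0 1 \<union> edges g 1 2) \<inter> \<Union>(edges f 2 3) \<subseteq> range (lv 0 2)"
 proof -
  have "\<Union>(edges h 0 1 \<union> edges g 1 2) \<subseteq> {0,1} \<times> UNIV \<union> {1,2} \<times> UNIV"
   using sub(1,2) unfolding Union_Un_distrib by (rule Un_mono)
  then have "\<Union>(edges h 0 1 \<union> edges g 1 2) \<inter> \<Union>(edges f 2 3)
    \<subseteq> ({0,1} \<times> UNIV \<union> {1,2} \<times> UNIV) \<inter> ({2,3} \<times> UNIV)"
   using sub(3) by (rule Int_mono)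
  then show ?thesis unfolding range_lv by (rule subset_trans) auto
 qed
 have 4: "\<Union>?G \<inter> ?O \<subseteq> range (lv 0 2) \<union> \<Union>(edges f 2 3)"
 proof
  fix z assume z: "z \<in> \<Union>?G \<inter> ?O"
  then have "z \<in> {0, 3} \<times> UNIV" unfolding range_lv by (rule IntD2)
  then have "fst z = 0 \<or> fst z = 3" by (cases z) simp
  moreover have "z \<in> \<Union>(edges f 2 3)" if "fst z = 3"
  proof -
   have "z \<notin> {0,1} \<times> UNIV" "z \<notin> {1,2} \<times> UNIV" using that by auto
   then have "z \<notin> \<Union>(edges h 0 1)" "z \<notin> \<Union>(edges g 1 2)"
    by - (rule contra_subsetD[OF sub(1)], assumption, rule contra_subsetD[OF sub(2)], assumption)
   then show ?thesis using IntD1[OF z] unfolding Union_Un_distrib by simp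
  qed
  ultimately show "z \<in> range (lv 0 2) \<union> \<Union>(edges f 2 3)" unfolding range_lv by (cases z) auto
 qed
 have finG: "finite (\<Union>?G)" using fin by simp
 have ne: "(0::nat) ~= 1" "(1::nat) ~= 2" "(2::nat) ~= 3" "(0::nat) ~= 3" "(0::nat) ~= 2" "(1::nat) ~= 3" by simp_all
 note A = dcomp_contract[OF ne(2,3,6) c1 refl 1, unfolded G1, OF 2 finG]
 note B = dcomp_contract[OF ne(1,2,5) c2 refl 3, OF 4 finG]
 have comm: "edges (dcomp f g) 1 3 \<union> edges h 0 1 = edges h 0 1 \<union> edges (dcomp f g) 1 3" by blast
 show "dcomp (dcomp f g) h = dcomp f (dcomp g h)"
  unfolding dcomp_levels[OF ne(1,6,4) c3] dcomp_levels[OF ne(5,3,4) c4]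
   A(1)[unfolded comm] B(1) ..
 show "loops f g + loops (dcomp f g) h = loops g h + loops f (dcomp g h)"
  unfolding loops_levels[OF ne(1,6,4) c3] loops_levels[OF ne(5,3,4) c4]
   A(2)[unfolded comm] B(2) ..
qed

section \<open>Upward and downward diagrams\<close>

lemma flip_point_invol [simp]: "flip_point (flip_point x) = x"
 by (cases x) simp_all

lemma inj_flip_point: "inj flip_point"
 by (metis flip_point_invol injI)

lemma flip_point_image_image [simp]: "flip_point ` flip_point ` e = e"
 by (simp add: image_image)

lemma flip_flip [simp]: "flip (flip d) = d"
 by (simp add: flip_def image_image)

lemma flip_mem: "e \<in> flip d \<longleftrightarrow> flip_point ` e \<in> d"
 unfolding flip_def by (metis (no_types, lifting) flip_point_image_image image_iff)

lemma flip_brauer: "d \<in> brauer p q ==> flip d \<in> brauer q p"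
proof -
 assume d: "d \<in> brauer p q"
 have "\<Union>(flip d) = flip_point ` \<Union>d" unfolding flip_def by auto
 also have "... = pts q p" unfolding brauer_Union[OF d] pts_def by (auto simp: image_Un image_image)
 finally have "\<Union>(flip d) = pts q p" .
 moreover have "disjoint (flip d)"
  unfolding flip_def using d by (intro disjoint_inj_image inj_flip_point) (simp add: brauer_iff)
 moreover have "\<forall>e\<in>flip d. card e = 2"
  using d inj_flip_point unfolding flip_def by (auto simp: brauer_iff card_image inj_on_subset)
 ultimately show ?thesis by (simp add: brauer_iff)
qed

lemma upward_flip [simp]: "upward (flip d) \<longleftrightarrow> downward d"
 and downward_flip [simp]: "downward (flip d) \<longleftrightarrow> upward d"
 by (simp_all add: upward_def downward_def flip_mem)

lemma monotone_flip: "monotone_diagram d ==> monotone_diagram (flip d)"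
 unfolding monotone_diagram_def flip_mem
proof (intro allI impI)
 fix i j k l
 assume m: "\<forall>i j k l. {Top i, Bot j} \<in> d & {Top k, Bot l} \<in> d & {Top i, Bot j} ~= {Top k, Bot l} -->
   0 < (int i - int k) * (int j - int l)"
  and e: "flip_point ` {Top i, Bot j} \<in> d & flip_point ` {Top k, Bot l} \<in> d
   & {Top i, Bot j} ~= {Top k, Bot l}"
 then have "{Top j, Bot i} \<in> d & {Top l, Bot k} \<in> d & {Top j, Bot i} ~= {Top l, Bot k}"
  by (auto simp: doubleton_eq_iff insert_commute)
 then have "0 < (int j - int l) * (int i - int k)" using m by blast
 then show "0 < (int i - int k) * (int j - int l)" by (simp add: mult.commute)
qed

lemma flip_up [simp]: "flip d \<in> Up p q \<longleftrightarrow> d \<in> Dn q p"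
 and flip_down [simp]: "flip d \<in> Dn p q \<longleftrightarrow> d \<in> Up q p"
 unfolding brauer_up_def brauer_down_def using flip_brauer[of d] flip_brauer[of "flip d"] by auto

lemma flip_up_mono [simp]: "flip d \<in> Um p q \<longleftrightarrow> d \<in> brauer_down_mono q p"
 and flip_down_mono [simp]: "flip d \<in> brauer_down_mono p q \<longleftrightarrow> d \<in> Um q p"
 unfolding brauer_up_mono_def brauer_down_mono_def
 using monotone_flip[of d] monotone_flip[of "flip d"] by auto

text \<open>Reflection of the glued picture in its middle level, which exchanges the two
  factors.\<close>

fun sw :: "glued_point => glued_point" where
 "sw (Upper i) = Lower i"
| "sw (Middle i) = Middle i"
| "sw (Lower i) = Upper i"

lemma sw_sw [simp]: "sw (sw x) = x"
 by (cases x) simp_all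

lemma sw_halves: "sw (upper_half x) = lower_half (flip_point x)" "sw (lower_half x) = upper_half (flip_point x)"
 "sw (outer x) = outer (flip_point x)"
 by (cases x; simp)+

lemma glue_flip: "glue (flip g) (flip f) = (`) sw ` glue f g"
 unfolding glue_def flip_def by (simp add: image_Un image_image sw_halves Un_commute)

lemma dcomp_flip:
 assumes f: "f \<in> brauer q r" and g: "g \<in> brauer p q"
 shows "dcomp (flip g) (flip f) = flip (dcomp f g)" and "loops (flip g) (flip f) = loops f g"
proof -
 have "components (flip g) (flip f) = cc (glue (flip g) (flip f))"
  by (rule components_eq[OF brauer_cards[OF flip_brauer[OF g] flip_brauer[OF f]]])
 also have "... = (`) sw ` cc (glue f g)"
  unfolding glue_flip by (rule cc_image) (metis injI sw_sw)
 also have "cc (glue f g) = components f g"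
  by (rule components_eq[OF brauer_cards[OF f g], symmetric])
 finally have c: "components (flip g) (flip f) = (`) sw ` components f g" .
 have v: "outer -` (sw ` X) = flip_point ` (outer -` X)" for X
 proof (intro equalityI subsetI)
  fix y assume "y \<in> outer -` (sw ` X)"
  then obtain x where "x \<in> X" "outer y = sw x" by auto
  then have "outer (flip_point y) \<in> X" by (metis sw_halves(3) sw_sw)
  then show "y \<in> flip_point ` (outer -` X)" by (metis flip_point_invol image_iff vimage_eq)
 next
  fix y assume "y \<in> flip_point ` (outer -` X)"
  then obtain x where "outer x \<in> X" "y = flip_point x" by auto
  then have "outer y = sw (outer x)" by (simp add: sw_halves)
  then show "y \<in> outer -` (sw ` X)" using \<open>outer x \<in> X\<close> by simp
 qed
 have gen: "{w X | X. X \<in> h ` C & w X ~= {}} = {w (h X) | X. X \<in> C & w (h X) ~= {}}"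
  "{X \<in> h ` C. w X = {}} = h ` {X \<in> C. w (h X) = {}}"
  for C :: "glued_point set set" and w :: "glued_point set => point set" and h by blast+
 have "dcomp (flip g) (flip f) = {flip_point ` (outer -` X) | X. X \<in> components f g & flip_point ` (outer -` X) ~= {}}"
  unfolding dcomp_def c gen(1) v ..
 also have "... = flip (dcomp f g)"
  unfolding flip_def dcomp_def image_is_empty by blast
 finally show "dcomp (flip g) (flip f) = flip (dcomp f g)" .
 have "inj sw" by (metis injI sw_sw)
 then have "inj_on ((`) sw) A" for A by (auto simp: inj_on_def inj_image_eq_iff)
 then show "loops (flip g) (flip f) = loops f g"
  unfolding loops_def c gen(2) v image_is_empty by (rule card_image)
qed

section \<open>Upward diagrams as strands and bottom pairs\<close>

definition strand :: "diagram => nat => nat" where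
 "strand f i = (THE j. {Top i, Bot j} \<in> f)"

definition bots :: "diagram => diagram" where
 "bots f = {e \<in> f. e \<subseteq> range Bot}"

text \<open>The bottom points of a diagram placed above \<open>f\<close> are pulled down along the
  strands of \<open>f\<close>.\<close>

definition rho :: "diagram => point => point" where
 "rho f x = (case x of Top i => Top i | Bot i => Bot (strand f i))"

lemma rho_simps [simp]: "rho f (Top i) = Top i" "rho f (Bot i) = Bot (strand f i)"
 by (simp_all add: rho_def)

lemma upD: "f \<in> Up p q ==> f \<in> brauer p q" and downD: "f \<in> Dn p q ==> f \<in> brauer p q"
 and up_monoD: "f \<in> Um p q ==> f \<in> Up p q"
 and down_monoD: "f \<in> brauer_down_mono p q ==> f \<in> Dn p q"
 by (simp_all add: brauer_up_def brauer_down_def brauer_up_mono_def brauer_down_mono_def)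

lemma up_edge:
 assumes f: "f \<in> Up q r" and e: "e \<in> f" "Top i \<in> e"
 obtains j where "j \<in> {1..r}" "e = {Top i, Bot j}"
proof -
 have "card e = 2" using f e by (meson brauer_card upD)
 then obtain y where y: "e = {Top i, y}" using e(2) by (auto simp: card_2_iff)
 show thesis
 proof (cases y)
  case (Top k)
  then show ?thesis using f e y by (auto simp: brauer_up_def upward_def)
 next
  case (Bot j)
  have "Bot j \<in> pts q r" using brauer_mem[OF upD[OF f] e(1)] y Bot by blast
  then show ?thesis using that y Bot by simp
 qed
qed

lemma strand_eqI: "f \<in> brauer q r ==> {Top i, Bot j} \<in> f ==> strand f i = j"
 unfolding strand_def
proof (rule the_equality)
 fix k assume "f \<in> brauer q r" "{Top i, Bot j} \<in> f" "{Top i, Bot k} \<in> f"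
 then have "{Top i, Bot j} = {Top i, Bot k}" using brauer_unique by (metis insertI1)
 then show "k = j" by (simp add: doubleton_eq_iff)
qed

lemma strand:
 assumes f: "f \<in> Up q r" and i: "i \<in> {1..q}"
 shows "{Top i, Bot (strand f i)} \<in> f" "strand f i \<in> {1..r}"
proof -
 obtain e where e: "e \<in> f" "Top i \<in> e" using brauer_ex[OF upD[OF f], of "Top i"] i by auto
 obtain j where "j \<in> {1..r}" "e = {Top i, Bot j}" using up_edge[OF f e] by metis
 then show "{Top i, Bot (strand f i)} \<in> f" "strand f i \<in> {1..r}"
  using strand_eqI[OF upD[OF f]] e by auto
qed

lemma strand_inj: "f \<in> Up q r ==> inj_on (strand f) {1..q}"
proof (rule inj_onI)
 fix i k assume f: "f \<in> Up q r" and ik: "i \<in> {1..q}" "k \<in> {1..q}" "strand f i = strand f k"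
 have "{Top i, Bot (strand f i)} = {Top k, Bot (strand f k)}"
  using strand(1)[OF f] ik brauer_unique[OF upD[OF f], of _ _ "Bot (strand f i)"]
  by (metis insertI1 insertI2)
 then show "i = k" by (simp add: doubleton_eq_iff)
qed

lemma up_split: "f \<in> Up q r ==> f = bots f \<union> (\<lambda>i. {Top i, Bot (strand f i)}) ` {1..q}"
proof (intro equalityI subsetI)
 fix e assume f: "f \<in> Up q r" and e: "e \<in> f"
 show "e \<in> bots f \<union> (\<lambda>i. {Top i, Bot (strand f i)}) ` {1..q}"
 proof (cases "\<exists>i. Top i \<in> e")
  case True
  then obtain i where i: "Top i \<in> e" by blast
  then have "i \<in> {1..q}" using brauer_mem[OF upD[OF f] e i] by simp
  moreover obtain j where "e = {Top i, Bot j}" using up_edge[OF f e i] by metis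
  ultimately show ?thesis using strand_eqI[OF upD[OF f]] e by auto
 next
  case False
  then have "x \<in> range Bot" if "x \<in> e" for x
   using that by (cases x) auto
  then show ?thesis using e by (auto simp: bots_def)
 qed
next
 fix e assume f: "f \<in> Up q r" and "e \<in> bots f \<union> (\<lambda>i. {Top i, Bot (strand f i)}) ` {1..q}"
 then show "e \<in> f" using strand(1)[OF f] unfolding bots_def by blast
qed

lemma strand_not_bots:
 assumes f: "f \<in> Up q r" and i: "i \<in> {1..q}" and e: "e \<in> bots f"
 shows "Bot (strand f i) \<notin> e"
proof
 assume "Bot (strand f i) \<in> e"
 then have "{Top i, Bot (strand f i)} = e"
  by (intro brauer_unique[OF upD[OF f] strand(1)[OF f i]]) (use e in \<open>simp_all add: bots_def\<close>)
 then show False using e by (auto simp: bots_def)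
qed

text \<open>Every middle point continues straight down along a strand of \<open>f\<close>. Hence no
  loop can close, and the composite is \<open>g\<close> with its bottom points relabelled, together
  with the bottom pairs of \<open>f\<close>.\<close>

lemma dcomp_up:
 assumes f: "f \<in> Up q r" and g: "g \<in> brauer p q"
 shows "dcomp f g = bots f \<union> (`) (rho f) ` g" and "loops f g = 0"
proof -
 note fb = upD[OF f]
 \<comment> \<open>The component of an edge \<open>e\<close> of \<open>g\<close>: its own points and
   the lower ends of the strands that leave it.\<close>
 define Y where "Y e = upper_half ` e \<union> (\<lambda>x. outer (rho f x)) ` e" for e
 let ?P = "Y ` g \<union> (`) outer ` bots f"
 have outer_rho: "outer (rho f x) = (case x of Top i => Upper i | Bot i => Lower (strand f i))" for x
  by (cases x) auto
 have bot_lower: "outer ` e = lower_half ` e" if "e \<subseteq> range Bot" for e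
  using that by (intro image_cong) auto
 have key: "x = x'" if "x \<in> pts p q" "x' \<in> pts p q" "z = upper_half x \<or> z = outer (rho f x)"
  "z = upper_half x' \<or> z = outer (rho f x')" for x x' z
  using that strand_inj[OF f] by (cases x; cases x') (auto simp: inj_on_eq_iff)
 have Ydisj: "e = e'" if e: "e \<in> g" "e' \<in> g" and z: "z \<in> Y e" "z \<in> Y e'" for e e' z
 proof -
  obtain x where x: "x \<in> e" "z = upper_half x \<or> z = outer (rho f x)" using z(1) unfolding Y_def by auto
  obtain x' where x': "x' \<in> e'" "z = upper_half x' \<or> z = outer (rho f x')" using z(2) unfolding Y_def by auto
  have "x = x'" using key[OF brauer_mem[OF g e(1) x(1)] brauer_mem[OF g e(2) x'(1)] x(2) x'(2)] .
  then show ?thesis using brauer_unique[OF g e, of x] x x' by simp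
 qed
 have YB: False if e: "e \<in> g" "z \<in> Y e" and b: "b \<in> bots f" "z \<in> outer ` b" for e z b
 proof -
  obtain x where x: "x \<in> e" "z = upper_half x \<or> z = outer (rho f x)" using e(2) unfolding Y_def by auto
  obtain j where j: "Bot j \<in> b" "z = Lower j" using b unfolding bots_def by auto
  then obtain i where i: "x = Bot i" "j = strand f i" using x(2) by (cases x) auto
  then have "i \<in> {1..q}" using brauer_mem[OF g e(1) x(1)] by simp
  then show False using strand_not_bots[OF f _ b(1)] i j by blast
 qed
 have part: "partition_on (\<Union>(glue f g)) ?P"
 proof (rule partition_onI)
  have "\<Union>?P \<subseteq> \<Union>(glue f g)"
  proof
   fix z assume "z \<in> \<Union>?P"
   then consider e x where "e \<in> g" "x \<in> e" "z = upper_half x" | e x where "e \<in> g" "x \<in> e" "z = outer (rho f x)"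
    | b where "b \<in> bots f" "z \<in> outer ` b"
    unfolding Y_def by blast
   then show "z \<in> \<Union>(glue f g)"
   proof cases
    case 1
    then show ?thesis unfolding glue_def by blast
   next
    case 2
    show ?thesis
    proof (cases x)
     case (Top i)
     then have "z = upper_half x" using 2 by simp
     then show ?thesis using 2 unfolding glue_def by blast
    next
     case (Bot i)
     then have "i \<in> {1..q}" using brauer_mem[OF g 2(1,2)] by simp
     then have "{Top i, Bot (strand f i)} \<in> f" by (rule strand(1)[OF f])
     moreover have "z = lower_half (Bot (strand f i))" using 2 Bot by simp
     ultimately show ?thesis unfolding glue_def by blast
    qed
   next
    case 3
    then have "z \<in> lower_half ` b" "b \<in> f" using bot_lower unfolding bots_def by auto
    then show ?thesis unfolding glue_def by blast
   qed
  qed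
  moreover have "\<Union>(glue f g) \<subseteq> \<Union>?P"
  proof
   fix z assume "z \<in> \<Union>(glue f g)"
   then consider e where "e \<in> g" "z \<in> upper_half ` e" | e x where "e \<in> f" "x \<in> e" "z = lower_half x"
    unfolding glue_def by blast
   then show "z \<in> \<Union>?P"
   proof cases
    case 1
    then show ?thesis unfolding Y_def by blast
   next
    case 2
    show ?thesis
    proof (cases "e \<in> bots f")
     case True
     then have "z \<in> outer ` e" using 2 bot_lower unfolding bots_def by auto
     then show ?thesis using True by blast
    next
     case False
     then obtain i where i: "i \<in> {1..q}" "e = {Top i, Bot (strand f i)}"
      using up_split[OF f] 2(1) by blast
     obtain e' where e': "e' \<in> g" "Bot i \<in> e'" using brauer_ex[OF g, of "Bot i"] i(1) by auto
     have "z = upper_half (Bot i) \<or> z = outer (rho f (Bot i))" using 2 i by auto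
     then have "z \<in> Y e'" using e' unfolding Y_def by blast
     then show ?thesis using e' by blast
    qed
   qed
  qed
  ultimately show "\<Union>?P = \<Union>(glue f g)" by blast
  show "{} \<notin> ?P"
  proof
   assume "{} \<in> ?P"
   then have "{} \<in> g \<or> {} \<in> f" unfolding Y_def bots_def by auto
   then show False using brauer_card[OF g] brauer_card[OF fb] by fastforce
  qed
  fix X X' assume X: "X \<in> ?P" "X' \<in> ?P" "X ~= X'"
  show "disjnt X X'"
  proof (rule ccontr)
   assume "\<not> disjnt X X'"
   then obtain z where z: "z \<in> X" "z \<in> X'" unfolding disjnt_def by blast
   from X(1) show False
   proof
    assume "X \<in> Y ` g"
    then obtain e where e: "e \<in> g" "X = Y e" by blast
    from X(2) show False
    proof
     assume "X' \<in> Y ` g"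
     then show False using Ydisj e z X(3) by blast
    next
     assume "X' \<in> (`) outer ` bots f"
     then show False using YB e z by blast
    qed
   next
    assume "X \<in> (`) outer ` bots f"
    then obtain b where b: "b \<in> bots f" "X = outer ` b" by blast
    from X(2) show False
    proof
     assume "X' \<in> Y ` g"
     then show False using YB b z by blast
    next
     assume "X' \<in> (`) outer ` bots f"
     then obtain b' where b': "b' \<in> bots f" "X' = outer ` b'" by blast
     then obtain w where "w \<in> b" "w \<in> b'" using z b inj_halves(3) by (auto simp: inj_eq)
     then have "b = b'" using brauer_unique[OF fb] b b' unfolding bots_def by blast
     then show False using b b' X(3) by blast
    qed
   qed
  qed
 qed
 have "cc (glue f g) = ?P"
 proof (rule cc_eqI[OF part])
  fix a assume "a \<in> glue f g"
  then consider e where "e \<in> g" "a = upper_half ` e" | e where "e \<in> f" "a = lower_half ` e"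
   unfolding glue_def by blast
  then show "\<exists>X\<in>?P. a \<subseteq> X"
  proof cases
   case 1
   then show ?thesis unfolding Y_def by blast
  next
   case 2
   show ?thesis
   proof (cases "e \<in> bots f")
    case True
    then have "a = outer ` e" using 2 bot_lower unfolding bots_def by auto
    then show ?thesis using True by blast
   next
    case False
    then obtain i where i: "i \<in> {1..q}" "e = {Top i, Bot (strand f i)}"
     using up_split[OF f] 2(1) by blast
    obtain e' where e': "e' \<in> g" "Bot i \<in> e'" using brauer_ex[OF g, of "Bot i"] i(1) by auto
    have "a = {upper_half (Bot i), outer (rho f (Bot i))}" using 2 i by simp
    then have "a \<subseteq> Y e'" using e' unfolding Y_def by blast
    then show ?thesis using e' by blast
   qed
  qed
 next
  fix X u v assume X: "X \<in> ?P" "u \<in> X" "v \<in> X"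
  from X(1) show "(u, v) \<in> conn (glue f g)"
  proof
   assume "X \<in> Y ` g"
   then obtain e where e: "e \<in> g" "X = Y e" by blast
   have up: "upper_half ` e \<in> glue f g" using e unfolding glue_def by blast
   obtain x where x: "x \<in> e" using brauer_card[OF g e(1)] by fastforce
   have c: "(upper_half x, w) \<in> conn (glue f g)" if w: "w \<in> X" for w
   proof -
    obtain y where y: "y \<in> e" "w = upper_half y \<or> w = outer (rho f y)"
     using w e(2) unfolding Y_def by blast
    have 1: "(upper_half x, upper_half y) \<in> conn (glue f g)" using up x y(1) by (blast intro: conn_edge)
    moreover have "(upper_half y, outer (rho f y)) \<in> conn (glue f g)"
    proof (cases y)
     case (Bot i)
     then have "i \<in> {1..q}" using brauer_mem[OF g e(1) y(1)] by simp
     then have "{Top i, Bot (strand f i)} \<in> f" by (rule strand(1)[OF f])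
     then have "lower_half ` {Top i, Bot (strand f i)} \<in> glue f g" unfolding glue_def by blast
     then show ?thesis by (rule conn_edge) (simp_all add: Bot)
    qed simp
    ultimately show ?thesis using y(2) conn_trans by metis
   qed
   show ?thesis using conn_trans[OF conn_sym[OF c[OF X(2)]] c[OF X(3)]] .
  next
   assume "X \<in> (`) outer ` bots f"
   then obtain b where b: "b \<in> bots f" "X = outer ` b" by blast
   then have "X = lower_half ` b" "b \<in> f" using bot_lower unfolding bots_def by auto
   then have "X \<in> glue f g" unfolding glue_def by blast
   then show ?thesis using X by (auto intro: conn_edge)
  qed
 qed
 moreover have "components f g = cc (glue f g)" by (rule components_eq[OF brauer_cards[OF fb g]])
 ultimately have c: "components f g = ?P" by simp
 have "outer -` upper_half ` e \<subseteq> rho f ` e" for e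
 proof
  fix x assume "x \<in> outer -` upper_half ` e"
  then obtain y where "y \<in> e" "outer x = upper_half y" by auto
  then show "x \<in> rho f ` e" by (cases x; cases y) force+
 qed
 moreover have "outer -` (\<lambda>x. outer (rho f x)) ` e = rho f ` e" for e
  using inj_vimage_image_eq[OF inj_halves(3), of "rho f ` e"] by (simp add: image_image)
 ultimately have vY: "outer -` Y e = rho f ` e" for e
  unfolding Y_def vimage_Un by blast
 have ne: "e ~= {}" if "e \<in> g \<union> bots f" for e
  using that brauer_card[OF g] brauer_card[OF fb] unfolding bots_def by fastforce
 have vP: "outer -` X ~= {}" if "X \<in> ?P" for X
  using that
 proof
  assume "X \<in> Y ` g"
  then obtain e where "e \<in> g" "X = Y e" by blast
  then show ?thesis using ne[of e] vY[of e] by simp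
 next
  assume "X \<in> (`) outer ` bots f"
  then obtain b where "b \<in> bots f" "X = outer ` b" by blast
  then show ?thesis using ne[of b] inj_vimage_image_eq[OF inj_halves(3), of b] by simp
 qed
 have "dcomp f g = (\<lambda>X. outer -` X) ` components f g" unfolding dcomp_def using vP[folded c] by blast
 also have "... = (\<lambda>e. outer -` Y e) ` g \<union> (\<lambda>b. outer -` outer ` b) ` bots f"
  unfolding c image_Un image_image ..
 finally have dc: "dcomp f g = (\<lambda>e. outer -` Y e) ` g \<union> (\<lambda>b. outer -` outer ` b) ` bots f" .
 show "dcomp f g = bots f \<union> (`) (rho f) ` g"
  unfolding dc vY inj_vimage_image_eq[OF inj_halves(3)] image_ident by (rule Un_commute)
 have none: "{X \<in> components f g. outer -` X = {}} = {}" using vP[folded c] by blast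
 show "loops f g = 0" unfolding loops_def none by (rule card.empty)
qed

section \<open>Composites of upward and of downward diagrams\<close>

lemma loops_up: "f \<in> Up q r ==> g \<in> brauer p q ==> loops f g = 0"
 by (rule dcomp_up(2))

lemma loops_down:
 assumes "f \<in> brauer q r" "g \<in> Dn p q"
 shows "loops f g = 0"
 using dcomp_up(2)[of "flip g" q p "flip f" r] dcomp_flip(2)[OF assms(1) downD[OF assms(2)]] assms
 by (simp add: flip_brauer)

lemma dcomp_up_up:
 assumes f: "f \<in> Up q r" and g: "g \<in> Up p q"
 shows "dcomp f g \<in> Up p r"
proof -
 have "{Top i, Top j} \<notin> dcomp f g" for i j
 proof
  assume "{Top i, Top j} \<in> dcomp f g"
  then consider "{Top i, Top j} \<in> bots f" | e where "e \<in> g" "{Top i, Top j} = rho f ` e"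
   unfolding dcomp_up(1)[OF f upD[OF g]] by blast
  then show False
  proof cases
   case 1
   then show ?thesis by (auto simp: bots_def)
  next
   case 2
   have "rho f x = x" if "x \<in> e" for x
   proof -
    have "rho f x \<in> {Top i, Top j}" using that 2(2) by blast
    then show ?thesis by (cases x) simp_all
   qed
   then have "rho f ` e = (\<lambda>x. x) ` e" by (rule image_cong[OF refl])
   then have "rho f ` e = e" by simp
   then show False using 2 g by (auto simp: brauer_up_def upward_def)
  qed
 qed
 then show ?thesis using dcomp_brauer[OF upD[OF f] upD[OF g]] by (auto simp: brauer_up_def upward_def)
qed

lemma dcomp_down_down:
 assumes f: "f \<in> Dn q r" and g: "g \<in> Dn p q"
 shows "dcomp f g \<in> Dn p r"
 using dcomp_up_up[of "flip g" q p "flip f" r] dcomp_flip(1)[OF downD[OF f] downD[OF g]] f g by simp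

text \<open>A pair of top points of \<open>g\<close> is a whole component of the glued graph and
  survives in every composite. So non-upward diagrams are stable under composition on the left,
  which is what makes the truncated actions associative.\<close>

lemma dcomp_up_right:
 assumes f: "f \<in> brauer q r" and g: "g \<in> brauer p q" and fg: "dcomp f g \<in> Up p r"
 shows "g \<in> Up p q"
proof (rule ccontr)
 assume "g \<notin> Up p q"
 then obtain i j where ij: "{Top i, Top j} \<in> g" using g by (auto simp: brauer_up_def upward_def)
 let ?X = "{Upper i, Upper j}"
 have comp: "components f g = cc (glue f g)" by (rule components_eq[OF brauer_cards[OF f g]])
 have X: "?X = upper_half ` {Top i, Top j}" by simp
 then have Xg: "?X \<in> glue f g" using ij unfolding glue_def by blast
 have closed: "y \<in> ?X" if "(Upper i, y) \<in> conn (glue f g)" for y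
  using that
 proof (induction rule: conn_induct)
  case (step y z a)
  then consider e where "e \<in> g" "a = upper_half ` e" | e where "e \<in> f" "a = lower_half ` e"
   unfolding glue_def by blast
  then show ?case
  proof cases
   case 1
   then obtain x where x: "x \<in> e" "y = upper_half x" using step by blast
   then have "x \<in> {Top i, Top j}" using step by (cases x) auto
   then have "e = {Top i, Top j}" using brauer_unique[OF g 1(1) ij] x by blast
   then have "a = ?X" using 1(2) by simp
   then show ?thesis using step.hyps(4) by simp
  next
   case 2
   then obtain x where "y = lower_half x" using step by blast
   then show ?thesis using step by (cases x) auto
  qed
 qed simp
 have "conn (glue f g) `` {Upper i} = ?X"
  using closed conn_edge[OF Xg, of "Upper i"] by blast
 then have "?X \<in> components f g" unfolding comp using cc_I[of "Upper i" "glue f g"] Xg by auto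
 moreover have "outer -` ?X = {Top i, Top j}"
  unfolding X by (auto elim!: outer.elims)
 ultimately have "{Top i, Top j} \<in> dcomp f g" unfolding dcomp_def by blast
 then show False using fg by (auto simp: brauer_up_def upward_def)
qed

lemma dcomp_down_left:
 assumes f: "f \<in> brauer q r" and g: "g \<in> brauer p q" and fg: "dcomp f g \<in> Dn p r"
 shows "f \<in> Dn q r"
 using dcomp_up_right[OF flip_brauer[OF g] flip_brauer[OF f]] fg dcomp_flip(1)[OF f g] by simp

subsection \<open>Level diagrams\<close>

lemma level_iff: "d \<in> brauer_level p p \<longleftrightarrow> d \<in> Up p p & d \<in> Dn p p"
 by (auto simp: brauer_level_def brauer_up_def brauer_down_def)

text \<open>The strands inject the top points into the bottom points; the parity comes from the
  pairs exhausting all \<open>p + q\<close> points.\<close>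

lemma up_le: "f \<in> Up p q ==> p \<preceq> q"
proof -
 assume f: "f \<in> Up p q"
 have "p = card (strand f ` {1..p})" using strand_inj[OF f] by (simp add: card_image)
 also have "... \<le> card {1..q}" using strand(2)[OF f] by (intro card_mono) auto
 finally have le: "p \<le> q" by simp
 have "card (\<Union>f) = (\<Sum>e\<in>f. card e)"
  using upD[OF f] by (intro card_Union_disjoint) (auto simp: brauer_iff card_ge_0_finite pairwise_def disjoint_def disjnt_def)
 also have "... = 2 * card f" using brauer_card[OF upD[OF f]] by simp
 finally have "card (\<Union>f) = 2 * card f" .
 moreover have "card (\<Union>f) = p + q"
  unfolding brauer_Union[OF upD[OF f]] pts_def
  by (subst card_Un_disjoint) (auto simp: card_image inj_on_def)
 ultimately have "even (p + q)" by simp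
 then show ?thesis using le unfolding parity_le_def by (metis even_diff_nat even_add)
qed

lemma down_le: "f \<in> Dn q p ==> p \<preceq> q"
 using up_le[of "flip f" p q] by simp

lemma strand_level: "f \<in> Up p p ==> strand f ` {1..p} = {1..p}"
 using strand_inj strand(2) by (metis endo_inj_surj finite_atLeastAtMost image_subsetI)

text \<open>With equally many top and bottom points the injective strand map is onto, so no bottom
  point is left for a bottom pair.\<close>

lemma bots_level: "f \<in> Up p p ==> bots f = {}"
proof (rule ccontr)
 assume f: "f \<in> Up p p" and "bots f ~= {}"
 then obtain e where e: "e \<in> bots f" by blast
 then have "card e = 2" using brauer_card[OF upD[OF f]] unfolding bots_def by blast
 then obtain x where "x \<in> e" by fastforce
 then obtain j where j: "Bot j \<in> e" using e unfolding bots_def by blast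
 then have "j \<in> {1..p}" using brauer_mem[OF upD[OF f], of e "Bot j"] e unfolding bots_def by simp
 then obtain i where "i \<in> {1..p}" "j = strand f i" using strand_level[OF f] by blast
 then show False using strand_not_bots[OF f _ e] j by blast
qed

lemma up_level: "f \<in> Up p p ==> f \<in> Dn p p"
proof -
 assume f: "f \<in> Up p p"
 have "{Bot i, Bot j} \<notin> f" for i j using bots_level[OF f] unfolding bots_def by auto
 then show ?thesis using upD[OF f] by (simp add: brauer_down_def downward_def)
qed

lemma down_level: "f \<in> Dn p p ==> f \<in> Up p p"
 using up_level[of "flip f" p] by simp

lemma level_eq: "brauer_level p p = Up p p" "brauer_level p p = Dn p p"
 using up_level down_level level_iff by blast+

lemma level_strands: "f \<in> Up p p ==> f = (\<lambda>i. {Top i, Bot (strand f i)}) ` {1..p}"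
 using up_split bots_level by fastforce

lemma dcomp_level_flip: "f \<in> brauer_level p p ==> dcomp f (flip f) = id_diagram p"
proof -
 assume "f \<in> brauer_level p p"
 then have f: "f \<in> Up p p" by (simp add: level_iff)
 have "flip f = (\<lambda>i. {Bot i, Top (strand f i)}) ` {1..p}"
  by (subst level_strands[OF f]) (simp add: flip_def image_image)
 then have "dcomp f (flip f) = (\<lambda>i. {Bot (strand f i), Top (strand f i)}) ` {1..p}"
  unfolding dcomp_up(1)[OF f flip_brauer[OF upD[OF f]]] bots_level[OF f] by (simp add: image_image)
 also have "... = (\<lambda>k. {Bot k, Top k}) ` strand f ` {1..p}" by (simp add: image_image)
 also have "... = id_diagram p" unfolding strand_level[OF f] id_diagram_def by (auto simp: insert_commute)
 finally show ?thesis .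
qed

lemma dcomp_flip_level: "f \<in> brauer_level p p ==> dcomp (flip f) f = id_diagram p"
 using dcomp_level_flip[of "flip f" p] by (simp add: level_iff)

lemma id_diagram_image: "id_diagram p = (\<lambda>i. {Top i, Bot i}) ` {1..p}"
 unfolding id_diagram_def by blast

lemma id_diagram_brauer: "id_diagram p \<in> brauer p p"
 unfolding brauer_iff id_diagram_image pts_def disjoint_def by auto

lemma id_diagram_up [simp]: "id_diagram p \<in> Up p p"
 unfolding brauer_up_def upward_def using id_diagram_brauer by (auto simp: id_diagram_image doubleton_eq_iff)

lemma id_diagram_down [simp]: "id_diagram p \<in> Dn p p"
 by (rule up_level) simp

lemma id_diagram_mono [simp]: "id_diagram p \<in> Um p p"
proof -
 have "monotone_diagram (id_diagram p)"
  unfolding monotone_diagram_def id_diagram_def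
  by (auto simp: doubleton_eq_iff zero_less_mult_iff)
 then show ?thesis by (simp add: brauer_up_mono_def)
qed

lemma flip_id [simp]: "flip (id_diagram p) = id_diagram p"
proof -
 show ?thesis by (simp add: id_diagram_image flip_def image_image insert_commute)
qed

lemma dcomp_id_left:
 assumes g: "g \<in> brauer p q"
 shows "dcomp (id_diagram q) g = g"
proof -
 have s: "strand (id_diagram q) i = i" if "i \<in> {1..q}" for i
  by (rule strand_eqI[OF id_diagram_brauer[of q]]) (use that in \<open>auto simp: id_diagram_def\<close>)
 have "rho (id_diagram q) ` e = e" if "e \<in> g" for e
 proof -
  have "rho (id_diagram q) x = x" if "x \<in> e" for x
   using brauer_mem[OF g \<open>e \<in> g\<close> that] s by (cases x) simp_all
  then show ?thesis by simp
 qed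
 then have "(`) (rho (id_diagram q)) ` g = g" by simp
 then show ?thesis using dcomp_up(1)[OF id_diagram_up g] bots_level[OF id_diagram_up] by simp
qed

lemma dcomp_id_right:
 assumes "g \<in> brauer p q"
 shows "dcomp g (id_diagram p) = g"
 using dcomp_id_left[OF flip_brauer[OF assms]] dcomp_flip(1)[OF assms id_diagram_brauer]
 by (metis flip_flip flip_id)

subsection \<open>Factorisation\<close>

lemma mono_strand:
 assumes h: "h \<in> Um t q" and i: "i \<in> {1..t}" and k: "k \<in> {1..t}" and "i < k"
 shows "strand h i < strand h k"
proof -
 have up: "h \<in> Up t q" by (rule up_monoD[OF h])
 have "{Top i, Bot (strand h i)} ~= {Top k, Bot (strand h k)}" using \<open>i < k\<close> by (simp add: doubleton_eq_iff)
 then have "0 < (int i - int k) * (int (strand h i) - int (strand h k))"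
  using h strand(1)[OF up i] strand(1)[OF up k] unfolding brauer_up_mono_def monotone_diagram_def by blast
 then show ?thesis using \<open>i < k\<close> by (simp add: zero_less_mult_iff)
qed

text \<open>This is how monotonicity pins down an upward diagram once the set of its strand ends is
  known: both enumerations are the sorted list of that set.\<close>

lemma increasing_enumeration_unique:
 fixes s s' :: "nat => nat"
 assumes s: "\<And>i k. i \<in> {1..t} ==> k \<in> {1..t} ==> i < k ==> s i < s k"
  and s': "\<And>i k. i \<in> {1..t'} ==> k \<in> {1..t'} ==> i < k ==> s' i < s' k"
  and eq: "s ` {1..t} = s' ` {1..t'}"
 shows "t = t' & (\<forall>i\<in>{1..t}. s i = s' i)"
proof -
 have "sorted_wrt (<) (map s [1..<Suc t])" "sorted_wrt (<) (map s' [1..<Suc t'])"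
  using s s' by (auto simp: sorted_wrt_iff_nth_less simp del: upt_Suc)
 moreover have "set (map s [1..<Suc t]) = set (map s' [1..<Suc t'])"
  using eq by (simp del: upt_Suc add: atLeastLessThanSuc_atLeastAtMost)
 ultimately have e: "map s [1..<Suc t] = map s' [1..<Suc t']" using strict_sorted_equal by metis
 then have "length (map s [1..<Suc t]) = length (map s' [1..<Suc t'])" by simp
 then have t: "t = t'" unfolding length_map length_upt by simp
 then have "\<forall>i\<in>set [1..<Suc t]. s i = s' i" using e map_eq_conv by metis
 then show ?thesis using t by (simp del: upt_Suc add: atLeastLessThanSuc_atLeastAtMost)
qed

lemma rho_inj: "f \<in> Up q r ==> x \<in> pts p q ==> y \<in> pts p q ==> rho f x = rho f y ==> x = y"
 using strand_inj[of f q r] by (cases x; cases y) (auto simp: inj_on_eq_iff)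

text \<open>As \<open>z\<close> has no bottom pair, each of its edges contains a top point, and
  \<open>rho h\<close> leaves that point in place.\<close>

lemma bots_dcomp:
 assumes h: "h \<in> Up t q" and z: "z \<in> Dn p t"
 shows "bots (dcomp h z) = bots h" "dcomp h z - bots h = (`) (rho h) ` z"
proof -
 have no: "\<not> rho h ` e \<subseteq> range Bot" if "e \<in> z" for e
 proof
  assume b: "rho h ` e \<subseteq> range Bot"
  have "card e = 2" using brauer_card[OF downD[OF z] that] .
  then obtain x y where e: "e = {x, y}" by (auto simp: card_2_iff)
  then have "rho h x \<in> range Bot" "rho h y \<in> range Bot" using b by auto
  then obtain i j where "x = Bot i" "y = Bot j" by (cases x; cases y) auto
  then show False using e that z by (auto simp: brauer_down_def downward_def)
 qed
 have d: "dcomp h z = bots h \<union> (`) (rho h) ` z" by (rule dcomp_up(1)[OF h downD[OF z]])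
 have R: "\<not> e \<subseteq> range Bot" if "e \<in> (`) (rho h) ` z" for e
  using that no by (elim imageE) simp
 have gen: "{e \<in> B \<union> R. e \<subseteq> range Bot} = B & B \<union> R - B = R"
  if "\<forall>e\<in>R. \<not> e \<subseteq> range Bot" "\<forall>e\<in>B. e \<subseteq> range Bot" for B R :: diagram
  using that by blast
 have B: "\<forall>e\<in>bots h. e \<subseteq> range Bot" by (simp add: bots_def)
 have "\<forall>e\<in>(`) (rho h) ` z. \<not> e \<subseteq> range Bot" using R by (rule ballI)
 from gen[OF this B] show "bots (dcomp h z) = bots h" "dcomp h z - bots h = (`) (rho h) ` z"
  unfolding d bots_def[of "bots h \<union> _"] by (rule conjunct1, rule conjunct2)
qed

lemma strands_dcomp:
 assumes h: "h \<in> Up t q" and z: "z \<in> Dn p t"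
 shows "strand h ` {1..t} = {j. Bot j \<in> \<Union>(dcomp h z - bots h)}"
proof -
 have "\<Union>((`) (rho h) ` z) = rho h ` \<Union>z" by auto
 also have "... = Top ` {1..p} \<union> Bot ` strand h ` {1..t}"
  unfolding brauer_Union[OF downD[OF z]] pts_def by (simp add: image_Un image_image)
 finally show ?thesis unfolding bots_dcomp(2)[OF h z] by auto
qed

text \<open>The bottom pairs of the composite are those of \<open>h\<close>, and its remaining
  bottom points are the strand ends of \<open>h\<close>. Monotonicity then determines
  \<open>h\<close>, and \<open>z\<close> is recovered because \<open>rho h\<close> is injective on
  its points.\<close>

lemma factor_unique:
 assumes h: "h \<in> Um t q" and z: "z \<in> Dn p t"
  and h': "h' \<in> Um t' q" and z': "z' \<in> Dn p t'"
  and eq: "dcomp h z = dcomp h' z'"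
 shows "t = t' & h = h' & z = z'"
proof -
 note u = up_monoD[OF h] and u' = up_monoD[OF h']
 have b: "bots h = bots h'" using bots_dcomp(1)[OF u z] bots_dcomp(1)[OF u' z'] eq by simp
 have "strand h ` {1..t} = strand h' ` {1..t'}"
  unfolding strands_dcomp[OF u z] strands_dcomp[OF u' z'] eq b ..
 then have ts: "t = t' & (\<forall>i\<in>{1..t}. strand h i = strand h' i)"
  by (intro increasing_enumeration_unique mono_strand[OF h] mono_strand[OF h'])
 then have t: "t = t'" ..
 have "(\<lambda>i. {Top i, Bot (strand h i)}) ` {1..t} = (\<lambda>i. {Top i, Bot (strand h' i)}) ` {1..t'}"
  unfolding t using ts t by (intro image_cong) auto
 then have hh: "h = h'"
  by (subst up_split[OF u], subst up_split[OF u']) (simp only: b)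
 have r: "(`) (rho h) ` z = (`) (rho h) ` z'"
  using bots_dcomp(2)[OF u z] bots_dcomp(2)[OF u' z'] eq hh by simp
 have sub: "e \<subseteq> pts p t" if "e \<in> z \<union> z'" for e
  using that brauer_mem[OF downD[OF z]] brauer_mem[OF downD[OF z']] t by blast
 have inj: "e = e'" if "e \<in> z \<union> z'" "e' \<in> z \<union> z'" "rho h ` e = rho h ` e'" for e e'
 proof -
  have "inj_on (rho h) (pts p t)" using rho_inj[OF u] by (auto intro: inj_onI)
  then show ?thesis using inj_on_image_eq_iff[of "rho h" "pts p t" e e'] sub that by blast
 qed
 have "z \<subseteq> z'" "z' \<subseteq> z"
 proof -
  show "z \<subseteq> z'"
  proof
   fix e assume e: "e \<in> z"
   then have "rho h ` e \<in> (`) (rho h) ` z'" using r by blast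
   then obtain e' where "e' \<in> z'" "rho h ` e = rho h ` e'" by blast
   then show "e \<in> z'" using inj[of e e'] e by simp
  qed
  show "z' \<subseteq> z"
  proof
   fix e assume e: "e \<in> z'"
   then have "rho h ` e \<in> (`) (rho h) ` z" using r by blast
   then obtain e' where "e' \<in> z" "rho h ` e = rho h ` e'" by blast
   then show "e \<in> z" using inj[of e e'] e by simp
  qed
 qed
 then have zz: "z = z'" by (rule equalityI)
 show ?thesis by (intro conjI t hh zz)
qed

lemma increasing_enumeration:
 assumes "finite (T :: nat set)"
 shows "\<exists>s. (\<forall>i\<in>{1..card T}. \<forall>k\<in>{1..card T}. i < k --> s i < s k) & s ` {1..card T} = T"
proof -
 let ?xs = "sorted_list_of_set T"
 \<comment> \<open>Diagram points are numbered from 1, list positions from 0.\<close>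
 let ?s = "\<lambda>k. ?xs ! (k - 1)"
 have len: "length ?xs = card T" by simp
 have 1: "?s i < ?s k" if "i \<in> {1..card T}" "k \<in> {1..card T}" "i < k" for i k
 proof -
  have "sorted_wrt (<) ?xs" by simp
  then show ?thesis using that by (auto simp: sorted_wrt_iff_nth_less)
 qed
 have "?s ` {1..card T} = (!) ?xs ` ((\<lambda>k. k - 1) ` {1..card T})" by (simp add: image_image)
 also have "(\<lambda>k. k - 1) ` {1..card T} = {..<card T}"
 proof (intro equalityI subsetI)
  fix x assume "x \<in> {..<card T}"
  then have "x = Suc x - 1" "Suc x \<in> {1..card T}" by auto
  then show "x \<in> (\<lambda>k. k - 1) ` {1..card T}" by blast
 qed auto
 also have "(!) ?xs ` {..<card T} = set ?xs"
  unfolding len[symmetric] using nth_image[of "length ?xs" ?xs] by (simp add: lessThan_atLeast0)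
 also have "... = T" using assms by simp
 finally have "?s ` {1..card T} = T" .
 then show ?thesis using 1 by (intro exI[of _ ?s]) simp
qed

text \<open>The bottom points that lie on no bottom pair are numbered in increasing order.
  \<open>h\<close> carries \<open>k\<close> to the \<open>k\<close>-th of them and keeps the bottom
  pairs; \<open>z\<close> is the rest of \<open>d\<close> with these points renamed.\<close>

lemma factor_exists:
 assumes d: "d \<in> brauer p q"
 obtains t h z where "h \<in> Um t q" "z \<in> Dn p t" "d = dcomp h z"
proof -
 let ?N = "d - bots d"
 define T where "T = {j. Bot j \<in> \<Union>?N}"
 define t where "t = card T"
 have Tq: "T \<subseteq> {1..q}" unfolding T_def using brauer_mem[OF d] by fastforce
 then have "finite T" using finite_subset by blast
 from increasing_enumeration[OF this] obtain s
  where s: "\<And>i k. i \<in> {1..t} ==> k \<in> {1..t} ==> i < k ==> s i < s k"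
  and sT: "s ` {1..t} = T" unfolding t_def by blast
 have s_inj: "i = k" if "i \<in> {1..t}" "k \<in> {1..t}" "s i = s k" for i k
  using s that by (metis less_irrefl linorder_neqE_nat)
 have sTi: "s k \<in> T" if "k \<in> {1..t}" for k using sT that by blast
 define h where "h = bots d \<union> (\<lambda>k. {Top k, Bot (s k)}) ` {1..t}"
 have bot_bots: "Bot j \<in> e ==> e \<in> bots d ==> j \<in> {1..q} & j \<notin> T" for j e
 proof -
  assume j: "Bot j \<in> e" "e \<in> bots d"
  then have e: "e \<in> d" by (simp add: bots_def)
  have "e' = e" if "e' \<in> d" "Bot j \<in> e'" for e' using brauer_unique[OF d that(1) e that(2) j(1)] .
  then show "j \<in> {1..q} & j \<notin> T" using brauer_mem[OF d e j(1)] j(2) unfolding T_def by auto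
 qed
 have h_cases: "e \<in> bots d \<or> (\<exists>k\<in>{1..t}. e = {Top k, Bot (s k)})" if "e \<in> h" for e
  using that unfolding h_def by blast
 have hb: "h \<in> brauer t q"
  unfolding brauer_iff
 proof (intro conjI ballI)
  show "\<Union>h = pts t q"
  proof (intro equalityI subsetI)
   fix x assume "x \<in> \<Union>h"
   then obtain e where e: "e \<in> h" "x \<in> e" by blast
   from h_cases[OF e(1)] show "x \<in> pts t q"
   proof
    assume b: "e \<in> bots d"
    then obtain j where "x = Bot j" using e unfolding bots_def by blast
    then show ?thesis using bot_bots[of j e] b e by simp
   next
    assume "\<exists>k\<in>{1..t}. e = {Top k, Bot (s k)}"
    then obtain k where k: "k \<in> {1..t}" "e = {Top k, Bot (s k)}" by blast
    then have "s k \<in> {1..q}" using sTi Tq by blast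
    then show ?thesis using k e(2) by auto
   qed
  next
   fix x assume x: "x \<in> pts t q"
   show "x \<in> \<Union>h"
   proof (cases x)
    case (Top k)
    then show ?thesis using x unfolding h_def by auto
   next
    case (Bot j)
    show ?thesis
    proof (cases "j \<in> T")
     case True
     then obtain k where "k \<in> {1..t}" "j = s k" using sT by blast
     then show ?thesis using Bot unfolding h_def by blast
    next
     case False
     obtain e where e: "e \<in> d" "Bot j \<in> e" using brauer_ex[OF d, of "Bot j"] x Bot by auto
     then have "e \<in> bots d" using False unfolding T_def by blast
     then show ?thesis using e Bot unfolding h_def by blast
    qed
   qed
  qed
  show "disjoint h"
  proof (rule disjointI)
   fix e e' assume e: "e \<in> h" "e' \<in> h" "e ~= e'"
   show "e \<inter> e' = {}"
   proof (rule ccontr)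
    assume "e \<inter> e' ~= {}"
    then obtain x where x: "x \<in> e" "x \<in> e'" by blast
    have bb: False if "a \<in> bots d" "x \<in> a" "k \<in> {1..t}" "x \<in> {Top k, Bot (s k)}" for a k
    proof -
     have "x = Bot (s k)" using that by (auto simp: bots_def)
     then show False using bot_bots[of "s k" a] that sTi by blast
    qed
    from h_cases[OF e(1)] h_cases[OF e(2)] show False
    proof (elim disjE bexE)
     assume "e \<in> bots d" "e' \<in> bots d"
     then show False using brauer_unique[OF d] x e(3) unfolding bots_def by blast
    next
     fix k k' assume "k \<in> {1..t}" "k' \<in> {1..t}" "e = {Top k, Bot (s k)}" "e' = {Top k', Bot (s k')}"
     then show False using x e(3) s_inj[of k k'] by auto
    qed (use bb x in blast)+
   qed
  qed
  fix e assume "e \<in> h"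
  from h_cases[OF this] show "card e = 2"
   using brauer_card[OF d] by (auto simp: bots_def)
 qed
 have hu: "h \<in> Up t q"
 proof -
  have "{Top i, Top j} \<notin> h" for i j
   using h_cases[of "{Top i, Top j}"] by (auto simp: bots_def doubleton_eq_iff)
  then show ?thesis using hb by (simp add: brauer_up_def upward_def)
 qed
 have st: "strand h k = s k" if "k \<in> {1..t}" for k
  by (rule strand_eqI[OF hb]) (use that in \<open>simp add: h_def\<close>)
 have edge_s: "i \<in> {1..t} & j = s i" if "{Top i, Bot j} \<in> h" for i j
  using h_cases[OF that] by (auto simp: bots_def doubleton_eq_iff)
 have hm: "h \<in> Um t q"
  unfolding brauer_up_mono_def monotone_diagram_def
 proof (intro CollectI conjI hu allI impI)
  fix i j k l assume a: "{Top i, Bot j} \<in> h & {Top k, Bot l} \<in> h & {Top i, Bot j} ~= {Top k, Bot l}"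
  then have e: "i \<in> {1..t}" "j = s i" "k \<in> {1..t}" "l = s k" using edge_s by blast+
  then have "i ~= k" using a by auto
  then consider "i < k" | "k < i" by linarith
  then show "0 < (int i - int k) * (int j - int l)"
  proof cases
   case 1
   then have "j < l" using s[of i k] e by simp
   then show ?thesis using 1 by (simp add: zero_less_mult_iff)
  next
   case 2
   then have "l < j" using s[of k i] e by simp
   then show ?thesis using 2 by (simp add: zero_less_mult_iff)
  qed
 qed
 have bots_h: "bots h = bots d" unfolding h_def bots_def by auto
 \<comment> \<open>Inverse of \<open>rho h\<close> on the points outside the bottom pairs.\<close>
 define psi where "psi x = (case x of Top i => Top i | Bot j => Bot (inv_into {1..t} s j))" for x
 have sN: "x \<in> \<Union>?N ==> (\<exists>i\<in>{1..p}. x = Top i) \<or> (\<exists>k\<in>{1..t}. x = Bot (s k))" for x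
 proof -
  assume x: "x \<in> \<Union>?N"
  show "(\<exists>i\<in>{1..p}. x = Top i) \<or> (\<exists>k\<in>{1..t}. x = Bot (s k))"
  proof (cases x)
   case (Top i)
   then show ?thesis using x brauer_mem[OF d] by fastforce
  next
   case (Bot j)
   then have "j \<in> s ` {1..t}" using x sT unfolding T_def by blast
   then show ?thesis using Bot by blast
  qed
 qed
 have psi_s: "psi (Bot (s k)) = Bot k" if "k \<in> {1..t}" for k
  unfolding psi_def using s_inj that by (auto simp: inj_on_def intro!: inv_into_f_eq)
 have psi_Top: "psi (Top i) = Top i" for i by (simp add: psi_def)
 have rp: "rho h (psi x) = x" if "x \<in> \<Union>?N" for x
  using sN[OF that] psi_s psi_Top st by auto
 define z where "z = (`) psi ` ?N"
 have z_rho: "(`) (rho h) ` z = ?N"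
 proof -
  have "rho h ` psi ` e = e" if "e \<in> ?N" for e
  proof -
   have "rho h ` psi ` e = (\<lambda>x. x) ` e" unfolding image_image using that rp by (intro image_cong) blast+
   then show ?thesis by simp
  qed
  then show ?thesis unfolding z_def image_image by simp
 qed
 have pinj: "inj_on psi (\<Union>?N)" using rp by (metis inj_onI)
 have zb: "z \<in> brauer p t"
  unfolding brauer_iff
 proof (intro conjI ballI)
  have "\<Union>z = psi ` \<Union>?N" unfolding z_def by auto
  also have "\<Union>?N = Top ` {1..p} \<union> Bot ` s ` {1..t}"
  proof (intro equalityI subsetI)
   fix x assume "x \<in> \<Union>?N"
   then show "x \<in> Top ` {1..p} \<union> Bot ` s ` {1..t}" using sN by blast
  next
   fix x assume "x \<in> Top ` {1..p} \<union> Bot ` s ` {1..t}"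
   then show "x \<in> \<Union>?N"
   proof
    assume "x \<in> Top ` {1..p}"
    then obtain i where i: "x = Top i" "i \<in> {1..p}" by blast
    then obtain e where "e \<in> d" "x \<in> e" using brauer_ex[OF d, of x] by auto
    then show ?thesis using i unfolding bots_def by blast
   next
    assume "x \<in> Bot ` s ` {1..t}"
    then show ?thesis unfolding sT T_def by blast
   qed
  qed
  also have "psi ` (Top ` {1..p} \<union> Bot ` s ` {1..t}) = pts p t"
   unfolding pts_def image_Un image_image psi_Top using psi_s by simp
  finally show "\<Union>z = pts p t" .
  have "disjoint ?N" using d unfolding brauer_iff disjoint_def by blast
  then show "disjoint z" unfolding z_def by (rule disjoint_image[OF pinj])
  fix e assume "e \<in> z"
  then obtain a where a: "a \<in> ?N" "e = psi ` a" unfolding z_def by blast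
  then have "inj_on psi a" using pinj by (metis Union_upper inj_on_subset)
  then show "card e = 2" using a brauer_card[OF d] by (simp add: card_image)
 qed
 have "{Bot i, Bot j} \<notin> z" for i j
 proof
  assume "{Bot i, Bot j} \<in> z"
  then have "rho h ` {Bot i, Bot j} \<in> ?N" using z_rho by blast
  then show False by (auto simp: bots_def)
 qed
 then have zd: "z \<in> Dn p t" using zb by (simp add: brauer_down_def downward_def)
 have "dcomp h z = bots d \<union> ?N" unfolding dcomp_up(1)[OF hu zb] bots_h z_rho ..
 then have "d = dcomp h z" unfolding bots_def by blast
 then show thesis using that hm zd by blast
qed

text \<open>In the factorisation of an upward diagram the downward factor is upward as well, so it
  is level.\<close>

lemma up_factor_exists:
 assumes u: "u \<in> Up p q"
 obtains h \<sigma> where "h \<in> Um p q" "\<sigma> \<in> brauer_level p p" "u = dcomp h \<sigma>"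
proof -
 obtain t h z where z: "h \<in> Um t q" "z \<in> Dn p t" "u = dcomp h z"
  using factor_exists[OF upD[OF u]] by blast
 have zu: "z \<in> Up p t"
  using dcomp_up_right[OF upD[OF up_monoD[OF z(1)]] downD[OF z(2)]] u z(3) by simp
 then have "p = t" using up_le[OF zu] down_le[OF z(2)] by (simp add: parity_le_def)
 then show thesis using that z zu by (simp add: level_iff)
qed

lemma up_factor_unique:
 assumes "h \<in> Um p q" "\<sigma> \<in> brauer_level p p" "h' \<in> Um p q" "\<sigma>' \<in> brauer_level p p"
  "dcomp h \<sigma> = dcomp h' \<sigma>'"
 shows "h = h' & \<sigma> = \<sigma>'"
 using factor_unique[of h p q \<sigma> p h' p \<sigma>'] assms by (simp add: level_iff)

lemma flip_level [simp]: "flip \<sigma> \<in> brauer_level p p \<longleftrightarrow> \<sigma> \<in> brauer_level p p"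
 by (auto simp: level_iff)

lemma down_factor_exists:
 assumes "z \<in> Dn q p"
 obtains h \<sigma> where "h \<in> Um p q" "\<sigma> \<in> brauer_level p p" "z = dcomp \<sigma> (flip h)"
proof -
 obtain h \<sigma> where h: "h \<in> Um p q" "\<sigma> \<in> brauer_level p p" "flip z = dcomp h \<sigma>"
  using up_factor_exists[of "flip z" p q] assms by auto
 have "z = flip (dcomp h \<sigma>)" using h(3) by (metis flip_flip)
 also have "... = dcomp (flip \<sigma>) (flip h)"
  using h by (intro dcomp_flip(1)[symmetric, of h p q \<sigma> p]) (simp_all add: level_iff upD up_monoD)
 finally have "z = dcomp (flip \<sigma>) (flip h)" .
 then show thesis by (rule that[OF h(1), rotated]) (simp add: h(2))
qed

lemma down_factor_unique:
 assumes h: "h \<in> Um p q" "\<sigma> \<in> brauer_level p p" and h': "h' \<in> Um p q" "\<sigma>' \<in> brauer_level p p"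
  and eq: "dcomp \<sigma> (flip h) = dcomp \<sigma>' (flip h')"
 shows "h = h' & \<sigma> = \<sigma>'"
proof -
 have fl: "flip (dcomp s (flip k)) = dcomp k (flip s)" if "k \<in> Um p q" "s \<in> brauer_level p p" for k s
  using that dcomp_flip(1)[of s p p "flip k" q]
  by (simp add: level_iff upD up_monoD flip_brauer)
 have "dcomp h (flip \<sigma>) = dcomp h' (flip \<sigma>')" using fl h h' eq by metis
 then have "h = h' & flip \<sigma> = flip \<sigma>'" using h h' by (intro up_factor_unique) auto
 then show ?thesis by (metis flip_flip)
qed

lemma level_down_down: "\<sigma> \<in> brauer_level t t ==> k \<in> Dn p t ==> dcomp \<sigma> k \<in> Dn p t"
 using dcomp_down_down[of \<sigma> t t k p] by (simp add: level_iff)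

text \<open>\<open>factorization\<close> is a definite description, so its value rests on
  uniqueness, applied twice: once to split off the upward factor and once to separate the level
  factor from the downward one.\<close>

lemma factorization_eq:
 assumes h: "h \<in> Um t q" and \<sigma>: "\<sigma> \<in> brauer_level t t" and k: "k \<in> brauer_down_mono p t"
 shows "factorization p q (dcomp h (dcomp \<sigma> k)) = (t, h, \<sigma>, k)"
 unfolding factorization_def
proof (rule the_equality)
 show "case (t, h, \<sigma>, k) of (t, f_up, f_level, f_down) =>
  f_up \<in> Um t q & f_level \<in> brauer_level t t & f_down \<in> brauer_down_mono p t &
  dcomp h (dcomp \<sigma> k) = dcomp f_up (dcomp f_level f_down)" using assms by simp
 fix x assume x: "case x of (t, f_up, f_level, f_down) =>
  f_up \<in> Um t q & f_level \<in> brauer_level t t & f_down \<in> brauer_down_mono p t &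
  dcomp h (dcomp \<sigma> k) = dcomp f_up (dcomp f_level f_down)"
 obtain t' h' \<sigma>' k' where x_eq: "x = (t', h', \<sigma>', k')" by (cases x) auto
 have x': "h' \<in> Um t' q" "\<sigma>' \<in> brauer_level t' t'" "k' \<in> brauer_down_mono p t'"
  "dcomp h (dcomp \<sigma> k) = dcomp h' (dcomp \<sigma>' k')" using x unfolding x_eq by auto
 have "t = t' & h = h' & dcomp \<sigma> k = dcomp \<sigma>' k'"
  using factor_unique[OF h level_down_down[OF \<sigma> down_monoD[OF k]] x'(1) level_down_down[OF x'(2) down_monoD[OF x'(3)]] x'(4)] .
 then have t: "t = t'" "h = h'" and e: "dcomp \<sigma> k = dcomp \<sigma>' k'" by auto
 have "flip k = flip k' & \<sigma> = \<sigma>'"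
  by (rule down_factor_unique[of _ t p]) (use k x' \<sigma> t e in auto)
 then show "x = (t, h, \<sigma>, k)" unfolding x_eq using t by (metis flip_flip)
qed

text \<open>The labels of the Gram matrix thereby index a basis of \<open>B^+(p, q)\<close>, and a
  coefficient vector of the matrix becomes an element of that module.\<close>

lemma bij_up_factor: "bij_betw (\<lambda>(h, \<sigma>). dcomp h \<sigma>) (gram_index p q) (Up p q)"
proof (rule bij_betw_imageI)
 show "inj_on (\<lambda>(h, \<sigma>). dcomp h \<sigma>) (gram_index p q)"
  unfolding gram_index_def
 proof (rule inj_onI)
  fix x y
  assume x: "x \<in> Um p q \<times> brauer_level p p" and y: "y \<in> Um p q \<times> brauer_level p p"
   and eq: "(case x of (h, \<sigma>) => dcomp h \<sigma>) = (case y of (h, \<sigma>) => dcomp h \<sigma>)"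
  show "x = y"
   using up_factor_unique[of "fst x" p q "snd x" "fst y" "snd y"] x y eq
   by (simp add: mem_Times_iff case_prod_beta prod_eq_iff)
 qed
 show "(\<lambda>(h, \<sigma>). dcomp h \<sigma>) ` gram_index p q = Up p q"
 proof (intro equalityI subsetI)
  fix u assume "u \<in> (\<lambda>(h, \<sigma>). dcomp h \<sigma>) ` gram_index p q"
  then show "u \<in> Up p q"
   unfolding gram_index_def by (auto simp: level_iff intro: dcomp_up_up up_monoD)
 next
  fix u assume "u \<in> Up p q"
  then show "u \<in> (\<lambda>(h, \<sigma>). dcomp h \<sigma>) ` gram_index p q"
   by (rule up_factor_exists) (auto simp: gram_index_def)
 qed
qed

lemma finite_up [simp]: "finite (Up p q)" and finite_down [simp]: "finite (Dn p q)"
 and finite_up_mono [simp]: "finite (Um p q)" and finite_level [simp]: "finite (brauer_level p q)"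
proof -
 have "Up p q \<subseteq> brauer p q" "Dn p q \<subseteq> brauer p q" "Um p q \<subseteq> brauer p q"
  "brauer_level p q \<subseteq> brauer p q"
  by (auto simp: brauer_up_def brauer_down_def brauer_up_mono_def brauer_level_def)
 then show "finite (Up p q)" "finite (Dn p q)" "finite (Um p q)" "finite (brauer_level p q)"
  using finite_brauer finite_subset by metis+
qed

section \<open>Linear extension\<close>

text \<open>Linearity on all functions rather than on a free module: the operators used here are
  finite sums over diagrams and make sense everywhere, so they can be composed without tracking
  supports.\<close>

definition lin :: "(('x => 'k::comm_ring_1) => 'y => 'k) => bool" where
 "lin T \<longleftrightarrow> (\<forall>f g. T (\<lambda>x. f x + g x) = (\<lambda>y. T f y + T g y)) & (\<forall>c f. T (\<lambda>x. c * f x) = (\<lambda>y. c * T f y))"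

definition sp :: "'x set => ('x => 'k::zero) set" where
 "sp X = {F. \<forall>x. x \<notin> X --> F x = 0}"

lemma lin_add: "lin T ==> T (\<lambda>x. f x + g x) = (\<lambda>y. T f y + T g y)"
 and lin_scale: "lin T ==> T (\<lambda>x. c * f x) = (\<lambda>y. c * T f y)"
 by (simp_all add: lin_def)

lemma lin_zero: "lin T ==> T (\<lambda>_. 0) = (\<lambda>_. 0)"
 using lin_scale[of T 0 "\<lambda>_. 0"] by simp

lemma lin_diff: "lin T ==> T (\<lambda>x. f x - g x) = (\<lambda>y. T f y - T g y)"
 using lin_add[of T f "\<lambda>x. (-1) * g x"] lin_scale[of T "-1" g] by simp

lemma lin_sum: "lin T ==> T (\<lambda>x. \<Sum>i\<in>I. F i x) = (\<lambda>y. \<Sum>i\<in>I. T (F i) y)"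
proof (induction I rule: infinite_finite_induct)
 case (insert a I)
 then show ?case using lin_add[of T "F a" "\<lambda>x. \<Sum>i\<in>I. F i x"] by simp
qed (simp_all add: lin_zero)

lemma lin_lincomb: "lin T ==> T (\<lambda>x. \<Sum>i\<in>I. c i * F i x) = (\<lambda>y. \<Sum>i\<in>I. c i * T (F i) y)"
 using lin_sum[of T "\<lambda>i x. c i * F i x" I] by (simp add: lin_scale)

lemma sp_expand:
 assumes "finite X" "F \<in> sp X"
 shows "F = (\<lambda>x. \<Sum>a\<in>X. F a * bv a x)"
proof
 fix x
 have "(\<Sum>a\<in>X. F a * bv a x) = (\<Sum>a\<in>X. if a = x then F a else 0)"
  by (intro sum.cong) (auto simp: basis_vec_def)
 also have "... = F x" using assms by (simp add: sp_def)
 finally show "F x = (\<Sum>a\<in>X. F a * bv a x)" ..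
qed

text \<open>Applied once in each argument, it reduces multilinear identities to identities between
  diagrams.\<close>

lemma lin_ext:
 assumes "lin T" "lin T'" "finite X" "F \<in> sp X" "\<And>a. a \<in> X ==> T (bv a) = T' (bv a)"
 shows "T F = T' F"
proof -
 have "T F = (\<lambda>y. \<Sum>a\<in>X. F a * T (bv a) y)"
  by (subst sp_expand[OF assms(3,4)]) (rule lin_lincomb[OF assms(1)])
 also have "... = (\<lambda>y. \<Sum>a\<in>X. F a * T' (bv a) y)"
  by (intro ext sum.cong refl) (simp add: assms(5))
 also have "... = T' F"
  by (subst (2) sp_expand[OF assms(3,4)]) (rule lin_lincomb[OF assms(2), symmetric])
 finally show ?thesis .
qed

named_theorems lin_intros

lemma lin_id [lin_intros]: "lin (\<lambda>f. f)"
 by (simp add: lin_def)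

lemma lin_const [lin_intros]: "lin (\<lambda>_ _. 0)"
 by (simp add: lin_def)

lemma lin_comp: "lin T ==> lin S ==> lin (\<lambda>f. T (S f))"
 by (simp add: lin_def)

lemma lin_sum_intro [lin_intros]: "(\<And>i. lin (T i)) ==> lin (\<lambda>f x. \<Sum>i\<in>I. T i f x)"
 by (simp add: lin_def sum.distrib sum_distrib_left)

lemma lin_add_intro [lin_intros]: "lin T ==> lin S ==> lin (\<lambda>f x. T f x + S f x)"
 by (simp add: lin_def algebra_simps)

lemma lin_diff_intro [lin_intros]: "lin T ==> lin S ==> lin (\<lambda>f x. T f x - S f x)"
 by (simp add: lin_def algebra_simps)

lemma lin_scale_intro [lin_intros]: "lin T ==> lin (\<lambda>f x. c * T f x)"
 by (simp add: lin_def algebra_simps)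

lemma lin_bcomp_left: "lin (\<lambda>f. bcomp dl p q r f g)"
 unfolding lin_def bcomp_def by (auto simp: algebra_simps sum.distrib sum_distrib_left)

lemma lin_bcomp_right: "lin (\<lambda>g. bcomp dl p q r f g)"
 unfolding lin_def bcomp_def by (auto simp: algebra_simps sum.distrib sum_distrib_left)

lemma lin_project: "lin (project X)"
 by (auto simp: lin_def project_def)

lemma lin_bcomp_left' [lin_intros]: "lin S ==> lin (\<lambda>f. bcomp dl p q r (S f) g)"
 by (rule lin_comp[OF lin_bcomp_left])

lemma lin_bcomp_right' [lin_intros]: "lin S ==> lin (\<lambda>f. bcomp dl p q r g (S f))"
 by (rule lin_comp[OF lin_bcomp_right])

lemma lin_project' [lin_intros]: "lin S ==> lin (\<lambda>f. project X (S f))"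
 by (rule lin_comp[OF lin_project])

lemmas bcomp_add_left = lin_add[OF lin_bcomp_left]
lemmas bcomp_add_right = lin_add[OF lin_bcomp_right]
lemmas bcomp_scale_left = lin_scale[OF lin_bcomp_left]
lemmas bcomp_scale_right = lin_scale[OF lin_bcomp_right]
lemmas bcomp_sum_left = lin_sum[OF lin_bcomp_left]
lemmas bcomp_zero_left [simp] = lin_zero[OF lin_bcomp_left]
lemmas bcomp_zero_right [simp] = lin_zero[OF lin_bcomp_right]
lemmas project_zero [simp] = lin_zero[OF lin_project]
lemmas project_scale = lin_scale[OF lin_project]
lemma basis_sp [simp]: "bv a \<in> sp X \<longleftrightarrow> a \<in> X"
 by (auto simp: sp_def basis_vec_def)

lemma zero_sp [simp]: "(\<lambda>_. 0) \<in> sp X"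
 by (simp add: sp_def)

lemma add_sp: "F \<in> sp X ==> G \<in> sp X ==> (\<lambda>x. F x + G x) \<in> sp X"
 and diff_sp: "F \<in> sp X ==> G \<in> sp X ==> (\<lambda>x. F x - G x) \<in> sp X" for F G :: "'x => 'k::comm_ring_1"
 by (simp_all add: sp_def)

lemma scale_sp: "f \<in> sp X ==> (\<lambda>x. c * f x) \<in> sp X" for f :: "'x => 'k::comm_ring_1"
 by (simp add: sp_def)

lemma sum_sp: "(\<And>i. i \<in> I ==> F i \<in> sp X) ==> (\<lambda>x. \<Sum>i\<in>I. F i x) \<in> sp X" for F :: "'i => 'x => 'k::comm_ring_1"
 by (simp add: sp_def)

lemma sp_mono: "X \<subseteq> Y ==> f \<in> sp X ==> f \<in> sp Y"
 by (auto simp: sp_def)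

lemma project_in_sp [simp]: "project X f \<in> sp X"
 by (simp add: sp_def project_def)

lemma project_sp: "f \<in> sp X ==> project X f = f"
 by (auto simp: sp_def project_def)

lemma project_basis: "project X (bv a) = (if a \<in> X then bv a else (\<lambda>_. 0))"
 by (auto simp: project_def basis_vec_def)

lemma project_project: "project X (project Y f) = project (X \<inter> Y) f"
 by (auto simp: project_def)

lemma bcomp_basis:
 assumes "a \<in> brauer q r" "b \<in> brauer p q"
 shows "bcomp dl p q r (bv a) (bv b) = (\<lambda>d. dl ^ loops a b * bv (dcomp a b) d)"
proof
 fix d
 have "bcomp dl p q r (bv a) (bv b) d
  = (\<Sum>a'\<in>brauer q r. \<Sum>b'\<in>brauer p q. (if a' = a & b' = b then dl ^ loops a b * bv (dcomp a b) d else 0))"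
  unfolding bcomp_def by (intro sum.cong refl) (auto simp: basis_vec_def)
 also have "... = (\<Sum>a'\<in>brauer q r. if a' = a then dl ^ loops a b * bv (dcomp a b) d else 0)"
  using assms by (intro sum.cong refl) (simp add: sum.delta)
 also have "... = dl ^ loops a b * bv (dcomp a b) d" using assms by (simp add: sum.delta)
 finally show "bcomp dl p q r (bv a) (bv b) d = dl ^ loops a b * bv (dcomp a b) d" .
qed

lemma bcomp_basis_up:
 "a \<in> Up q r ==> b \<in> brauer p q ==> bcomp dl p q r (bv a) (bv b) = bv (dcomp a b)"
 by (simp add: bcomp_basis upD loops_up)

lemma bcomp_basis_down:
 "a \<in> brauer q r ==> b \<in> Dn p q ==> bcomp dl p q r (bv a) (bv b) = bv (dcomp a b)"
 by (simp add: bcomp_basis downD loops_down)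

lemma bcomp_sp_sub:
 assumes f: "f \<in> sp A" and g: "g \<in> sp B"
  and C: "\<And>a b. a \<in> A ==> b \<in> B ==> a \<in> brauer q r ==> b \<in> brauer p q ==> dcomp a b \<in> C"
 shows "bcomp dl p q r f g \<in> sp C"
 unfolding sp_def
proof (intro CollectI allI impI)
 fix d assume d: "d \<notin> C"
 have "f a * g b * (dl ^ loops a b * bv (dcomp a b) d) = 0" if "a \<in> brauer q r" "b \<in> brauer p q" for a b
 proof (cases "a \<in> A & b \<in> B")
  case True
  then have "dcomp a b ~= d" using C that d by blast
  then show ?thesis by (simp add: basis_vec_def)
 next
  case False
  then show ?thesis using f g by (auto simp: sp_def)
 qed
 then show "bcomp dl p q r f g d = 0" unfolding bcomp_def by (simp add: sum.neutral)
qed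

lemma bcomp_sp [simp]: "bcomp dl p q r f g \<in> sp (brauer p r)"
 by (rule bcomp_sp_sub[of _ UNIV _ UNIV]) (auto simp: sp_def dcomp_brauer)

text \<open>On diagrams the two powers of \<open>dl\<close> agree by the additivity of loop
  numbers.\<close>

lemma bcomp_assoc:
 assumes f: "f \<in> sp (brauer r s)" and g: "g \<in> sp (brauer q r)" and h: "h \<in> sp (brauer p q)"
 shows "bcomp dl p q s (bcomp dl q r s f g) h = bcomp dl p r s f (bcomp dl p q r g h)"
proof (rule lin_ext[OF _ _ _ h])
 fix c assume c: "c \<in> brauer p q"
 show "bcomp dl p q s (bcomp dl q r s f g) (bv c) = bcomp dl p r s f (bcomp dl p q r g (bv c))"
 proof (rule lin_ext[OF _ _ _ g])
  fix b assume b: "b \<in> brauer q r"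
  show "bcomp dl p q s (bcomp dl q r s f (bv b)) (bv c)
   = bcomp dl p r s f (bcomp dl p q r (bv b) (bv c))"
  proof (rule lin_ext[OF _ _ _ f])
   fix a assume a: "a \<in> brauer r s"
   note D = dcomp_assoc_loops[OF c b a]
   have "dl ^ loops a b * (dl ^ loops (dcomp a b) c * x) = dl ^ loops b c * (dl ^ loops a (dcomp b c) * x)" for x
    using D(2) by (metis mult.assoc power_add)
   then show "bcomp dl p q s (bcomp dl q r s (bv a) (bv b)) (bv c)
    = bcomp dl p r s (bv a) (bcomp dl p q r (bv b) (bv c))"
    using a b c by (simp add: bcomp_basis bcomp_scale_left bcomp_scale_right dcomp_brauer D(1))
  qed (intro lin_intros finite_brauer)+
 qed (intro lin_intros finite_brauer)+
qed (intro lin_intros finite_brauer)+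

lemma bcomp_id_left: "g \<in> sp (brauer p q) ==> bcomp dl p q q (bv (id_diagram q)) g = g"
 by (rule lin_ext[of "\<lambda>g. bcomp dl p q q (bv (id_diagram q)) g" "\<lambda>g. g", OF _ _ finite_brauer])
  (auto intro!: lin_intros simp: bcomp_basis_up dcomp_id_left)

lemma bcomp_id_right: "g \<in> sp (brauer p q) ==> bcomp dl p p q g (bv (id_diagram p)) = g"
 by (rule lin_ext[of "\<lambda>g. bcomp dl p p q g (bv (id_diagram p))" "\<lambda>g. g", OF _ _ finite_brauer])
  (auto intro!: lin_intros simp: bcomp_basis_down dcomp_id_right)

section \<open>Level parts and projections\<close>

definition Lv :: "nat => nat => diagram set" where
 "Lv p q = Up p q \<inter> Dn p q"

abbreviation (input) "pv p q \<equiv> project (Lv p q)"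

lemma Lv_same: "\<sigma> \<in> Lv p q ==> p = q"
 using up_le[of \<sigma> p q] down_le[of \<sigma> p q] by (simp add: Lv_def parity_le_def)

text \<open>Giving the symmetric groups hom-sets between all objects, empty off the diagonal, allows
  the level part of an arrow between different objects to be written without a case
  distinction.\<close>

lemma Lv_eq: "Lv p q = (if p = q then brauer_level p p else {})"
 using Lv_same[of _ p q] by (auto simp: Lv_def level_iff)

lemma Lv_self: "Lv p p = brauer_level p p"
 by (simp add: Lv_eq)

lemma finite_Lv [simp]: "finite (Lv p q)"
 by (simp add: Lv_def)

lemma Lv_sub: "Lv p q \<subseteq> Up p q" "Lv p q \<subseteq> Dn p q" "Lv p q \<subseteq> brauer p q"
 by (auto simp: Lv_def upD)

lemma up_sub: "Up p q \<subseteq> brauer p q" and down_sub: "Dn p q \<subseteq> brauer p q"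
 by (auto simp: upD downD)

lemma sp_up: "f \<in> sp (Up p q) ==> f \<in> sp (brauer p q)"
 and sp_down: "f \<in> sp (Dn p q) ==> f \<in> sp (brauer p q)"
 and sp_Lv_up: "f \<in> sp (Lv p q) ==> f \<in> sp (Up p q)"
 and sp_Lv_down: "f \<in> sp (Lv p q) ==> f \<in> sp (Dn p q)"
 and sp_Lv: "f \<in> sp (Lv p q) ==> f \<in> sp (brauer p q)"
 using sp_mono Lv_sub up_sub down_sub by metis+

lemma bcomp_up_up: "f \<in> sp (Up q r) ==> g \<in> sp (Up p q) ==> bcomp dl p q r f g \<in> sp (Up p r)"
 by (rule bcomp_sp_sub) (auto intro: dcomp_up_up)

lemma bcomp_down_down: "f \<in> sp (Dn q r) ==> g \<in> sp (Dn p q) ==> bcomp dl p q r f g \<in> sp (Dn p r)"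
 by (rule bcomp_sp_sub) (auto intro: dcomp_down_down)

lemma bcomp_Lv_Lv: "f \<in> sp (Lv q r) ==> g \<in> sp (Lv p q) ==> bcomp dl p q r f g \<in> sp (Lv p r)"
 by (rule bcomp_sp_sub) (auto intro: dcomp_up_up dcomp_down_down simp: Lv_def)

lemma project_basis_scaled: "project X (\<lambda>d. c * bv a d) = (\<lambda>d. c * project X (bv a) d)"
 by (rule project_scale)

text \<open>A left factor outside \<open>A\<close> contributes nothing to the \<open>C\<close>-part
  of a product, so it may be dropped beforehand. For downward diagrams this expresses that the
  non-downward ones are stable under composition on the right.\<close>

lemma project_absorb_left:
 assumes f: "f \<in> sp (brauer q r)" and g: "g \<in> sp (brauer p q)"
  and C: "\<And>a b. a \<in> brauer q r ==> b \<in> brauer p q ==> dcomp a b \<in> C ==> a \<in> A"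
 shows "project C (bcomp dl p q r (project A f) g) = project C (bcomp dl p q r f g)"
proof (rule lin_ext[OF _ _ _ f])
 fix a assume a: "a \<in> brauer q r"
 show "project C (bcomp dl p q r (project A (bv a)) g) = project C (bcomp dl p q r (bv a) g)"
 proof (rule lin_ext[OF _ _ _ g])
  fix b assume b: "b \<in> brauer p q"
  show "project C (bcomp dl p q r (project A (bv a)) (bv b))
   = project C (bcomp dl p q r (bv a) (bv b))"
   using C[OF a b] by (auto simp: project_basis bcomp_basis[OF a b] project_basis_scaled)
 qed (intro lin_intros finite_brauer)+
qed (intro lin_intros finite_brauer)+

lemma project_absorb_right:
 assumes f: "f \<in> sp (brauer q r)" and g: "g \<in> sp (brauer p q)"
  and C: "\<And>a b. a \<in> brauer q r ==> b \<in> brauer p q ==> dcomp a b \<in> C ==> b \<in> A"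
 shows "project C (bcomp dl p q r f (project A g)) = project C (bcomp dl p q r f g)"
proof (rule lin_ext[OF _ _ _ f])
 fix a assume a: "a \<in> brauer q r"
 show "project C (bcomp dl p q r (bv a) (project A g)) = project C (bcomp dl p q r (bv a) g)"
 proof (rule lin_ext[OF _ _ _ g])
  fix b assume b: "b \<in> brauer p q"
  show "project C (bcomp dl p q r (bv a) (project A (bv b)))
   = project C (bcomp dl p q r (bv a) (bv b))"
   using C[OF a b] by (auto simp: project_basis bcomp_basis[OF a b] project_basis_scaled)
 qed (intro lin_intros finite_brauer)+
qed (intro lin_intros finite_brauer)+

lemma up_absorb: "f \<in> sp (brauer q r) ==> g \<in> sp (brauer p q) ==>
  pu p r (bcomp dl p q r f (pu p q g)) = pu p r (bcomp dl p q r f g)"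
 by (rule project_absorb_right) (auto intro: dcomp_up_right)

lemma down_absorb: "f \<in> sp (brauer q r) ==> g \<in> sp (brauer p q) ==>
  pd p r (bcomp dl p q r (pd q r f) g) = pd p r (bcomp dl p q r f g)"
 by (rule project_absorb_left) (auto intro: dcomp_down_left)

lemma Lv_absorb_right: "f \<in> sp (brauer q r) ==> g \<in> sp (brauer p q) ==>
  pv p r (bcomp dl p q r f (pu p q g)) = pv p r (bcomp dl p q r f g)"
 by (rule project_absorb_right) (auto intro: dcomp_up_right simp: Lv_def)

lemma Lv_absorb_left: "f \<in> sp (brauer q r) ==> g \<in> sp (brauer p q) ==>
  pv p r (bcomp dl p q r (pd q r f) g) = pv p r (bcomp dl p q r f g)"
 by (rule project_absorb_left) (auto intro: dcomp_down_left simp: Lv_def)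

text \<open>Composing with a diagram of \<open>B\<close> neither creates nor destroys the property
  projected to. In the applications these are level diagrams, which are invertible.\<close>

lemma project_commute_left:
 assumes f: "f \<in> sp (brauer q r)" and g: "g \<in> sp B" "B \<subseteq> brauer p q"
  and C: "\<And>a b. a \<in> brauer q r ==> b \<in> B ==> dcomp a b \<in> C \<longleftrightarrow> a \<in> A"
 shows "project C (bcomp dl p q r f g) = bcomp dl p q r (project A f) g"
proof (rule lin_ext[OF _ _ _ f])
 fix a assume a: "a \<in> brauer q r"
 show "project C (bcomp dl p q r (bv a) g) = bcomp dl p q r (project A (bv a)) g"
 proof (rule lin_ext[OF _ _ _ g(1)])
  fix b assume b: "b \<in> B"
  then have "b \<in> brauer p q" using g(2) by blast
  then show "project C (bcomp dl p q r (bv a) (bv b))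
   = bcomp dl p q r (project A (bv a)) (bv b)"
   using C[OF a b] a by (auto simp: project_basis bcomp_basis project_basis_scaled)
 qed (intro lin_intros finite_subset[OF g(2)] finite_brauer)+
qed (intro lin_intros finite_brauer)+

lemma project_commute_right:
 assumes f: "f \<in> sp B" "B \<subseteq> brauer q r" and g: "g \<in> sp (brauer p q)"
  and C: "\<And>a b. a \<in> B ==> b \<in> brauer p q ==> dcomp a b \<in> C \<longleftrightarrow> b \<in> A"
 shows "project C (bcomp dl p q r f g) = bcomp dl p q r f (project A g)"
proof (rule lin_ext[OF _ _ _ g])
 fix b assume b: "b \<in> brauer p q"
 show "project C (bcomp dl p q r f (bv b)) = bcomp dl p q r f (project A (bv b))"
 proof (rule lin_ext[OF _ _ _ f(1)])
  fix a assume a: "a \<in> B"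
  then have "a \<in> brauer q r" using f(2) by blast
  then show "project C (bcomp dl p q r (bv a) (bv b))
   = bcomp dl p q r (bv a) (project A (bv b))"
   using C[OF a b] b by (auto simp: project_basis bcomp_basis project_basis_scaled)
 qed (intro lin_intros finite_subset[OF f(2)] finite_brauer)+
qed (intro lin_intros finite_brauer)+

lemma dcomp_level_cancel_left:
 assumes "\<sigma> \<in> brauer_level q q" "b \<in> brauer p q"
 shows "dcomp (flip \<sigma>) (dcomp \<sigma> b) = b"
proof -
 have s: "\<sigma> \<in> brauer q q" using assms(1) by (simp add: level_iff upD)
 have "dcomp (flip \<sigma>) (dcomp \<sigma> b) = dcomp (dcomp (flip \<sigma>) \<sigma>) b"
  by (rule dcomp_assoc_loops(1)[OF assms(2) s flip_brauer[OF s], symmetric])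
 then show ?thesis by (simp add: dcomp_flip_level[OF assms(1)] dcomp_id_left[OF assms(2)])
qed

lemma dcomp_level_cancel_right:
 assumes "\<sigma> \<in> brauer_level p p" "a \<in> brauer p q"
 shows "dcomp (dcomp a \<sigma>) (flip \<sigma>) = a"
proof -
 have s: "\<sigma> \<in> brauer p p" using assms(1) by (simp add: level_iff upD)
 have "dcomp (dcomp a \<sigma>) (flip \<sigma>) = dcomp a (dcomp \<sigma> (flip \<sigma>))"
  by (rule dcomp_assoc_loops(1)[OF flip_brauer[OF s] s assms(2)])
 then show ?thesis by (simp add: dcomp_level_flip[OF assms(1)] dcomp_id_right[OF assms(2)])
qed

lemma dcomp_Lv_down_iff:
 assumes s: "\<sigma> \<in> Lv q r" and b: "b \<in> brauer p q"
 shows "dcomp \<sigma> b \<in> Dn p r \<longleftrightarrow> b \<in> Dn p q"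
proof -
 have r: "q = r" by (rule Lv_same[OF s])
 have l: "\<sigma> \<in> brauer_level q q" using s by (simp add: r Lv_self)
 then have l': "\<sigma> \<in> Dn q q" "flip \<sigma> \<in> Dn q q" by (simp_all add: level_iff)
 show ?thesis
  using dcomp_down_down[OF l'(2), of "dcomp \<sigma> b" p] dcomp_down_down[OF l'(1), of b p]
  unfolding dcomp_level_cancel_left[OF l b] r by blast
qed

lemma dcomp_Lv_up_iff:
 assumes s: "\<sigma> \<in> Lv p q" and a: "a \<in> brauer q r"
 shows "dcomp a \<sigma> \<in> Up p r \<longleftrightarrow> a \<in> Up q r"
proof -
 have r: "p = q" by (rule Lv_same[OF s])
 have l: "\<sigma> \<in> brauer_level q q" using s by (simp add: r Lv_self)
 then have l': "\<sigma> \<in> Up q q" "flip \<sigma> \<in> Up q q" by (simp_all add: level_iff)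
 show ?thesis
  using dcomp_up_up[OF _ l'(2), of "dcomp a \<sigma>" r] dcomp_up_up[OF _ l'(1), of a r]
  unfolding dcomp_level_cancel_right[OF l a] r by blast
qed

lemma dcomp_Lv_left_iff:
 assumes s: "\<sigma> \<in> Lv q r" and b: "b \<in> brauer p q"
 shows "dcomp \<sigma> b \<in> Lv p r \<longleftrightarrow> b \<in> Lv p q"
proof -
 have "b \<in> Up p q" if "dcomp \<sigma> b \<in> Up p r"
  using dcomp_up_right[OF _ b that] s by (simp add: Lv_def upD)
 moreover have "dcomp \<sigma> b \<in> Up p r" if "b \<in> Up p q"
  using dcomp_up_up[OF _ that] s by (simp add: Lv_def)
 ultimately show ?thesis using dcomp_Lv_down_iff[OF s b] by (auto simp: Lv_def)
qed

lemma dcomp_Lv_right_iff: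
 assumes s: "\<sigma> \<in> Lv p q" and a: "a \<in> brauer q r"
 shows "dcomp a \<sigma> \<in> Lv p r \<longleftrightarrow> a \<in> Lv q r"
proof -
 have "a \<in> Dn q r" if "dcomp a \<sigma> \<in> Dn p r"
  using dcomp_down_left[OF a _ that] s by (simp add: Lv_def upD)
 moreover have "dcomp a \<sigma> \<in> Dn p r" if "a \<in> Dn q r"
  using dcomp_down_down[OF that] s by (simp add: Lv_def)
 ultimately show ?thesis using dcomp_Lv_up_iff[OF s a] by (auto simp: Lv_def)
qed

lemma project_up_Lv: "f \<in> sp (brauer q r) ==> g \<in> sp (Lv p q) ==>
  pu p r (bcomp dl p q r f g) = bcomp dl p q r (pu q r f) g"
 by (rule project_commute_left[OF _ _ Lv_sub(3)]) (auto simp: dcomp_Lv_up_iff)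

lemma project_down_Lv: "f \<in> sp (Lv q r) ==> g \<in> sp (brauer p q) ==>
  pd p r (bcomp dl p q r f g) = bcomp dl p q r f (pd p q g)"
 by (rule project_commute_right[OF _ Lv_sub(3)]) (auto simp: dcomp_Lv_down_iff)

lemma project_Lv_left: "f \<in> sp (Lv q r) ==> g \<in> sp (brauer p q) ==>
  pv p r (bcomp dl p q r f g) = bcomp dl p q r f (pv p q g)"
 by (rule project_commute_right[OF _ Lv_sub(3)]) (auto simp: dcomp_Lv_left_iff)

lemma project_Lv_right: "f \<in> sp (brauer q r) ==> g \<in> sp (Lv p q) ==>
  pv p r (bcomp dl p q r f g) = bcomp dl p q r (pv q r f) g"
 by (rule project_commute_left[OF _ _ Lv_sub(3)]) (auto simp: dcomp_Lv_right_iff)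

section \<open>The linear categories and bimodules\<close>

lemma carrier_free: "finite X ==> carrier (free_module X) = sp X"
 by (auto simp: free_module_def sp_def supp_def intro: finite_subset)

lemma free_add [simp]: "F +[free_module X] G = (\<lambda>x. F x + G x)"
 and free_smult [simp]: "c *[free_module X] F = (\<lambda>x. c * F x)"
 and free_zero [simp]: "0[free_module X] = (\<lambda>_. 0)"
 by (simp_all add: free_module_def)

lemma ground_simps [simp]: "carrier ground_ring = UNIV" "x +[ground_ring] y = x + y"
 "x \<otimes>\<^bsub>ground_ring\<^esub> y = x * y" "\<one>\<^bsub>ground_ring\<^esub> = 1" "0[ground_ring] = 0"
 by (simp_all add: ground_ring_def)

lemma cring_ground: "cring (ground_ring :: 'k::comm_ring_1 ring)"
proof (rule cringI)
 show "abelian_group (ground_ring :: 'k ring)"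
  by (rule abelian_groupI) (auto simp: algebra_simps intro: exI[of _ "- _"] left_minus)
 show "comm_monoid (ground_ring :: 'k ring)"
  by (rule comm_monoidI) (auto simp: algebra_simps)
qed (auto simp: algebra_simps)

lemma is_moduleI:
 fixes M :: "('k::comm_ring_1, 'a) module"
 assumes "0[M] \<in> carrier M"
  and "\<And>x y. x \<in> carrier M ==> y \<in> carrier M ==> x +[M] y \<in> carrier M"
  and "\<And>x y. x \<in> carrier M ==> y \<in> carrier M ==> x +[M] y = y +[M] x"
  and "\<And>x y z. x \<in> carrier M ==> y \<in> carrier M ==> z \<in> carrier M ==> (x +[M] y) +[M] z = x +[M] (y +[M] z)"
  and "\<And>x. x \<in> carrier M ==> 0[M] +[M] x = x"
  and "\<And>x. x \<in> carrier M ==> (-1) *[M] x +[M] x = 0[M]"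
  and "\<And>c x. x \<in> carrier M ==> c *[M] x \<in> carrier M"
  and "\<And>c d x. x \<in> carrier M ==> (c + d) *[M] x = c *[M] x +[M] d *[M] x"
  and "\<And>c x y. x \<in> carrier M ==> y \<in> carrier M ==> c *[M] (x +[M] y) = c *[M] x +[M] c *[M] y"
  and "\<And>c d x. x \<in> carrier M ==> (c * d) *[M] x = c *[M] (d *[M] x)"
  and "\<And>x. x \<in> carrier M ==> 1 *[M] x = x"
 shows "is_module M"
proof (rule moduleI[OF cring_ground])
 show "abelian_group M"
 proof (rule abelian_groupI)
  fix x assume x: "x \<in> carrier M"
  show "\<exists>y\<in>carrier M. y +[M] x = 0[M]"
   using assms(6)[OF x] assms(7)[OF x] by (rule bexI)
 qed (fact assms)+
qed (simp_all add: assms(7-))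

lemma module_free:
 fixes X :: "'x set"
 shows "is_module (free_module X :: ('k::comm_ring_1, 'x => 'k) module)"
proof (rule is_moduleI)
 fix F G :: "'x => 'k" and c
 assume F: "F \<in> carrier (free_module X)"
 then have f: "finite (supp F)" "supp F \<subseteq> X" by (auto simp: free_module_def)
 have "supp (\<lambda>x. c * F x) \<subseteq> supp F" by (auto simp: supp_def)
 then show "c *[free_module X] F \<in> carrier (free_module X)"
  using f finite_subset[of "supp (\<lambda>x. c * F x)" "supp F"] by (auto simp: free_module_def)
 assume G: "G \<in> carrier (free_module X)"
 then have g: "finite (supp G)" "supp G \<subseteq> X" by (auto simp: free_module_def)
 have "supp (\<lambda>x. F x + G x) \<subseteq> supp F \<union> supp G" by (auto simp: supp_def)
 then show "F +[free_module X] G \<in> carrier (free_module X)"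
  using f g finite_subset[of "supp (\<lambda>x. F x + G x)" "supp F \<union> supp G"] by (auto simp: free_module_def)
qed (auto simp: algebra_simps free_module_def supp_def)

lemma lin_linear_maps:
 "lin T ==> finite X ==> finite Y ==> (\<And>f. f \<in> sp X ==> T f \<in> sp Y) ==> T \<in> linear_maps (free_module X) (free_module Y)"
 by (auto simp: linear_maps_def carrier_free lin_add lin_scale)

lemma brauer_simps [simp]: "Obj (brauer_category dl) = UNIV" "Hom (brauer_category dl) = (\<lambda>p q. free_module (brauer p q))"
 "Comp (brauer_category dl) = bcomp dl" "Ident (brauer_category dl) = (\<lambda>p. bv (id_diagram p))"
 by (simp_all add: brauer_category_def)

lemma symmetric_simps [simp]: "Obj (symmetric_category dl) = UNIV" "Hom (symmetric_category dl) = (\<lambda>p q. free_module (Lv p q))"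
 "Comp (symmetric_category dl) = bcomp dl" "Ident (symmetric_category dl) = (\<lambda>p. bv (id_diagram p))"
 by (simp_all add: symmetric_category_def Lv_eq)

lemma truncate_simps [simp]: "Obj (truncate r C) = Obj C \<inter> {q. q \<preceq> r}" "Hom (truncate r C) = Hom C"
 "Comp (truncate r C) = Comp C" "Ident (truncate r C) = Ident C"
 by (simp_all add: truncate_def full_subcategory_def)

lemma linear_category_truncate: "linear_category C ==> linear_category (truncate r C)"
 unfolding linear_category_def by simp

lemma linear_category_brauer: "linear_category (brauer_category dl)"
 by (rule linear_category.intro)
  (auto simp: carrier_free module_free bcomp_assoc bcomp_id_left bcomp_id_right id_diagram_brauer
   intro!: lin_linear_maps lin_intros)

lemma id_Lv [simp]: "id_diagram p \<in> Lv p p"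
 by (simp add: Lv_def)

lemma linear_category_symmetric: "linear_category (symmetric_category dl)"
 by (rule linear_category.intro)
  (auto simp: carrier_free module_free sp_Lv bcomp_assoc bcomp_id_left bcomp_id_right bcomp_Lv_Lv
   intro!: lin_linear_maps lin_intros)

lemma up_simps [simp]: "BMod (up_bimodule dl) = (\<lambda>p q. free_module (Up p q))"
 "Lact (up_bimodule dl) = (\<lambda>p q q' g f. pu p q' (bcomp dl p q q' g f))"
 "Ract (up_bimodule dl) = (\<lambda>p' p q f \<sigma>. bcomp dl p' p q f \<sigma>)"
 by (simp_all add: up_bimodule_def)

lemma down_simps [simp]: "BMod (down_bimodule dl) = (\<lambda>q s. free_module (Dn q s))"
 "Lact (down_bimodule dl) = (\<lambda>q s s' \<sigma> f. bcomp dl q s s' \<sigma> f)"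
 "Ract (down_bimodule dl) = (\<lambda>p q s f g. pd p s (bcomp dl p q s f g))"
 by (simp_all add: down_bimodule_def)

text \<open>Associativity of the truncated action is \<open>up_absorb\<close>; the two actions
  commute because composing with level diagrams commutes with the projection.\<close>

lemma bimodule_up: "bimodule (truncate r (brauer_category dl)) (truncate r (symmetric_category dl)) (up_bimodule dl)"
proof -
 have lr: "bcomp dl x' x y' (pu x y' (bcomp dl x y y' g m)) h
  = pu x' y' (bcomp dl x' y y' g (bcomp dl x' x y m h))"
  if h: "h \<in> sp (Lv x' x)" and gm: "g \<in> sp (brauer y y')" "m \<in> sp (Up x y)" for x x' y y' g h m
 proof -
  have "bcomp dl x' x y' (pu x y' (bcomp dl x y y' g m)) h
   = pu x' y' (bcomp dl x' x y' (bcomp dl x y y' g m) h)"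
   by (rule project_up_Lv[OF bcomp_sp h, symmetric])
  then show ?thesis using gm h by (simp add: bcomp_assoc sp_up sp_Lv)
 qed
 show ?thesis
  by (intro bimodule.intro bimodule_axioms.intro linear_category_truncate linear_category_brauer
    linear_category_symmetric)
   (auto simp: carrier_free module_free sp_up sp_Lv sp_Lv_up bcomp_assoc bcomp_id_left bcomp_id_right
    bcomp_up_up project_sp up_absorb lr intro!: lin_linear_maps lin_intros)
qed

lemma bimodule_down: "bimodule (truncate r (symmetric_category dl)) (truncate r (brauer_category dl)) (down_bimodule dl)"
proof -
 have lr: "bcomp dl x' y y' g (pd x' y (bcomp dl x' x y m h))
  = pd x' y' (bcomp dl x' y y' g (bcomp dl x' x y m h))"
  if g: "g \<in> sp (Lv y y')" for x x' y y' g h m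
  by (rule project_down_Lv[OF g bcomp_sp, symmetric])
 show ?thesis
  by (intro bimodule.intro bimodule_axioms.intro linear_category_truncate linear_category_brauer
    linear_category_symmetric)
   (auto simp: carrier_free module_free sp_down sp_Lv sp_Lv_down bcomp_id_left bcomp_id_right
    bcomp_down_down project_sp lr down_absorb bcomp_assoc intro!: lin_linear_maps lin_intros)
qed

section \<open>Square systems and the Gram matrix\<close>

text \<open>Matrices labelled by an arbitrary finite set, read through an enumeration of the kind
  chosen in \<open>gram_polynomial\<close>.\<close>

definition indexed_mat :: "nat => (nat => 'i) => ('i => 'i => 'k) => 'k mat" where
 "indexed_mat n en a = mat n n (\<lambda>(i, j). a (en i) (en j))"

lemma indexed_mat_carrier [simp]: "indexed_mat n en a \<in> carrier_mat n n"
 by (simp add: indexed_mat_def)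

lemma indexed_mat_mult:
 fixes a b :: "'i => 'i => 'k::comm_ring_1"
 assumes en: "bij_betw en {0..<n} I"
 shows "indexed_mat n en a * indexed_mat n en b = indexed_mat n en (\<lambda>i j. \<Sum>k\<in>I. a i k * b k j)"
proof (rule eq_matI)
 fix i j assume "i < dim_row (indexed_mat n en (\<lambda>i j. \<Sum>k\<in>I. a i k * b k j))"
  "j < dim_col (indexed_mat n en (\<lambda>i j. \<Sum>k\<in>I. a i k * b k j))"
 then have ij: "i < n" "j < n" by (simp_all add: indexed_mat_def)
 have "(indexed_mat n en a * indexed_mat n en b) $$ (i, j) = (\<Sum>k\<in>{0..<n}. a (en i) (en k) * b (en k) (en j))"
  using ij by (simp add: indexed_mat_def scalar_prod_def)
 also have "... = (\<Sum>k\<in>I. a (en i) k * b k (en j))"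
  by (rule sum.reindex_bij_betw[OF en])
 finally show "(indexed_mat n en a * indexed_mat n en b) $$ (i, j)
   = indexed_mat n en (\<lambda>i j. \<Sum>k\<in>I. a i k * b k j) $$ (i, j)"
  using ij by (simp add: indexed_mat_def)
qed (simp_all add: indexed_mat_def)

lemma indexed_mat_one:
 fixes a :: "'i => 'i => 'k::comm_ring_1"
 assumes en: "bij_betw en {0..<n} I"
 shows "indexed_mat n en a = 1\<^sub>m n \<longleftrightarrow> (\<forall>i\<in>I. \<forall>j\<in>I. a i j = (if i = j then 1 else 0))"
proof
 assume eq: "indexed_mat n en a = 1\<^sub>m n"
 show "\<forall>i\<in>I. \<forall>j\<in>I. a i j = (if i = j then 1 else 0)"
 proof (intro ballI)
  fix i j assume ij: "i \<in> I" "j \<in> I"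
  obtain i' j' where e: "i' < n" "j' < n" "i = en i'" "j = en j'"
   using ij bij_betw_imp_surj_on[OF en] by (metis (no_types, lifting) atLeastLessThan_iff imageE)
  have "a i j = indexed_mat n en a $$ (i', j')" using e by (simp add: indexed_mat_def)
  also have "... = (if i' = j' then 1 else 0)" using e eq by simp
  also have "i' = j' \<longleftrightarrow> i = j" using e bij_betw_imp_inj_on[OF en] by (auto simp: inj_on_eq_iff)
  finally show "a i j = (if i = j then 1 else 0)" .
 qed
next
 assume eq: "\<forall>i\<in>I. \<forall>j\<in>I. a i j = (if i = j then 1 else 0)"
 show "indexed_mat n en a = 1\<^sub>m n"
 proof (rule eq_matI)
  fix i j assume "i < dim_row (1\<^sub>m n :: 'k mat)" "j < dim_col (1\<^sub>m n :: 'k mat)"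
  then have ij: "i < n" "j < n" by simp_all
  then have "en i \<in> I" "en j \<in> I" using bij_betwE[OF en] by simp_all
  moreover have "en i = en j \<longleftrightarrow> i = j" using ij bij_betw_imp_inj_on[OF en] by (auto simp: inj_on_eq_iff)
  ultimately show "indexed_mat n en a $$ (i, j) = 1\<^sub>m n $$ (i, j)" using ij eq by (simp add: indexed_mat_def)
 qed (simp_all add: indexed_mat_def)
qed

lemma indexed_mat_surj:
 fixes M :: "'k mat"
 assumes en: "bij_betw en {0..<n} I" and M: "M \<in> carrier_mat n n"
 shows "M = indexed_mat n en (\<lambda>i j. M $$ (inv_into {0..<n} en i, inv_into {0..<n} en j))"
 by (rule eq_matI) (use M bij_betw_inv_into_left[OF en] in \<open>auto simp: indexed_mat_def\<close>)

lemma det_unit_of_right_inverse: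
 fixes a b :: "'i => 'i => 'k::comm_ring_1"
 assumes en: "bij_betw en {0..<n} I"
  and ab: "\<And>i j. i \<in> I ==> j \<in> I ==> (\<Sum>k\<in>I. a i k * b k j) = (if i = j then 1 else 0)"
 shows "Determinant.det (indexed_mat n en a) dvd 1"
proof -
 have "indexed_mat n en a * indexed_mat n en b = 1\<^sub>m n"
  unfolding indexed_mat_mult[OF en] indexed_mat_one[OF en] using ab by blast
 then have "Determinant.det (indexed_mat n en a) * Determinant.det (indexed_mat n en b) = 1"
  using det_mult[of "indexed_mat n en a" n "indexed_mat n en b"] by simp
 then show ?thesis by (metis dvd_triv_left)
qed

text \<open>Over any commutative ring the adjugate divided by a unit determinant is an inverse on
  both sides.\<close>

lemma inverse_of_det_unit:
 fixes a :: "'i => 'i => 'k::comm_ring_1"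
 assumes en: "bij_betw en {0..<n} I" and d: "Determinant.det (indexed_mat n en a) dvd 1"
 shows "\<exists>b. (\<forall>i\<in>I. \<forall>j\<in>I. (\<Sum>k\<in>I. a i k * b k j) = (if i = j then 1 else 0)) &
  (\<forall>i\<in>I. \<forall>j\<in>I. (\<Sum>k\<in>I. b i k * a k j) = (if i = j then 1 else 0))"
proof -
 let ?A = "indexed_mat n en a"
 obtain c where c: "Determinant.det ?A * c = 1" using d by (metis dvdE)
 define B where "B = c \<cdot>\<^sub>m adj_mat ?A"
 note adj = adj_mat[OF indexed_mat_carrier[of n en a]]
 have Bc: "B \<in> carrier_mat n n" using adj(1) by (simp add: B_def)
 have one: "c \<cdot>\<^sub>m (Determinant.det ?A \<cdot>\<^sub>m 1\<^sub>m n) = 1\<^sub>m n"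
  using c by (intro eq_matI) (auto simp: mult.commute)
 have AB: "?A * B = 1\<^sub>m n"
  unfolding B_def mult_smult_distrib[OF indexed_mat_carrier adj(1)] adj(2) by (rule one)
 have BA: "B * ?A = 1\<^sub>m n"
  unfolding B_def mult_smult_assoc_mat[OF adj(1) indexed_mat_carrier] adj(3) by (rule one)
 obtain b where b: "B = indexed_mat n en b" using indexed_mat_surj[OF en Bc] by blast
 have 1: "\<forall>i\<in>I. \<forall>j\<in>I. (\<Sum>k\<in>I. a i k * b k j) = (if i = j then 1 else 0)"
  using AB unfolding b indexed_mat_mult[OF en] indexed_mat_one[OF en] .
 have 2: "\<forall>i\<in>I. \<forall>j\<in>I. (\<Sum>k\<in>I. b i k * a k j) = (if i = j then 1 else 0)"
  using BA unfolding b indexed_mat_mult[OF en] indexed_mat_one[OF en] .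
 from 1 2 show ?thesis by blast
qed

lemma det_nonzero_of_injective:
 fixes a :: "'i => 'i => 'k::field"
 assumes en: "bij_betw en {0..<n} I"
  and inj: "\<And>v. (\<And>i. i \<in> I ==> (\<Sum>k\<in>I. a i k * v k) = 0) ==> (\<And>i. i \<in> I ==> v i = 0)"
 shows "Determinant.det (indexed_mat n en a) ~= 0"
proof
 assume "Determinant.det (indexed_mat n en a) = 0"
 then obtain v where v: "v \<in> carrier_vec n" "v ~= 0\<^sub>v n" "indexed_mat n en a *\<^sub>v v = 0\<^sub>v n"
  using det_0_iff_vec_prod_zero_field[OF indexed_mat_carrier] by blast
 define w where "w i = v $ inv_into {0..<n} en i" for i
 have wen: "w (en k) = v $ k" if "k < n" for k
  unfolding w_def using bij_betw_inv_into_left[OF en] that by simp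
 have zero: "(\<Sum>k\<in>I. a i k * w k) = 0" if i: "i \<in> I" for i
 proof -
  obtain i' where i': "i' < n" "i = en i'"
   using i bij_betw_imp_surj_on[OF en] by (metis (no_types, lifting) atLeastLessThan_iff imageE)
  have "(\<Sum>k\<in>I. a i k * w k) = (\<Sum>k\<in>{0..<n}. a i (en k) * w (en k))"
   by (rule sum.reindex_bij_betw[OF en, symmetric])
  also have "... = (indexed_mat n en a *\<^sub>v v) $ i'"
   using i' v(1) by (simp add: indexed_mat_def scalar_prod_def wen)
  also have "... = 0" using v(3) i' by simp
  finally show ?thesis .
 qed
 have w0: "w i = 0" if "i \<in> I" for i
  by (rule inj[OF zero that])
 have "v = 0\<^sub>v n"
 proof (rule eq_vecI)
  fix k assume "k < dim_vec (0\<^sub>v n :: 'k vec)"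
  then have "k < n" by simp
  then show "v $ k = 0\<^sub>v n $ k" using wen w0 bij_betwE[OF en] by simp
 qed (use v in simp)
 then show False using v(2) by blast
qed

text \<open>Stands in for a dimension count over a ring: preimages of the basis vectors are the
  columns of a right inverse, so the determinant is a unit and there is a left inverse as
  well.\<close>

lemma surjective_injective:
 fixes T :: "('x => 'k::comm_ring_1) => 'x => 'k"
 assumes T: "lin T" and X: "finite X" and surj: "\<And>b. b \<in> X ==> \<exists>f\<in>sp X. T f = bv b"
  and f: "f \<in> sp X" "\<And>x. x \<in> X ==> T f x = 0"
 shows "f = (\<lambda>_. 0)"
proof -
 obtain en where en: "bij_betw en {0..<card X} X" using ex_bij_betw_nat_finite[OF X] by blast
 have Tval: "T g i = (\<Sum>j\<in>X. T (bv j) i * g j)" if "g \<in> sp X" for g i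
  by (subst sp_expand[OF X that], subst lin_lincomb[OF T]) (simp add: mult.commute)
 obtain v where v: "\<And>b. b \<in> X ==> v b \<in> sp X & T (v b) = bv b" using surj by metis
 have "Determinant.det (indexed_mat (card X) en (\<lambda>i j. T (bv j) i)) dvd 1"
 proof (rule det_unit_of_right_inverse[OF en])
  fix i j assume "i \<in> X" "j \<in> X"
  then show "(\<Sum>k\<in>X. T (bv k) i * v j k) = (if i = j then 1 else 0)"
   using Tval[of "v j" i] v[of j] by (simp add: basis_vec_def)
 qed
 from inverse_of_det_unit[OF en this] obtain c
  where c: "\<forall>i\<in>X. \<forall>j\<in>X. (\<Sum>k\<in>X. c i k * T (bv j) k) = (if i = j then 1 else 0)"
  by blast
 have "f i = 0" if i: "i \<in> X" for i
 proof -
  have "f i = (\<Sum>j\<in>X. if i = j then f j else 0)" using i X by simp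
  also have "... = (\<Sum>j\<in>X. (if i = j then 1 else 0) * f j)" by (intro sum.cong) simp_all
  also have "... = (\<Sum>j\<in>X. (\<Sum>k\<in>X. c i k * T (bv j) k) * f j)"
   using c i by (intro sum.cong) simp_all
  also have "... = (\<Sum>k\<in>X. c i k * (\<Sum>j\<in>X. T (bv j) k * f j))"
   unfolding sum_distrib_right sum_distrib_left by (subst sum.swap) (simp add: mult.assoc)
  also have "... = (\<Sum>k\<in>X. c i k * T f k)" using Tval[OF f(1)] by simp
  also have "... = 0" using f(2) by simp
  finally show ?thesis .
 qed
 then show ?thesis using f(1) by (auto simp: sp_def)
qed

subsection \<open>Specialisation of the Gram polynomial\<close>

definition spec :: "'k::comm_ring_1 => int poly => 'k" where
 "spec dl P = poly (map_poly of_int P) dl"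

text \<open>As a ring homomorphism, evaluation at \<open>dl\<close> passes through the determinant
  and turns the universal Gram polynomial into a determinant over the ground ring.\<close>

lemma spec_hom: "comm_ring_hom (spec dl :: int poly => 'k::comm_ring_1)"
proof
 fix P Q :: "int poly"
 have "map_poly of_int (P + Q) = (map_poly of_int P + map_poly of_int Q :: 'k poly)"
  by (rule poly_eqI) (simp add: coeff_map_poly)
 then show "spec dl (P + Q) = spec dl P + spec dl Q" by (simp add: spec_def)
 have "map_poly of_int (P * Q) = (map_poly of_int P * map_poly of_int Q :: 'k poly)"
  by (rule poly_eqI) (simp add: coeff_map_poly coeff_mult)
 then show "spec dl (P * Q) = spec dl P * spec dl Q" by (simp add: spec_def)
qed (simp_all add: spec_def)

lemma spec_x: "spec dl (monom 1 1) = dl"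
 unfolding spec_def by (simp add: map_poly_monom poly_monom)

text \<open>The pairing \<open>b\<close>, extended bilinearly and allowed between any two objects:
  it is the level part of the composite and vanishes when \<open>p\<close> and \<open>s\<close>
  differ.\<close>

abbreviation pr :: "'k::comm_ring_1 => nat => nat => nat => (diagram => 'k) => (diagram => 'k) => diagram => 'k" where
 "pr dl p q s e f \<equiv> pv p s (bcomp dl p q s e f)"

lemma level_pairing_eq:
 assumes "e \<in> brauer q p" "f \<in> brauer p q"
 shows "level_pairing dl p e f = pr dl p q p (bv e) (bv f)"
 unfolding level_pairing_def bcomp_basis[OF assms] project_basis_scaled project_basis Lv_self by simp

text \<open>The column label \<open>(g, \<tau>)\<close> is absorbed into the basis element
  \<open>dcomp g \<tau>\<close> of \<open>B^+(p, q)\<close>, which the right linearity of the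
  pairing permits. The rows then compute the coefficients of the pairings with the elements
  \<open>flip h\<close>.\<close>

definition gram :: "'k::comm_ring_1 => nat => nat => diagram \<times> diagram => diagram \<times> diagram => 'k" where
 "gram dl p q i j = pr dl p q p (bv (flip (fst i))) (bv (dcomp (fst j) (snd j))) (snd i)"

lemma up_mono_brauer: "h \<in> Um p q ==> h \<in> brauer p q"
 by (simp add: up_monoD upD)

lemma spec_gram:
 assumes i: "i \<in> gram_index p q" and j: "j \<in> gram_index p q"
 shows "spec dl (gram_entry p q i j) = gram dl p q i j"
proof -
 interpret comm_ring_hom "spec dl :: int poly => 'a" by (rule spec_hom)
 obtain f \<sigma> g \<tau> where ij: "i = (f, \<sigma>)" "j = (g, \<tau>)" by (cases i; cases j)
 have f: "f \<in> Um p q" and g: "g \<in> Um p q" and s: "\<sigma> \<in> brauer_level p p"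
  and t: "\<tau> \<in> brauer_level p p" using i j by (auto simp: ij gram_index_def)
 have basis: "spec dl (bv x y) = bv x y" for x y :: diagram by (simp add: basis_vec_def)
 have lp: "spec dl (level_pairing (monom 1 1) p (flip f) g d) = level_pairing dl p (flip f) g d" for d
  unfolding level_pairing_def by (simp add: basis hom_mult hom_power spec_x[simplified])
 have "spec dl (gram_entry p q i j) = bcomp dl p p p (level_pairing dl p (flip f) g) (bv \<tau>) \<sigma>"
  unfolding gram_entry_def ij bcomp_def
  by (simp only: prod.case hom_sum hom_mult hom_power basis lp spec_x)
 also have "... = bcomp dl p p p (pr dl p q p (bv (flip f)) (bv g)) (bv \<tau>) \<sigma>"
  using level_pairing_eq[OF flip_brauer[OF up_mono_brauer[OF f]] up_mono_brauer[OF g], of dl] by simp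
 also have "... = pr dl p q p (bv (flip f)) (bcomp dl p p q (bv g) (bv \<tau>)) \<sigma>"
 proof -
  have "bcomp dl p p p (pr dl p q p (bv (flip f)) (bv g)) (bv \<tau>)
   = pv p p (bcomp dl p p p (bcomp dl p q p (bv (flip f)) (bv g)) (bv \<tau>))"
   using t by (intro project_Lv_right[symmetric]) (simp_all add: Lv_self)
  then show ?thesis using f g t
   by (subst (asm) bcomp_assoc) (simp_all add: flip_brauer up_mono_brauer level_iff upD)
 qed
 also have "bcomp dl p p q (bv g) (bv \<tau>) = bv (dcomp g \<tau>)"
  using g t by (intro bcomp_basis_up) (simp_all add: up_monoD level_iff upD)
 finally show ?thesis by (simp add: gram_def ij)
qed

lemma finite_gram_index: "finite (gram_index p q)"
 by (simp add: gram_index_def)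

text \<open>The enumeration chosen inside \<open>gram_polynomial\<close> is handed on together with
  the criterion, so that both speak of the same matrix.\<close>

lemma non_singular_iff:
 obtains en where "bij_betw en {0..<card (gram_index p q)} (gram_index p q)"
  and "non_singular_at dl p q \<longleftrightarrow> Determinant.det (indexed_mat (card (gram_index p q)) en (gram dl p q)) dvd 1"
proof -
 let ?n = "card (gram_index p q)"
 define en where "en = (SOME enum. bij_betw enum {0..<?n} (gram_index p q))"
 have en: "bij_betw en {0..<?n} (gram_index p q)"
  unfolding en_def by (rule someI_ex[OF ex_bij_betw_nat_finite[OF finite_gram_index]])
 interpret comm_ring_hom "spec dl :: int poly => 'a" by (rule spec_hom)
 have "gram_polynomial p q = Determinant.det (mat ?n ?n (\<lambda>(i, j). gram_entry p q (en i) (en j)))"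
  by (simp add: gram_polynomial_def en_def Let_def)
 then have "spec dl (gram_polynomial p q)
  = Determinant.det (map_mat (spec dl) (mat ?n ?n (\<lambda>(i, j). gram_entry p q (en i) (en j))))"
  by simp
 also have "map_mat (spec dl) (mat ?n ?n (\<lambda>(i, j). gram_entry p q (en i) (en j))) = indexed_mat ?n en (gram dl p q)"
  unfolding indexed_mat_def using bij_betwE[OF en] by (intro eq_matI) (auto simp: spec_gram)
 finally show thesis using that en unfolding non_singular_at_def spec_def by simp
qed

lemma pr_expand:
 assumes x: "x \<in> sp (Up p q)"
 shows "pr dl p q p (bv (flip f)) x \<sigma>
  = (\<Sum>j\<in>gram_index p q. gram dl p q (f, \<sigma>) j * x (dcomp (fst j) (snd j)))"
proof -
 have "pr dl p q p (bv (flip f)) x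
  = (\<lambda>d. \<Sum>u\<in>Up p q. x u * pr dl p q p (bv (flip f)) (bv u) d)"
  by (subst sp_expand[OF finite_up x])
   (rule lin_lincomb[OF lin_project'[OF lin_bcomp_right]])
 then have "pr dl p q p (bv (flip f)) x \<sigma>
  = (\<Sum>u\<in>Up p q. x u * pr dl p q p (bv (flip f)) (bv u) \<sigma>)" by simp
 also have "... = (\<Sum>j\<in>gram_index p q. x (case j of (h, \<sigma>) => dcomp h \<sigma>)
   * pr dl p q p (bv (flip f)) (bv (case j of (h, \<sigma>) => dcomp h \<sigma>)) \<sigma>)"
  by (rule sum.reindex_bij_betw[OF bij_up_factor, symmetric])
 finally show ?thesis by (simp add: gram_def case_prod_beta mult.commute)
qed

text \<open>The dual element at \<open>h\<close> is the column of the inverse Gram matrix at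
  \<open>(h, id_diagram p)\<close>. Faithfulness of the pairing is the other half, that the inverse
  also works from the left.\<close>

lemma non_singular_dual_basis:
 assumes ns: "non_singular_at dl p q"
 shows "\<And>h. h \<in> Um p q ==> \<exists>x\<in>sp (Up p q). \<forall>h'\<in>Um p q.
   pr dl p q p (bv (flip h')) x = (if h' = h then bv (id_diagram p) else (\<lambda>_. 0))"
  and "\<And>x. x \<in> sp (Up p q) ==>
   (\<And>h. h \<in> Um p q ==> pr dl p q p (bv (flip h)) x = (\<lambda>_. 0)) ==> x = (\<lambda>_. 0)"
proof -
 obtain en where en: "bij_betw en {0..<card (gram_index p q)} (gram_index p q)"
  and d: "Determinant.det (indexed_mat (card (gram_index p q)) en (gram dl p q)) dvd 1"
  using non_singular_iff ns by metis
 from inverse_of_det_unit[OF en d] obtain b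
  where b1: "\<forall>i\<in>gram_index p q. \<forall>j\<in>gram_index p q.
   (\<Sum>k\<in>gram_index p q. gram dl p q i k * b k j) = (if i = j then 1 else 0)"
  and b2: "\<forall>i\<in>gram_index p q. \<forall>j\<in>gram_index p q.
   (\<Sum>k\<in>gram_index p q. b i k * gram dl p q k j) = (if i = j then 1 else 0)" by blast
 let ?dc = "\<lambda>j. dcomp (fst j) (snd j)"
 have bij: "bij_betw ?dc (gram_index p q) (Up p q)"
  using bij_up_factor[of p q] by (simp add: case_prod_unfold)
 show "\<exists>x\<in>sp (Up p q). \<forall>h'\<in>Um p q.
   pr dl p q p (bv (flip h')) x = (if h' = h then bv (id_diagram p) else (\<lambda>_. 0))"
  if h: "h \<in> Um p q" for h
 proof -
  define x where "x u = (if u \<in> Up p q then b (inv_into (gram_index p q) ?dc u) (h, id_diagram p) else 0)" for u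
  have xsp: "x \<in> sp (Up p q)" by (simp add: sp_def x_def)
  have xj: "x (?dc j) = b j (h, id_diagram p)" if "j \<in> gram_index p q" for j
   using bij_betwE[OF bij] bij_betw_inv_into_left[OF bij] that by (simp add: x_def)
  have hi: "(h, id_diagram p) \<in> gram_index p q" using h by (simp add: gram_index_def level_iff)
  have "pr dl p q p (bv (flip h')) x = (if h' = h then bv (id_diagram p) else (\<lambda>_. 0))"
   if h': "h' \<in> Um p q" for h'
  proof
   fix \<sigma>
   show "pr dl p q p (bv (flip h')) x \<sigma> = (if h' = h then bv (id_diagram p) else (\<lambda>_. 0)) \<sigma>"
   proof (cases "\<sigma> \<in> brauer_level p p")
    case True
    then have i: "(h', \<sigma>) \<in> gram_index p q" using h' by (simp add: gram_index_def)
    have "pr dl p q p (bv (flip h')) x \<sigma> = (\<Sum>j\<in>gram_index p q. gram dl p q (h', \<sigma>) j * b j (h, id_diagram p))"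
     unfolding pr_expand[OF xsp] using xj by simp
    also have "... = (if (h', \<sigma>) = (h, id_diagram p) then 1 else 0)" using b1 i hi by blast
    finally show ?thesis by (auto simp: basis_vec_def)
   next
    case False
    moreover have "\<sigma> ~= id_diagram p" using False by (auto simp: level_iff)
    ultimately show ?thesis by (simp add: project_def Lv_self basis_vec_def)
   qed
  qed
  then show ?thesis using xsp by blast
 qed
 show "x = (\<lambda>_. 0)" if x: "x \<in> sp (Up p q)"
  and 0: "\<And>h. h \<in> Um p q ==> pr dl p q p (bv (flip h)) x = (\<lambda>_. 0)" for x
 proof -
  have zero: "(\<Sum>j\<in>gram_index p q. gram dl p q i j * x (?dc j)) = 0" if "i \<in> gram_index p q" for i
   using pr_expand[OF x, of dl "fst i" "snd i"] 0[of "fst i"] that by (auto simp: gram_index_def)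
  have "x (?dc i) = 0" if i: "i \<in> gram_index p q" for i
  proof -
   have "x (?dc i) = (\<Sum>j\<in>gram_index p q. if i = j then x (?dc j) else 0)"
    using i finite_gram_index[of p q] by simp
   also have "... = (\<Sum>j\<in>gram_index p q. (if i = j then 1 else 0) * x (?dc j))"
    by (intro sum.cong) simp_all
   also have "... = (\<Sum>j\<in>gram_index p q. (\<Sum>k\<in>gram_index p q. b i k * gram dl p q k j) * x (?dc j))"
    using b2 i by (intro sum.cong) simp_all
   also have "... = (\<Sum>k\<in>gram_index p q. b i k * (\<Sum>j\<in>gram_index p q. gram dl p q k j * x (?dc j)))"
    unfolding sum_distrib_right sum_distrib_left by (subst sum.swap) (simp add: mult.assoc)
   also have "... = 0" using zero by simp
   finally show ?thesis .
  qed
  then have "\<forall>u\<in>?dc ` gram_index p q. x u = 0" by simp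
  then have "x u = 0" if "u \<in> Up p q" for u
   using that unfolding bij_betw_imp_surj_on[OF bij] by simp
  then show ?thesis using x by (auto simp: sp_def)
 qed
qed

text \<open>The given elements are the columns of a right inverse of the Gram matrix.\<close>

lemma non_singular_of_right_inverse:
 assumes "\<And>h \<sigma>. h \<in> Um p q ==> \<sigma> \<in> brauer_level p p ==>
  \<exists>x\<in>sp (Up p q). \<forall>h'\<in>Um p q.
   pr dl p q p (bv (flip h')) x = (if h' = h then bv \<sigma> else (\<lambda>_. 0))"
 shows "non_singular_at dl p q"
proof -
 have "\<forall>j\<in>gram_index p q. \<exists>x. x \<in> sp (Up p q) & (\<forall>h'\<in>Um p q.
   pr dl p q p (bv (flip h')) x = (if h' = fst j then bv (snd j) else (\<lambda>_. 0)))"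
  using assms by (fastforce simp: gram_index_def)
 from bchoice[OF this] obtain x where x: "\<forall>j\<in>gram_index p q. x j \<in> sp (Up p q) & (\<forall>h'\<in>Um p q.
   pr dl p q p (bv (flip h')) (x j) = (if h' = fst j then bv (snd j) else (\<lambda>_. 0)))" by blast
 obtain en where en: "bij_betw en {0..<card (gram_index p q)} (gram_index p q)"
  and d: "non_singular_at dl p q \<longleftrightarrow> Determinant.det (indexed_mat (card (gram_index p q)) en (gram dl p q)) dvd 1"
  using non_singular_iff by metis
 show ?thesis
  unfolding d
 proof (rule det_unit_of_right_inverse[OF en])
  fix i j assume ij: "i \<in> gram_index p q" "j \<in> gram_index p q"
  have fi: "fst i \<in> Um p q" using ij by (auto simp: gram_index_def)
  have xj: "x j \<in> sp (Up p q)" using x ij(2) by blast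
  have "(\<Sum>k\<in>gram_index p q. gram dl p q i k * x j (dcomp (fst k) (snd k)))
   = pr dl p q p (bv (flip (fst i))) (x j) (snd i)"
   by (subst pr_expand[OF xj]) simp
  also have "pr dl p q p (bv (flip (fst i))) (x j) = (if fst i = fst j then bv (snd j) else (\<lambda>_. 0))"
   using x ij(2) fi by blast
  finally show "(\<Sum>k\<in>gram_index p q. gram dl p q i k * x j (dcomp (fst k) (snd k))) = (if i = j then 1 else 0)"
   by (auto simp: basis_vec_def prod_eq_iff)
 qed
qed

text \<open>Over a field an injective square matrix has nonzero determinant; in this form condition
  (4) will yield non-singularity.\<close>

lemma non_singular_of_injective:
 fixes dl :: "'k::field"
 assumes inj: "\<And>x. x \<in> sp (Up p q) ==>
   (\<And>h. h \<in> Um p q ==> pr dl p q p (bv (flip h)) x = (\<lambda>_. 0)) ==> x = (\<lambda>_. 0)"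
 shows "non_singular_at dl p q"
proof -
 obtain en where en: "bij_betw en {0..<card (gram_index p q)} (gram_index p q)"
  and d: "non_singular_at dl p q \<longleftrightarrow> Determinant.det (indexed_mat (card (gram_index p q)) en (gram dl p q)) dvd 1"
  using non_singular_iff by metis
 let ?dc = "\<lambda>j. dcomp (fst j) (snd j)"
 have bij: "bij_betw ?dc (gram_index p q) (Up p q)"
  using bij_up_factor[of p q] by (simp add: case_prod_unfold)
 have "Determinant.det (indexed_mat (card (gram_index p q)) en (gram dl p q)) ~= 0"
 proof (rule det_nonzero_of_injective[OF en])
  fix v i assume v: "\<And>i. i \<in> gram_index p q ==> (\<Sum>k\<in>gram_index p q. gram dl p q i k * v k) = 0"
   and i: "i \<in> gram_index p q"
  define x where "x u = (if u \<in> Up p q then v (inv_into (gram_index p q) ?dc u) else 0)" for u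
  have xsp: "x \<in> sp (Up p q)" by (simp add: sp_def x_def)
  have xj: "x (?dc j) = v j" if "j \<in> gram_index p q" for j
   using bij_betwE[OF bij] bij_betw_inv_into_left[OF bij] that by (simp add: x_def)
  have "x = (\<lambda>_. 0)"
  proof (rule inj[OF xsp])
   fix h assume h: "h \<in> Um p q"
   show "pr dl p q p (bv (flip h)) x = (\<lambda>_. 0)"
   proof
    fix \<sigma>
    show "pr dl p q p (bv (flip h)) x \<sigma> = 0"
    proof (cases "\<sigma> \<in> brauer_level p p")
     case True
     then have "(h, \<sigma>) \<in> gram_index p q" using h by (simp add: gram_index_def)
     from v[OF this] show ?thesis unfolding pr_expand[OF xsp] using xj by simp
    qed (simp add: project_def Lv_self)
   qed
  qed
  then show "v i = 0" using xj[OF i] by simp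
 qed
 then show ?thesis unfolding d by (simp add: dvd_field_iff)
qed

section \<open>Non-singular parameters\<close>

lemma parity_le_trans: "p \<preceq> q ==> q \<preceq> r ==> p \<preceq> r"
 unfolding parity_le_def by (metis Nat.add_diff_assoc2 add.commute even_add le_add_diff_inverse le_trans)

lemma parity_le_refl [simp]: "p \<preceq> p"
 by (simp add: parity_le_def)

lemma finite_parity_le [simp]: "finite {s. s \<preceq> q}"
 by (rule finite_subset[of _ "{..q}"]) (auto simp: parity_le_def)

lemma diff_zero_eq: "(\<lambda>d. F d - G d) = (\<lambda>_. 0) ==> F = (G :: 'x => 'k::comm_ring_1)"
 by (simp add: fun_eq_iff)

text \<open>The pairing is linear over level diagrams because composing with them commutes with
  taking level parts.\<close>

lemma Lv_pr_left:
 assumes "\<sigma> \<in> sp (Lv s s')" "e \<in> sp (brauer q s)" "f \<in> sp (brauer p q)"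
 shows "pr dl p q s' (bcomp dl q s s' \<sigma> e) f = bcomp dl p s s' \<sigma> (pr dl p q s e f)"
 using assms project_Lv_left[OF assms(1) bcomp_sp, of p dl dl q e f]
 by (simp add: bcomp_assoc sp_Lv)

lemma Lv_pr_right:
 assumes "\<sigma> \<in> sp (Lv p' p)" "e \<in> sp (brauer q s)" "f \<in> sp (brauer p q)"
 shows "pr dl p' q s e (bcomp dl p' p q f \<sigma>) = bcomp dl p' p s (pr dl p q s e f) \<sigma>"
 using assms project_Lv_right[OF bcomp_sp assms(1), of s dl dl q e f]
 by (simp add: bcomp_assoc sp_Lv)

lemma sp_down_empty: "\<not> s \<preceq> q ==> y \<in> sp (Dn q s) ==> y = (\<lambda>_. 0)"
 using down_le[of _ q s] by (auto simp: sp_def)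

lemma sp_up_empty: "\<not> s \<preceq> q ==> y \<in> sp (Up s q) ==> y = (\<lambda>_. 0)"
 using up_le[of _ s q] by (auto simp: sp_def)

lemma project_Lv_diff: "s ~= t ==> pv s t f = (\<lambda>_. 0)"
 by (simp add: Lv_eq project_def)

text \<open>\<open>e\<close> acts on the right module \<open>B^-\<close> as the projection to level
  diagrams. This one-sided condition suits an induction; how \<open>e\<close> behaves on its left is
  deduced once the action on \<open>B^-\<close> is known to be faithful.\<close>

definition top_unit :: "'k::comm_ring_1 => nat => (diagram => 'k) => bool" where
 "top_unit dl p e \<longleftrightarrow> e \<in> sp (brauer p p) &
  (\<forall>s. \<forall>y\<in>sp (Dn p s). pd p s (bcomp dl p p s y e) = pv p s y)"

text \<open>The computation behind the later ones: between \<open>f\<close> and \<open>w\<close> the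
  element \<open>e\<close> lets only the level part of \<open>y f\<close> through, so the pairing of
  \<open>y\<close> with \<open>f\<close> remains, composed with \<open>w\<close>.\<close>

lemma top_unit_sandwich:
 assumes e: "top_unit dl t e" and f: "f \<in> sp (brauer t q)" and w: "w \<in> sp (Dn q' t)"
  and y: "y \<in> sp (brauer q s)"
 shows "pd q' s (bcomp dl q' q s y (bcomp dl q' t q f (bcomp dl q' t t e w)))
  = bcomp dl q' t s (pr dl t q s y f) w"
proof -
 have esp: "e \<in> sp (brauer t t)" using e by (simp add: top_unit_def)
 have "pd q' s (bcomp dl q' q s y (bcomp dl q' t q f (bcomp dl q' t t e w)))
  = pd q' s (bcomp dl q' t s (bcomp dl t t s (bcomp dl t q s y f) e) w)"
  using f y w esp by (simp add: bcomp_assoc sp_down)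
 also have "... = pd q' s (bcomp dl q' t s
   (pd t s (bcomp dl t t s (bcomp dl t q s y f) e)) w)"
  using w by (simp add: down_absorb sp_down)
 also have "pd t s (bcomp dl t t s (bcomp dl t q s y f) e)
  = pd t s (bcomp dl t t s (pd t s (bcomp dl t q s y f)) e)"
  using esp by (simp add: down_absorb)
 also have "... = pv t s (pd t s (bcomp dl t q s y f))"
  using e by (simp add: top_unit_def)
 also have "... = pr dl t q s y f"
  by (simp add: project_project Int_absorb2 Lv_sub)
 also have "pd q' s (bcomp dl q' t s (pr dl t q s y f) w) = bcomp dl q' t s (pr dl t q s y f) w"
  by (intro project_sp bcomp_down_down w sp_Lv_down) simp
 finally show ?thesis .
qed

section \<open>Dual bases and the elements e_p\<close>

locale non_singular =
 fixes dl :: "'k::comm_ring_1" and r :: nat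
 assumes ns: "non_singular_upto dl r"
begin

definition dual :: "nat => nat => diagram => diagram => 'k" where
 "dual p q h = (SOME x. x \<in> sp (Up p q) & (\<forall>h'\<in>Um p q.
   pr dl p q p (bv (flip h')) x = (if h' = h then bv (id_diagram p) else (\<lambda>_. 0))))"

lemma dual:
 assumes "q \<preceq> r" "h \<in> Um p q"
 shows "dual p q h \<in> sp (Up p q)"
  and "h' \<in> Um p q ==> pr dl p q p (bv (flip h')) (dual p q h)
   = (if h' = h then bv (id_diagram p) else (\<lambda>_. 0))"
proof -
 have "p \<preceq> q" using assms(2) up_le up_monoD by blast
 then have "non_singular_at dl p q" using ns assms(1) by (simp add: non_singular_upto_def)
 from someI_ex[OF non_singular_dual_basis(1)[OF this assms(2), unfolded Bex_def]]
 show "dual p q h \<in> sp (Up p q)"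
  "h' \<in> Um p q ==> pr dl p q p (bv (flip h')) (dual p q h)
   = (if h' = h then bv (id_diagram p) else (\<lambda>_. 0))"
  unfolding dual_def by blast+
qed

lemma pairing_faithful:
 assumes "q \<preceq> r" "x \<in> sp (Up p q)"
  "\<And>h. h \<in> Um p q ==> pr dl p q p (bv (flip h)) x = (\<lambda>_. 0)"
 shows "x = (\<lambda>_. 0)"
proof (cases "p \<preceq> q")
 case True
 then have "non_singular_at dl p q" using ns assms(1) by (simp add: non_singular_upto_def)
 from non_singular_dual_basis(2)[OF this assms(2,3)] show ?thesis .
next
 case False
 then show ?thesis using sp_up_empty assms(2) by blast
qed

text \<open>Up to a level factor on the left, which both sides respect, \<open>y\<close> may be
  taken to be some \<open>flip k\<close>; duality then leaves the single term
  \<open>h = k\<close>.\<close>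

lemma down_dual_expand:
 assumes q: "q \<preceq> r" and y: "y \<in> sp (Dn q s)"
 shows "(\<lambda>d. \<Sum>h\<in>Um s q. bcomp dl q s s (pr dl s q s y (dual s q h)) (bv (flip h)) d) = y"
proof (rule lin_ext[OF _ _ finite_down y])
 fix z assume z: "z \<in> Dn q s"
 obtain k \<sigma> where k: "k \<in> Um s q" and \<sigma>: "\<sigma> \<in> brauer_level s s" and zk: "z = dcomp \<sigma> (flip k)"
  using down_factor_exists[OF z] by blast
 have \<sigma>': "\<sigma> \<in> Lv s s" using \<sigma> by (simp add: Lv_self)
 then have \<sigma>b: "\<sigma> \<in> brauer s s" using Lv_sub by blast
 have fk: "flip k \<in> Dn q s" using k by (simp add: up_monoD)
 have zb: "bv z = bcomp dl q s s (bv \<sigma>) (bv (flip k))"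
  unfolding zk by (simp add: bcomp_basis_down[OF \<sigma>b fk])
 have "bcomp dl q s s (pr dl s q s (bv z) (dual s q h)) (bv (flip h)) d
  = (if k = h then bv z d else 0)" if h: "h \<in> Um s q" for h d
 proof -
  have "pr dl s q s (bv z) (dual s q h)
   = bcomp dl s s s (bv \<sigma>) (pr dl s q s (bv (flip k)) (dual s q h))"
   unfolding zb using \<sigma>' fk dual(1)[OF q h] by (intro Lv_pr_left) (simp_all add: downD sp_up)
  also have "... = (if k = h then bv \<sigma> else (\<lambda>_. 0))"
   unfolding dual(2)[OF q h k] using \<sigma>b by (simp add: bcomp_id_right)
  finally show ?thesis using zb by simp
 qed
 then show "(\<lambda>d. \<Sum>h\<in>Um s q. bcomp dl q s s (pr dl s q s (bv z) (dual s q h)) (bv (flip h)) d)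
  = bv z" using k by simp
qed (intro lin_intros)+

text \<open>Here both halves of the inverse Gram matrix enter: the two sides have the same pairing
  with every \<open>flip k\<close>, and the pairing is faithful.\<close>

lemma up_dual_expand:
 assumes q: "q \<preceq> r" and x: "x \<in> sp (Up s q)"
 shows "(\<lambda>d. \<Sum>h\<in>Um s q. bcomp dl s s q (dual s q h) (pr dl s q s (bv (flip h)) x) d) = x"
  (is "?y = x")
proof -
 have ysp: "?y \<in> sp (Up s q)"
  by (intro sum_sp bcomp_up_up dual(1)[OF q] sp_Lv_up) auto
 have "(\<lambda>d. ?y d - x d) = (\<lambda>_. 0)"
 proof (rule pairing_faithful[OF q diff_sp[OF ysp x]])
  fix k assume k: "k \<in> Um s q"
  have kb: "flip k \<in> brauer q s" using k by (simp add: flip_brauer up_mono_brauer)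
  have L: "lin (pr dl s q s (bv (flip k)))" by (intro lin_intros)
  have "pr dl s q s (bv (flip k)) ?y
   = (\<lambda>d. \<Sum>h\<in>Um s q. pr dl s q s (bv (flip k))
     (bcomp dl s s q (dual s q h) (pr dl s q s (bv (flip h)) x)) d)"
   by (rule lin_sum[OF L])
  also have "... = (\<lambda>d. \<Sum>h\<in>Um s q. if k = h then pr dl s q s (bv (flip h)) x d else 0)"
  proof (intro ext sum.cong refl)
   fix h d assume h: "h \<in> Um s q"
   have "pr dl s q s (bv (flip k)) (bcomp dl s s q (dual s q h) (pr dl s q s (bv (flip h)) x))
    = bcomp dl s s s (pr dl s q s (bv (flip k)) (dual s q h)) (pr dl s q s (bv (flip h)) x)"
    using kb dual(1)[OF q h] by (intro Lv_pr_right) (simp_all add: sp_up)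
   then show "pr dl s q s (bv (flip k)) (bcomp dl s s q (dual s q h) (pr dl s q s (bv (flip h)) x)) d
    = (if k = h then pr dl s q s (bv (flip h)) x d else 0)"
    unfolding dual(2)[OF q h k] by (simp add: bcomp_id_left sp_Lv)
  qed
  also have "... = pr dl s q s (bv (flip k)) x" using k by simp
  finally show "pr dl s q s (bv (flip k)) (\<lambda>d. ?y d - x d) = (\<lambda>_. 0)"
   unfolding lin_diff[OF L] by simp
 qed
 then show ?thesis by (rule diff_zero_eq)
qed

text \<open>The terms subtracted from the identity factor through objects \<open>t < p\<close>. On
  \<open>y\<close> in \<open>B^-(p, s)\<close> with \<open>s < p\<close> those with
  \<open>t = s\<close> add up to \<open>y\<close> and the others vanish, so everything cancels; for
  \<open>s = p\<close> all of them vanish and \<open>y\<close> remains.\<close>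

lemma top_unit_exists: "p \<preceq> r ==> \<exists>e. top_unit dl p e"
proof (induction p rule: less_induct)
 case (less p)
 let ?S = "{t. t \<preceq> p & t < p}"
 have "\<forall>t\<in>?S. \<exists>e. top_unit dl t e"
  using less parity_le_trans by blast
 from bchoice[OF this] obtain E where E: "\<And>t. t \<in> ?S ==> top_unit dl t (E t)" by blast
 define G where "G t h = bcomp dl p t p (dual t p h) (bcomp dl p t t (E t) (bv (flip h)))" for t h
 define e where "e = (\<lambda>d. bv (id_diagram p) d - (\<Sum>t\<in>?S. \<Sum>h\<in>Um t p. G t h d))"
 have esp: "e \<in> sp (brauer p p)"
  unfolding e_def G_def by (intro diff_sp sum_sp) (simp_all add: id_diagram_brauer)
 have "pd p s (bcomp dl p p s y e) = pv p s y"
  if y: "y \<in> sp (Dn p s)" for s y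
 proof (cases "s \<preceq> p")
  case False
  then show ?thesis using sp_down_empty[OF _ y] by simp
 next
  case True
  have L: "lin (\<lambda>x. pd p s (bcomp dl p p s y x))" by (intro lin_intros)
  have G: "pd p s (bcomp dl p p s y (G t h))
    = (if t = s then bcomp dl p s s (pr dl s p s y (dual s p h)) (bv (flip h)) else (\<lambda>_. 0))"
   if t: "t \<in> ?S" and h: "h \<in> Um t p" for t h
  proof -
   have "pd p s (bcomp dl p p s y (G t h))
    = bcomp dl p t s (pr dl t p s y (dual t p h)) (bv (flip h))"
    unfolding G_def using E[OF t] dual(1)[OF less.prems h] h y
    by (intro top_unit_sandwich) (simp_all add: sp_up sp_down up_monoD)
   then show ?thesis by (auto simp: project_Lv_diff)
  qed
  have "pd p s (bcomp dl p p s y e)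
   = (\<lambda>d. pd p s (bcomp dl p p s y (bv (id_diagram p))) d
     - (\<Sum>t\<in>?S. \<Sum>h\<in>Um t p. pd p s (bcomp dl p p s y (G t h)) d))"
   unfolding e_def lin_diff[OF L] lin_sum[OF L] by (rule refl)
  also have "... = (\<lambda>d. y d - (\<Sum>t\<in>?S. if t = s then y d else 0))"
  proof
   fix d
   have y1: "pd p s (bcomp dl p p s y (bv (id_diagram p))) = y"
    using y by (simp add: bcomp_id_right sp_down project_sp)
   have "(\<Sum>h\<in>Um t p. pd p s (bcomp dl p p s y (G t h)) d)
    = (if t = s then y d else 0)" if t: "t \<in> ?S" for t
   proof (cases "t = s")
    case True
    have "(\<Sum>h\<in>Um s p. bcomp dl p s s (pr dl s p s y (dual s p h)) (bv (flip h)) d) = y d"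
     using down_dual_expand[OF less.prems y] by (rule fun_cong)
    then show ?thesis using G[OF t] True by simp
   qed (use G[OF t] in simp)
   then show "pd p s (bcomp dl p p s y (bv (id_diagram p))) d
     - (\<Sum>t\<in>?S. \<Sum>h\<in>Um t p. pd p s (bcomp dl p p s y (G t h)) d)
    = y d - (\<Sum>t\<in>?S. if t = s then y d else 0)"
    unfolding y1 by simp
  qed
  also have "... = pv p s y"
  proof (cases "s = p")
   case True
   then have "y \<in> sp (Lv p s)" using y by (simp add: Lv_self level_eq(2))
   then show ?thesis using True by (simp add: project_sp)
  next
   case False
   then have "s < p" using \<open>s \<preceq> p\<close> unfolding parity_le_def by linarith
   then have "s \<in> ?S" using \<open>s \<preceq> p\<close> by simp
   moreover have "finite ?S" by (rule finite_subset[OF _ finite_parity_le[of p]]) auto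
   ultimately show ?thesis using False by (simp add: project_Lv_diff)
  qed
  finally show ?thesis .
 qed
 then show ?case using esp unfolding top_unit_def by blast
qed

definition eu :: "nat => diagram => 'k" where
 "eu p = (SOME e. top_unit dl p e)"

lemma eu: "p \<preceq> r ==> top_unit dl p (eu p)"
 unfolding eu_def by (rule someI_ex[OF top_unit_exists])

lemma eu_sp: "p \<preceq> r ==> eu p \<in> sp (brauer p p)"
 using eu by (simp add: top_unit_def)

lemma eu_down: "p \<preceq> r ==> y \<in> sp (Dn p s) ==>
  pd p s (bcomp dl p p s y (eu p)) = pv p s y"
 using eu by (simp add: top_unit_def)

end

section \<open>The linear maps underlying L\<close>

definition Lm :: "'k::comm_ring_1 => nat => nat => (diagram => 'k) => diagram => 'k" where
 "Lm dl q q' g = (\<lambda>d. \<Sum>p | p \<preceq> q'. \<Sum>h\<in>Um p q'.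
    bcomp dl q p q' (bv h)
     (pd q p (bcomp dl q q' p (bv (flip h)) g)) d)"

lemma L_functor_simps [simp]: "Fobj (L_functor dl) = (\<lambda>q. q)" "Fmap (L_functor dl) = Lm dl"
 by (auto simp: L_functor_def Lm_def fun_eq_iff)

lemma lin_Lm: "lin (Lm dl q q')"
 unfolding Lm_def by (intro lin_intros)

lemma Lm_sp: "Lm dl q q' g \<in> sp (brauer q q')"
 unfolding Lm_def by (intro sum_sp) simp

context non_singular
begin

text \<open>Preimages under \<open>L\<close> are explicit: the row of \<open>L\<close> at
  \<open>k\<close> becomes, after the inserted \<open>eu t\<close>, a pairing with
  \<open>flip k\<close>, and the dual basis turns these pairings into Kronecker deltas.\<close>

lemma Lm_basis:
 assumes qr: "q' \<preceq> r" and h: "h \<in> Um t q'" and z: "z \<in> Dn q t"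
 shows "Lm dl q q' (bcomp dl q t q' (dual t q' h) (bcomp dl q t t (eu t) (bv z))) = bv (dcomp h z)"
proof -
 have tq: "t \<preceq> q'" using h up_le up_monoD by blast
 have tr: "t \<preceq> r" using parity_le_trans[OF tq qr] .
 let ?g = "bcomp dl q t q' (dual t q' h) (bcomp dl q t t (eu t) (bv z))"
 have c: "pd q p (bcomp dl q q' p (bv (flip k)) ?g)
  = (if p = t & k = h then bv z else (\<lambda>_. 0))" if k: "k \<in> Um p q'" for p k
 proof -
  have "pd q p (bcomp dl q q' p (bv (flip k)) ?g)
   = bcomp dl q t p (pr dl t q' p (bv (flip k)) (dual t q' h)) (bv z)"
   using eu[OF tr] dual(1)[OF qr h] z k
   by (intro top_unit_sandwich) (simp_all add: sp_up flip_brauer up_mono_brauer)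
  also have "... = (if p = t & k = h then bv z else (\<lambda>_. 0))"
  proof (cases "p = t")
   case True
   then show ?thesis using dual(2)[OF qr h, of k] k z by (auto simp: bcomp_id_left downD)
  next
   case False
   then show ?thesis by (simp add: project_Lv_diff)
  qed
  finally show ?thesis .
 qed
 show ?thesis
 proof
  fix d
  have hz: "bcomp dl q t q' (bv h) (bv z) = bv (dcomp h z)"
   using h z by (intro bcomp_basis_up) (simp_all add: up_monoD downD)
  have "Lm dl q q' ?g d = (\<Sum>p | p \<preceq> q'. \<Sum>k\<in>Um p q'. if p = t & k = h then bv (dcomp h z) d else 0)"
   unfolding Lm_def using c by (intro sum.cong refl) (auto simp: hz)
  also have "... = (\<Sum>p | p \<preceq> q'. if p = t then bv (dcomp h z) d else 0)"
  proof (intro sum.cong refl)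
   fix p
   show "(\<Sum>k\<in>Um p q'. if p = t & k = h then bv (dcomp h z) d else 0)
    = (if p = t then bv (dcomp h z) d else (0 :: 'k))"
    using h by (cases "p = t") simp_all
  qed
  also have "... = bv (dcomp h z) d" using tq by simp
  finally show "Lm dl q q' ?g d = bv (dcomp h z) d" .
 qed
qed

lemma Lm_surj:
 assumes "q' \<preceq> r" "d \<in> brauer q q'"
 shows "\<exists>g\<in>sp (brauer q q'). Lm dl q q' g = bv d"
proof -
 obtain t h z where h: "h \<in> Um t q'" and z: "z \<in> Dn q t" and d: "d = dcomp h z"
  using factor_exists[OF assms(2)] by blast
 show ?thesis using Lm_basis[OF assms(1) h z] d by (metis bcomp_sp)
qed

lemma Lm_inj:
 assumes "q' \<preceq> r" "g \<in> sp (brauer q q')" "Lm dl q q' g = (\<lambda>_. 0)"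
 shows "g = (\<lambda>_. 0)"
 by (rule surjective_injective[OF lin_Lm finite_brauer Lm_surj[OF assms(1)] assms(2)])
  (assumption, rule fun_cong[OF assms(3)])

text \<open>An arrow enters \<open>Lm\<close> only through its action on the elements
  \<open>flip h\<close> of \<open>B^-\<close>, so the injectivity of \<open>Lm\<close> is a
  faithfulness statement. The identities for \<open>eu\<close> that follow are tested in this
  way.\<close>

lemma down_action_faithful:
 assumes q': "q' \<preceq> r" and g: "g \<in> sp (brauer q q')" "g' \<in> sp (brauer q q')"
  and eq: "\<And>s y. y \<in> sp (Dn q' s) ==>
   pd q s (bcomp dl q q' s y g) = pd q s (bcomp dl q q' s y g')"
 shows "g = g'"
proof -
 have "Lm dl q q' g = Lm dl q q' g'"
  unfolding Lm_def by (intro ext sum.cong refl) (simp add: eq up_monoD)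
 then have "Lm dl q q' (\<lambda>d. g d - g' d) = (\<lambda>_. 0)" by (simp add: lin_diff[OF lin_Lm])
 from Lm_inj[OF q' diff_sp[OF g] this] show ?thesis by (rule diff_zero_eq)
qed

text \<open>\<open>eu p\<close> reduces the test element \<open>y\<close> to its level part, and
  composing with level diagrams commutes with the downward projection.\<close>

lemma eu_kills_nondown:
 assumes p: "p \<preceq> r" and x: "x \<in> sp (brauer q p)"
 shows "bcomp dl q p p (eu p) (pd q p x) = bcomp dl q p p (eu p) x"
proof (rule down_action_faithful[OF p])
 fix s and y :: "diagram => 'k" assume y: "y \<in> sp (Dn p s)"
 have key: "pd q s (bcomp dl q p s y (bcomp dl q p p (eu p) w))
  = bcomp dl q p s (pv p s y) (pd q p w)" if w: "w \<in> sp (brauer q p)" for w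
 proof -
  have "pd q s (bcomp dl q p s y (bcomp dl q p p (eu p) w))
   = pd q s (bcomp dl q p s (pd p s (bcomp dl p p s y (eu p))) w)"
   using w y eu_sp[OF p] by (simp add: down_absorb bcomp_assoc sp_down)
  also have "... = pd q s (bcomp dl q p s (pv p s y) w)"
   by (simp add: eu_down[OF p y])
  also have "... = bcomp dl q p s (pv p s y) (pd q p w)"
   by (rule project_down_Lv[OF project_in_sp w])
  finally show ?thesis .
 qed
 have "pd q p (pd q p x) = pd q p x"
  by (simp add: project_project)
 then show "pd q s (bcomp dl q p s y (bcomp dl q p p (eu p) (pd q p x)))
  = pd q s (bcomp dl q p s y (bcomp dl q p p (eu p) x))"
  using key[OF x] key[of "pd q p x"] by (simp add: sp_down)
qed simp_all

text \<open>Once tested on \<open>y\<close>, both sides depend on \<open>x\<close> only through the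
  level part of \<open>y x\<close>, to which the non-upward diagrams in \<open>x\<close> do not
  contribute.\<close>

lemma eu_kills_nonup:
 assumes p: "p \<preceq> r" and q: "q \<preceq> r" and x: "x \<in> sp (brauer p q)"
 shows "bcomp dl p p q (pu p q x) (eu p) = bcomp dl p p q x (eu p)"
proof (rule down_action_faithful[OF q])
 fix s and y :: "diagram => 'k" assume y: "y \<in> sp (Dn q s)"
 have key: "pd p s (bcomp dl p q s y (bcomp dl p p q w (eu p)))
  = pv p s (bcomp dl p q s y w)" if w: "w \<in> sp (brauer p q)" for w
 proof -
  have "pd p s (bcomp dl p q s y (bcomp dl p p q w (eu p)))
   = pd p s (bcomp dl p p s (pd p s (bcomp dl p q s y w)) (eu p))"
   using w y eu_sp[OF p] by (simp add: down_absorb bcomp_assoc sp_down)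
  also have "... = pv p s (bcomp dl p q s y w)"
   using eu_down[OF p, of "pd p s (bcomp dl p q s y w)" s]
   by (simp add: project_project Int_absorb2 Lv_sub)
  finally show ?thesis .
 qed
 show "pd p s (bcomp dl p q s y (bcomp dl p p q (pu p q x) (eu p)))
  = pd p s (bcomp dl p q s y (bcomp dl p p q x (eu p)))"
  using key[OF x] key[of "pu p q x"] x y by (simp add: sp_up sp_down Lv_absorb_right)
qed simp_all

text \<open>Both sides act on \<open>y\<close> by taking the level part and composing with
  \<open>\<sigma>\<close>, in either order.\<close>

lemma eu_central:
 assumes p: "p \<preceq> r" and q: "q \<preceq> r" and \<sigma>: "\<sigma> \<in> sp (Lv p q)"
 shows "bcomp dl p p q \<sigma> (eu p) = bcomp dl p q q (eu q) \<sigma>"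
proof (rule down_action_faithful[OF q])
 fix s and y :: "diagram => 'k" assume y: "y \<in> sp (Dn q s)"
 have "pd p s (bcomp dl p q s y (bcomp dl p p q \<sigma> (eu p)))
  = pd p s (bcomp dl p p s (bcomp dl p q s y \<sigma>) (eu p))"
  using y \<sigma> eu_sp[OF p] by (simp add: bcomp_assoc sp_down sp_Lv)
 also have "... = pv p s (bcomp dl p q s y \<sigma>)"
  by (rule eu_down[OF p bcomp_down_down[OF y sp_Lv_down[OF \<sigma>]]])
 also have "... = bcomp dl p q s (pv q s y) \<sigma>"
  using y \<sigma> by (intro project_Lv_right) (simp_all add: sp_down)
 also have "... = pd p s (bcomp dl p q s (pv q s y) \<sigma>)"
  using y \<sigma> by (intro project_sp[symmetric] bcomp_down_down sp_Lv_down) simp_all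
 also have "... = pd p s (bcomp dl p q s (pd q s (bcomp dl q q s y (eu q))) \<sigma>)"
  by (simp add: eu_down[OF q y])
 also have "... = pd p s (bcomp dl p q s y (bcomp dl p q q (eu q) \<sigma>))"
  using y \<sigma> eu_sp[OF q] by (simp add: down_absorb bcomp_assoc sp_down sp_Lv)
 finally show "pd p s (bcomp dl p q s y (bcomp dl p p q \<sigma> (eu p)))
  = pd p s (bcomp dl p q s y (bcomp dl p q q (eu q) \<sigma>))" .
qed simp_all

text \<open>On a test element \<open>y\<close> of \<open>B^-(q, s)\<close> the sandwich lemma leaves
  only the terms with \<open>t = s\<close>, and these sum to \<open>y\<close> by
  \<open>down_dual_expand\<close>.\<close>

lemma id_resolution:
 assumes q: "q \<preceq> r"
 shows "(\<lambda>d. \<Sum>s | s \<preceq> q. \<Sum>h\<in>Um s q.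
   bcomp dl q s q (dual s q h) (bcomp dl q s s (eu s) (bv (flip h))) d) = bv (id_diagram q)"
  (is "?i = _")
proof (rule down_action_faithful[OF q])
 show "?i \<in> sp (brauer q q)" by (intro sum_sp) simp
 show "bv (id_diagram q) \<in> sp (brauer q q)" by (simp add: id_diagram_brauer)
 fix s and y :: "diagram => 'k" assume y: "y \<in> sp (Dn q s)"
 have L: "lin (\<lambda>x. pd q s (bcomp dl q q s y x))" by (intro lin_intros)
 have "pd q s (bcomp dl q q s y ?i)
  = (\<lambda>d. \<Sum>t | t \<preceq> q. \<Sum>h\<in>Um t q. pd q s (bcomp dl q q s y
    (bcomp dl q t q (dual t q h) (bcomp dl q t t (eu t) (bv (flip h))))) d)"
  unfolding lin_sum[OF L] by (rule refl)
 also have "... = (\<lambda>d. \<Sum>t | t \<preceq> q. if t = s then y d else 0)"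
 proof (intro ext sum.cong refl)
  fix d t assume t: "t \<in> {t. t \<preceq> q}"
  then have tr: "t \<preceq> r" using parity_le_trans q by blast
  have "pd q s (bcomp dl q q s y
    (bcomp dl q t q (dual t q h) (bcomp dl q t t (eu t) (bv (flip h)))))
   = bcomp dl q t s (pr dl t q s y (dual t q h)) (bv (flip h))" if h: "h \<in> Um t q" for h
   using eu[OF tr] dual(1)[OF q h] h y
   by (intro top_unit_sandwich) (simp_all add: sp_up sp_down up_monoD)
  then have "(\<Sum>h\<in>Um t q. pd q s (bcomp dl q q s y
    (bcomp dl q t q (dual t q h) (bcomp dl q t t (eu t) (bv (flip h))))) d)
   = (\<Sum>h\<in>Um t q. bcomp dl q t s (pr dl t q s y (dual t q h)) (bv (flip h)) d)"
   by simp
  also have "... = (if t = s then y d else 0)"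
  proof (cases "t = s")
   case True
   then show ?thesis using fun_cong[OF down_dual_expand[OF q y], of d] by simp
  qed (simp add: project_Lv_diff)
  finally show "(\<Sum>h\<in>Um t q. pd q s (bcomp dl q q s y
    (bcomp dl q t q (dual t q h) (bcomp dl q t t (eu t) (bv (flip h))))) d) = (if t = s then y d else 0)" .
 qed
 also have "... = y" using sp_down_empty[OF _ y] by (cases "s \<preceq> q") auto
 also have "y = pd q s (bcomp dl q q s y (bv (id_diagram q)))"
  using y by (simp add: bcomp_id_right sp_down project_sp)
 finally show "pd q s (bcomp dl q q s y ?i)
  = pd q s (bcomp dl q q s y (bv (id_diagram q)))" .
qed

end

section \<open>The functor to the matrix category\<close>

lemma linear_mapsD:
 assumes "f \<in> linear_maps M N"
 shows "x \<in> carrier M ==> f x \<in> carrier N"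
  and "x \<in> carrier M ==> y \<in> carrier M ==> f (x +[M] y) = f x +[N] f y"
  and "x \<in> carrier M ==> f (c *[M] x) = c *[N] f x"
 using assms by (auto simp: linear_maps_def)

lemma linear_mapsI:
 assumes "\<And>x. x \<in> carrier M ==> f x \<in> carrier N"
  and "\<And>x y. x \<in> carrier M ==> y \<in> carrier M ==> f (x +[M] y) = f x +[N] f y"
  and "\<And>c x. x \<in> carrier M ==> f (c *[M] x) = c *[N] f x"
 shows "f \<in> linear_maps M N"
 using assms by (auto simp: linear_maps_def)

lemma linear_maps_comp: "f \<in> linear_maps L M ==> g \<in> linear_maps M N ==> (\<lambda>x. g (f x)) \<in> linear_maps L N"
 by (rule linear_mapsI) (simp_all add: linear_mapsD)

lemma linear_maps_cong:
 assumes M: "is_module M" and f: "f \<in> linear_maps M N" and eq: "\<And>x. x \<in> carrier M ==> g x = f x"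
 shows "g \<in> linear_maps M N"
proof -
 interpret Module.module ground_ring M by (rule M)
 show ?thesis
  by (rule linear_mapsI) (simp_all add: eq linear_mapsD[OF f])
qed

lemma linear_maps_inv:
 assumes M: "is_module M" and f: "f \<in> linear_maps M N" and bij: "bij_betw f (carrier M) (carrier N)"
 shows "inv_into (carrier M) f \<in> linear_maps N M"
proof (rule linear_mapsI)
 interpret Module.module ground_ring M by (rule M)
 let ?g = "inv_into (carrier M) f"
 have g: "?g y \<in> carrier M" "f (?g y) = y" if "y \<in> carrier N" for y
  using bij that by (auto simp: bij_betw_def inv_into_into f_inv_into_f)
 have gi: "?g (f x) = x" if "x \<in> carrier M" for x using bij that by (simp add: bij_betw_def)
 show "?g y \<in> carrier M" if "y \<in> carrier N" for y using g that by blast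
 show "?g (y +[N] z) = ?g y +[M] ?g z" if y: "y \<in> carrier N" and z: "z \<in> carrier N" for y z
 proof -
  have "f (?g y +[M] ?g z) = y +[N] z" using g y z by (simp add: linear_mapsD(2)[OF f])
  then show ?thesis using gi[of "?g y +[M] ?g z"] g y z by simp
 qed
 show "?g (c *[N] y) = c *[M] ?g y" if y: "y \<in> carrier N" for c y
 proof -
  have "f (c *[M] ?g y) = c *[N] y" using g y by (simp add: linear_mapsD(3)[OF f])
  then show ?thesis using gi[of "c *[M] ?g y"] g y by simp
 qed
qed

text \<open>The category laws of the target are carried over along the bijections. In this way
  associativity and units of the truncated \<open>mB\<close> come from those of
  \<open>B\<close>.\<close>

lemma transport_category:
 fixes C :: "('o, 'a, 'k::comm_ring_1) lincat" and D :: "('o, 'b, 'k) lincat"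
 assumes C: "linear_category C" and Obj: "Obj D = Obj C"
  and HD: "\<And>x y. x \<in> Obj C ==> y \<in> Obj C ==> is_module (Hom D x y)"
  and lin: "\<And>x y. x \<in> Obj C ==> y \<in> Obj C ==> \<phi> x y \<in> linear_maps (Hom C x y) (Hom D x y)"
  and bij: "\<And>x y. x \<in> Obj C ==> y \<in> Obj C ==> bij_betw (\<phi> x y) (Arr C x y) (Arr D x y)"
  and id: "\<And>x. x \<in> Obj C ==> \<phi> x x (Ident C x) = Ident D x"
  and comp: "\<And>x y z f g. x \<in> Obj C ==> y \<in> Obj C ==> z \<in> Obj C ==> f \<in> Arr C x y ==> g \<in> Arr C y z ==>
   \<phi> x z (Comp C x y z g f) = Comp D x y z (\<phi> y z g) (\<phi> x y f)"
  and F: "Fobj F = (\<lambda>x. x)" "Fmap F = \<phi>"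
 shows "category_isomorphism C D F"
proof -
 interpret C: linear_category C by (rule C)
 define \<psi> where "\<psi> x y = inv_into (Arr C x y) (\<phi> x y)" for x y
 have \<psi>l: "\<psi> x y \<in> linear_maps (Hom D x y) (Hom C x y)" if "x \<in> Obj C" "y \<in> Obj C" for x y
  unfolding \<psi>_def using that by (intro linear_maps_inv C.Hom_module lin bij)
 have \<psi>in: "\<psi> x y f \<in> Arr C x y" if "x \<in> Obj C" "y \<in> Obj C" "f \<in> Arr D x y" for x y f
  using linear_mapsD(1)[OF \<psi>l] that by blast
 have \<phi>\<psi>: "\<phi> x y (\<psi> x y f) = f" if "x \<in> Obj C" "y \<in> Obj C" "f \<in> Arr D x y" for x y f
  unfolding \<psi>_def using bij[OF that(1,2)] that(3) by (simp add: bij_betw_def f_inv_into_f)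
 have \<psi>\<phi>: "\<psi> x y (\<phi> x y f) = f" if "x \<in> Obj C" "y \<in> Obj C" "f \<in> Arr C x y" for x y f
  unfolding \<psi>_def using bij[OF that(1,2)] that(3) by (simp add: bij_betw_def)
 have \<phi>in: "\<phi> x y f \<in> Arr D x y" if "x \<in> Obj C" "y \<in> Obj C" "f \<in> Arr C x y" for x y f
  using linear_mapsD(1)[OF lin] that by blast
 have cin: "Comp C x y z g f \<in> Arr C x z"
  if "x \<in> Obj C" "y \<in> Obj C" "z \<in> Obj C" "f \<in> Arr C x y" "g \<in> Arr C y z" for x y z f g
  using linear_mapsD(1)[OF C.Comp_linear_left] that by blast
 have DC: "Comp D x y z g f = \<phi> x z (Comp C x y z (\<psi> y z g) (\<psi> x y f))"
  if "x \<in> Obj C" "y \<in> Obj C" "z \<in> Obj C" "f \<in> Arr D x y" "g \<in> Arr D y z" for x y z f g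
  using that by (simp add: comp \<psi>in \<phi>\<psi>)
 have D: "linear_category D"
 proof (rule linear_category.intro, unfold Obj)
  fix x y z g assume o: "x \<in> Obj C" "y \<in> Obj C" "z \<in> Obj C" and g: "g \<in> Arr D y z"
  have "(\<lambda>f. \<phi> x z (Comp C x y z (\<psi> y z g) (\<psi> x y f))) \<in> linear_maps (Hom D x y) (Hom D x z)"
   using o g by (intro linear_maps_comp[OF _ lin] linear_maps_comp[OF \<psi>l C.Comp_linear_right] \<psi>in)
  then show "Comp D x y z g \<in> linear_maps (Hom D x y) (Hom D x z)"
   by (rule linear_maps_cong[OF HD, rotated 2]) (use o g in \<open>simp_all add: DC\<close>)
 next
  fix x y z f assume o: "x \<in> Obj C" "y \<in> Obj C" "z \<in> Obj C" and f: "f \<in> Arr D x y"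
  have "(\<lambda>g. \<phi> x z (Comp C x y z (\<psi> y z g) (\<psi> x y f))) \<in> linear_maps (Hom D y z) (Hom D x z)"
   using o f by (intro linear_maps_comp[OF _ lin] linear_maps_comp[OF \<psi>l C.Comp_linear_left] \<psi>in)
  then show "(\<lambda>g. Comp D x y z g f) \<in> linear_maps (Hom D y z) (Hom D x z)"
   by (rule linear_maps_cong[OF HD, rotated 2]) (use o f in \<open>simp_all add: DC\<close>)
 next
  fix w x y z f g h
  assume o: "w \<in> Obj C" "x \<in> Obj C" "y \<in> Obj C" "z \<in> Obj C"
   and a: "f \<in> Arr D w x" "g \<in> Arr D x y" "h \<in> Arr D y z"
  then show "Comp D w y z h (Comp D w x y g f) = Comp D w x z (Comp D x y z h g) f"
   by (simp add: DC \<phi>in cin \<psi>in \<psi>\<phi> C.Comp_assoc)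
 next
  fix x assume "x \<in> Obj C"
  then show "Ident D x \<in> Arr D x x" using \<phi>in[OF _ _ C.Ident_in] id by metis
 next
  fix x y f assume o: "x \<in> Obj C" "y \<in> Obj C" and f: "f \<in> Arr D x y"
  have "Ident D y \<in> Arr D y y" "\<psi> y y (Ident D y) = Ident C y"
   "Ident D x \<in> Arr D x x" "\<psi> x x (Ident D x) = Ident C x"
   using o \<phi>in[OF _ _ C.Ident_in] id \<psi>\<phi>[OF _ _ C.Ident_in] by metis+
  then show "Comp D x y y (Ident D y) f = f" "Comp D x x y f (Ident D x) = f"
   using o f by (simp_all add: DC \<psi>in C.Comp_Ident_left C.Comp_Ident_right \<phi>\<psi>)
 qed (rule HD)
 interpret D: linear_category D by (rule D)
 have LF: "linear_functor C D F"
  by (intro linear_functor.intro C D linear_functor_axioms.intro) (simp_all add: F Obj lin id comp)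
 define G where "G = \<lparr>Fobj = (\<lambda>x. x), Fmap = \<psi>\<rparr>"
 have G: "Fobj G = (\<lambda>x. x)" "Fmap G = \<psi>" by (simp_all add: G_def)
 have LG: "linear_functor D C G"
 proof (intro linear_functor.intro C D linear_functor_axioms.intro)
  fix x y z f g assume "x \<in> Obj D" "y \<in> Obj D" "z \<in> Obj D" "f \<in> Arr D x y" "g \<in> Arr D y z"
  then show "Fmap G x z (Comp D x y z g f)
   = Comp C (Fobj G x) (Fobj G y) (Fobj G z) (Fmap G y z g) (Fmap G x y f)"
   by (simp add: G Obj DC \<psi>\<phi> cin \<psi>in)
 next
  fix x assume "x \<in> Obj D"
  then show "Fmap G x x (Ident D x) = Ident C (Fobj G x)"
   using \<psi>\<phi>[of x x "Ident C x"] id[of x] C.Ident_in[of x] by (simp add: G Obj)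
 qed (simp_all add: G Obj \<psi>l)
 show ?thesis
  unfolding category_isomorphism_def functor_eq_on_def comp_functor_def id_functor_def
  using LF LG by (intro conjI exI[of _ G]) (simp_all add: F G Obj \<psi>\<phi> \<phi>\<psi>)
qed

subsection \<open>Composition of matrices\<close>

definition mcomp :: "nat => nat => nat => (diagram => 'k::comm_ring_1) => (diagram => 'k) => diagram => 'k" where
 "mcomp p q r f g d = (\<Sum>a\<in>brauer q r. \<Sum>b\<in>brauer p q. f a * g b * matrix_dcomp p q r a b d)"

lemma matrix_simps [simp]: "Obj matrix_brauer_category = UNIV"
 "Hom matrix_brauer_category = (\<lambda>p q. free_module (brauer p q))"
 "Comp matrix_brauer_category = mcomp"
 "Ident matrix_brauer_category = (\<lambda>p d. \<Sum>s | s \<preceq> p. \<Sum>f\<in>Um s p. bv (dcomp f (flip f)) d)"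
 by (simp_all add: matrix_brauer_category_def mcomp_def fun_eq_iff)

lemma lin_mcomp_left [lin_intros]: "lin S ==> lin (\<lambda>f. mcomp p q r (S f) g)"
 unfolding lin_def mcomp_def by (auto simp: fun_eq_iff algebra_simps sum.distrib sum_distrib_left)

lemma lin_mcomp_right [lin_intros]: "lin S ==> lin (\<lambda>g. mcomp p q r f (S g))"
 unfolding lin_def mcomp_def by (auto simp: fun_eq_iff algebra_simps sum.distrib sum_distrib_left)

lemma mcomp_basis:
 assumes "a \<in> brauer q r" "b \<in> brauer p q"
 shows "mcomp p q r (bv a) (bv b) = matrix_dcomp p q r a b"
proof
 fix d
 have "mcomp p q r (bv a) (bv b) d
  = (\<Sum>a'\<in>brauer q r. \<Sum>b'\<in>brauer p q. (if a' = a & b' = b then matrix_dcomp p q r a b d else 0))"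
  unfolding mcomp_def by (intro sum.cong refl) (auto simp: basis_vec_def)
 also have "... = (\<Sum>a'\<in>brauer q r. if a' = a then matrix_dcomp p q r a b d else 0)"
  using assms by (intro sum.cong refl) simp
 also have "... = matrix_dcomp p q r a b d" using assms by simp
 finally show "mcomp p q r (bv a) (bv b) d = matrix_dcomp p q r a b d" .
qed

text \<open>The product rule of matrix units, extended linearly in the downward part
  \<open>w\<close> of the second factor: a unit ending in \<open>flip e\<close> meets only the
  summand with \<open>k = e\<close>.\<close>

lemma mcomp_factors:
 fixes dl :: "'k::comm_ring_1"
 assumes h: "h \<in> Um t r" and \<sigma>: "\<sigma> \<in> brauer_level t t" and e: "e \<in> Um t q"
  and k: "k \<in> Um s q" and w: "w \<in> sp (Dn p s)"
 shows "mcomp p q r (bv (dcomp h (dcomp \<sigma> (flip e)))) (bcomp dl p s q (bv k) w)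
  = (if s = t & k = e then bcomp dl p t r (bv h) (bcomp dl p t t (bv \<sigma>) w) else (\<lambda>_. 0))"
  (is "?L w = ?R w")
proof (rule lin_ext[of ?L ?R, OF _ _ finite_down w])
 show "lin ?R"
 proof (cases "s = t & k = e")
  case True
  show ?thesis unfolding if_P[OF True] by (intro lin_intros)
 next
  case False
  show ?thesis unfolding if_not_P[OF False] by (intro lin_intros)
 qed
 fix z assume z: "z \<in> Dn p s"
 obtain m \<tau> where m: "m \<in> Um s p" and \<tau>: "\<tau> \<in> brauer_level s s" and zm: "z = dcomp \<tau> (flip m)"
  using down_factor_exists[OF z] by blast
 have fe: "flip e \<in> brauer_down_mono q t" and fm: "flip m \<in> brauer_down_mono p s" using e m by simp_all
 have kb: "k \<in> brauer s q" and hb: "h \<in> brauer t r" and eb: "flip e \<in> brauer q t" and \<sigma>b: "\<sigma> \<in> brauer t t"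
  and zb: "z \<in> brauer p s" and \<tau>b: "\<tau> \<in> brauer s s" and mb: "flip m \<in> brauer p s"
  using h e k z m \<sigma> \<tau> by (simp_all add: up_mono_brauer flip_brauer level_iff upD downD)
 have "?L (bv z) = mcomp p q r (bv (dcomp h (dcomp \<sigma> (flip e)))) (bv (dcomp k z))"
  using k zb by (simp add: bcomp_basis_up up_monoD)
 also have "... = matrix_dcomp p q r (dcomp h (dcomp \<sigma> (flip e))) (dcomp k (dcomp \<tau> (flip m)))"
  unfolding zm[symmetric]
  by (rule mcomp_basis[OF dcomp_brauer[OF hb dcomp_brauer[OF \<sigma>b eb]] dcomp_brauer[OF kb zb]])
 also have "... = (if t = s & e = k then bv (dcomp h (dcomp (dcomp \<sigma> \<tau>) (flip m))) else (\<lambda>_. 0))"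
  unfolding matrix_dcomp_def factorization_eq[OF h \<sigma> fe] factorization_eq[OF k \<tau> fm] by simp
 also have "... = ?R (bv z)"
 proof (cases "s = t & k = e")
  case True
  then have "dcomp (dcomp \<sigma> \<tau>) (flip m) = dcomp \<sigma> z"
   unfolding zm using dcomp_assoc_loops(1)[OF mb \<tau>b, of \<sigma> t] \<sigma>b by simp
  moreover have "bcomp dl p t t (bv \<sigma>) (bv z) = bv (dcomp \<sigma> z)"
   using \<sigma> zb True by (intro bcomp_basis_up) (simp_all add: level_iff)
  moreover have "bcomp dl p t r (bv h) (bv (dcomp \<sigma> z)) = bv (dcomp h (dcomp \<sigma> z))"
   using h \<sigma>b zb True by (intro bcomp_basis_up dcomp_brauer[of \<sigma> t]) (simp_all add: up_monoD)
  ultimately show ?thesis using True by simp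
 next
  case False
  then have False': "\<not> (t = s & e = k)" by blast
  show ?thesis unfolding if_not_P[OF False] if_not_P[OF False'] by (rule refl)
 qed
 finally show "?L (bv z) = ?R (bv z)" .
qed (intro lin_intros)

text \<open>The reason why \<open>L\<close> is multiplicative. For
  \<open>y = dcomp \<sigma> (flip e)\<close> the matrix product selects the row of
  \<open>Lm dl p q g\<close> at \<open>e\<close>, which is the downward part of
  \<open>flip e\<close> composed with \<open>g\<close>, and \<open>\<sigma>\<close> passes through
  the projection.\<close>

lemma mcomp_row:
 assumes h: "h \<in> Um t r" and y: "y \<in> sp (Dn q t)" and g: "g \<in> sp (brauer p q)"
 shows "mcomp p q r (bcomp dl q t r (bv h) y) (Lm dl p q g)
  = bcomp dl p t r (bv h) (pd p t (bcomp dl p q t y g))"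
proof (rule lin_ext[OF _ _ finite_down y])
 fix z assume z: "z \<in> Dn q t"
 obtain e \<sigma> where e: "e \<in> Um t q" and \<sigma>: "\<sigma> \<in> brauer_level t t" and ze: "z = dcomp \<sigma> (flip e)"
  using down_factor_exists[OF z] by blast
 have tq: "t \<preceq> q" using down_le[OF z] .
 have \<sigma>': "\<sigma> \<in> Lv t t" using \<sigma> by (simp add: Lv_self)
 have fe: "flip e \<in> Dn q t" using e by (simp add: up_monoD)
 let ?c = "\<lambda>s k. pd p s (bcomp dl p q s (bv (flip k)) g)"
 let ?a = "bv (dcomp h (dcomp \<sigma> (flip e))) :: diagram => 'a"
 let ?v = "bcomp dl p t r (bv h) (bcomp dl p t t (bv \<sigma>) (?c t e))"
 have L: "lin (mcomp p q r ?a)" using lin_mcomp_right[OF lin_id] .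
 have "bcomp dl q t r (bv h) (bv z) = ?a"
  using h z unfolding ze[symmetric] by (intro bcomp_basis_up) (simp_all add: up_monoD downD)
 then have "mcomp p q r (bcomp dl q t r (bv h) (bv z)) (Lm dl p q g)
  = (\<lambda>d. \<Sum>s | s \<preceq> q. \<Sum>k\<in>Um s q. mcomp p q r ?a (bcomp dl p s q (bv k) (?c s k)) d)"
  unfolding Lm_def by (simp only: lin_sum[OF L])
 also have "... = (\<lambda>d. \<Sum>s | s \<preceq> q. \<Sum>k\<in>Um s q. if s = t & k = e then ?v d else 0)"
  by (intro ext sum.cong refl, subst mcomp_factors[OF h \<sigma> e]) auto
 also have "... = (\<lambda>d. \<Sum>s | s \<preceq> q. if s = t then ?v d else 0)"
 proof (intro ext sum.cong refl)
  fix s d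
  show "(\<Sum>k\<in>Um s q. if s = t & k = e then ?v d else 0) = (if s = t then ?v d else 0)"
   using e by (cases "s = t") simp_all
 qed
 also have "... = ?v" using tq by simp
 also have "bcomp dl p t t (bv \<sigma>) (?c t e)
  = pd p t (bcomp dl p t t (bv \<sigma>) (bcomp dl p q t (bv (flip e)) g))"
  using \<sigma>' by (intro project_down_Lv[symmetric]) simp_all
 also have "bcomp dl p t t (bv \<sigma>) (bcomp dl p q t (bv (flip e)) g) = bcomp dl p q t (bv z) g"
 proof -
  have "bcomp dl q t t (bv \<sigma>) (bv (flip e)) = bv z"
   unfolding ze using \<sigma> fe by (intro bcomp_basis_up) (simp_all add: level_iff downD)
  moreover have "bcomp dl p q t (bcomp dl q t t (bv \<sigma>) (bv (flip e))) g
   = bcomp dl p t t (bv \<sigma>) (bcomp dl p q t (bv (flip e)) g)"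
   using \<sigma> fe g by (intro bcomp_assoc) (simp_all add: level_iff upD downD)
  ultimately show ?thesis by simp
 qed
 finally show "mcomp p q r (bcomp dl q t r (bv h) (bv z)) (Lm dl p q g)
  = bcomp dl p t r (bv h) (pd p t (bcomp dl p q t (bv z) g))" .
qed (intro lin_intros)+

text \<open>Row by row, \<open>mcomp_row\<close> yields the downward part of a product whose left
  factor has already been projected; by \<open>down_absorb\<close> that inner projection changes
  nothing.\<close>

lemma Lm_comp:
 assumes f: "f \<in> sp (brauer q r)" and g: "g \<in> sp (brauer p q)"
 shows "Lm dl p r (bcomp dl p q r f g) = mcomp p q r (Lm dl q r f) (Lm dl p q g)"
proof -
 have L: "lin (\<lambda>x. mcomp p q r x (Lm dl p q g))" using lin_mcomp_left[OF lin_id] .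
 have "mcomp p q r (Lm dl q r f) (Lm dl p q g) = (\<lambda>d. \<Sum>t | t \<preceq> r. \<Sum>h\<in>Um t r.
  mcomp p q r (bcomp dl q t r (bv h)
   (pd q t (bcomp dl q r t (bv (flip h)) f))) (Lm dl p q g) d)"
  unfolding Lm_def[of dl q r f] by (simp only: lin_sum[OF L])
 also have "... = Lm dl p r (bcomp dl p q r f g)"
  unfolding Lm_def[of dl p r]
 proof (intro ext sum.cong refl)
  fix d t h assume h: "h \<in> Um t r"
  have fh: "bv (flip h) \<in> sp (brauer r t)" using h by (simp add: flip_brauer up_mono_brauer)
  have "pd p t (bcomp dl p q t (pd q t (bcomp dl q r t (bv (flip h)) f)) g)
   = pd p t (bcomp dl p r t (bv (flip h)) (bcomp dl p q r f g))"
   using f g fh by (simp add: down_absorb bcomp_assoc)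
  then show "mcomp p q r (bcomp dl q t r (bv h)
   (pd q t (bcomp dl q r t (bv (flip h)) f))) (Lm dl p q g) d
   = bcomp dl p t r (bv h) (project (Dn p t)
    (bcomp dl p r t (bv (flip h)) (bcomp dl p q r f g))) d"
   by (subst mcomp_row[OF h _ g]) simp_all
 qed
 finally show ?thesis ..
qed

lemma Lm_id: "Lm dl q q (bv (id_diagram q))
  = (\<lambda>d. \<Sum>s | s \<preceq> q. \<Sum>f\<in>Um s q. bv (dcomp f (flip f)) d)"
 unfolding Lm_def
proof (intro ext sum.cong refl)
 fix d s h assume h: "h \<in> Um s q"
 have fh: "flip h \<in> Dn q s" using h by (simp add: up_monoD)
 have "bcomp dl q q s (bv (flip h)) (bv (id_diagram q)) = bv (flip h)"
  using fh by (intro bcomp_id_right) (simp add: downD)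
 then have "pd q s (bcomp dl q q s (bv (flip h)) (bv (id_diagram q))) = bv (flip h)"
  using fh by (simp add: project_sp)
 moreover have "bcomp dl q s q (bv h) (bv (flip h)) = bv (dcomp h (flip h))"
  using h fh by (intro bcomp_basis_up) (simp_all add: up_monoD downD)
 ultimately show "bcomp dl q s q (bv h)
   (pd q s (bcomp dl q q s (bv (flip h)) (bv (id_diagram q)))) d
  = bv (dcomp h (flip h)) d" by simp
qed

lemma (in non_singular) L_isomorphism:
 "category_isomorphism (truncate r (brauer_category dl)) (truncate r matrix_brauer_category) (L_functor dl)"
proof (rule transport_category[where \<phi> = "Lm dl"])
 show "linear_category (truncate r (brauer_category dl))"
  by (rule linear_category_truncate[OF linear_category_brauer])
 show "bij_betw (Lm dl x y) (Arr (truncate r (brauer_category dl)) x y) (Arr (truncate r matrix_brauer_category) x y)"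
  if "x \<in> Obj (truncate r (brauer_category dl))" "y \<in> Obj (truncate r (brauer_category dl))" for x y
 proof -
  have y: "y \<preceq> r" using that by simp
  have "bij_betw (Lm dl x y) (sp (brauer x y)) (sp (brauer x y))"
  proof (rule bij_betw_imageI)
   show "inj_on (Lm dl x y) (sp (brauer x y))"
   proof (rule inj_onI)
    fix f g assume fg: "f \<in> sp (brauer x y)" "g \<in> sp (brauer x y)" "Lm dl x y f = Lm dl x y g"
    then have "Lm dl x y (\<lambda>d. f d - g d) = (\<lambda>_. 0)" by (simp add: lin_diff[OF lin_Lm])
    from Lm_inj[OF y diff_sp[OF fg(1,2)] this] show "f = g" by (rule diff_zero_eq)
   qed
   show "Lm dl x y ` sp (brauer x y) = sp (brauer x y)"
   proof (intro equalityI subsetI)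
    fix F :: "diagram => 'k" assume F: "F \<in> sp (brauer x y)"
    have "\<forall>d\<in>brauer x y. \<exists>g. g \<in> sp (brauer x y) & Lm dl x y g = bv d"
     using Lm_surj[OF y] by blast
    from bchoice[OF this] obtain G where G: "\<And>d. d \<in> brauer x y ==> G d \<in> sp (brauer x y) & Lm dl x y (G d) = bv d"
     by blast
    let ?g = "\<lambda>e. \<Sum>d\<in>brauer x y. F d * G d e"
    have "Lm dl x y ?g = (\<lambda>e. \<Sum>d\<in>brauer x y. F d * bv d e)"
     unfolding lin_lincomb[OF lin_Lm] using G by (intro ext sum.cong) simp_all
    also have "... = F" by (rule sp_expand[OF finite_brauer F, symmetric])
    finally have eq: "Lm dl x y ?g = F" .
    have "?g \<in> sp (brauer x y)" using G by (intro sum_sp scale_sp) blast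
    then have "Lm dl x y ?g \<in> Lm dl x y ` sp (brauer x y)" by (rule imageI)
    then show "F \<in> Lm dl x y ` sp (brauer x y)" unfolding eq .
   qed (use Lm_sp in blast)
  qed
  then show ?thesis by (simp add: carrier_free)
 qed
qed (auto simp: carrier_free module_free Lm_sp Lm_id Lm_comp intro!: lin_linear_maps lin_Lm)

subsection \<open>Non-singularity from surjectivity of the functor\<close>

lemma bcomp_up_mono_coeff:
 assumes k: "k \<in> Um t q" and c: "c \<in> sp (Dn p t)"
  and h: "h \<in> Um s q" and z: "z \<in> Dn p s"
 shows "bcomp dl p t q (bv k) c (dcomp h z) = (if t = s & k = h then c z else 0)"
proof -
 have "bcomp dl p t q (bv k) c = (\<lambda>d. \<Sum>w\<in>Dn p t. c w * bcomp dl p t q (bv k) (bv w) d)"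
  by (subst sp_expand[OF finite_down c]) (rule lin_lincomb[OF lin_bcomp_right])
 then have "bcomp dl p t q (bv k) c (dcomp h z) = (\<Sum>w\<in>Dn p t. c w * bv (dcomp k w) (dcomp h z))"
  using k by (simp add: bcomp_basis_up up_monoD downD)
 also have "... = (\<Sum>w\<in>Dn p t. if w = z then (if t = s & k = h then c z else 0) else 0)"
 proof (intro sum.cong refl)
  fix w assume w: "w \<in> Dn p t"
  show "c w * bv (dcomp k w) (dcomp h z) = (if w = z then (if t = s & k = h then c z else 0) else 0)"
  proof (cases "dcomp k w = dcomp h z")
   case True
   then show ?thesis using factor_unique[OF k w h z True] by (simp add: basis_vec_def)
  next
   case False
   then show ?thesis by (auto simp: basis_vec_def)
  qed
 qed
 also have "... = (if t = s & k = h then c z else 0)" using z by simp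
 finally show ?thesis .
qed

text \<open>By unique factorisation the summands of \<open>Lm\<close> share no diagram, so the rows
  can be read off from coefficients.\<close>

lemma Lm_coeff:
 assumes h: "h \<in> Um s q'" and z: "z \<in> Dn q s"
 shows "Lm dl q q' g (dcomp h z) = pd q s (bcomp dl q q' s (bv (flip h)) g) z"
  (is "_ = ?c s h z")
proof -
 have sq: "s \<preceq> q'" using h up_le up_monoD by blast
 have "Lm dl q q' g (dcomp h z) = (\<Sum>t | t \<preceq> q'. \<Sum>k\<in>Um t q'. if t = s & k = h then ?c s h z else 0)"
  unfolding Lm_def using bcomp_up_mono_coeff[OF _ project_in_sp h z, of _ _ dl] by (intro sum.cong refl) auto
 also have "... = (\<Sum>t | t \<preceq> q'. if t = s then ?c s h z else 0)"
 proof (intro sum.cong refl)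
  fix t
  show "(\<Sum>k\<in>Um t q'. if t = s & k = h then ?c s h z else 0) = (if t = s then ?c s h z else 0)"
   using h by (cases "t = s") simp_all
 qed
 also have "... = ?c s h z" using sq by simp
 finally show ?thesis .
qed

text \<open>Take a preimage \<open>y\<close> of \<open>dcomp h \<sigma>\<close> under
  \<open>L\<close>. Among the rows at \<open>k\<close> in \<open>Um p q\<close> it has
  \<open>\<sigma>\<close> at \<open>h\<close> and zero elsewhere. These rows are the pairings of its
  upward part, which is therefore a column of a right inverse of the Gram matrix.\<close>

lemma non_singular_of_L_isomorphism:
 assumes iso: "category_isomorphism (truncate r (brauer_category dl)) (truncate r matrix_brauer_category) (L_functor dl)"
 shows "non_singular_upto dl r"
 unfolding non_singular_upto_def
proof (intro allI impI)
 fix p q assume pq: "p \<preceq> q & q \<preceq> r"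
 then have pr: "p \<preceq> r" and qr: "q \<preceq> r" using parity_le_trans by blast+
 obtain G where G: "linear_functor (truncate r matrix_brauer_category) (truncate r (brauer_category dl)) G"
  and FG: "functor_eq_on (truncate r matrix_brauer_category) (comp_functor (L_functor dl) G) id_functor"
  using iso unfolding category_isomorphism_def by blast
 have obj: "Fobj G x = x" if "x \<preceq> r" for x
  using FG that by (simp add: functor_eq_on_def comp_functor_def id_functor_def)
 have LG: "Lm dl p q (Fmap G p q f) = f" if "f \<in> sp (brauer p q)" for f
  using FG that pr qr obj by (simp add: functor_eq_on_def comp_functor_def id_functor_def carrier_free)
 have Gin: "Fmap G p q f \<in> sp (brauer p q)" if "f \<in> sp (brauer p q)" for f
  using linear_mapsD(1)[OF linear_functor.Fmap_linear[OF G, of p q], of f] pr qr obj that by (simp add: carrier_free)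
 show "non_singular_at dl p q"
 proof (rule non_singular_of_right_inverse)
  fix h \<sigma> assume h: "h \<in> Um p q" and \<sigma>: "\<sigma> \<in> brauer_level p p"
  have b: "bv (dcomp h \<sigma>) \<in> sp (brauer p q)"
   using h \<sigma> by (simp add: dcomp_brauer[of h p q \<sigma> p] up_mono_brauer level_iff upD)
  define y where "y = Fmap G p q (bv (dcomp h \<sigma>))"
  have y: "y \<in> sp (brauer p q)" "Lm dl p q y = bv (dcomp h \<sigma>)"
   using LG[OF b] Gin[OF b] by (simp_all add: y_def)
  have "pr dl p q p (bv (flip k)) (pu p q y) = (if k = h then bv \<sigma> else (\<lambda>_. 0))"
   if k: "k \<in> Um p q" for k
  proof
   fix z
   have "pr dl p q p (bv (flip k)) (pu p q y)
    = pd p p (bcomp dl p q p (bv (flip k)) y)"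
    using y(1) k by (subst Lv_absorb_right) (simp_all add: flip_brauer up_mono_brauer Lv_self level_eq(2))
   moreover have "pd p p (bcomp dl p q p (bv (flip k)) y) z
    = (if k = h then bv \<sigma> else (\<lambda>_. 0)) z"
   proof (cases "z \<in> Dn p p")
    case True
    have "pd p p (bcomp dl p q p (bv (flip k)) y) z = bv (dcomp h \<sigma>) (dcomp k z)"
     unfolding y(2)[symmetric] by (rule Lm_coeff[OF k True, symmetric])
    also have "... = (if k = h then bv \<sigma> else (\<lambda>_. 0)) z"
     using up_factor_unique[OF k _ h \<sigma>, of z] True by (auto simp: basis_vec_def level_eq(2))
    finally show ?thesis .
   next
    case False
    then have "z ~= \<sigma>" using \<sigma> by (auto simp: level_iff)
    then show ?thesis using False by (simp add: project_def basis_vec_def)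
   qed
   ultimately show "pr dl p q p (bv (flip k)) (pu p q y) z
    = (if k = h then bv \<sigma> else (\<lambda>_. 0)) z" by simp
  qed
  then show "\<exists>x\<in>sp (Up p q). \<forall>k\<in>Um p q.
    pr dl p q p (bv (flip k)) x = (if k = h then bv \<sigma> else (\<lambda>_. 0))"
   by (intro bexI[of _ "pu p q y"]) auto
 qed
qed

section \<open>Tensor products of bimodules\<close>

definition ext :: "('i => 'd => 'k::comm_ring_1) => ('i => 'k) => 'd => 'k" where
 "ext \<beta> F = (\<lambda>d. \<Sum>i\<in>supp F. F i * \<beta> i d)"

abbreviation fm :: "'i set => ('i => 'k::comm_ring_1) set" where
 "fm Y \<equiv> carrier (free_module Y)"

lemma fm_iff: "F \<in> fm Y \<longleftrightarrow> finite (supp F) & supp F \<subseteq> Y"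
 by (simp add: free_module_def)

lemma ext_superset: "finite S ==> supp F \<subseteq> S ==> ext \<beta> F = (\<lambda>d. \<Sum>i\<in>S. F i * \<beta> i d)"
 unfolding ext_def by (rule ext, rule sum.mono_neutral_left) (auto simp: supp_def)

lemma ext_add: "F \<in> fm Y ==> G \<in> fm Y ==> ext \<beta> (\<lambda>i. F i + G i) = (\<lambda>d. ext \<beta> F d + ext \<beta> G d)"
proof -
 assume FG: "F \<in> fm Y" "G \<in> fm Y"
 let ?S = "supp F \<union> supp G"
 have S: "finite ?S" "supp (\<lambda>i. F i + G i) \<subseteq> ?S" using FG by (auto simp: fm_iff supp_def)
 have "ext \<beta> F = (\<lambda>d. \<Sum>i\<in>?S. F i * \<beta> i d)" "ext \<beta> G = (\<lambda>d. \<Sum>i\<in>?S. G i * \<beta> i d)"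
  using S by (auto intro!: ext_superset)
 then show ?thesis unfolding ext_superset[OF S] by (simp add: algebra_simps sum.distrib)
qed

lemma ext_scale: "F \<in> fm Y ==> ext \<beta> (\<lambda>i. c * F i) = (\<lambda>d. c * ext \<beta> F d)"
proof -
 assume F: "F \<in> fm Y"
 have S: "finite (supp F)" "supp (\<lambda>i. c * F i) \<subseteq> supp F" using F by (auto simp: fm_iff supp_def)
 show ?thesis unfolding ext_superset[OF S] by (simp add: ext_def sum_distrib_left mult.assoc)
qed

lemma fm_add: "F \<in> fm Y ==> G \<in> fm Y ==> (\<lambda>i. F i + G i) \<in> fm Y"
proof -
 assume FG: "F \<in> fm Y" "G \<in> fm Y"
 have "supp (\<lambda>i. F i + G i) \<subseteq> supp F \<union> supp G" by (auto simp: supp_def)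
 then show ?thesis using FG finite_subset[of _ "supp F \<union> supp G"] unfolding fm_iff by blast
qed

lemma fm_scale: "F \<in> fm Y ==> (\<lambda>i. c * F i) \<in> fm Y"
proof -
 assume F: "F \<in> fm Y"
 have "supp (\<lambda>i. c * F i) \<subseteq> supp F" by (auto simp: supp_def)
 then show ?thesis using F finite_subset[of _ "supp F"] unfolding fm_iff by blast
qed

lemma fm_diff: "F \<in> fm Y ==> G \<in> fm Y ==> (\<lambda>i. F i - G i) \<in> fm Y"
 using fm_add[of F Y "\<lambda>i. (-1) * G i"] fm_scale[of G Y "-1"] by simp

lemma ext_diff: "F \<in> fm Y ==> G \<in> fm Y ==> ext \<beta> (\<lambda>i. F i - G i) = (\<lambda>d. ext \<beta> F d - ext \<beta> G d)"
 using ext_add[of F Y "\<lambda>i. (-1) * G i" \<beta>] fm_scale[of G Y "-1"] ext_scale[of G Y \<beta> "-1"] by simp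

lemma fm_zero [simp]: "(\<lambda>_. 0) \<in> fm Y"
 by (simp add: fm_iff supp_def)

lemma ext_zero [simp]: "ext \<beta> (\<lambda>_. 0) = (\<lambda>_. 0)"
 by (simp add: ext_def supp_def)

lemma supp_basis: "supp (bv i :: _ => 'k::comm_ring_1) = {i}"
 by (auto simp: supp_def basis_vec_def)

lemma fm_basis [simp]: "(bv i :: _ => 'k::comm_ring_1) \<in> fm Y \<longleftrightarrow> i \<in> Y"
 by (simp add: fm_iff supp_basis)

lemma ext_basis [simp]: "ext \<beta> (bv i) = \<beta> i"
 by (simp add: ext_def supp_basis) (simp add: basis_vec_def)

lemma ext_sp: "(\<And>i. i \<in> Y ==> \<beta> i \<in> sp X) ==> F \<in> fm Y ==> ext \<beta> F \<in> sp X"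
 unfolding ext_def by (rule sum_sp, rule scale_sp) (auto simp: fm_iff)

lemma lin_ext_comp: "lin T ==> T (ext \<beta> F) = ext (\<lambda>i. T (\<beta> i)) F"
 unfolding ext_def by (rule lin_lincomb)

lemma ext_cong: "F \<in> fm Y ==> (\<And>i. i \<in> Y ==> \<beta> i = \<beta>' i) ==> ext \<beta> F = ext \<beta>' F"
 unfolding ext_def by (intro HOL.ext sum.cong) (auto simp: fm_iff)

lemma fm_expand: "F \<in> fm Y ==> F = ext bv F"
proof
 fix x assume F: "F \<in> fm Y"
 have "ext bv F x = (\<Sum>i\<in>supp F. if i = x then F x else 0)"
  unfolding ext_def by (intro sum.cong) (auto simp: basis_vec_def)
 also have "... = F x" using F by (auto simp: fm_iff supp_def)
 finally show "F x = ext bv F x" ..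
qed

lemma fm_induct [consumes 1, case_names zero add]:
 assumes F: "F \<in> fm Y" and zero: "P (\<lambda>_. 0)"
  and add: "\<And>G i c. G \<in> fm Y ==> i \<in> Y ==> P G ==> P (\<lambda>x. c * bv i x + G x)"
 shows "P F"
proof -
 have gen: "P (\<lambda>x. \<Sum>i\<in>S. F i * bv i x) & (\<lambda>x. \<Sum>i\<in>S. F i * bv i x) \<in> fm Y" if "finite S" "S \<subseteq> Y" for S
  using that
 proof (induction S rule: finite_induct)
  case (insert a S)
  then have IH: "P (\<lambda>x. \<Sum>i\<in>S. F i * bv i x)" "(\<lambda>x. \<Sum>i\<in>S. F i * bv i x) \<in> fm Y" by auto
  have "(\<lambda>x. F a * bv a x) \<in> fm Y" using insert by (intro fm_scale) simp
  from fm_add[OF this IH(2)] add[OF IH(2) _ IH(1), of a "F a"] show ?case using insert by simp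
 qed (simp add: zero)
 have "P (ext bv F)" unfolding ext_def using gen[of "supp F"] F by (simp add: fm_iff)
 then show ?thesis using fm_expand[OF F] by simp
qed

lemma push_eq_ext: "push \<phi> F = ext (\<lambda>i. bv (\<phi> i)) F" if "F \<in> fm Y"
proof
 fix y
 have "push \<phi> F y = (\<Sum>x\<in>{x \<in> supp F. \<phi> x = y}. F x)" by (simp add: push_def)
 also have "... = (\<Sum>x\<in>supp F. if \<phi> x = y then F x else 0)"
  using that by (intro sum.inter_filter) (simp add: fm_iff)
 also have "... = ext (\<lambda>i. bv (\<phi> i)) F y"
  unfolding ext_def by (intro sum.cong) (auto simp: basis_vec_def)
 finally show "push \<phi> F y = ext (\<lambda>i. bv (\<phi> i)) F y" .
qed

lemma push_fm: "F \<in> fm Y ==> (\<And>i. i \<in> Y ==> \<phi> i \<in> Z) ==> push \<phi> F \<in> fm Z"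
proof (induction F rule: fm_induct)
 case (add G i c)
 have "push \<phi> (\<lambda>x. c * bv i x + G x) = (\<lambda>x. c * bv (\<phi> i) x + push \<phi> G x)"
 proof -
  have s: "(\<lambda>x. c * bv i x) \<in> fm Y" using add by (intro fm_scale) simp
  have "push \<phi> (\<lambda>x. c * bv i x + G x) = ext (\<lambda>i. bv (\<phi> i)) (\<lambda>x. c * bv i x + G x)"
   by (rule push_eq_ext[OF fm_add[OF s add(1)]])
  also have "... = (\<lambda>x. c * bv (\<phi> i) x + push \<phi> G x)"
   unfolding ext_add[OF s add(1)] push_eq_ext[OF add(1)]
   using ext_scale[of "bv i" Y "\<lambda>i. bv (\<phi> i)" c] add by simp
  finally show ?thesis .
 qed
 then show ?case using add by (simp add: fm_add fm_scale)
qed (simp add: push_eq_ext[OF fm_zero])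

lemma ext_push:
 fixes F :: "'i => 'k::comm_ring_1"
 shows "F \<in> fm Y ==> ext \<beta> (push \<phi> F) = ext (\<lambda>i. \<beta> (\<phi> i)) F"
proof (induction F rule: fm_induct)
 case (add G i c)
 have s: "(\<lambda>x. c * bv i x) \<in> fm Y" using add by (intro fm_scale) simp
 have pG: "push \<phi> G \<in> fm UNIV" by (rule push_fm[OF add(1)]) simp
 have b: "(bv (\<phi> i) :: _ => 'k) \<in> fm UNIV" by simp
 have "push \<phi> (\<lambda>x. c * bv i x + G x) = (\<lambda>x. c * bv (\<phi> i) x + push \<phi> G x)"
  unfolding push_eq_ext[OF fm_add[OF s add(1)]] ext_add[OF s add(1)] push_eq_ext[OF add(1)]
  using ext_scale[of "bv i" Y "\<lambda>i. bv (\<phi> i)" c] add by simp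
 then have "ext \<beta> (push \<phi> (\<lambda>x. c * bv i x + G x)) = (\<lambda>d. c * \<beta> (\<phi> i) d + ext \<beta> (push \<phi> G) d)"
  by (simp add: ext_add[OF fm_scale[OF b] pG] ext_scale[OF b])
 also have "... = ext (\<lambda>i. \<beta> (\<phi> i)) (\<lambda>x. c * bv i x + G x)"
  unfolding ext_add[OF s add(1)] add(3)
  using ext_scale[of "bv i" Y "\<lambda>i. \<beta> (\<phi> i)" c] add by simp
 finally show ?case .
qed (simp add: push_eq_ext[OF fm_zero])

lemma push_lin:
 assumes "F \<in> fm Y" "G \<in> fm Y"
 shows "push \<phi> (\<lambda>i. F i + G i) = (\<lambda>j. push \<phi> F j + push \<phi> G j)"
  and "push \<phi> (\<lambda>i. F i - G i) = (\<lambda>j. push \<phi> F j - push \<phi> G j)"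
  and "push \<phi> (\<lambda>i. c * F i) = (\<lambda>j. c * push \<phi> F j)"
 unfolding push_eq_ext[OF fm_add[OF assms]] push_eq_ext[OF fm_diff[OF assms]] push_eq_ext[OF fm_scale[OF assms(1)]]
  push_eq_ext[OF assms(1)] push_eq_ext[OF assms(2)]
  ext_add[OF assms] ext_diff[OF assms] ext_scale[OF assms(1)] by (rule refl)+

lemma push_basis: "push \<phi> (bv i) = bv (\<phi> i)"
 using push_eq_ext[of "bv i" UNIV \<phi>] by simp

subsection \<open>Quotients of free modules\<close>

definition subspace_of :: "'i set => ('i => 'k::comm_ring_1) set => bool" where
 "subspace_of Y K \<longleftrightarrow> K \<subseteq> fm Y & (\<lambda>_. 0) \<in> K & (\<forall>F\<in>K. \<forall>G\<in>K. (\<lambda>i. F i + G i) \<in> K) & (\<forall>c. \<forall>F\<in>K. (\<lambda>i. c * F i) \<in> K)"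

lemma free_inv:
 fixes F :: "'i => 'k::comm_ring_1"
 assumes "F \<in> fm Y"
 shows "\<ominus>\<^bsub>free_module Y\<^esub> F = (\<lambda>i. - F i)"
proof -
 interpret Module.module ground_ring "free_module Y :: ('k, 'i => 'k) module" by (rule module_free)
 have "(\<lambda>i. - F i) \<in> fm Y" using fm_scale[OF assms, of "-1"] by simp
 then show ?thesis by (intro minus_equality[symmetric, THEN sym]) (use assms in simp_all)
qed

lemma submodule_iff:
 fixes K :: "('i => 'k::comm_ring_1) set"
 shows "submodule K (ground_ring :: 'k ring) (free_module Y) \<longleftrightarrow> subspace_of Y K"
proof
 interpret Module.module ground_ring "free_module Y :: ('k, 'i => 'k) module" by (rule module_free)
 {
  assume K: "submodule K (ground_ring :: 'k ring) (free_module Y)"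
  have add: "(\<lambda>i. F i + G i) \<in> K" if "F \<in> K" "G \<in> K" for F G using submoduleE(5)[OF K that] by simp
  have scale: "(\<lambda>i. c * F i) \<in> K" if "F \<in> K" for c F using submoduleE(4)[OF K _ that, of c] by simp
  obtain F where "F \<in> K" using submoduleE(2)[OF K] by blast
  then have "(\<lambda>_. 0) \<in> K" using scale[of F 0] by simp
  then show "subspace_of Y K" unfolding subspace_of_def using submoduleE(1)[OF K] add scale by blast
 }
 assume K: "subspace_of Y K"
 show "submodule K (ground_ring :: 'k ring) (free_module Y)"
 proof (rule submoduleI)
  fix F assume "F \<in> K"
  then have "(\<lambda>i. (-1) * F i) \<in> K" "F \<in> fm Y" using K unfolding subspace_of_def by blast+
  then show "\<ominus>\<^bsub>free_module Y\<^esub> F \<in> K" by (simp add: free_inv)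
 qed (use K in \<open>auto simp: subspace_of_def\<close>)
qed

lemma span_eq: "submodule_span (free_module Y) R = \<Inter>{K. subspace_of Y K & R \<subseteq> K}"
 by (simp add: submodule_span_def submodule_iff)

lemma subspace_fm: "subspace_of Y (fm Y)"
 by (auto simp: subspace_of_def fm_add fm_scale)

lemma subspace_span: "R \<subseteq> fm Y ==> subspace_of Y (submodule_span (free_module Y) R)"
 unfolding span_eq
proof -
 assume "R \<subseteq> fm Y"
 then have "\<Inter>{K. subspace_of Y K & R \<subseteq> K} \<subseteq> fm Y" using subspace_fm by blast
 then show "subspace_of Y (\<Inter>{K. subspace_of Y K & R \<subseteq> K})"
  unfolding subspace_of_def[of Y "\<Inter>{K. subspace_of Y K & R \<subseteq> K}"]
  by (auto simp: subspace_of_def)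
qed

lemma span_superset: "R \<subseteq> submodule_span (free_module Y) R"
 unfolding span_eq by blast

lemma span_minimal: "subspace_of Y K ==> R \<subseteq> K ==> submodule_span (free_module Y) R \<subseteq> K"
 unfolding span_eq by blast

definition cset :: "('i => 'k::comm_ring_1) set => ('i => 'k) => ('i => 'k) set" where
 "cset K F = (\<lambda>h i. h i + F i) ` K"

lemma coset_eq: "K +>\<^bsub>free_module Y\<^esub> F = cset K F"
 by (auto simp: a_r_coset_def r_coset_def cset_def)

locale free_quotient =
 fixes Y :: "'i set" and K :: "('i => 'k::comm_ring_1) set"
 assumes sub: "subspace_of Y K"
begin

lemma K_fm: "F \<in> K ==> F \<in> fm Y" and K_zero: "(\<lambda>_. 0) \<in> K"
 and K_add: "F \<in> K ==> G \<in> K ==> (\<lambda>i. F i + G i) \<in> K" and K_scale: "F \<in> K ==> (\<lambda>i. c * F i) \<in> K"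
 using sub unfolding subspace_of_def by blast+

lemma K_diff: "F \<in> K ==> G \<in> K ==> (\<lambda>i. F i - G i) \<in> K"
 using K_add[of F "\<lambda>i. (-1) * G i"] K_scale[of G "-1"] by simp

lemma cset_mem: "G \<in> cset K F \<longleftrightarrow> (\<lambda>i. G i - F i) \<in> K"
proof
 assume "(\<lambda>i. G i - F i) \<in> K"
 then have "(\<lambda>i. (G i - F i) + F i) \<in> cset K F" unfolding cset_def by (rule rev_image_eqI) simp
 then show "G \<in> cset K F" by simp
qed (auto simp: cset_def)

lemma cset_self: "F \<in> cset K F"
 unfolding cset_mem using K_zero by simp

lemma cset_eq_iff: "cset K F = cset K G \<longleftrightarrow> (\<lambda>i. F i - G i) \<in> K"
proof
 assume "cset K F = cset K G"
 then show "(\<lambda>i. F i - G i) \<in> K" using cset_self[of F] cset_mem by blast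
next
 assume FG: "(\<lambda>i. F i - G i) \<in> K"
 have "(\<lambda>i. H i - F i) \<in> K \<longleftrightarrow> (\<lambda>i. H i - G i) \<in> K" for H
  using K_add[of "\<lambda>i. H i - F i", OF _ FG] K_diff[of "\<lambda>i. H i - G i", OF _ FG] by auto
 then show "cset K F = cset K G" using cset_mem by blast
qed

lemma cset_fm: "F \<in> fm Y ==> G \<in> cset K F ==> G \<in> fm Y"
 unfolding cset_def using K_fm fm_add by blast

lemma quotient_carrier: "carrier (quotient_module (free_module Y) K) = cset K ` fm Y"
proof -
 have "a_rcosets\<^bsub>free_module Y\<^esub> K = (\<Union>F\<in>fm Y. {K +>\<^bsub>free_module Y\<^esub> F})"
  by (simp add: A_RCOSETS_def RCOSETS_def a_r_coset_def)
 then show ?thesis by (auto simp: quotient_module_def coset_eq)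
qed

lemma quotient_add: "cset K F +[quotient_module (free_module Y) K] cset K G = cset K (\<lambda>i. F i + G i)"
proof -
 have "cset K F +[quotient_module (free_module Y) K] cset K G = (\<Union>A\<in>cset K F. \<Union>B\<in>cset K G. {\<lambda>i. A i + B i})"
  by (simp add: quotient_module_def set_add_def set_mult_def)
 also have "... = cset K (\<lambda>i. F i + G i)"
 proof (intro equalityI subsetI)
  fix H assume "H \<in> (\<Union>A\<in>cset K F. \<Union>B\<in>cset K G. {\<lambda>i. A i + B i})"
  then obtain A B where "A \<in> cset K F" "B \<in> cset K G" "H = (\<lambda>i. A i + B i)" by blast
  then show "H \<in> cset K (\<lambda>i. F i + G i)"
   using K_add[of "\<lambda>i. A i - F i" "\<lambda>i. B i - G i"] unfolding cset_mem by (simp add: algebra_simps)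
 next
  fix H assume "H \<in> cset K (\<lambda>i. F i + G i)"
  then have "(\<lambda>i. H i - G i) \<in> cset K F" unfolding cset_mem by (simp add: algebra_simps)
  moreover have "H = (\<lambda>i. (H i - G i) + G i)" by simp
  ultimately show "H \<in> (\<Union>A\<in>cset K F. \<Union>B\<in>cset K G. {\<lambda>i. A i + B i})" using cset_self by blast
 qed
 finally show ?thesis .
qed

text \<open>Operations on cosets are unions over representatives; when all representatives give the
  same coset, the union is that coset.\<close>

lemma Union_cset_const: "(\<And>G. G \<in> cset K F ==> Q G = Z) ==> (\<Union>G\<in>cset K F. Q G) = Z"
 using cset_self[of F] by blast

lemma quotient_smult: "c *[quotient_module (free_module Y) K] cset K F = cset K (\<lambda>i. c * F i)"
proof -
 have "c *[quotient_module (free_module Y) K] cset K F = (\<Union>G\<in>cset K F. cset K (\<lambda>i. c * G i))"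
  by (simp add: quotient_module_def coset_eq)
 also have "... = cset K (\<lambda>i. c * F i)"
 proof (rule Union_cset_const)
  fix G assume "G \<in> cset K F"
  then show "cset K (\<lambda>i. c * G i) = cset K (\<lambda>i. c * F i)"
   using K_scale[of "\<lambda>i. G i - F i" c] unfolding cset_eq_iff cset_mem by (simp add: algebra_simps)
 qed
 finally show ?thesis .
qed

end

subsection \<open>Balanced maps\<close>

locale tensor = M: bimodule C D M + N: bimodule D E N
 for C :: "('o, 'a, 'k::comm_ring_1) lincat" and D :: "('p, 'b, 'k) lincat" and E :: "('q, 'c, 'k) lincat"
  and M :: "('o, 'a, 'p, 'b, 'k, 'm) bimod" and N :: "('p, 'b, 'q, 'c, 'k, 'n) bimod"
begin

abbreviation "Y \<equiv> tensor_symbols D M N"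
abbreviation "KT \<equiv> tensor_kernel D M N"
abbreviation "MN \<equiv> tensor_bimodule D M N"

lemma Y_iff: "(y, m, n) \<in> Y x z \<longleftrightarrow> y \<in> Obj D & m \<in> carrier (BMod M y z) & n \<in> carrier (BMod N x y)"
 by (simp add: tensor_symbols_def)

lemma M_add: "y \<in> Obj D ==> z \<in> Obj C ==> m \<in> carrier (BMod M y z) ==> m' \<in> carrier (BMod M y z) ==> m +[BMod M y z] m' \<in> carrier (BMod M y z)"
 and M_scale: "y \<in> Obj D ==> z \<in> Obj C ==> m \<in> carrier (BMod M y z) ==> c *[BMod M y z] m \<in> carrier (BMod M y z)"
proof -
 assume yz: "y \<in> Obj D" "z \<in> Obj C"
 interpret Module.module ground_ring "BMod M y z" by (rule M.BMod_module[OF yz])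
 show "m \<in> carrier (BMod M y z) ==> m' \<in> carrier (BMod M y z) ==> m +[BMod M y z] m' \<in> carrier (BMod M y z)"
  "m \<in> carrier (BMod M y z) ==> c *[BMod M y z] m \<in> carrier (BMod M y z)" by simp_all
qed

lemma N_add: "x \<in> Obj E ==> y \<in> Obj D ==> n \<in> carrier (BMod N x y) ==> n' \<in> carrier (BMod N x y) ==> n +[BMod N x y] n' \<in> carrier (BMod N x y)"
 and N_scale: "x \<in> Obj E ==> y \<in> Obj D ==> n \<in> carrier (BMod N x y) ==> c *[BMod N x y] n \<in> carrier (BMod N x y)"
proof -
 assume xy: "x \<in> Obj E" "y \<in> Obj D"
 interpret Module.module ground_ring "BMod N x y" by (rule N.BMod_module[OF xy])
 show "n \<in> carrier (BMod N x y) ==> n' \<in> carrier (BMod N x y) ==> n +[BMod N x y] n' \<in> carrier (BMod N x y)"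
  "n \<in> carrier (BMod N x y) ==> c *[BMod N x y] n \<in> carrier (BMod N x y)" by simp_all
qed

lemmas M_L = linear_mapsD[OF M.Lact_linear_right] and M_R = linear_mapsD[OF M.Ract_linear_left]
 and N_L = linear_mapsD[OF N.Lact_linear_right] and N_R = linear_mapsD[OF N.Ract_linear_left]

lemma relation_cases [consumes 1, case_names add_left add_right scale_left scale_right balanced]:
 assumes "F \<in> tensor_relations D M N x z"
  and "\<And>y m m' n. y \<in> Obj D ==> m \<in> carrier (BMod M y z) ==> m' \<in> carrier (BMod M y z) ==> n \<in> carrier (BMod N x y) ==>
   F = (\<lambda>i. bv (y, m +[BMod M y z] m', n) i - bv (y, m, n) i - bv (y, m', n) i) ==> P"
  and "\<And>y m n n'. y \<in> Obj D ==> m \<in> carrier (BMod M y z) ==> n \<in> carrier (BMod N x y) ==> n' \<in> carrier (BMod N x y) ==>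
   F = (\<lambda>i. bv (y, m, n +[BMod N x y] n') i - bv (y, m, n) i - bv (y, m, n') i) ==> P"
  and "\<And>y c m n. y \<in> Obj D ==> m \<in> carrier (BMod M y z) ==> n \<in> carrier (BMod N x y) ==>
   F = (\<lambda>i. bv (y, c *[BMod M y z] m, n) i - c * bv (y, m, n) i) ==> P"
  and "\<And>y c m n. y \<in> Obj D ==> m \<in> carrier (BMod M y z) ==> n \<in> carrier (BMod N x y) ==>
   F = (\<lambda>i. bv (y, m, c *[BMod N x y] n) i - c * bv (y, m, n) i) ==> P"
  and "\<And>y y' g m n. y \<in> Obj D ==> y' \<in> Obj D ==> g \<in> Arr D y y' ==> m \<in> carrier (BMod M y' z) ==> n \<in> carrier (BMod N x y) ==>
   F = (\<lambda>i. bv (y, Ract M y y' z m g, n) i - bv (y', m, Lact N x y y' g n) i) ==> P"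
 shows P
 using assms(1) unfolding tensor_relations_def Un_iff mem_Collect_eq
 by (elim disjE exE conjE)
  (rule assms(2), assumption+, rule assms(3), assumption+, rule assms(4), assumption+,
   rule assms(5), assumption+, rule assms(6), assumption+)

lemma relations_fm:
 assumes "x \<in> Obj E" "z \<in> Obj C"
 shows "tensor_relations D M N x z \<subseteq> fm (Y x z)"
proof
 fix F assume "F \<in> tensor_relations D M N x z"
 then show "F \<in> fm (Y x z)"
  by (cases rule: relation_cases)
   (use assms in \<open>auto intro!: fm_diff fm_scale simp: Y_iff M_add M_scale N_add N_scale M_R N_L\<close>)
qed

lemma quot: "x \<in> Obj E ==> z \<in> Obj C ==> free_quotient (Y x z) (KT x z)"
 unfolding tensor_kernel_def by (intro free_quotient.intro subspace_span relations_fm)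

lemma kernel_rel: "tensor_relations D M N x z \<subseteq> KT x z"
 unfolding tensor_kernel_def by (rule span_superset)

lemma K_add_left: "y \<in> Obj D ==> m \<in> carrier (BMod M y z) ==> m' \<in> carrier (BMod M y z) ==> n \<in> carrier (BMod N x y) ==>
   (\<lambda>i. bv (y, m +[BMod M y z] m', n) i - bv (y, m, n) i - bv (y, m', n) i) \<in> KT x z"
 and K_add_right: "y \<in> Obj D ==> m \<in> carrier (BMod M y z) ==> n \<in> carrier (BMod N x y) ==> n' \<in> carrier (BMod N x y) ==>
   (\<lambda>i. bv (y, m, n +[BMod N x y] n') i - bv (y, m, n) i - bv (y, m, n') i) \<in> KT x z"
 and K_scale_left: "y \<in> Obj D ==> m \<in> carrier (BMod M y z) ==> n \<in> carrier (BMod N x y) ==>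
   (\<lambda>i. bv (y, c *[BMod M y z] m, n) i - c * bv (y, m, n) i) \<in> KT x z"
 and K_scale_right: "y \<in> Obj D ==> m \<in> carrier (BMod M y z) ==> n \<in> carrier (BMod N x y) ==>
   (\<lambda>i. bv (y, m, c *[BMod N x y] n) i - c * bv (y, m, n) i) \<in> KT x z"
 and K_balanced: "y \<in> Obj D ==> y' \<in> Obj D ==> g \<in> Arr D y y' ==> m \<in> carrier (BMod M y' z) ==> n \<in> carrier (BMod N x y) ==>
   (\<lambda>i. bv (y, Ract M y y' z m g, n) i - bv (y', m, Lact N x y y' g n) i) \<in> KT x z"
proof -
 show "y \<in> Obj D ==> m \<in> carrier (BMod M y z) ==> m' \<in> carrier (BMod M y z) ==> n \<in> carrier (BMod N x y) ==>
   (\<lambda>i. bv (y, m +[BMod M y z] m', n) i - bv (y, m, n) i - bv (y, m', n) i) \<in> KT x z"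
  by (rule subsetD[OF kernel_rel], unfold tensor_relations_def, rule UnI1, rule UnI1, rule UnI1, rule UnI1,
   rule CollectI, intro exI conjI, rule refl, assumption+)
 show "y \<in> Obj D ==> m \<in> carrier (BMod M y z) ==> n \<in> carrier (BMod N x y) ==> n' \<in> carrier (BMod N x y) ==>
   (\<lambda>i. bv (y, m, n +[BMod N x y] n') i - bv (y, m, n) i - bv (y, m, n') i) \<in> KT x z"
  by (rule subsetD[OF kernel_rel], unfold tensor_relations_def, rule UnI1, rule UnI1, rule UnI1, rule UnI2,
   rule CollectI, intro exI conjI, rule refl, assumption+)
 show "y \<in> Obj D ==> m \<in> carrier (BMod M y z) ==> n \<in> carrier (BMod N x y) ==>
   (\<lambda>i. bv (y, c *[BMod M y z] m, n) i - c * bv (y, m, n) i) \<in> KT x z"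
  by (rule subsetD[OF kernel_rel], unfold tensor_relations_def, rule UnI1, rule UnI1, rule UnI2,
   rule CollectI, intro exI conjI, rule refl, assumption+)
 show "y \<in> Obj D ==> m \<in> carrier (BMod M y z) ==> n \<in> carrier (BMod N x y) ==>
   (\<lambda>i. bv (y, m, c *[BMod N x y] n) i - c * bv (y, m, n) i) \<in> KT x z"
  by (rule subsetD[OF kernel_rel], unfold tensor_relations_def, rule UnI1, rule UnI2,
   rule CollectI, intro exI conjI, rule refl, assumption+)
 show "y \<in> Obj D ==> y' \<in> Obj D ==> g \<in> Arr D y y' ==> m \<in> carrier (BMod M y' z) ==> n \<in> carrier (BMod N x y) ==>
   (\<lambda>i. bv (y, Ract M y y' z m g, n) i - bv (y', m, Lact N x y y' g n) i) \<in> KT x z"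
  by (rule subsetD[OF kernel_rel], unfold tensor_relations_def, rule UnI2,
   rule CollectI, intro exI conjI, rule refl, assumption+)
qed

lemma kernel_induct:
 assumes x: "x \<in> Obj E" and z: "z \<in> Obj C" and F: "F \<in> KT x z"
  and sub: "subspace_of (Y x z) {F \<in> fm (Y x z). Q F}" and rel: "\<And>F. F \<in> tensor_relations D M N x z ==> Q F"
 shows "Q F"
proof -
 have "KT x z \<subseteq> {F \<in> fm (Y x z). Q F}"
  unfolding tensor_kernel_def by (rule span_minimal[OF sub]) (use relations_fm[OF x z] rel in blast)
 then show ?thesis using F by blast
qed

text \<open>By linearity of the action each relation goes to a relation of the same kind; for the
  balancing relation the left and right actions on \<open>M\<close> have to commute.\<close>

lemma push_kernel_left:
 assumes x: "x \<in> Obj E" and z: "z \<in> Obj C" "z' \<in> Obj C" and g: "g \<in> Arr C z z'" and F: "F \<in> KT x z"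
 shows "push (\<lambda>(y, m, n). (y, Lact M y z z' g m, n)) F \<in> KT x z'"
proof (rule kernel_induct[OF x z(1) F])
 let ?\<phi> = "\<lambda>(y, m, n). (y, Lact M y z z' g m, n)"
 interpret q: free_quotient "Y x z'" "KT x z'" by (rule quot[OF x z(2)])
 show "subspace_of (Y x z) {F \<in> fm (Y x z). push ?\<phi> F \<in> KT x z'}"
  by (auto simp: subspace_of_def fm_add fm_scale push_lin[where Y = "Y x z"] q.K_add q.K_scale q.K_zero push_eq_ext[OF fm_zero])
 fix F assume F: "F \<in> tensor_relations D M N x z"
 have b: "(bv i :: _ => 'k) \<in> fm UNIV" for i :: "'p \<times> 'm \<times> 'n" by simp
 note pl = push_lin[of _ UNIV, OF fm_diff[OF b b] b] push_lin[of _ UNIV, OF b b] push_lin[of _ UNIV, OF b fm_scale[OF b]] push_basis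
 from F show "push ?\<phi> F \<in> KT x z'"
 proof (cases rule: relation_cases)
  case (add_left y m m' n)
  then show ?thesis unfolding add_left(5) pl using x z g by (simp add: M_L K_add_left)
 next
  case (add_right y m n n')
  then show ?thesis unfolding add_right(5) pl using x z g by (simp add: M_L K_add_right)
 next
  case (scale_left y c m n)
  then show ?thesis unfolding scale_left(4) pl using x z g by (simp add: M_L K_scale_left)
 next
  case (scale_right y c m n)
  then show ?thesis unfolding scale_right(4) pl using x z g by (simp add: M_L K_scale_right)
 next
  case (balanced y y' h m n)
  then show ?thesis unfolding balanced(6) pl using x z g
   by (simp add: M_L K_balanced M.Lact_Ract[symmetric])
 qed
qed

lemma push_kernel_right:
 assumes x: "x \<in> Obj E" "x' \<in> Obj E" and z: "z \<in> Obj C" and h: "h \<in> Arr E x' x" and F: "F \<in> KT x z"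
 shows "push (\<lambda>(y, m, n). (y, m, Ract N x' x y n h)) F \<in> KT x' z"
proof (rule kernel_induct[OF x(1) z F])
 let ?\<phi> = "\<lambda>(y, m, n). (y, m, Ract N x' x y n h)"
 interpret q: free_quotient "Y x' z" "KT x' z" by (rule quot[OF x(2) z])
 show "subspace_of (Y x z) {F \<in> fm (Y x z). push ?\<phi> F \<in> KT x' z}"
  by (auto simp: subspace_of_def fm_add fm_scale push_lin[where Y = "Y x z"] q.K_add q.K_scale q.K_zero push_eq_ext[OF fm_zero])
 fix F assume F: "F \<in> tensor_relations D M N x z"
 have b: "(bv i :: _ => 'k) \<in> fm UNIV" for i :: "'p \<times> 'm \<times> 'n" by simp
 note pl = push_lin[of _ UNIV, OF fm_diff[OF b b] b] push_lin[of _ UNIV, OF b b] push_lin[of _ UNIV, OF b fm_scale[OF b]] push_basis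
 from F show "push ?\<phi> F \<in> KT x' z"
 proof (cases rule: relation_cases)
  case (add_left y m m' n)
  then show ?thesis unfolding add_left(5) pl using x z h by (simp add: N_R K_add_left)
 next
  case (add_right y m n n')
  then show ?thesis unfolding add_right(5) pl using x z h by (simp add: N_R K_add_right)
 next
  case (scale_left y c m n)
  then show ?thesis unfolding scale_left(4) pl using x z h by (simp add: N_R K_scale_left)
 next
  case (scale_right y c m n)
  then show ?thesis unfolding scale_right(4) pl using x z h by (simp add: N_R K_scale_right)
 next
  case (balanced y y' g m n)
  then show ?thesis unfolding balanced(6) pl using x z h
   by (simp add: N_R K_balanced N.Lact_Ract)
 qed
qed

lemma T_carrier: "x \<in> Obj E ==> z \<in> Obj C ==> carrier (BMod MN x z) = cset (KT x z) ` fm (Y x z)"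
 using free_quotient.quotient_carrier[OF quot] by (simp add: tensor_bimodule_def)

lemma T_add: "x \<in> Obj E ==> z \<in> Obj C ==>
  cset (KT x z) F +[BMod MN x z] cset (KT x z) G = cset (KT x z) (\<lambda>i. F i + G i)"
 using free_quotient.quotient_add[OF quot] by (simp add: tensor_bimodule_def)

lemma T_smult: "x \<in> Obj E ==> z \<in> Obj C ==>
  c *[BMod MN x z] cset (KT x z) F = cset (KT x z) (\<lambda>i. c * F i)"
 using free_quotient.quotient_smult[OF quot] by (simp add: tensor_bimodule_def)

lemma T_Lact:
 assumes x: "x \<in> Obj E" and z: "z \<in> Obj C" "z' \<in> Obj C" and g: "g \<in> Arr C z z'" and F: "F \<in> fm (Y x z)"
 shows "Lact MN x z z' g (cset (KT x z) F) = cset (KT x z') (push (\<lambda>(y, m, n). (y, Lact M y z z' g m, n)) F)"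
proof -
 let ?\<phi> = "\<lambda>(y, m, n). (y, Lact M y z z' g m, n)"
 interpret q: free_quotient "Y x z" "KT x z" by (rule quot[OF x z(1)])
 interpret q': free_quotient "Y x z'" "KT x z'" by (rule quot[OF x z(2)])
 have "Lact MN x z z' g (cset (KT x z) F) = (\<Union>G\<in>cset (KT x z) F. cset (KT x z') (push ?\<phi> G))"
  by (simp add: tensor_bimodule_def coset_eq)
 also have "... = cset (KT x z') (push ?\<phi> F)"
 proof (rule q.Union_cset_const)
  fix G assume G: "G \<in> cset (KT x z) F"
  then have "push ?\<phi> (\<lambda>i. G i - F i) \<in> KT x z'"
   unfolding q.cset_mem by (rule push_kernel_left[OF x z g])
  then show "cset (KT x z') (push ?\<phi> G) = cset (KT x z') (push ?\<phi> F)"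
   unfolding q'.cset_eq_iff push_lin(2)[OF q.cset_fm[OF F G] F] .
 qed
 finally show ?thesis .
qed

lemma T_Ract:
 assumes x: "x \<in> Obj E" "x' \<in> Obj E" and z: "z \<in> Obj C" and h: "h \<in> Arr E x' x" and F: "F \<in> fm (Y x z)"
 shows "Ract MN x' x z (cset (KT x z) F) h = cset (KT x' z) (push (\<lambda>(y, m, n). (y, m, Ract N x' x y n h)) F)"
proof -
 let ?\<phi> = "\<lambda>(y, m, n). (y, m, Ract N x' x y n h)"
 interpret q: free_quotient "Y x z" "KT x z" by (rule quot[OF x(1) z])
 interpret q': free_quotient "Y x' z" "KT x' z" by (rule quot[OF x(2) z])
 have "Ract MN x' x z (cset (KT x z) F) h = (\<Union>G\<in>cset (KT x z) F. cset (KT x' z) (push ?\<phi> G))"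
  by (simp add: tensor_bimodule_def coset_eq)
 also have "... = cset (KT x' z) (push ?\<phi> F)"
 proof (rule q.Union_cset_const)
  fix G assume G: "G \<in> cset (KT x z) F"
  then have "push ?\<phi> (\<lambda>i. G i - F i) \<in> KT x' z"
   unfolding q.cset_mem by (rule push_kernel_right[OF x z h])
  then show "cset (KT x' z) (push ?\<phi> G) = cset (KT x' z) (push ?\<phi> F)"
   unfolding q'.cset_eq_iff push_lin(2)[OF q.cset_fm[OF F G] F] .
 qed
 finally show ?thesis .
qed

text \<open>The values are functions into \<open>'k\<close>, since all modules mapped into are free
  on diagrams.\<close>

definition balanced :: "'q => 'o => ('p \<times> 'm \<times> 'n => 'd => 'k) => bool" where
 "balanced x z \<beta> \<longleftrightarrow>
   (\<forall>y m m' n. y \<in> Obj D & m \<in> carrier (BMod M y z) & m' \<in> carrier (BMod M y z) & n \<in> carrier (BMod N x y) -->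
    \<beta> (y, m +[BMod M y z] m', n) = (\<lambda>d. \<beta> (y, m, n) d + \<beta> (y, m', n) d)) &
   (\<forall>y m n n'. y \<in> Obj D & m \<in> carrier (BMod M y z) & n \<in> carrier (BMod N x y) & n' \<in> carrier (BMod N x y) -->
    \<beta> (y, m, n +[BMod N x y] n') = (\<lambda>d. \<beta> (y, m, n) d + \<beta> (y, m, n') d)) &
   (\<forall>y c m n. y \<in> Obj D & m \<in> carrier (BMod M y z) & n \<in> carrier (BMod N x y) -->
    \<beta> (y, c *[BMod M y z] m, n) = (\<lambda>d. c * \<beta> (y, m, n) d)) &
   (\<forall>y c m n. y \<in> Obj D & m \<in> carrier (BMod M y z) & n \<in> carrier (BMod N x y) -->
    \<beta> (y, m, c *[BMod N x y] n) = (\<lambda>d. c * \<beta> (y, m, n) d)) &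
   (\<forall>y y' g m n. y \<in> Obj D & y' \<in> Obj D & g \<in> Arr D y y' & m \<in> carrier (BMod M y' z) & n \<in> carrier (BMod N x y) -->
    \<beta> (y, Ract M y y' z m g, n) = \<beta> (y', m, Lact N x y y' g n))"

lemma ext_kernel:
 assumes x: "x \<in> Obj E" and z: "z \<in> Obj C" and \<beta>: "balanced x z \<beta>" and F: "F \<in> KT x z"
 shows "ext \<beta> F = (\<lambda>_. 0)"
proof (rule kernel_induct[OF x z F])
 show "subspace_of (Y x z) {F \<in> fm (Y x z). ext \<beta> F = (\<lambda>_. 0)}"
  by (auto simp: subspace_of_def fm_add fm_scale ext_add[where Y = "Y x z"] ext_scale[where Y = "Y x z"])
 fix F assume F: "F \<in> tensor_relations D M N x z"
 have b: "(bv i :: _ => 'k) \<in> fm UNIV" for i :: "'p \<times> 'm \<times> 'n" by simp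
 note el = ext_diff[of _ UNIV, OF fm_diff[OF b b] b] ext_diff[of _ UNIV, OF b b] ext_diff[of _ UNIV, OF b fm_scale[OF b]]
  ext_scale[of _ UNIV, OF b] ext_basis
 from F show "ext \<beta> F = (\<lambda>_. 0)"
 proof (cases rule: relation_cases)
  case (add_left y m m' n)
  then have "\<beta> (y, m +[BMod M y z] m', n) = (\<lambda>d. \<beta> (y, m, n) d + \<beta> (y, m', n) d)"
   using \<beta> unfolding balanced_def by simp
  then show ?thesis unfolding add_left(5) el by simp
 next
  case (add_right y m n n')
  then have "\<beta> (y, m, n +[BMod N x y] n') = (\<lambda>d. \<beta> (y, m, n) d + \<beta> (y, m, n') d)"
   using \<beta> unfolding balanced_def by simp
  then show ?thesis unfolding add_right(5) el by simp
 next
  case (scale_left y c m n)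
  then have "\<beta> (y, c *[BMod M y z] m, n) = (\<lambda>d. c * \<beta> (y, m, n) d)"
   using \<beta> unfolding balanced_def by simp
  then show ?thesis unfolding scale_left(4) el by simp
 next
  case (scale_right y c m n)
  then have "\<beta> (y, m, c *[BMod N x y] n) = (\<lambda>d. c * \<beta> (y, m, n) d)"
   using \<beta> unfolding balanced_def by simp
  then show ?thesis unfolding scale_right(4) el by simp
 next
  case (balanced y y' g m n)
  then have "\<beta> (y, Ract M y y' z m g, n) = \<beta> (y', m, Lact N x y y' g n)"
   using \<beta> unfolding balanced_def by simp
  then show ?thesis unfolding balanced(6) el by simp
 qed
qed

text \<open>Cosets are bare sets, so a representative is chosen; the choice is harmless for balanced
  maps by \<open>ext_kernel\<close>.\<close>

definition desc :: "('p \<times> 'm \<times> 'n => 'd => 'k) => ('p \<times> 'm \<times> 'n => 'k) set => 'd => 'k" where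
 "desc \<beta> A = ext \<beta> (SOME F. F \<in> A)"

lemma desc_cset:
 assumes x: "x \<in> Obj E" and z: "z \<in> Obj C" and \<beta>: "balanced x z \<beta>" and F: "F \<in> fm (Y x z)"
 shows "desc \<beta> (cset (KT x z) F) = ext \<beta> F"
proof -
 interpret q: free_quotient "Y x z" "KT x z" by (rule quot[OF x z])
 let ?G = "SOME G. G \<in> cset (KT x z) F"
 have G: "?G \<in> cset (KT x z) F" by (rule someI[where P = "\<lambda>G. G \<in> cset (KT x z) F", OF q.cset_self])
 have "ext \<beta> (\<lambda>i. ?G i - F i) = (\<lambda>_. 0)"
  using G unfolding q.cset_mem by (rule ext_kernel[OF x z \<beta>])
 then have "(\<lambda>d. ext \<beta> ?G d - ext \<beta> F d) = (\<lambda>_. 0)"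
  unfolding ext_diff[OF q.cset_fm[OF F G] F] .
 then show ?thesis unfolding desc_def by (rule diff_zero_eq)
qed

text \<open>\<open>\<Theta>\<close> turns each value into a combination of symbols and is linear
  only modulo the kernel. Since it undoes \<open>\<beta>\<close> on symbols modulo the kernel, every
  class is that of \<open>\<Theta>\<close> applied to its value, which gives injectivity;
  surjectivity is \<open>\<beta>\<Theta>\<close>.\<close>

lemma tensor_isomorphic:
 fixes R :: "('o, 'a, 'q, 'c, 'k, 'd => 'k) bimod"
 assumes bal: "\<And>x z. x \<in> Obj E ==> z \<in> Obj C ==> balanced x z (\<beta> x z)"
  and R: "\<And>x z. x \<in> Obj E ==> z \<in> Obj C ==> BMod R x z = free_module (X x z)" and fin: "\<And>x z. finite (X x z)"
  and \<beta>sp: "\<And>x z i. x \<in> Obj E ==> z \<in> Obj C ==> i \<in> Y x z ==> \<beta> x z i \<in> sp (X x z)"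
  and linL: "\<And>x z z' g. lin (Lact R x z z' g)" and linR: "\<And>x x' z h. lin (\<lambda>m. Ract R x' x z m h)"
  and eqL: "\<And>x z z' g y m n. x \<in> Obj E ==> z \<in> Obj C ==> z' \<in> Obj C ==> g \<in> Arr C z z' ==> (y, m, n) \<in> Y x z ==>
   \<beta> x z' (y, Lact M y z z' g m, n) = Lact R x z z' g (\<beta> x z (y, m, n))"
  and eqR: "\<And>x x' z h y m n. x \<in> Obj E ==> x' \<in> Obj E ==> z \<in> Obj C ==> h \<in> Arr E x' x ==> (y, m, n) \<in> Y x z ==>
   \<beta> x' z (y, m, Ract N x' x y n h) = Ract R x' x z (\<beta> x z (y, m, n)) h"
  and \<Theta>fm: "\<And>x z v. x \<in> Obj E ==> z \<in> Obj C ==> v \<in> sp (X x z) ==> \<Theta> x z v \<in> fm (Y x z)"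
  and \<Theta>lin: "\<And>x z v w c. x \<in> Obj E ==> z \<in> Obj C ==> v \<in> sp (X x z) ==> w \<in> sp (X x z) ==>
   (\<lambda>i. \<Theta> x z (\<lambda>d. c * v d + w d) i - (c * \<Theta> x z v i + \<Theta> x z w i)) \<in> KT x z"
  and \<Theta>0: "\<And>x z. x \<in> Obj E ==> z \<in> Obj C ==> \<Theta> x z (\<lambda>_. 0) \<in> KT x z"
  and \<Theta>\<beta>: "\<And>x z i. x \<in> Obj E ==> z \<in> Obj C ==> i \<in> Y x z ==> (\<lambda>j. bv i j - \<Theta> x z (\<beta> x z i) j) \<in> KT x z"
  and \<beta>\<Theta>: "\<And>x z v. x \<in> Obj E ==> z \<in> Obj C ==> v \<in> sp (X x z) ==> ext (\<beta> x z) (\<Theta> x z v) = v"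
 shows "bimodule_isomorphic C E MN R"
proof -
 let ?\<Phi> = "\<lambda>x z. desc (\<beta> x z)"
 have \<Phi>: "?\<Phi> x z (cset (KT x z) F) = ext (\<beta> x z) F" if "x \<in> Obj E" "z \<in> Obj C" "F \<in> fm (Y x z)" for x z F
  by (rule desc_cset[OF that(1,2) bal[OF that(1,2)] that(3)])
 have bij: "?\<Phi> x z \<in> linear_maps (BMod MN x z) (BMod R x z) &
   bij_betw (?\<Phi> x z) (carrier (BMod MN x z)) (carrier (BMod R x z))" if x: "x \<in> Obj E" and z: "z \<in> Obj C" for x z
 proof
  interpret q: free_quotient "Y x z" "KT x z" by (rule quot[OF x z])
  have esp: "ext (\<beta> x z) F \<in> sp (X x z)" if "F \<in> fm (Y x z)" for F
   by (rule ext_sp[OF \<beta>sp[OF x z] that])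
  show "?\<Phi> x z \<in> linear_maps (BMod MN x z) (BMod R x z)"
   by (rule linear_mapsI)
    (use x z in \<open>auto simp: T_carrier T_add T_smult \<Phi> R carrier_free fin esp fm_add fm_scale
     ext_add[where Y = "Y x z"] ext_scale[where Y = "Y x z"]\<close>)
  \<comment> \<open>The normal form known for symbols extends to their combinations, the defects of
    linearity of \<open>\<Theta>\<close> lying in the kernel.\<close>
  have norm: "(\<lambda>j. F j - \<Theta> x z (ext (\<beta> x z) F) j) \<in> KT x z" if "F \<in> fm (Y x z)" for F
   using that
  proof (induction F rule: fm_induct)
   case zero
   then show ?case using q.K_scale[OF \<Theta>0[OF x z], of "-1"] by simp
  next
   case (add G i c)
   have bi: "(bv i :: _ => 'k) \<in> fm (Y x z)" using add by simp
   have e: "ext (\<beta> x z) (\<lambda>j. c * bv i j + G j) = (\<lambda>d. c * \<beta> x z i d + ext (\<beta> x z) G d)"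
    by (simp add: ext_add[OF fm_scale[OF bi] add(1)] ext_scale[OF bi])
   have 1: "(\<lambda>j. c * (bv i j - \<Theta> x z (\<beta> x z i) j)) \<in> KT x z"
    by (rule q.K_scale[OF \<Theta>\<beta>[OF x z add(2)]])
   have 2: "(\<lambda>j. \<Theta> x z (\<lambda>d. c * \<beta> x z i d + ext (\<beta> x z) G d) j
     - (c * \<Theta> x z (\<beta> x z i) j + \<Theta> x z (ext (\<beta> x z) G) j)) \<in> KT x z"
    by (rule \<Theta>lin[OF x z \<beta>sp[OF x z add(2)] esp[OF add(1)]])
   from q.K_diff[OF q.K_add[OF 1 add(3)] 2] show ?case unfolding e by (simp add: algebra_simps)
  qed
  show "bij_betw (?\<Phi> x z) (carrier (BMod MN x z)) (carrier (BMod R x z))"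
  proof (rule bij_betw_imageI)
   show "inj_on (?\<Phi> x z) (carrier (BMod MN x z))"
   proof (rule inj_onI)
    fix A B assume A: "A \<in> carrier (BMod MN x z)" and B: "B \<in> carrier (BMod MN x z)" and eq: "?\<Phi> x z A = ?\<Phi> x z B"
    obtain F where F: "F \<in> fm (Y x z)" "A = cset (KT x z) F" using A x z by (auto simp: T_carrier)
    obtain G where G: "G \<in> fm (Y x z)" "B = cset (KT x z) G" using B x z by (auto simp: T_carrier)
    have "ext (\<beta> x z) F = ext (\<beta> x z) G" using eq F G \<Phi>[OF x z] by simp
    then have "(\<lambda>j. F j - G j) \<in> KT x z" using q.K_diff[OF norm[OF F(1)] norm[OF G(1)]] by simp
    then show "A = B" unfolding F(2) G(2) q.cset_eq_iff .
   qed
   show "?\<Phi> x z ` carrier (BMod MN x z) = carrier (BMod R x z)"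
   proof (intro equalityI subsetI)
    fix v assume "v \<in> ?\<Phi> x z ` carrier (BMod MN x z)"
    then show "v \<in> carrier (BMod R x z)" using x z \<Phi> esp by (auto simp: T_carrier R carrier_free fin)
   next
    fix v assume "v \<in> carrier (BMod R x z)"
    then have v: "v \<in> sp (X x z)" using x z by (simp add: R carrier_free fin)
    have "v = ?\<Phi> x z (cset (KT x z) (\<Theta> x z v))" using \<Phi>[OF x z \<Theta>fm[OF x z v]] \<beta>\<Theta>[OF x z v] by simp
    moreover have "cset (KT x z) (\<Theta> x z v) \<in> carrier (BMod MN x z)"
     using \<Theta>fm[OF x z v] x z by (simp add: T_carrier)
    ultimately show "v \<in> ?\<Phi> x z ` carrier (BMod MN x z)" by (rule image_eqI)
   qed
  qed
 qed
 have L: "?\<Phi> x z' (Lact MN x z z' g A) = Lact R x z z' g (?\<Phi> x z A)"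
  if x: "x \<in> Obj E" and z: "z \<in> Obj C" "z' \<in> Obj C" and g: "g \<in> Arr C z z'" and A: "A \<in> carrier (BMod MN x z)" for x z z' g A
 proof -
  obtain F where F: "F \<in> fm (Y x z)" "A = cset (KT x z) F" using A x z by (auto simp: T_carrier)
  let ?\<phi> = "\<lambda>(y, m, n). (y, Lact M y z z' g m, n)"
  have p: "push ?\<phi> F \<in> fm (Y x z')"
   by (rule push_fm[OF F(1)]) (use x z g in \<open>auto simp: Y_iff M_L\<close>)
  have "?\<Phi> x z' (Lact MN x z z' g A) = ext (\<lambda>i. \<beta> x z' (?\<phi> i)) F"
   unfolding F(2) T_Lact[OF x z g F(1)] \<Phi>[OF x z(2) p] by (rule ext_push[OF F(1)])
  also have "... = ext (\<lambda>i. Lact R x z z' g (\<beta> x z i)) F"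
   by (rule ext_cong[OF F(1)]) (auto simp: eqL[OF x z g])
  also have "... = Lact R x z z' g (?\<Phi> x z A)"
   unfolding F(2) \<Phi>[OF x z(1) F(1)] by (rule lin_ext_comp[OF linL, symmetric])
  finally show ?thesis .
 qed
 have R': "?\<Phi> x' z (Ract MN x' x z A h) = Ract R x' x z (?\<Phi> x z A) h"
  if x: "x \<in> Obj E" "x' \<in> Obj E" and z: "z \<in> Obj C" and h: "h \<in> Arr E x' x" and A: "A \<in> carrier (BMod MN x z)" for x x' z h A
 proof -
  obtain F where F: "F \<in> fm (Y x z)" "A = cset (KT x z) F" using A x z by (auto simp: T_carrier)
  let ?\<phi> = "\<lambda>(y, m, n). (y, m, Ract N x' x y n h)"
  have p: "push ?\<phi> F \<in> fm (Y x' z)"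
   by (rule push_fm[OF F(1)]) (use x z h in \<open>auto simp: Y_iff N_R\<close>)
  have "?\<Phi> x' z (Ract MN x' x z A h) = ext (\<lambda>i. \<beta> x' z (?\<phi> i)) F"
   unfolding F(2) T_Ract[OF x z h F(1)] \<Phi>[OF x(2) z p] by (rule ext_push[OF F(1)])
  also have "... = ext (\<lambda>i. Ract R x' x z (\<beta> x z i) h) F"
   by (rule ext_cong[OF F(1)]) (auto simp: eqR[OF x z h])
  also have "... = Ract R x' x z (?\<Phi> x z A) h"
   unfolding F(2) \<Phi>[OF x(1) z F(1)] by (rule lin_ext_comp[OF linR, symmetric])
  finally show ?thesis .
 qed
 show ?thesis
  unfolding bimodule_isomorphic_def
  by (rule exI[of _ ?\<Phi>]) (intro conjI ballI bij L R')
qed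

end

section \<open>The bimodule condition\<close>

context tensor
begin

lemma K_sum:
 assumes x: "x \<in> Obj E" and z: "z \<in> Obj C" and F: "\<And>i. i \<in> I ==> F i \<in> KT x z"
 shows "(\<lambda>j. \<Sum>i\<in>I. F i j) \<in> KT x z"
proof -
 interpret q: free_quotient "Y x z" "KT x z" by (rule quot[OF x z])
 show ?thesis using F by (induction I rule: infinite_finite_induct) (simp_all add: q.K_zero q.K_add)
qed

lemma K_zero_left:
 assumes "y \<in> Obj D" "m \<in> carrier (BMod M y z)" "n \<in> carrier (BMod N x y)"
 shows "bv (y, 0 *[BMod M y z] m, n) \<in> KT x z"
 using K_scale_left[OF assms, of 0] by simp

lemma K_zero_right:
 assumes "y \<in> Obj D" "m \<in> carrier (BMod M y z)" "n \<in> carrier (BMod N x y)"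
 shows "bv (y, m, 0 *[BMod N x y] n) \<in> KT x z"
 using K_scale_right[OF assms, of 0] by simp

end

lemma fm_sum: "(\<And>i. i \<in> I ==> F i \<in> fm Y) ==> (\<lambda>j. \<Sum>i\<in>I. F i j) \<in> fm Y"
 by (induction I rule: infinite_finite_induct) (simp_all add: fm_add)

lemma ext_sum: "(\<And>i. i \<in> I ==> F i \<in> fm Y) ==> ext \<beta> (\<lambda>j. \<Sum>i\<in>I. F i j) = (\<lambda>d. \<Sum>i\<in>I. ext \<beta> (F i) d)"
proof (induction I rule: infinite_finite_induct)
 case (insert a I)
 then show ?case by (simp add: ext_add[where Y = Y] fm_sum)
qed simp_all

abbreviation Bt :: "nat => 'k::comm_ring_1 => (nat, diagram => 'k, 'k) lincat" where
 "Bt r dl \<equiv> truncate r (brauer_category dl)"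

abbreviation St :: "nat => 'k::comm_ring_1 => (nat, diagram => 'k, 'k) lincat" where
 "St r dl \<equiv> truncate r (symmetric_category dl)"

lemma regular_simps [simp]: "BMod (regular_bimodule C) = Hom C"
 "Lact (regular_bimodule C) = (\<lambda>x y y' g m. Comp C x y y' g m)"
 "Ract (regular_bimodule C) = (\<lambda>x' x y m h. Comp C x' x y m h)"
 by (simp_all add: regular_bimodule_def)

lemma tensor_up_down: "tensor (Bt r dl) (St r dl) (Bt r dl) (up_bimodule dl) (down_bimodule dl)"
 by (intro tensor.intro bimodule_up bimodule_down)

lemma tensor_down_up: "tensor (St r dl) (Bt r dl) (St r dl) (down_bimodule dl) (up_bimodule dl)"
 by (intro tensor.intro bimodule_up bimodule_down)

text \<open>Every \<open>m \<otimes> n\<close> in \<open>B\<^sup>- \<otimes> B\<^sup>+\<close> equals \<open>m n \<otimes> 1 = 1 \<otimes> m n\<close>, in which only the level part of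
 \<open>m n\<close> survives.\<close>

lemma down_up_isomorphic:
 fixes dl :: "'k::comm_ring_1"
 shows "bimodule_isomorphic (St r dl) (St r dl) (tensor_bimodule (Bt r dl) (down_bimodule dl) (up_bimodule dl))
   (regular_bimodule (St r dl))"
proof -
 interpret tensor "St r dl" "Bt r dl" "St r dl" "down_bimodule dl" "up_bimodule dl" by (rule tensor_down_up)
 define \<beta> where "\<beta> x z = (\<lambda>(y, m, n). pr dl x y z m n)" for x z
 define \<Theta> where "\<Theta> x z v =
  (bv (x, v, bv (id_diagram x)) :: nat \<times> (diagram => 'k) \<times> (diagram => 'k) => 'k)" for x z :: nat and v
 have Yi: "(y, m, n) \<in> Y x z \<longleftrightarrow> y \<preceq> r & m \<in> sp (Dn y z) & n \<in> sp (Up x y)" for x y z m n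
  by (simp add: Y_iff carrier_free)
 have idup: "bv (id_diagram x) \<in> sp (Up x x)" and iddn: "bv (id_diagram x) \<in> sp (Dn x x)" for x
  by simp_all
 have idn: "\<And>n. n \<in> sp (Up x y) ==> pu x y (bcomp dl x x y n (bv (id_diagram x))) = n" for x y
  by (simp add: bcomp_id_right sp_up project_sp)
 \<comment> \<open>\<open>n\<close>, regarded as an arrow of \<open>B\<close> acting on the identity
   diagram, is moved across the tensor sign.\<close>
 have eq1: "(\<lambda>i. bv (y, m, n) i - bv (x, pd x z (bcomp dl x y z m n), bv (id_diagram x)) i) \<in> KT x z"
  if "x \<preceq> r" "z \<preceq> r" "(y, m, n) \<in> Y x z" for x y z m n
 proof -
  interpret q: free_quotient "Y x z" "KT x z" using that by (intro quot) simp_all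
  have "(\<lambda>i. bv (x, pd x z (bcomp dl x y z m n), bv (id_diagram x)) i - bv (y, m, n) i) \<in> KT x z"
   using K_balanced[of x y n m z "bv (id_diagram x)" x] that idn[of n x y] by (simp add: Yi carrier_free sp_up)
  from q.K_scale[OF this, of "-1"] show ?thesis by simp
 qed
 have eq2: "(\<lambda>i. bv (x, w, bv (id_diagram x)) i - bv (z, bv (id_diagram z), pu x z w) i) \<in> KT x z"
  if "x \<preceq> r" "z \<preceq> r" "w \<in> sp (Dn x z)" for x z w
  using K_balanced[of x z w "bv (id_diagram z)" z "bv (id_diagram x)" x] that
  by (simp add: carrier_free sp_down bcomp_id_left bcomp_id_right project_sp)
 show ?thesis
 proof (rule tensor_isomorphic[where \<beta> = \<beta> and X = Lv and \<Theta> = \<Theta>])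
  fix x z assume x: "x \<in> Obj (St r dl)" and z: "z \<in> Obj (St r dl)"
  then have xr: "x \<preceq> r" and zr: "z \<preceq> r" by simp_all
  interpret q: free_quotient "Y x z" "KT x z" by (rule quot[OF x z])
  show "balanced x z (\<beta> x z)"
   unfolding balanced_def \<beta>_def
   by (auto simp: carrier_free lin_add[OF lin_project'[OF lin_bcomp_left]] lin_add[OF lin_project'[OF lin_bcomp_right]]
    lin_scale[OF lin_project'[OF lin_bcomp_left]] lin_scale[OF lin_project'[OF lin_bcomp_right]]
    lin_add[OF lin_project] bcomp_add_left bcomp_add_right bcomp_scale_left bcomp_scale_right project_scale
    Lv_absorb_left Lv_absorb_right bcomp_assoc sp_up sp_down)
  show "\<beta> x z i \<in> sp (Lv x z)" for i by (cases i) (simp add: \<beta>_def)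
  show "\<Theta> x z v \<in> fm (Y x z)" if "v \<in> sp (Lv x z)" for v
   using that xr by (simp add: \<Theta>_def Yi sp_Lv_down)
  show "(\<lambda>i. \<Theta> x z (\<lambda>d. c * v d + w d) i - (c * \<Theta> x z v i + \<Theta> x z w i)) \<in> KT x z"
   if v: "v \<in> sp (Lv x z)" and w: "w \<in> sp (Lv x z)" for v w c
  proof -
   have 1: "(\<lambda>i. \<Theta> x z (\<lambda>d. c * v d + w d) i - \<Theta> x z (\<lambda>d. c * v d) i - \<Theta> x z w i) \<in> KT x z"
    using K_add_left[of x "\<lambda>d. c * v d" z w "bv (id_diagram x)" x] v w xr
    by (simp add: \<Theta>_def carrier_free sp_Lv_down scale_sp)
   have 2: "(\<lambda>i. \<Theta> x z (\<lambda>d. c * v d) i - c * \<Theta> x z v i) \<in> KT x z"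
    using K_scale_left[of x v z "bv (id_diagram x)" x c] v xr
    by (simp add: \<Theta>_def carrier_free sp_Lv_down)
   from q.K_add[OF 1 2] show ?thesis by (simp add: algebra_simps)
  qed
  show "\<Theta> x z (\<lambda>_. 0) \<in> KT x z"
   using K_zero_left[of x "\<lambda>_. 0" z "bv (id_diagram x)" x] xr by (simp add: \<Theta>_def carrier_free)
  show "(\<lambda>j. bv i j - \<Theta> x z (\<beta> x z i) j) \<in> KT x z" if i: "i \<in> Y x z" for i
  proof -
   obtain y m n where i_eq: "i = (y, m, n)" by (cases i)
   define w where "w = pd x z (bcomp dl x y z m n)"
   define w' where "w' = \<beta> x z i"
   \<comment> \<open>\<open>w\<close> and its level part \<open>w'\<close> have the same upward
     projection, so \<open>w \<otimes> 1\<close> and \<open>w' \<otimes> 1\<close> are both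
     congruent to \<open>1 \<otimes> w'\<close>.\<close>
   have ww: "pu x z w = w'" "pu x z w' = w'"
    unfolding w_def w'_def \<beta>_def i_eq by (simp_all add: project_project Lv_def Int_ac)
   have wd: "w \<in> sp (Dn x z)" "w' \<in> sp (Dn x z)"
    unfolding w_def w'_def \<beta>_def i_eq by (simp_all add: sp_Lv_down)
   note 1 = eq1[OF xr zr i[unfolded i_eq], folded w_def i_eq]
   note 2 = eq2[OF xr zr wd(1), unfolded ww] and 3 = eq2[OF xr zr wd(2), unfolded ww]
   from q.K_add[OF 1 q.K_diff[OF 2 3]] show ?thesis by (simp add: \<Theta>_def w'_def)
  qed
  show "ext (\<beta> x z) (\<Theta> x z v) = v" if "v \<in> sp (Lv x z)" for v
   using that by (simp add: \<Theta>_def \<beta>_def bcomp_id_right sp_Lv project_sp)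
 next
  fix x z z' g y m n
  assume "z \<in> Obj (St r dl)" "z' \<in> Obj (St r dl)" "g \<in> Arr (St r dl) z z'" "(y, m, n) \<in> Y x z"
  then show "\<beta> x z' (y, Lact (down_bimodule dl) y z z' g m, n) = Lact (regular_bimodule (St r dl)) x z z' g (\<beta> x z (y, m, n))"
   by (simp add: \<beta>_def Yi carrier_free Lv_pr_left sp_up sp_down)
 next
  fix x x' z h y m n
  assume "x \<in> Obj (St r dl)" "x' \<in> Obj (St r dl)" "h \<in> Arr (St r dl) x' x" "(y, m, n) \<in> Y x z"
  then show "\<beta> x' z (y, m, Ract (up_bimodule dl) x' x y n h) = Ract (regular_bimodule (St r dl)) x' x z (\<beta> x z (y, m, n)) h"
   by (simp add: \<beta>_def Yi carrier_free Lv_pr_right sp_up sp_down)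
 qed (auto simp: lin_bcomp_left lin_bcomp_right)
qed

context non_singular
begin

text \<open>The map is \<open>m \<otimes> n -> m e_y n\<close>. The inserted \<open>e_y\<close>
  absorbs what the truncated actions discard, by \<open>eu_kills_nonup\<close> on the left and
  \<open>eu_kills_nondown\<close> on the right, and \<open>eu_central\<close> makes the map
  balanced. Its inverse comes from \<open>id_resolution\<close>: \<open>v\<close> goes to the sum of
  the dual elements, each tensored with the downward part of \<open>flip h\<close> composed with
  \<open>v\<close>.\<close>

lemma up_down_isomorphic:
 "bimodule_isomorphic (Bt r dl) (Bt r dl) (tensor_bimodule (St r dl) (up_bimodule dl) (down_bimodule dl))
   (regular_bimodule (Bt r dl))"
proof -
 interpret tensor "Bt r dl" "St r dl" "Bt r dl" "up_bimodule dl" "down_bimodule dl" by (rule tensor_up_down)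
 define \<beta> where "\<beta> x z = (\<lambda>(y, m, n). bcomp dl x y z m (bcomp dl x y y (eu y) n))" for x z
 define c where "c x z s h v = pd x s (bcomp dl x z s (bv (flip h)) v)" for x z s h v
 define \<Theta> where "\<Theta> x z v = (\<lambda>i. \<Sum>s | s \<preceq> z. \<Sum>h\<in>Um s z.
  bv (s, dual s z h, c x z s h v) i :: 'k)" for x z v
 have Yi: "(y, m, n) \<in> Y x z \<longleftrightarrow> y \<preceq> r & m \<in> sp (Up y z) & n \<in> sp (Dn x y)" for x y z m n
  by (simp add: Y_iff carrier_free)
 have linc: "lin (c x z s h)" for x z s h unfolding c_def by (intro lin_intros)
 have csp: "c x z s h v \<in> sp (Dn x s)" for x z s h v by (simp add: c_def)
 have cov: "bcomp dl x s s (eu s) (c x z s h v) = bcomp dl x s s (eu s) (bcomp dl x z s (bv (flip h)) v)" if "s \<preceq> r" for x z s h v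
  unfolding c_def by (rule eu_kills_nondown[OF that bcomp_sp])
 show ?thesis
 proof (rule tensor_isomorphic[where \<beta> = \<beta> and X = brauer and \<Theta> = \<Theta>])
  fix x z assume x: "x \<in> Obj (Bt r dl)" and z: "z \<in> Obj (Bt r dl)"
  then have xr: "x \<preceq> r" and zr: "z \<preceq> r" by simp_all
  have sr: "s \<preceq> r" if "s \<preceq> z" for s using parity_le_trans[OF that zr] .
  interpret q: free_quotient "Y x z" "KT x z" by (rule quot[OF x z])
  have bal: "bcomp dl x y z (bcomp dl y y' z m g) (bcomp dl x y y (eu y) n)
   = bcomp dl x y' z m (bcomp dl x y' y' (eu y') (bcomp dl x y y' g n))"
   if "y \<preceq> r" "y' \<preceq> r" "g \<in> sp (Lv y y')" "m \<in> sp (Up y' z)" "n \<in> sp (Dn x y)" for y y' g m n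
  proof -
   have "bcomp dl x y z (bcomp dl y y' z m g) (bcomp dl x y y (eu y) n)
    = bcomp dl x y' z m (bcomp dl x y y' (bcomp dl y y y' g (eu y)) n)"
    using that eu_sp[of y] by (simp add: bcomp_assoc sp_up sp_down sp_Lv)
   also have "... = bcomp dl x y' z m (bcomp dl x y' y' (eu y') (bcomp dl x y y' g n))"
    unfolding eu_central[OF that(1-3)] using that eu_sp[of y'] by (simp add: bcomp_assoc sp_down sp_Lv)
   finally show ?thesis .
  qed
  show "balanced x z (\<beta> x z)"
   unfolding balanced_def \<beta>_def
   by (auto simp: carrier_free bcomp_add_left bcomp_add_right bcomp_scale_left bcomp_scale_right bal)
  show "\<beta> x z i \<in> sp (brauer x z)" for i by (cases i) (simp add: \<beta>_def)
  have term_Y: "(s, dual s z h, c x z s h v) \<in> Y x z" if "s \<preceq> z" "h \<in> Um s z" for s h v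
   using that sr dual(1)[OF zr] csp by (simp add: Yi)
  show \<Theta>fm: "\<Theta> x z v \<in> fm (Y x z)" for v
   unfolding \<Theta>_def by (intro fm_sum) (simp add: term_Y)
  show "(\<lambda>i. \<Theta> x z (\<lambda>d. a * v d + w d) i - (a * \<Theta> x z v i + \<Theta> x z w i)) \<in> KT x z" for v w a
  proof -
   have "(\<lambda>i. bv (s, dual s z h, c x z s h (\<lambda>d. a * v d + w d)) i
     - (a * bv (s, dual s z h, c x z s h v) i + bv (s, dual s z h, c x z s h w) i)) \<in> KT x z"
    if s: "s \<preceq> z" and h: "h \<in> Um s z" for s h
   proof -
    have e: "c x z s h (\<lambda>d. a * v d + w d) = (\<lambda>d. a * c x z s h v d + c x z s h w d)"
     by (simp add: lin_add[OF linc] lin_scale[OF linc])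
    have 1: "(\<lambda>i. bv (s, dual s z h, \<lambda>d. a * c x z s h v d + c x z s h w d) i
     - bv (s, dual s z h, \<lambda>d. a * c x z s h v d) i - bv (s, dual s z h, c x z s h w) i) \<in> KT x z"
     using K_add_right[of s "dual s z h" z "\<lambda>d. a * c x z s h v d" x "c x z s h w"] sr[OF s] dual(1)[OF zr h] csp
     by (simp add: carrier_free scale_sp)
    have 2: "(\<lambda>i. bv (s, dual s z h, \<lambda>d. a * c x z s h v d) i - a * bv (s, dual s z h, c x z s h v) i) \<in> KT x z"
     using K_scale_right[of s "dual s z h" z "c x z s h v" x a] sr[OF s] dual(1)[OF zr h] csp
     by (simp add: carrier_free)
    from q.K_add[OF 1 2] show ?thesis unfolding e by (simp add: algebra_simps)
   qed
   then have "(\<lambda>i. \<Sum>s | s \<preceq> z. \<Sum>h\<in>Um s z. bv (s, dual s z h, c x z s h (\<lambda>d. a * v d + w d)) i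
     - (a * bv (s, dual s z h, c x z s h v) i + bv (s, dual s z h, c x z s h w) i)) \<in> KT x z"
    using x z by (intro K_sum) simp_all
   then show ?thesis unfolding \<Theta>_def by (simp add: sum_subtractf sum.distrib sum_distrib_left)
  qed
  have zero_term: "bv (s, dual s z h, \<lambda>_. 0) \<in> KT x z" if s: "s \<preceq> z" and h: "h \<in> Um s z" for s h
   using K_zero_right[of s "dual s z h" z "\<lambda>_. 0" x] sr[OF s] dual(1)[OF zr h] by (simp add: carrier_free)
  show "\<Theta> x z (\<lambda>_. 0) \<in> KT x z"
   unfolding \<Theta>_def lin_zero[OF linc] using x z zero_term by (intro K_sum) simp_all
  show "(\<lambda>j. bv i j - \<Theta> x z (\<beta> x z i) j) \<in> KT x z" if i: "i \<in> Y x z" for i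
  proof -
   obtain y m n where i_eq: "i = (y, m, n)" by (cases i)
   have y: "y \<preceq> r" and m: "m \<in> sp (Up y z)" and n: "n \<in> sp (Dn x y)" using i by (auto simp: i_eq Yi)
   \<comment> \<open>The sandwich lemma leaves the pairing of \<open>flip h\<close> with
     \<open>m\<close>, so the terms with \<open>s\<close> different from \<open>y\<close> come out
     zero.\<close>
   have cb: "c x z s h (\<beta> x z i) = bcomp dl x y s (pr dl y z s (bv (flip h)) m) n" if h: "h \<in> Um s z" for s h
    unfolding c_def \<beta>_def i_eq prod.case using eu[OF y] m n h
    by (intro top_unit_sandwich) (simp_all add: sp_up flip_brauer up_mono_brauer)
   define T where "T s h = (\<lambda>j. bv (s, dual s z h, c x z s h (\<beta> x z i)) j :: 'k)" for s h
   have other: "T s h \<in> KT x z" if s: "s \<preceq> z" and h: "h \<in> Um s z" and ne: "s ~= y" for s h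
    unfolding T_def using cb[OF h] zero_term[OF s h] ne by (simp add: project_Lv_diff)
   \<comment> \<open>\<open>m\<close> is expanded in the dual basis, its pairings with the
     \<open>flip h\<close> being level coefficients on the right; these are moved across the tensor
     sign one term at a time.\<close>
   define a where "a h = bcomp dl y y z (dual y z h) (pr dl y z y (bv (flip h)) m)" for h
   have asp: "a h \<in> sp (Up y z)" if "h \<in> Um y z" for h
    unfolding a_def by (rule bcomp_up_up[OF dual(1)[OF zr that] sp_Lv_up[OF project_in_sp]])
   have move: "(\<lambda>j. bv (y, a h, n) j - T y h j) \<in> KT x z" if h: "h \<in> Um y z" for h
    using K_balanced[of y y "pr dl y z y (bv (flip h)) m" "dual y z h" z n x] y n dual(1)[OF zr h]
    by (simp add: carrier_free a_def T_def cb[OF h])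
   have add: "(\<lambda>j. bv (y, \<lambda>d. \<Sum>h\<in>H. a h d, n) j - (\<Sum>h\<in>H. bv (y, a h, n) j)) \<in> KT x z"
    if "finite H" "H \<subseteq> Um y z" for H
    using that
   proof (induction H rule: finite_induct)
    case empty
    show ?case using K_zero_left[of y "\<lambda>_. 0" z n x] y n by (simp add: carrier_free)
   next
    case (insert h H)
    have 1: "(\<lambda>j. bv (y, \<lambda>d. a h d + (\<Sum>h\<in>H. a h d), n) j - bv (y, a h, n) j
      - bv (y, \<lambda>d. \<Sum>h\<in>H. a h d, n) j) \<in> KT x z"
     using K_add_left[of y "a h" z "\<lambda>d. \<Sum>h\<in>H. a h d" n x] y n asp insert by (simp add: carrier_free sum_sp subset_iff)
    from q.K_add[OF 1 insert.IH] insert show ?case by (simp add: algebra_simps)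
   qed
   have m_eq: "(\<lambda>d. \<Sum>h\<in>Um y z. a h d) = m" unfolding a_def by (rule up_dual_expand[OF zr m])
   have 1: "(\<lambda>j. bv i j - (\<Sum>h\<in>Um y z. T y h j)) \<in> KT x z"
   proof -
    have "(\<lambda>j. \<Sum>h\<in>Um y z. bv (y, a h, n) j - T y h j) \<in> KT x z"
     using x z move by (intro K_sum)
    from q.K_add[OF add[OF finite_up_mono order_refl] this] show ?thesis
     unfolding m_eq i_eq by (simp add: sum_subtractf)
   qed
   have sum_split: "(\<Sum>s | s \<preceq> z. \<Sum>h\<in>Um s z. T s h j)
    = (\<Sum>h\<in>Um y z. T y h j) + (\<Sum>s\<in>{s. s \<preceq> z} - {y}. \<Sum>h\<in>Um s z. T s h j)" for j
   proof (cases "y \<preceq> z")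
    case True
    then show ?thesis by (simp add: sum.remove[of _ y])
   next
    case False
    then have "Um y z = {}" using up_le up_monoD by blast
    moreover have "{s. s \<preceq> z} - {y} = {s. s \<preceq> z}" using False by blast
    ultimately show ?thesis by simp
   qed
   have 2: "(\<lambda>j. \<Sum>s\<in>{s. s \<preceq> z} - {y}. \<Sum>h\<in>Um s z. T s h j) \<in> KT x z"
    using x z other by (intro K_sum) simp_all
   from q.K_diff[OF 1 2] show ?thesis
    unfolding \<Theta>_def using sum_split by (simp add: T_def algebra_simps)
  qed
  show "ext (\<beta> x z) (\<Theta> x z v) = v" if v: "v \<in> sp (brauer x z)" for v
  proof -
   have "ext (\<beta> x z) (\<Theta> x z v) = (\<lambda>d. \<Sum>s | s \<preceq> z. \<Sum>h\<in>Um s z. \<beta> x z (s, dual s z h, c x z s h v) d)"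
   proof -
    have t: "(bv (s, dual s z h, c x z s h v) :: _ => 'k) \<in> fm (Y x z)" if "s \<in> {s. s \<preceq> z}" "h \<in> Um s z" for s h
     using term_Y that by simp
    show ?thesis unfolding \<Theta>_def
     by (subst ext_sum[where Y = "Y x z"], rule fm_sum, erule (1) t)
      (intro HOL.ext sum.cong refl, subst ext_sum[where Y = "Y x z"], erule (1) t, simp)
   qed
   also have "... = (\<lambda>d. \<Sum>s | s \<preceq> z. \<Sum>h\<in>Um s z.
     bcomp dl x z z (bcomp dl z s z (dual s z h) (bcomp dl z s s (eu s) (bv (flip h)))) v d)"
   proof (intro HOL.ext sum.cong refl)
    fix d s h assume s: "s \<in> {s. s \<preceq> z}" and h: "h \<in> Um s z"
    have sr': "s \<preceq> r" using sr s by simp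
    have "\<beta> x z (s, dual s z h, c x z s h v)
     = bcomp dl x z z (bcomp dl z s z (dual s z h) (bcomp dl z s s (eu s) (bv (flip h)))) v"
     unfolding \<beta>_def prod.case cov[OF sr']
     using v eu_sp[OF sr'] dual(1)[OF zr h] h by (simp add: bcomp_assoc sp_up flip_brauer up_mono_brauer)
    then show "\<beta> x z (s, dual s z h, c x z s h v) d
     = bcomp dl x z z (bcomp dl z s z (dual s z h) (bcomp dl z s s (eu s) (bv (flip h)))) v d" by simp
   qed
   also have "... = bcomp dl x z z (\<lambda>d. \<Sum>s | s \<preceq> z. \<Sum>h\<in>Um s z.
     bcomp dl z s z (dual s z h) (bcomp dl z s s (eu s) (bv (flip h))) d) v"
    by (simp only: bcomp_sum_left)
   also have "... = v" unfolding id_resolution[OF zr] by (rule bcomp_id_left[OF v])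
   finally show ?thesis .
  qed
 next
  fix x z z' g y m n
  assume a: "x \<in> Obj (Bt r dl)" "z \<in> Obj (Bt r dl)" "z' \<in> Obj (Bt r dl)" "g \<in> Arr (Bt r dl) z z'" "(y, m, n) \<in> Y x z"
  then have yr: "y \<preceq> r" and zr: "z' \<preceq> r" and g: "g \<in> sp (brauer z z')" and m: "m \<in> sp (brauer y z)" and n: "n \<in> sp (brauer x y)"
   by (simp_all add: Yi carrier_free sp_up sp_down)
  have "bcomp dl x y z' (pu y z' (bcomp dl y z z' g m)) (bcomp dl x y y (eu y) n)
   = bcomp dl x y z' (bcomp dl y y z' (pu y z' (bcomp dl y z z' g m)) (eu y)) n"
   using n eu_sp[OF yr] by (simp add: bcomp_assoc sp_up)
  also have "... = bcomp dl x y z' (bcomp dl y y z' (bcomp dl y z z' g m) (eu y)) n"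
   unfolding eu_kills_nonup[OF yr zr bcomp_sp] ..
  also have "... = bcomp dl x z z' g (bcomp dl x y z m (bcomp dl x y y (eu y) n))"
   using n m g eu_sp[OF yr] by (simp add: bcomp_assoc)
  finally show "\<beta> x z' (y, Lact (up_bimodule dl) y z z' g m, n) = Lact (regular_bimodule (Bt r dl)) x z z' g (\<beta> x z (y, m, n))"
   by (simp add: \<beta>_def)
 next
  fix x x' z h y m n
  assume a: "x \<in> Obj (Bt r dl)" "x' \<in> Obj (Bt r dl)" "h \<in> Arr (Bt r dl) x' x" "(y, m, n) \<in> Y x z"
  then have yr: "y \<preceq> r" and h: "h \<in> sp (brauer x' x)" and m: "m \<in> sp (brauer y z)" and n: "n \<in> sp (brauer x y)"
   by (simp_all add: Yi carrier_free sp_up sp_down)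
  have "bcomp dl x' y y (eu y) (pd x' y (bcomp dl x' x y n h)) = bcomp dl x' y y (eu y) (bcomp dl x' x y n h)"
   by (rule eu_kills_nondown[OF yr bcomp_sp])
  then show "\<beta> x' z (y, m, Ract (down_bimodule dl) x' x y n h) = Ract (regular_bimodule (Bt r dl)) x' x z (\<beta> x z (y, m, n)) h"
   using m n h eu_sp[OF yr] by (simp add: \<beta>_def bcomp_assoc)
 qed (auto simp: lin_bcomp_left lin_bcomp_right)
qed

lemma morita_bimodules: "gives_morita_equivalence (Bt r dl) (St r dl) (up_bimodule dl) (down_bimodule dl)"
 unfolding gives_morita_equivalence_def
 by (intro conjI bimodule_up bimodule_down up_down_isomorphic down_up_isomorphic)

end

subsection \<open>Non-singularity from the bimodule isomorphism\<close>

text \<open>The determinants of three square matrices with product 1 are all units. The Gram matrix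
  will be known only as the middle factor of such a product.\<close>

lemma det_unit_of_factor:
 fixes a b c :: "'i => 'i => 'k::comm_ring_1"
 assumes en: "bij_betw en {0..<n} I"
  and abc: "\<And>i j. i \<in> I ==> j \<in> I ==> (\<Sum>k\<in>I. b i k * (\<Sum>l\<in>I. a k l * c l j)) = (if i = j then 1 else 0)"
 shows "Determinant.det (indexed_mat n en a) dvd 1"
proof -
 let ?M = "indexed_mat n en"
 have "?M b * (?M a * ?M c) = 1\<^sub>m n"
  unfolding indexed_mat_mult[OF en] indexed_mat_one[OF en] using abc by blast
 then have "Determinant.det (?M b * (?M a * ?M c)) = 1" by simp
 then have "Determinant.det (?M b) * (Determinant.det (?M a) * Determinant.det (?M c)) = 1"
  using det_mult[of "?M b" n "?M a * ?M c"] det_mult[of "?M a" n "?M c"]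
  by (simp add: mult_carrier_mat[of _ n n])
 then have "Determinant.det (?M a) * (Determinant.det (?M b) * Determinant.det (?M c)) = 1"
  by (simp add: mult.left_commute)
 then show ?thesis by (rule dvdI[OF sym])
qed

lemma lin_eval: "lin (\<lambda>V \<tau>. V (h, \<tau>))"
 by (simp add: lin_def)

lemma lin_coeff: "lin (\<lambda>n d. n z * c d)"
 by (simp add: lin_def fun_eq_iff algebra_simps)

text \<open>Left linearity over level diagrams expresses the pairing with any \<open>n\<close>
  through the pairings with the elements \<open>flip h\<close>, hence through coordinates that the
  Gram matrix computes.\<close>

lemma pr_row:
 fixes dl :: "'k::comm_ring_1"
 assumes n: "n \<in> sp (Dn q p)" and y: "y \<in> sp (brauer p q)"
 shows "pr dl p q p n y = (\<lambda>d. \<Sum>h\<in>Um p q. \<Sum>\<sigma>\<in>brauer_level p p.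
  n (dcomp \<sigma> (flip h)) * bcomp dl p p p (bv \<sigma>) (pr dl p q p (bv (flip h)) y) d)"
proof (rule lin_ext[OF _ _ finite_down n])
 fix z assume z: "z \<in> Dn q p"
 obtain k \<tau> where k: "k \<in> Um p q" and \<tau>: "\<tau> \<in> brauer_level p p" and zk: "z = dcomp \<tau> (flip k)"
  using down_factor_exists[OF z] by blast
 let ?R = "\<lambda>h \<sigma>. bcomp dl p p p (bv \<sigma>) (pr dl p q p (bv (flip h)) y)"
 have fk: "flip k \<in> Dn q p" using k by (simp add: up_monoD)
 have \<tau>': "\<tau> \<in> Lv p p" using \<tau> by (simp add: Lv_self)
 then have zb: "bv z = bcomp dl q p p (bv \<tau>) (bv (flip k))"
  unfolding zk using bcomp_basis_down[OF _ fk, of \<tau> p dl] Lv_sub(3)[of p p] by auto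
 have "pr dl p q p (bv z) y = ?R k \<tau>"
  unfolding zb using \<tau>' fk y by (intro Lv_pr_left) (simp_all add: downD)
 also have "... = (\<lambda>d. \<Sum>h\<in>Um p q. if h = k then ?R k \<tau> d else 0)" using k by simp
 also have "... = (\<lambda>d. \<Sum>h\<in>Um p q. \<Sum>\<sigma>\<in>brauer_level p p. if \<sigma> = \<tau> then (if h = k then ?R k \<tau> d else 0) else 0)"
  using \<tau> by simp
 also have "... = (\<lambda>d. \<Sum>h\<in>Um p q. \<Sum>\<sigma>\<in>brauer_level p p. bv z (dcomp \<sigma> (flip h)) * ?R h \<sigma> d)"
 proof (intro HOL.ext sum.cong refl)
  fix d h \<sigma> assume h: "h \<in> Um p q" and \<sigma>: "\<sigma> \<in> brauer_level p p"
  have "dcomp \<sigma> (flip h) = z \<longleftrightarrow> h = k & \<sigma> = \<tau>"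
   using down_factor_unique[OF h \<sigma> k \<tau>] unfolding zk by blast
  then show "(if \<sigma> = \<tau> then (if h = k then ?R k \<tau> d else 0) else 0) = bv z (dcomp \<sigma> (flip h)) * ?R h \<sigma> d"
   by (auto simp: basis_vec_def)
 qed
 finally show "pr dl p q p (bv z) y = (\<lambda>d. \<Sum>h\<in>Um p q. \<Sum>\<sigma>\<in>brauer_level p p.
  bv z (dcomp \<sigma> (flip h)) * ?R h \<sigma> d)" .
qed (intro lin_intros lin_coeff)+

text \<open>The isomorphism is an arbitrary one. The element \<open>u q\<close> lying over
  \<open>id_q\<close> acts on \<open>B^+(p, q)\<close> through its tensor factors, and this action
  sees its argument only through the Gram matrix. As it can be made to return any given
  \<open>f\<close>, the identity matrix factors through the Gram matrix.\<close>

lemma non_singular_of_bimodules: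
 fixes dl :: "'k::comm_ring_1"
 assumes iso: "bimodule_isomorphic (Bt r dl) (Bt r dl) (tensor_bimodule (St r dl) (up_bimodule dl) (down_bimodule dl))
   (regular_bimodule (Bt r dl))"
 shows "non_singular_upto dl r"
 unfolding non_singular_upto_def
proof (intro allI impI)
 fix p q assume pq: "p \<preceq> q & q \<preceq> r"
 then have pR: "p \<preceq> r" and qR: "q \<preceq> r" using parity_le_trans by blast+
 interpret tensor "Bt r dl" "St r dl" "Bt r dl" "up_bimodule dl" "down_bimodule dl" by (rule tensor_up_down)
 have O: "x \<in> Obj (Bt r dl) \<longleftrightarrow> x \<preceq> r" for x by simp
 have Yi: "(y, m, n) \<in> Y x z \<longleftrightarrow> y \<preceq> r & m \<in> sp (Up y z) & n \<in> sp (Dn x y)" for x y z m n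
  by (simp add: Y_iff carrier_free)
 obtain \<Phi> where bij: "\<And>x y. x \<preceq> r ==> y \<preceq> r ==> bij_betw (\<Phi> x y) (carrier (BMod MN x y)) (sp (brauer x y))"
  and \<Phi>L: "\<And>x y y' g A. x \<preceq> r ==> y \<preceq> r ==> y' \<preceq> r ==> g \<in> sp (brauer y y') ==> A \<in> carrier (BMod MN x y) ==>
   \<Phi> x y' (Lact MN x y y' g A) = bcomp dl x y y' g (\<Phi> x y A)"
  and \<Phi>R: "\<And>x x' y h A. x \<preceq> r ==> x' \<preceq> r ==> y \<preceq> r ==> h \<in> sp (brauer x' x) ==> A \<in> carrier (BMod MN x y) ==>
   \<Phi> x' y (Ract MN x' x y A h) = bcomp dl x' x y (\<Phi> x y A) h"
 proof -
  from iso obtain \<Phi> where "(\<forall>x\<in>Obj (Bt r dl). \<forall>y\<in>Obj (Bt r dl). \<Phi> x y \<in> linear_maps (BMod MN x y) (BMod (regular_bimodule (Bt r dl)) x y) &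
    bij_betw (\<Phi> x y) (carrier (BMod MN x y)) (carrier (BMod (regular_bimodule (Bt r dl)) x y)))"
   "(\<forall>x\<in>Obj (Bt r dl). \<forall>y\<in>Obj (Bt r dl). \<forall>y'\<in>Obj (Bt r dl). \<forall>g\<in>Arr (Bt r dl) y y'. \<forall>m\<in>carrier (BMod MN x y).
    \<Phi> x y' (Lact MN x y y' g m) = Lact (regular_bimodule (Bt r dl)) x y y' g (\<Phi> x y m))"
   "(\<forall>x\<in>Obj (Bt r dl). \<forall>x'\<in>Obj (Bt r dl). \<forall>y\<in>Obj (Bt r dl). \<forall>h\<in>Arr (Bt r dl) x' x. \<forall>m\<in>carrier (BMod MN x y).
    \<Phi> x' y (Ract MN x' x y m h) = Ract (regular_bimodule (Bt r dl)) x' x y (\<Phi> x y m) h)"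
   unfolding bimodule_isomorphic_def by (elim exE conjE)
  then show ?thesis by (intro that[of \<Phi>]) (simp_all add: carrier_free regular_bimodule_def)
 qed
 have Lc: "Lact MN x y y' g A \<in> carrier (BMod MN x y')"
  if as: "x \<preceq> r" "y \<preceq> r" "y' \<preceq> r" "g \<in> sp (brauer y y')" "A \<in> carrier (BMod MN x y)" for x y y' g A
 proof -
  obtain F where F: "F \<in> fm (Y x y)" "A = cset (KT x y) F" using as by (auto simp: T_carrier)
  have "push (\<lambda>(s, m, n). (s, Lact (up_bimodule dl) s y y' g m, n)) F \<in> fm (Y x y')"
   by (rule push_fm[OF F(1)]) (auto simp: Yi)
  then show ?thesis unfolding F(2) using as F(1) by (simp add: T_Lact T_carrier carrier_free)
 qed
 have Rc: "Ract MN x' x y A h \<in> carrier (BMod MN x' y)"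
  if as: "x \<preceq> r" "x' \<preceq> r" "y \<preceq> r" "h \<in> sp (brauer x' x)" "A \<in> carrier (BMod MN x y)" for x x' y h A
 proof -
  obtain F where F: "F \<in> fm (Y x y)" "A = cset (KT x y) F" using as by (auto simp: T_carrier)
  have "push (\<lambda>(s, m, n). (s, m, Ract (down_bimodule dl) x' x s n h)) F \<in> fm (Y x' y)"
   by (rule push_fm[OF F(1)]) (auto simp: Yi)
  then show ?thesis unfolding F(2) using as F(1) by (simp add: T_Ract T_carrier carrier_free)
 qed
 \<comment> \<open>\<open>m \<otimes> n\<close> acts on \<open>f\<close> by pairing \<open>n\<close>
   with \<open>f\<close> and then applying \<open>m\<close>.\<close>
 define \<beta> where "\<beta> x z f = (\<lambda>(y, m, n). bcomp dl p y z m (pr dl p x y n f))" for x z f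
 have bal: "balanced x z (\<beta> x z f)" if "f \<in> sp (Up p x)" for x z f
  unfolding balanced_def \<beta>_def using that
  by (auto simp: carrier_free bcomp_add_left bcomp_add_right bcomp_scale_left bcomp_scale_right
    lin_add[OF lin_project] project_scale project_Lv_left bcomp_assoc sp_up sp_down sp_Lv)
 have desc: "desc (\<beta> x z f) (cset (KT x z) F) = ext (\<beta> x z f) F"
  if "x \<preceq> r" "z \<preceq> r" "f \<in> sp (Up p x)" "F \<in> fm (Y x z)" for x z f F
  using that by (intro desc_cset bal) simp_all
 \<comment> \<open>Left multiplication of the tensor acts on the result, while right multiplication,
   treated next, is shifted to the argument; both are truncated.\<close>
 have left: "desc (\<beta> x z' f) (Lact MN x z z' g A) = pu p z' (bcomp dl p z z' g (desc (\<beta> x z f) A))"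
  if o: "x \<preceq> r" "z \<preceq> r" "z' \<preceq> r" and g: "g \<in> sp (brauer z z')" and f: "f \<in> sp (Up p x)"
   and A: "A \<in> carrier (BMod MN x z)" for x z z' g f A
 proof -
  obtain F where F: "F \<in> fm (Y x z)" "A = cset (KT x z) F" using A o by (auto simp: T_carrier)
  let ?\<phi> = "\<lambda>(s, m, n). (s, Lact (up_bimodule dl) s z z' g m, n)"
  have pf: "push ?\<phi> F \<in> fm (Y x z')" by (rule push_fm[OF F(1)]) (auto simp: Yi)
  have "desc (\<beta> x z' f) (Lact MN x z z' g A) = ext (\<lambda>i. \<beta> x z' f (?\<phi> i)) F"
   unfolding F(2) using o g F(1) pf f by (simp add: T_Lact carrier_free desc ext_push[OF F(1)])
  also have "... = ext (\<lambda>i. pu p z' (bcomp dl p z z' g (\<beta> x z f i))) F"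
  proof (rule ext_cong[OF F(1)])
   fix i assume "i \<in> Y x z"
   then obtain s m n where i: "i = (s, m, n)" "m \<in> sp (Up s z)" by (cases i) (auto simp: Yi)
   have "bcomp dl p s z' (pu s z' (bcomp dl s z z' g m)) (pr dl p x s n f)
    = pu p z' (bcomp dl p s z' (bcomp dl s z z' g m) (pr dl p x s n f))"
    by (rule project_up_Lv[symmetric]) simp_all
   then show "\<beta> x z' f (?\<phi> i) = pu p z' (bcomp dl p z z' g (\<beta> x z f i))"
    using g i by (simp add: \<beta>_def bcomp_assoc sp_up sp_Lv)
  qed
  also have "... = pu p z' (bcomp dl p z z' g (ext (\<beta> x z f) F))"
   by (rule lin_ext_comp[OF lin_project'[OF lin_bcomp_right], symmetric])
  also have "ext (\<beta> x z f) F = desc (\<beta> x z f) A" unfolding F(2) using desc o f F(1) by simp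
  finally show ?thesis .
 qed
 have right: "desc (\<beta> x' z f) (Ract MN x' x z A h) = desc (\<beta> x z (pu p x (bcomp dl p x' x h f))) A"
  if o: "x \<preceq> r" "x' \<preceq> r" "z \<preceq> r" and h: "h \<in> sp (brauer x' x)" and f: "f \<in> sp (Up p x')"
   and A: "A \<in> carrier (BMod MN x z)" for x x' z h f A
 proof -
  obtain F where F: "F \<in> fm (Y x z)" "A = cset (KT x z) F" using A o by (auto simp: T_carrier)
  let ?\<phi> = "\<lambda>(s, m, n). (s, m, Ract (down_bimodule dl) x' x s n h)"
  have pf: "push ?\<phi> F \<in> fm (Y x' z)" by (rule push_fm[OF F(1)]) (auto simp: Yi)
  have "desc (\<beta> x' z f) (Ract MN x' x z A h) = ext (\<lambda>i. \<beta> x' z f (?\<phi> i)) F"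
   unfolding F(2) using o h F(1) pf f by (simp add: T_Ract carrier_free desc ext_push[OF F(1)])
  also have "... = ext (\<beta> x z (pu p x (bcomp dl p x' x h f))) F"
  proof (rule ext_cong[OF F(1)])
   fix i assume "i \<in> Y x z"
   then obtain s m n where i: "i = (s, m, n)" "n \<in> sp (Dn x s)" by (cases i) (auto simp: Yi)
   then show "\<beta> x' z f (?\<phi> i) = \<beta> x z (pu p x (bcomp dl p x' x h f)) i"
    using h f by (simp add: \<beta>_def Lv_absorb_left Lv_absorb_right bcomp_assoc sp_up sp_down)
  qed
  also have "... = desc (\<beta> x z (pu p x (bcomp dl p x' x h f))) A"
   unfolding F(2) using desc o F(1) by simp
  finally show ?thesis .
 qed
 define u where "u x = inv_into (carrier (BMod MN x x)) (\<Phi> x x) (bv (id_diagram x))" for x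
 have u: "u x \<in> carrier (BMod MN x x)" "\<Phi> x x (u x) = bv (id_diagram x)" if "x \<preceq> r" for x
 proof -
  have "bv (id_diagram x) \<in> \<Phi> x x ` carrier (BMod MN x x)"
   using bij[OF that that] by (simp add: bij_betw_def id_diagram_brauer)
  then show "u x \<in> carrier (BMod MN x x)" "\<Phi> x x (u x) = bv (id_diagram x)"
   unfolding u_def by (rule inv_into_into, rule f_inv_into_f)
 qed
 have \<Phi>inj: "A = B" if "x \<preceq> r" "y \<preceq> r" "A \<in> carrier (BMod MN x y)" "B \<in> carrier (BMod MN x y)" "\<Phi> x y A = \<Phi> x y B" for x y A B
  using bij[OF that(1,2)] that(3-5) by (meson bij_betw_imp_inj_on inj_onD)
 \<comment> \<open>Naturality of \<open>u\<close>: both sides lie over \<open>g\<close> under the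
   injective \<open>\<Phi>\<close>.\<close>
 have slide: "Lact MN p p q g (u p) = Ract MN p q q (u q) g" if "g \<in> sp (brauer p q)" for g
  using that pR qR u by (intro \<Phi>inj[OF pR qR] Lc Rc) (simp_all add: \<Phi>L \<Phi>R bcomp_id_left bcomp_id_right)
 have idY: "(p, bv (id_diagram p), bv (id_diagram p)) \<in> Y p p" using pR by (simp add: Yi)
 \<comment> \<open>The symbol \<open>id \<otimes> id\<close> acts on \<open>id_p\<close> as the
   identity. Writing it as \<open>g0\<close> applied to \<open>u p\<close> shows that
   \<open>g0\<close> is a left inverse, up to the upward projection, of the value \<open>t\<close>
   of \<open>u p\<close> on \<open>id_p\<close>.\<close>
 define w where "w = cset (KT p p) (bv (p, bv (id_diagram p), bv (id_diagram p)))"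
 have w: "w \<in> carrier (BMod MN p p)" unfolding w_def using idY pR by (simp add: T_carrier)
 define g0 where "g0 = \<Phi> p p w"
 have g0: "g0 \<in> sp (brauer p p)" using bij[OF pR pR] w unfolding g0_def by (auto simp: bij_betw_def)
 have w_eq: "w = Lact MN p p p g0 (u p)"
  using g0 pR u w by (intro \<Phi>inj[OF pR pR] Lc) (simp_all add: \<Phi>L bcomp_id_right g0_def[symmetric])
 let ?id = "bv (id_diagram p) :: diagram => 'k"
 have idu: "?id \<in> sp (Up p p)" by simp
 define t where "t = desc (\<beta> p p ?id) (u p)"
 have "pu p p (bcomp dl p p p g0 t) = desc (\<beta> p p ?id) w"
  unfolding t_def w_eq by (rule left[OF pR pR pR g0 idu u(1)[OF pR], symmetric])
 also have "... = \<beta> p p ?id (p, ?id, ?id)"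
  unfolding w_def using desc[OF pR pR idu, of "bv (p, ?id, ?id)"] idY by simp
 also have "... = ?id" by (simp add: \<beta>_def bcomp_id_left project_sp id_diagram_brauer)
 finally have g0t: "pu p p (bcomp dl p p p g0 t) = ?id" .
 have tsp: "t \<in> sp (brauer p p)"
 proof -
  obtain F where F: "F \<in> fm (Y p p)" "u p = cset (KT p p) F" using u(1)[OF pR] pR by (auto simp: T_carrier)
  have "ext (\<beta> p p ?id) F \<in> sp (brauer p p)"
   by (rule ext_sp[OF _ F(1)]) (auto simp: \<beta>_def)
  then show ?thesis unfolding t_def F(2) desc[OF pR pR idu F(1)] .
 qed
 \<comment> \<open>Composing \<open>f\<close> with \<open>g0\<close> beforehand compensates for
   \<open>t\<close>: the action of \<open>u q\<close> then returns \<open>f\<close> itself.\<close>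
 define y where "y f = pu p q (bcomp dl p p q f g0)" for f
 have ysp: "y f \<in> sp (Up p q)" for f by (simp add: y_def)
 have surj: "desc (\<beta> q q (y f)) (u q) = f" if f: "f \<in> sp (Up p q)" for f
 proof -
  let ?h = "bcomp dl p p q f g0"
  have "pu p q (bcomp dl p p q ?h ?id) = y f" by (simp add: y_def bcomp_id_right)
  then have "desc (\<beta> q q (y f)) (u q) = desc (\<beta> p q ?id) (Ract MN p q q (u q) ?h)"
   using right[OF qR pR qR bcomp_sp[of dl p p q f g0] idu u(1)[OF qR]] by simp
  also have "... = desc (\<beta> p q ?id) (Lact MN p p q ?h (u p))" by (simp add: slide)
  also have "... = pu p q (bcomp dl p p q ?h t)"
   unfolding t_def by (rule left[OF pR pR qR bcomp_sp idu u(1)[OF pR]])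
  also have "... = pu p q (bcomp dl p p q f (pu p p (bcomp dl p p p g0 t)))"
   using f g0 tsp by (simp add: bcomp_assoc sp_up up_absorb)
  also have "... = f" unfolding g0t using f by (simp add: bcomp_id_right sp_up project_sp)
  finally show ?thesis .
 qed
 obtain U where U: "U \<in> fm (Y q q)" "u q = cset (KT q q) U" using u(1)[OF qR] qR by (auto simp: T_carrier)
 \<comment> \<open>The action of \<open>u q\<close> as a linear function of the Gram coordinates
   \<open>V\<close>. A representative \<open>U\<close> is fixed, and only symbols through the object
   \<open>p\<close> count, the pairing being zero at the others.\<close>
 define \<kappa> where "\<kappa> V = (\<lambda>d. \<Sum>i\<in>supp U. U i * (if fst i = p then bcomp dl p p q (fst (snd i))
  (\<lambda>d. \<Sum>h\<in>Um p q. \<Sum>\<sigma>\<in>brauer_level p p. snd (snd i) (dcomp \<sigma> (flip h)) *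
   bcomp dl p p p (bv \<sigma>) (\<lambda>\<tau>. V (h, \<tau>)) d) else (\<lambda>_. 0)) d)" for V
 have lin_if: "lin (\<lambda>V. if P then T V else (\<lambda>_. 0))" if "lin T" for P and T :: "(diagram \<times> diagram => 'k) => diagram => 'k"
  using that lin_const by (cases P) simp_all
 have lin\<kappa>: "lin \<kappa>" unfolding \<kappa>_def by (intro lin_intros lin_if lin_eval)
 define V where "V f = (\<lambda>k. if k \<in> gram_index p q then pr dl p q p (bv (flip (fst k))) f (snd k) else 0)" for f
 have Vsp: "V f \<in> sp (gram_index p q)" for f by (simp add: sp_def V_def)
 have \<kappa>V: "ext (\<beta> q q f) U = \<kappa> (V f)" if f: "f \<in> sp (Up p q)" for f
  unfolding ext_def \<kappa>_def
 proof (intro HOL.ext sum.cong refl)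
  fix d i assume "i \<in> supp U"
  then have "i \<in> Y q q" using U(1) unfolding fm_iff by blast
  then obtain s m n where i: "i = (s, m, n)" "n \<in> sp (Dn q s)" by (cases i) (auto simp: Yi)
  have "\<beta> q q f i = (if s = p then bcomp dl p p q m (\<lambda>d. \<Sum>h\<in>Um p q. \<Sum>\<sigma>\<in>brauer_level p p.
    n (dcomp \<sigma> (flip h)) * bcomp dl p p p (bv \<sigma>) (\<lambda>\<tau>. V f (h, \<tau>)) d) else (\<lambda>_. 0))"
  proof (cases "s = p")
   case True
   have Vh: "(\<lambda>\<tau>. V f (h, \<tau>)) = pr dl p q p (bv (flip h)) f" if "h \<in> Um p q" for h
    using that by (auto simp: V_def gram_index_def project_def Lv_self)
   have "pr dl p q p n f = (\<lambda>d. \<Sum>h\<in>Um p q. \<Sum>\<sigma>\<in>brauer_level p p.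
    n (dcomp \<sigma> (flip h)) * bcomp dl p p p (bv \<sigma>) (\<lambda>\<tau>. V f (h, \<tau>)) d)"
    using pr_row[OF i(2)[unfolded True] sp_up[OF f], of dl] Vh by simp
   then show ?thesis using True by (simp add: \<beta>_def i(1))
  next
   case False
   then show ?thesis by (simp add: \<beta>_def i(1) project_Lv_diff)
  qed
  then show "U i * \<beta> q q f i d = U i * (if fst i = p then bcomp dl p p q (fst (snd i))
   (\<lambda>d. \<Sum>h\<in>Um p q. \<Sum>\<sigma>\<in>brauer_level p p. snd (snd i) (dcomp \<sigma> (flip h)) *
    bcomp dl p p p (bv \<sigma>) (\<lambda>\<tau>. V f (h, \<tau>)) d) else (\<lambda>_. 0)) d"
   by (simp add: i(1))
 qed
 obtain en where en: "bij_betw en {0..<card (gram_index p q)} (gram_index p q)"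
  and d: "non_singular_at dl p q \<longleftrightarrow> Determinant.det (indexed_mat (card (gram_index p q)) en (gram dl p q)) dvd 1"
  using non_singular_iff by metis
 let ?dc = "\<lambda>j. dcomp (fst j) (snd j)"
 have bijdc: "bij_betw ?dc (gram_index p q) (Up p q)"
  using bij_up_factor[of p q] by (simp add: case_prod_unfold)
 show "non_singular_at dl p q"
  unfolding d
 proof (rule det_unit_of_factor[OF en])
  fix i j assume ij: "i \<in> gram_index p q" "j \<in> gram_index p q"
  have fj: "bv (?dc j) \<in> sp (Up p q)" using bij_betwE[OF bijdc] ij by simp
  let ?y = "y (bv (?dc j))"
  have "\<kappa> (V ?y) = (\<lambda>e. \<Sum>k\<in>gram_index p q. V ?y k * \<kappa> (bv k) e)"
   by (subst sp_expand[OF finite_gram_index Vsp]) (rule lin_lincomb[OF lin\<kappa>])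
  then have "(\<Sum>k\<in>gram_index p q. \<kappa> (bv k) (?dc i) * V ?y k) = \<kappa> (V ?y) (?dc i)"
   by (simp add: mult.commute)
  also have "\<kappa> (V ?y) = bv (?dc j)"
   using \<kappa>V[OF ysp] surj[OF fj] desc[OF qR qR ysp U(1)] U(2) by simp
  also have "bv (?dc j) (?dc i) = (if i = j then 1 else (0::'k))"
   using ij inj_on_eq_iff[OF bij_betw_imp_inj_on[OF bijdc]] by (simp add: basis_vec_def)
  finally have "(\<Sum>k\<in>gram_index p q. \<kappa> (bv k) (?dc i) * V ?y k) = (if i = j then 1 else 0)" .
  moreover have "V ?y k = (\<Sum>l\<in>gram_index p q. gram dl p q k l * ?y (?dc l))" if "k \<in> gram_index p q" for k
   using that pr_expand[where dl = dl and f = "fst k" and \<sigma> = "snd k", OF ysp] by (simp add: V_def)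
  ultimately show "(\<Sum>k\<in>gram_index p q. \<kappa> (bv k) (?dc i) *
    (\<Sum>l\<in>gram_index p q. gram dl p q k l * y (bv (?dc j)) (?dc l))) = (if i = j then 1 else 0)"
   by simp
 qed
qed

section \<open>Functor categories and equivalences\<close>

text \<open>Subtraction is written throughout as scaling by -1, since linear maps are given as
  respecting sums and scalar multiples.\<close>

lemma module_laws:
 fixes M :: "('k::comm_ring_1, 'a) module"
 assumes "is_module M"
 shows "0[M] \<in> carrier M"
  and "\<And>x y. x \<in> carrier M ==> y \<in> carrier M ==> x +[M] y \<in> carrier M"
  and "\<And>x y. x \<in> carrier M ==> y \<in> carrier M ==> x +[M] y = y +[M] x"
  and "\<And>x y z. x \<in> carrier M ==> y \<in> carrier M ==> z \<in> carrier M ==> (x +[M] y) +[M] z = x +[M] (y +[M] z)"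
  and "\<And>x. x \<in> carrier M ==> 0[M] +[M] x = x"
  and "\<And>x. x \<in> carrier M ==> x +[M] 0[M] = x"
  and "\<And>x. x \<in> carrier M ==> (-1) *[M] x +[M] x = 0[M]"
  and "\<And>c x. x \<in> carrier M ==> c *[M] x \<in> carrier M"
  and "\<And>c d x. x \<in> carrier M ==> (c + d) *[M] x = c *[M] x +[M] d *[M] x"
  and "\<And>c x y. x \<in> carrier M ==> y \<in> carrier M ==> c *[M] (x +[M] y) = c *[M] x +[M] c *[M] y"
  and "\<And>c d x. x \<in> carrier M ==> (c * d) *[M] x = c *[M] (d *[M] x)"
  and "\<And>x. x \<in> carrier M ==> 1 *[M] x = x"
  and "\<And>x. x \<in> carrier M ==> 0 *[M] x = 0[M]"
  and "\<And>c. c *[M] 0[M] = 0[M]"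
  and "\<And>x y. x \<in> carrier M ==> y \<in> carrier M ==> x +[M] (-1) *[M] y = 0[M] ==> x = y"
  and "\<And>x y z. x \<in> carrier M ==> y \<in> carrier M ==> z \<in> carrier M ==> x +[M] (y +[M] z) = y +[M] (x +[M] z)"
  and "comm_monoid (add_monoid M)" and "abelian_monoid M"
  and "\<And>x. x \<in> carrier M ==> x +[M] (-1) *[M] x = 0[M]"
  and "\<And>c d x. x \<in> carrier M ==> c *[M] (d *[M] x) = d *[M] (c *[M] x)"
proof -
 interpret Module.module ground_ring M by (rule assms)
 have o: "1 *[M] x = x" if "x \<in> carrier M" for x using smult_one[OF that] by simp
 have z: "0 *[M] x = 0[M]" if "x \<in> carrier M" for x using smult_l_null[OF that] by simp
 have d: "(c + d) *[M] x = c *[M] x +[M] d *[M] x" if "x \<in> carrier M" for c d x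
  using smult_l_distr[of c d x] that by simp
 have n: "(-1) *[M] x +[M] x = 0[M]" if "x \<in> carrier M" for x
  using d[OF that, of "-1" 1] z[OF that] o[OF that] by simp
 show "\<And>x. x \<in> carrier M ==> 1 *[M] x = x" by (rule o)
 show "\<And>x. x \<in> carrier M ==> 0 *[M] x = 0[M]" by (rule z)
 show "\<And>c d x. x \<in> carrier M ==> (c + d) *[M] x = c *[M] x +[M] d *[M] x" by (rule d)
 show "\<And>x. x \<in> carrier M ==> (-1) *[M] x +[M] x = 0[M]" by (rule n)
 have a: "(c * d) *[M] x = c *[M] (d *[M] x)" if "x \<in> carrier M" for c d x
  using smult_assoc1[of c d x] that by simp
 show "\<And>c d x. x \<in> carrier M ==> (c * d) *[M] x = c *[M] (d *[M] x)" by (rule a)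
 show "c *[M] (d *[M] x) = d *[M] (c *[M] x)" if "x \<in> carrier M" for c d x
  using a[OF that, of c d] a[OF that, of d c] by (simp add: mult.commute)
 show "x +[M] (-1) *[M] x = 0[M]" if "x \<in> carrier M" for x
  using n[OF that] that by (simp add: a_comm)
 show "x = y" if "x \<in> carrier M" "y \<in> carrier M" "x +[M] (-1) *[M] y = 0[M]" for x y
 proof -
  have "(x +[M] (-1) *[M] y) +[M] y = x" using that(1,2) n[OF that(2)] by (simp add: a_assoc)
  then show ?thesis using that by simp
 qed
 show "c *[M] 0[M] = 0[M]" for c by simp
 show "comm_monoid (add_monoid M)" by (rule a_comm_monoid)
 show "abelian_monoid M" by unfold_locales
qed (use assms in \<open>auto simp: Module.module_def abelian_group_def abelian_monoid.a_ac abelian_monoid.zero_closed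
  abelian_monoid.a_closed abelian_monoid.l_zero abelian_monoid.r_zero module_axioms_def
  intro: Module.module.smult_closed Module.module.smult_r_null abelian_monoid.a_assoc abelian_monoid.a_comm\<close>)

lemma linear_maps_zero:
 assumes "is_module M" "is_module N" "f \<in> linear_maps M N"
 shows "f 0[M] = 0[N]"
 using linear_mapsD(3)[OF assms(3) module_laws(1)[OF assms(1)], of 0]
  module_laws(13)[OF assms(2) linear_mapsD(1)[OF assms(3) module_laws(1)[OF assms(1)]]]
 by (simp add: module_laws(13)[OF assms(1)] module_laws(1)[OF assms(1)])

lemma (in linear_category) Comp_in:
 "x \<in> Obj C ==> y \<in> Obj C ==> z \<in> Obj C ==> f \<in> Arr C x y ==> g \<in> Arr C y z ==> Comp C x y z g f \<in> Arr C x z"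
 using linear_mapsD(1)[OF Comp_linear_right] by blast

lemma module_category_simps [simp]:
 "Obj Md = {M. is_module M}"
 "Comp Md L M N g f = compose (carrier L) g f"
 "Ident Md M = (\<lambda>x\<in>carrier M. x)"
 "carrier (Hom Md M N) = linear_maps M N \<inter> extensional (carrier M)"
 "zero (Hom Md M N) = (\<lambda>x\<in>carrier M. 0[N])"
 "f +[Hom Md M N] g = (\<lambda>x\<in>carrier M. f x +[N] g x)"
 "c *[Hom Md M N] f = (\<lambda>x\<in>carrier M. c *[N] f x)"
 by (simp_all add: module_category_def)

lemma linear_category_module_category:
 "linear_category (Md :: (('k::comm_ring_1, 'u) module, 'u => 'u, 'k) lincat)"
proof (rule linear_category.intro)
 fix M N :: "('k, 'u) module"
 assume "M \<in> Obj Md" "N \<in> Obj Md"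
 then have m: "is_module M" "is_module N" by simp_all
 note L = module_laws[OF m(1)] module_laws[OF m(2)]
 have c: "(\<lambda>x\<in>carrier M. f x +[N] g x) \<in> linear_maps M N"
  if "f \<in> linear_maps M N" "g \<in> linear_maps M N" for f g
  by (rule linear_mapsI) (simp_all add: L linear_mapsD[OF that(1)] linear_mapsD[OF that(2)])
 have s: "(\<lambda>x\<in>carrier M. c *[N] f x) \<in> linear_maps M N" if "f \<in> linear_maps M N" for f c
  by (rule linear_mapsI) (simp_all add: L linear_mapsD[OF that])
 have i: "f x \<in> carrier N" if "f \<in> linear_maps M N" "x \<in> carrier M" for f x by (rule linear_mapsD(1)[OF that])
 have z: "(\<lambda>x\<in>carrier M. 0[N]) \<in> linear_maps M N" by (rule linear_mapsI) (simp_all add: L)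
 show "is_module (Hom Md M N)"
  by (rule is_moduleI, simp_all add: c s i z L extensional_restrict cong: restrict_cong)
qed (auto simp: linear_mapsD module_laws(2,8) compose_def extensional_restrict cong: restrict_cong intro!: linear_mapsI)

lemma nat_trans_iff: "\<eta> \<in> nat_trans C D F G \<longleftrightarrow> \<eta> \<in> extensional (Obj C) &
  (\<forall>x\<in>Obj C. \<eta> x \<in> Arr D (Fobj F x) (Fobj G x)) &
  (\<forall>x\<in>Obj C. \<forall>y\<in>Obj C. \<forall>f\<in>Arr C x y.
    Comp D (Fobj F x) (Fobj F y) (Fobj G y) (\<eta> y) (Fmap F x y f) =
    Comp D (Fobj F x) (Fobj G x) (Fobj G y) (Fmap G x y f) (\<eta> x))"
 by (auto simp: nat_trans_def PiE_def)

lemma functor_category_simps [simp]: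
 "Obj (functor_category C D) = {F. linear_functor C D F}"
 "Comp (functor_category C D) F G H \<theta> \<eta> = (\<lambda>x\<in>Obj C. Comp D (Fobj F x) (Fobj G x) (Fobj H x) (\<theta> x) (\<eta> x))"
 "Ident (functor_category C D) F = (\<lambda>x\<in>Obj C. Ident D (Fobj F x))"
 "carrier (Hom (functor_category C D) F G) = nat_trans C D F G"
 "zero (Hom (functor_category C D) F G) = (\<lambda>x\<in>Obj C. 0[Hom D (Fobj F x) (Fobj G x)])"
 "\<eta> +[Hom (functor_category C D) F G] \<theta> = (\<lambda>x\<in>Obj C. \<eta> x +[Hom D (Fobj F x) (Fobj G x)] \<theta> x)"
 "c *[Hom (functor_category C D) F G] \<eta> = (\<lambda>x\<in>Obj C. c *[Hom D (Fobj F x) (Fobj G x)] \<eta> x)"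
 by (simp_all add: functor_category_def)

lemma linear_functor_arr:
 assumes "linear_functor C D F" "x \<in> Obj C" "y \<in> Obj C" "f \<in> Arr C x y"
 shows "Fmap F x y f \<in> Arr D (Fobj F x) (Fobj F y)"
 using linear_mapsD(1)[OF linear_functor.Fmap_linear[OF assms(1-3)] assms(4)] .

lemma linear_category_functor_category:
 assumes C: "linear_category C" and D: "linear_category D"
 shows "linear_category (functor_category C D)"
proof -
 interpret C: linear_category C by (rule C)
 interpret D: linear_category D by (rule D)
 note O = linear_functor.Fobj_in and A = linear_functor_arr
 have add: "(\<lambda>x\<in>Obj C. \<eta> x +[Hom D (Fobj F x) (Fobj G x)] \<theta> x) \<in> nat_trans C D F G"
  if "linear_functor C D F" "linear_functor C D G" "\<eta> \<in> nat_trans C D F G" "\<theta> \<in> nat_trans C D F G" for F G \<eta> \<theta>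
  using that unfolding nat_trans_iff
  by (auto simp: module_laws[OF D.Hom_module] O A linear_mapsD[OF D.Comp_linear_left] linear_mapsD[OF D.Comp_linear_right])
 have scale: "(\<lambda>x\<in>Obj C. c *[Hom D (Fobj F x) (Fobj G x)] \<eta> x) \<in> nat_trans C D F G"
  if "linear_functor C D F" "linear_functor C D G" "\<eta> \<in> nat_trans C D F G" for F G \<eta> c
  using that unfolding nat_trans_iff
  by (auto simp: module_laws[OF D.Hom_module] O A linear_mapsD[OF D.Comp_linear_left] linear_mapsD[OF D.Comp_linear_right])
 have zero: "(\<lambda>x\<in>Obj C. 0[Hom D (Fobj F x) (Fobj G x)]) \<in> nat_trans C D F G"
  if "linear_functor C D F" "linear_functor C D G" for F G
  using that unfolding nat_trans_iff
  by (auto simp: module_laws[OF D.Hom_module] O A linear_maps_zero[OF D.Hom_module D.Hom_module D.Comp_linear_left]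
    linear_maps_zero[OF D.Hom_module D.Hom_module D.Comp_linear_right])
 have comp: "(\<lambda>x\<in>Obj C. Comp D (Fobj F x) (Fobj G x) (Fobj H x) (\<theta> x) (\<eta> x)) \<in> nat_trans C D F H"
  if F: "linear_functor C D F" "linear_functor C D G" "linear_functor C D H"
   and \<eta>: "\<eta> \<in> nat_trans C D F G" and \<theta>: "\<theta> \<in> nat_trans C D G H" for F G H \<eta> \<theta>
  unfolding nat_trans_iff
 proof (intro conjI ballI)
  fix x y f assume x: "x \<in> Obj C" "y \<in> Obj C" and f: "f \<in> Arr C x y"
  note m = \<eta>[unfolded nat_trans_iff] \<theta>[unfolded nat_trans_iff]
  let ?c = "\<lambda>x y z. Comp D x y z"
  have "?c (Fobj F x) (Fobj F y) (Fobj H y) (?c (Fobj F y) (Fobj G y) (Fobj H y) (\<theta> y) (\<eta> y)) (Fmap F x y f)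
   = ?c (Fobj F x) (Fobj G y) (Fobj H y) (\<theta> y) (?c (Fobj F x) (Fobj F y) (Fobj G y) (\<eta> y) (Fmap F x y f))"
   using F x f m by (intro D.Comp_assoc[symmetric]) (auto simp: O A)
  also have "... = ?c (Fobj F x) (Fobj G y) (Fobj H y) (\<theta> y) (?c (Fobj F x) (Fobj G x) (Fobj G y) (Fmap G x y f) (\<eta> x))"
   using m x f by simp
  also have "... = ?c (Fobj F x) (Fobj G x) (Fobj H y) (?c (Fobj G x) (Fobj G y) (Fobj H y) (\<theta> y) (Fmap G x y f)) (\<eta> x)"
   using F x f m by (intro D.Comp_assoc) (auto simp: O A)
  also have "... = ?c (Fobj F x) (Fobj G x) (Fobj H y) (?c (Fobj G x) (Fobj H x) (Fobj H y) (Fmap H x y f) (\<theta> x)) (\<eta> x)"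
   using m x f by simp
  also have "... = ?c (Fobj F x) (Fobj H x) (Fobj H y) (Fmap H x y f) (?c (Fobj F x) (Fobj G x) (Fobj H x) (\<theta> x) (\<eta> x))"
   using F x f m by (intro D.Comp_assoc[symmetric]) (auto simp: O A)
  finally show "?c (Fobj F x) (Fobj F y) (Fobj H y) ((\<lambda>x\<in>Obj C. ?c (Fobj F x) (Fobj G x) (Fobj H x) (\<theta> x) (\<eta> x)) y) (Fmap F x y f) =
    ?c (Fobj F x) (Fobj H x) (Fobj H y) (Fmap H x y f) ((\<lambda>x\<in>Obj C. ?c (Fobj F x) (Fobj G x) (Fobj H x) (\<theta> x) (\<eta> x)) x)"
   using x by simp
 qed (use F \<eta> \<theta> in \<open>auto simp: nat_trans_iff O intro!: D.Comp_in\<close>)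
 have arr: "\<eta> x \<in> Arr D (Fobj F x) (Fobj G x)" if "\<eta> \<in> nat_trans C D F G" "x \<in> Obj C" for \<eta> F G x
  using that by (simp add: nat_trans_iff)
 have ext: "\<eta> \<in> extensional (Obj C)" if "\<eta> \<in> nat_trans C D F G" for \<eta> F G
  using that by (simp add: nat_trans_iff)
 have eqr: "restrict \<eta> (Obj C) = \<eta>" if "\<eta> \<in> nat_trans C D F G" for \<eta> F G
  by (rule extensional_restrict[OF ext[OF that]])
 have ext1: "(\<lambda>x\<in>Obj C. P x) = \<eta>" if "\<eta> \<in> nat_trans C D F G" "\<And>x. x \<in> Obj C ==> P x = \<eta> x" for P \<eta> F G
  using that ext by (intro extensionalityI[of _ "Obj C"]) auto
 show ?thesis
 proof (rule linear_category.intro)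
  fix F assume "F \<in> Obj (functor_category C D)"
  then have F: "linear_functor C D F" by simp
  show "Ident (functor_category C D) F \<in> Arr (functor_category C D) F F"
   using F by (auto simp: nat_trans_iff O A D.Ident_in D.Comp_Ident_left D.Comp_Ident_right)
  fix G assume "G \<in> Obj (functor_category C D)"
  then have G: "linear_functor C D G" by simp
  note H = module_laws[OF D.Hom_module[OF O[OF F] O[OF G]]]
  show "is_module (Hom (functor_category C D) F G)"
   by (rule is_moduleI, simp_all add: add scale zero F G H arr eqr cong: restrict_cong)
  fix \<eta> assume "\<eta> \<in> Arr (functor_category C D) F G"
  then have \<eta>: "\<eta> \<in> nat_trans C D F G" by simp
  show "Comp (functor_category C D) F G G (Ident (functor_category C D) G) \<eta> = \<eta>"
   using \<eta> by (auto intro!: ext1 D.Comp_Ident_left O[OF F] O[OF G] arr)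
  show "Comp (functor_category C D) F F G \<eta> (Ident (functor_category C D) F) = \<eta>"
   using \<eta> by (auto intro!: ext1 D.Comp_Ident_right O[OF F] O[OF G] arr)
 qed (auto simp: comp O arr linear_mapsD[OF D.Comp_linear_left] linear_mapsD[OF D.Comp_linear_right]
   intro!: linear_mapsI restrict_ext D.Comp_assoc)
qed

text \<open>Preimages and isomorphisms are chosen for all objects of \<open>D\<close>. Each law of
  the functor in the other direction is checked after applying \<open>F\<close>, by
  faithfulness.\<close>

lemma linearly_equivalent_of_fully_faithful:
 assumes F: "linear_functor C D F"
  and full: "\<And>x y g. x \<in> Obj C ==> y \<in> Obj C ==> g \<in> Arr D (Fobj F x) (Fobj F y) ==> \<exists>f\<in>Arr C x y. Fmap F x y f = g"
  and faithful: "\<And>x y f f'. x \<in> Obj C ==> y \<in> Obj C ==> f \<in> Arr C x y ==> f' \<in> Arr C x y ==>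
   Fmap F x y f = Fmap F x y f' ==> f = f'"
  and dense: "\<And>z. z \<in> Obj D ==> \<exists>x\<in>Obj C. \<exists>a. iso_arrow D (Fobj F x) z a"
 shows "linearly_equivalent C D"
proof -
 interpret F: linear_functor C D F by (rule F)
 have "\<exists>x a b. z \<in> Obj D --> x \<in> Obj C & a \<in> Arr D (Fobj F x) z & b \<in> Arr D z (Fobj F x) &
   Comp D (Fobj F x) z (Fobj F x) b a = Ident D (Fobj F x) & Comp D z (Fobj F x) z a b = Ident D z" for z
  using dense[of z] unfolding iso_arrow_def by meson
 then obtain K a b where K: "\<And>z. z \<in> Obj D ==> K z \<in> Obj C"
  and a: "\<And>z. z \<in> Obj D ==> a z \<in> Arr D (Fobj F (K z)) z"
  and b: "\<And>z. z \<in> Obj D ==> b z \<in> Arr D z (Fobj F (K z))"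
  and ba: "\<And>z. z \<in> Obj D ==> Comp D (Fobj F (K z)) z (Fobj F (K z)) (b z) (a z) = Ident D (Fobj F (K z))"
  and ab: "\<And>z. z \<in> Obj D ==> Comp D z (Fobj F (K z)) z (a z) (b z) = Ident D z"
  by metis
 define lift where "lift x y = inv_into (Arr C x y) (Fmap F x y)" for x y
 have bij: "bij_betw (Fmap F x y) (Arr C x y) (Arr D (Fobj F x) (Fobj F y))" if "x \<in> Obj C" "y \<in> Obj C" for x y
  unfolding bij_betw_def
 proof (intro conjI inj_onI equalityI subsetI)
  show "g \<in> Fmap F x y ` Arr C x y" if "g \<in> Arr D (Fobj F x) (Fobj F y)" for g
   using full[OF \<open>x \<in> Obj C\<close> \<open>y \<in> Obj C\<close> that] by blast
 qed (use that faithful linear_functor_arr[OF F] in \<open>auto 4 3\<close>)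
 have lift: "lift x y g \<in> Arr C x y" "Fmap F x y (lift x y g) = g"
  if "x \<in> Obj C" "y \<in> Obj C" "g \<in> Arr D (Fobj F x) (Fobj F y)" for x y g
  using bij[OF that(1,2)] that(3) unfolding lift_def bij_betw_def by (auto intro: inv_into_into f_inv_into_f)
 have lift_lin: "lift x y \<in> linear_maps (Hom D (Fobj F x) (Fobj F y)) (Hom C x y)" if "x \<in> Obj C" "y \<in> Obj C" for x y
  unfolding lift_def using that by (intro linear_maps_inv bij F.Fmap_linear F.C.Hom_module)
 note O = F.Fobj_in K a b F.C.Ident_in F.D.Ident_in
 note ca = F.D.Comp_assoc[symmetric] F.D.Comp_in F.D.Comp_Ident_left F.D.Comp_Ident_right
 have ab': "Comp D w (Fobj F (K z)) z (a z) (Comp D w z (Fobj F (K z)) (b z) g) = g"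
  if "w \<in> Obj D" "z \<in> Obj D" "g \<in> Arr D w z" for w z g
  using F.D.Comp_assoc[of w z "Fobj F (K z)" z g "b z" "a z"] that by (simp add: O ab F.D.Comp_Ident_left)
 have ba': "Comp D w z (Fobj F (K z)) (b z) (Comp D w (Fobj F (K z)) z (a z) g) = g"
  if "w \<in> Obj D" "z \<in> Obj D" "g \<in> Arr D w (Fobj F (K z))" for w z g
  using F.D.Comp_assoc[of w "Fobj F (K z)" z "Fobj F (K z)" g "a z" "b z"] that by (simp add: O ba F.D.Comp_Ident_left)
 \<comment> \<open>An arrow is conjugated by the chosen isomorphisms into the image of
   \<open>F\<close> and then lifted.\<close>
 define G where "G = \<lparr>Fobj = K, Fmap = (\<lambda>z w g. lift (K z) (K w)
   (Comp D (Fobj F (K z)) w (Fobj F (K w)) (b w) (Comp D (Fobj F (K z)) z w g (a z))))\<rparr>"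
 have Gs [simp]: "Fobj G = K" "Fmap G = (\<lambda>z w g. lift (K z) (K w)
   (Comp D (Fobj F (K z)) w (Fobj F (K w)) (b w) (Comp D (Fobj F (K z)) z w g (a z))))"
  by (simp_all add: G_def)
 have FG: "Fmap F (K z) (K w) (Fmap G z w g) = Comp D (Fobj F (K z)) w (Fobj F (K w)) (b w) (Comp D (Fobj F (K z)) z w g (a z))"
  and Garr: "Fmap G z w g \<in> Arr C (K z) (K w)"
  if "z \<in> Obj D" "w \<in> Obj D" "g \<in> Arr D z w" for z w g
  using that by (simp_all add: lift O F.D.Comp_in)
 have G: "linear_functor D C G"
 proof
  fix z w assume zw: "z \<in> Obj D" "w \<in> Obj D"
  show "Fmap G z w \<in> linear_maps (Hom D z w) (Hom C (Fobj G z) (Fobj G w))"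
   unfolding Gs using zw by (intro linear_maps_comp[OF linear_maps_comp[OF F.D.Comp_linear_left F.D.Comp_linear_right] lift_lin]) (simp_all add: O)
 next
  fix z assume z: "z \<in> Obj D"
  show "Fmap G z z (Ident D z) = Ident C (Fobj G z)"
   using z FG[of z z "Ident D z"] Garr[of z z "Ident D z"]
   by (intro faithful[of "K z" "K z"]) (simp_all add: O ca ba F.Fmap_Ident del: Gs(2))
 next
  fix x y z f g assume o: "x \<in> Obj D" "y \<in> Obj D" "z \<in> Obj D" "f \<in> Arr D x y" "g \<in> Arr D y z"
  have "Fmap F (K x) (K z) (Comp C (K x) (K y) (K z) (Fmap G y z g) (Fmap G x y f)) = Fmap F (K x) (K z) (Fmap G x z (Comp D x y z g f))"
   using o by (simp add: F.Fmap_Comp FG Garr O ca ab' del: Gs(2))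
  then show "Fmap G x z (Comp D x y z g f) = Comp C (Fobj G x) (Fobj G y) (Fobj G z) (Fmap G y z g) (Fmap G x y f)"
   using o unfolding Gs(1) by (intro faithful[of "K x" "K z"]) (simp_all add: O ca F.C.Comp_in Garr del: Gs(2))
 qed (simp_all add: K)
 define u where "u x = lift (K (Fobj F x)) x (a (Fobj F x))" for x
 define v where "v x = lift x (K (Fobj F x)) (b (Fobj F x))" for x
 have u: "u x \<in> Arr C (K (Fobj F x)) x" "Fmap F (K (Fobj F x)) x (u x) = a (Fobj F x)"
  and v: "v x \<in> Arr C x (K (Fobj F x))" "Fmap F x (K (Fobj F x)) (v x) = b (Fobj F x)" if "x \<in> Obj C" for x
  using that by (simp_all add: u_def v_def lift O)
 have "nat_isomorphic C C (comp_functor G F) id_functor"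
  unfolding nat_isomorphic_def
 proof (intro bexI[of _ "restrict u (Obj C)"] ballI)
  fix x assume x: "x \<in> Obj C"
  have "Comp C (K (Fobj F x)) x (K (Fobj F x)) (v x) (u x) = Ident C (K (Fobj F x))"
   using x by (intro faithful[of "K (Fobj F x)" "K (Fobj F x)"])
    (simp_all add: u v F.Fmap_Comp F.Fmap_Ident O F.C.Comp_in ba)
  moreover have "Comp C x (K (Fobj F x)) x (u x) (v x) = Ident C x"
   using x by (intro faithful[of x x]) (simp_all add: u v F.Fmap_Comp F.Fmap_Ident O F.C.Comp_in ab)
  ultimately show "iso_arrow C (Fobj (comp_functor G F) x) (Fobj id_functor x) (restrict u (Obj C) x)"
   unfolding iso_arrow_def using x
   by (auto simp: comp_functor_def id_functor_def u v intro!: bexI[of _ "v x"])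
 next
  have "Comp C (K (Fobj F x)) (K (Fobj F y)) y (u y) (Fmap G (Fobj F x) (Fobj F y) (Fmap F x y f))
    = Comp C (K (Fobj F x)) x y f (u x)" if "x \<in> Obj C" "y \<in> Obj C" "f \<in> Arr C x y" for x y f
   using that by (intro faithful[of "K (Fobj F x)" y])
    (simp_all add: u FG Garr F.Fmap_Comp O ca F.C.Comp_in ab' linear_functor_arr[OF F] del: Gs(2))
  then show "restrict u (Obj C) \<in> nat_trans C C (comp_functor G F) id_functor"
   unfolding nat_trans_iff by (auto simp: comp_functor_def id_functor_def u simp del: Gs(2))
 qed
 moreover have "nat_isomorphic D D (comp_functor F G) id_functor"
  unfolding nat_isomorphic_def
 proof (intro bexI[of _ "restrict a (Obj D)"] ballI)
  fix x assume x: "x \<in> Obj D"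
  show "iso_arrow D (Fobj (comp_functor F G) x) (Fobj id_functor x) (restrict a (Obj D) x)"
   unfolding iso_arrow_def using x by (auto simp: comp_functor_def id_functor_def O ab ba intro!: bexI[of _ "b x"])
 next
  show "restrict a (Obj D) \<in> nat_trans D D (comp_functor F G) id_functor"
   unfolding nat_trans_iff by (auto simp: comp_functor_def id_functor_def FG Garr O ca ab' simp del: Gs(2))
 qed
 ultimately show ?thesis unfolding linearly_equivalent_def using F G by blast
qed

text \<open>The pseudo-inverse is transported along the equivalence and conjugated by the unit isomorphism.\<close>

lemma regular_of_linearly_equivalent:
 assumes eq: "linearly_equivalent C D"
  and reg: "\<And>x y f. x \<in> Obj D ==> y \<in> Obj D ==> f \<in> Arr D x y ==>
   \<exists>g\<in>Arr D y x. Comp D x y y (Comp D y x y f g) f = f"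
  and x: "x \<in> Obj C" "y \<in> Obj C" and f: "f \<in> Arr C x y"
 shows "\<exists>g\<in>Arr C y x. Comp C x y y (Comp C y x y f g) f = f"
proof -
 obtain F G where F: "linear_functor C D F" and G: "linear_functor D C G"
  and iso: "nat_isomorphic C C (comp_functor G F) id_functor"
  using eq unfolding linearly_equivalent_def by blast
 obtain \<eta> where \<eta>: "\<eta> \<in> nat_trans C C (comp_functor G F) id_functor"
   "\<forall>x\<in>Obj C. iso_arrow C (Fobj G (Fobj F x)) x (\<eta> x)"
  using iso unfolding nat_isomorphic_def Bex_def
  by (elim exE conjE) (rule that, assumption, simp add: comp_functor_def id_functor_def)
 interpret F: linear_functor C D F by (rule F)
 interpret G: linear_functor D C G by (rule G)
 let ?P = "\<lambda>x. Fobj G (Fobj F x)" and ?c = "\<lambda>x y z. Comp C x y z"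
 obtain j where j: "j \<in> Arr D (Fobj F y) (Fobj F x)"
  and fj: "Comp D (Fobj F x) (Fobj F y) (Fobj F y) (Comp D (Fobj F y) (Fobj F x) (Fobj F y) (Fmap F x y f) j) (Fmap F x y f) = Fmap F x y f"
  using reg[OF F.Fobj_in F.Fobj_in linear_functor_arr[OF F]] x f by meson
 let ?Gf = "Fmap G (Fobj F x) (Fobj F y) (Fmap F x y f)" and ?Gj = "Fmap G (Fobj F y) (Fobj F x) j"
 have P: "?P x \<in> Obj C" "?P y \<in> Obj C" using x F.Fobj_in G.Fobj_in by blast+
 have Ff: "Fmap F x y f \<in> Arr D (Fobj F x) (Fobj F y)" by (rule linear_functor_arr[OF F x f])
 have Ga: "?Gf \<in> Arr C (?P x) (?P y)" "?Gj \<in> Arr C (?P y) (?P x)"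
  using x f j Ff by (auto intro!: linear_functor_arr[OF G] F.Fobj_in)
 have Gfj: "?c (?P x) (?P y) (?P y) (?c (?P y) (?P x) (?P y) ?Gf ?Gj) ?Gf = ?Gf"
  using arg_cong[OF fj, of "Fmap G (Fobj F x) (Fobj F y)"] x j Ff
  by (simp add: G.Fmap_Comp F.Fobj_in F.D.Comp_in)
 obtain k where k: "k \<in> Arr C y (?P y)" "?c (?P y) y (?P y) k (\<eta> y) = Ident C (?P y)" "?c y (?P y) y (\<eta> y) k = Ident C y"
  using bspec[OF \<eta>(2) x(2)] by (auto simp: iso_arrow_def comp_functor_def id_functor_def)
 obtain l where l: "l \<in> Arr C x (?P x)" "?c x (?P x) x (\<eta> x) l = Ident C x"
  using bspec[OF \<eta>(2) x(1)] by (auto simp: iso_arrow_def comp_functor_def id_functor_def)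
 have h: "\<eta> x \<in> Arr C (?P x) x" "\<eta> y \<in> Arr C (?P y) y"
  using \<eta>(1) x by (auto simp: nat_trans_iff comp_functor_def id_functor_def)
 have n: "?c (?P x) (?P y) y (\<eta> y) ?Gf = ?c (?P x) x y f (\<eta> x)"
  using \<eta>(1) x f unfolding nat_trans_iff by (simp add: comp_functor_def id_functor_def)
 note ca = F.C.Comp_assoc[symmetric] F.C.Comp_in F.C.Comp_Ident_left F.C.Comp_Ident_right
 have n': "?c w x y f (?c w (?P x) x (\<eta> x) t) = ?c w (?P y) y (\<eta> y) (?c w (?P x) (?P y) ?Gf t)"
  if "w \<in> Obj C" "t \<in> Arr C w (?P x)" for w t
  using that n x P h Ga f F.C.Comp_assoc[of w "?P x" x y t "\<eta> x" f] F.C.Comp_assoc[of w "?P x" "?P y" y t ?Gf "\<eta> y"] by simp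
 have k': "?c w y (?P y) k (?c w (?P y) y (\<eta> y) t) = t" if "w \<in> Obj C" "t \<in> Arr C w (?P y)" for w t
  using that x P h k F.C.Comp_assoc[of w "?P y" y "?P y" t "\<eta> y" k] by (simp add: F.C.Comp_Ident_left)
 have fl: "f = ?c x (?P y) y (\<eta> y) (?c x (?P x) (?P y) ?Gf l)"
  using n'[OF x(1) l(1)] l f x by (simp add: F.C.Comp_Ident_right)
 have Gfj': "?c x (?P x) (?P y) ?Gf (?c x (?P y) (?P x) ?Gj (?c x (?P x) (?P y) ?Gf l)) = ?c x (?P x) (?P y) ?Gf l"
  using arg_cong[OF Gfj, of "\<lambda>t. ?c x (?P x) (?P y) t l"] x P Ga l by (simp add: ca)
 define g where "g = ?c y (?P x) x (\<eta> x) (?c y (?P y) (?P x) ?Gj k)"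
 have g: "g \<in> Arr C y x" unfolding g_def using x P h Ga k by (simp add: F.C.Comp_in)
 have kf: "?c x y (?P y) k f = ?c x (?P x) (?P y) ?Gf l"
  using k'[OF x(1), of "?c x (?P x) (?P y) ?Gf l"] x P Ga l by (simp add: fl[symmetric] F.C.Comp_in)
 have "?c x y y (?c y x y f g) f = ?c x y y (?c y (?P y) y (\<eta> y) (?c y (?P x) (?P y) ?Gf (?c y (?P y) (?P x) ?Gj k))) f"
  unfolding g_def using n'[OF x(2), of "?c y (?P y) (?P x) ?Gj k"] x P Ga k by (simp add: F.C.Comp_in)
 also have "... = ?c x (?P y) y (\<eta> y) (?c x (?P x) (?P y) ?Gf (?c x (?P y) (?P x) ?Gj (?c x y (?P y) k f)))"
  using x P h Ga k f by (simp add: ca)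
 also have "... = f" unfolding kf Gfj' by (rule fl[symmetric])
 finally show ?thesis using g by blast
qed

section \<open>Module-valued functors\<close>

lemma module_functorD:
 assumes M: "linear_functor C Md M" and x: "x \<in> Obj C"
 shows "is_module (Fobj M x)"
  and "m \<in> car M x ==> Fmap M x x (Ident C x) m = m"
  and "y \<in> Obj C ==> g \<in> Arr C x y ==> Fmap M x y g \<in> linear_maps (Fobj M x) (Fobj M y)"
  and "y \<in> Obj C ==> g \<in> Arr C x y ==> Fmap M x y g \<in> extensional (car M x)"
  and "y \<in> Obj C ==> g \<in> Arr C x y ==> h \<in> Arr C x y ==> m \<in> car M x ==>
   Fmap M x y (g +[Hom C x y] h) m = Fmap M x y g m +[Fobj M y] Fmap M x y h m"
  and "y \<in> Obj C ==> g \<in> Arr C x y ==> m \<in> car M x ==>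
   Fmap M x y (c *[Hom C x y] g) m = c *[Fobj M y] Fmap M x y g m"
  and "y \<in> Obj C ==> z \<in> Obj C ==> g \<in> Arr C x y ==> h \<in> Arr C y z ==> m \<in> car M x ==>
   Fmap M x z (Comp C x y z h g) m = Fmap M y z h (Fmap M x y g m)"
proof -
 interpret M: linear_functor C Md M by (rule M)
 show "is_module (Fobj M x)" using M.Fobj_in[OF x] by simp
 show "Fmap M x x (Ident C x) m = m" if "m \<in> car M x"
  using that by (simp add: M.Fmap_Ident[OF x])
 fix y assume y: "y \<in> Obj C"
 note l = linear_mapsD[OF M.Fmap_linear[OF x y]]
 {
  fix g assume g: "g \<in> Arr C x y"
  show "Fmap M x y g \<in> linear_maps (Fobj M x) (Fobj M y)" "Fmap M x y g \<in> extensional (car M x)"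
   using l(1)[OF g] by auto
  assume m: "m \<in> car M x"
  show "Fmap M x y (c *[Hom C x y] g) m = c *[Fobj M y] Fmap M x y g m"
   using m by (simp add: l(3)[OF g])
  show "Fmap M x y (g +[Hom C x y] h) m = Fmap M x y g m +[Fobj M y] Fmap M x y h m" if "h \<in> Arr C x y"
   using m by (simp add: l(2)[OF g that])
  show "Fmap M x z (Comp C x y z h g) m = Fmap M y z h (Fmap M x y g m)" if "z \<in> Obj C" "h \<in> Arr C y z"
   using m by (simp add: M.Fmap_Comp[OF x y that(1) g that(2)] compose_def)
 }
qed

lemma module_functorI:
 assumes C: "linear_category C"
  and P: "\<And>x. x \<in> Obj C ==> is_module (P x)"
  and lin: "\<And>x y g. x \<in> Obj C ==> y \<in> Obj C ==> g \<in> Arr C x y ==> act x y g \<in> linear_maps (P x) (P y)"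
  and add: "\<And>x y g h m. x \<in> Obj C ==> y \<in> Obj C ==> g \<in> Arr C x y ==> h \<in> Arr C x y ==> m \<in> carrier (P x) ==>
   act x y (g +[Hom C x y] h) m = act x y g m +[P y] act x y h m"
  and scale: "\<And>x y c g m. x \<in> Obj C ==> y \<in> Obj C ==> g \<in> Arr C x y ==> m \<in> carrier (P x) ==>
   act x y (c *[Hom C x y] g) m = c *[P y] act x y g m"
  and id: "\<And>x m. x \<in> Obj C ==> m \<in> carrier (P x) ==> act x x (Ident C x) m = m"
  and comp: "\<And>x y z g h m. x \<in> Obj C ==> y \<in> Obj C ==> z \<in> Obj C ==> g \<in> Arr C x y ==> h \<in> Arr C y z ==>
   m \<in> carrier (P x) ==> act x z (Comp C x y z h g) m = act y z h (act x y g m)"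
 shows "linear_functor C Md \<lparr>Fobj = P, Fmap = (\<lambda>x y g. restrict (act x y g) (carrier (P x)))\<rparr>"
proof -
 interpret C: linear_category C by (rule C)
 have r: "restrict (act x y g) (carrier (P x)) \<in> linear_maps (P x) (P y)" if "x \<in> Obj C" "y \<in> Obj C" "g \<in> Arr C x y" for x y g
  by (rule linear_maps_cong[OF P[OF that(1)] lin[OF that]]) simp
 let ?M = "\<lparr>Fobj = P, Fmap = (\<lambda>x y g. restrict (act x y g) (carrier (P x)))\<rparr>"
 have i: "act x y g m \<in> carrier (P y)" if "x \<in> Obj C" "y \<in> Obj C" "g \<in> Arr C x y" "m \<in> carrier (P x)" for x y g m
  using linear_mapsD(1)[OF lin[OF that(1-3)] that(4)] .
 show ?thesis
 proof (intro linear_functor.intro linear_functor_axioms.intro C linear_category_module_category)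
  fix x y assume xy: "x \<in> Obj C" "y \<in> Obj C"
  show "Fmap ?M x y \<in> linear_maps (Hom C x y) (Hom Md (Fobj ?M x) (Fobj ?M y))"
   by (rule linear_mapsI)
    (simp_all add: xy r module_laws(2,8)[OF C.Hom_module[OF xy]] add scale cong: restrict_cong)
  fix z f g assume "z \<in> Obj C" "f \<in> Arr C x y" "g \<in> Arr C y z"
  then show "Fmap ?M x z (Comp C x y z g f) = Comp Md (Fobj ?M x) (Fobj ?M y) (Fobj ?M z) (Fmap ?M y z g) (Fmap ?M x y f)"
   using xy by (simp add: compose_def comp i cong: restrict_cong)
 qed (simp_all add: P id cong: restrict_cong)
qed

lemma module_nat_iff:
 assumes M: "linear_functor C Md M" and N: "linear_functor C Md N"
 shows "\<eta> \<in> nat_trans C Md M N \<longleftrightarrow> \<eta> \<in> extensional (Obj C) &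
  (\<forall>x\<in>Obj C. \<eta> x \<in> linear_maps (Fobj M x) (Fobj N x) & \<eta> x \<in> extensional (car M x)) &
  (\<forall>x\<in>Obj C. \<forall>y\<in>Obj C. \<forall>g\<in>Arr C x y. \<forall>m\<in>car M x. \<eta> y (Fmap M x y g m) = Fmap N x y g (\<eta> x m))"
proof -
 have c: "compose A f g = compose A f' g' \<longleftrightarrow> (\<forall>m\<in>A. f (g m) = f' (g' m))" for A f g f' g'
  by (auto simp: compose_def restrict_def fun_eq_iff)
 show ?thesis by (simp add: nat_trans_iff c Int_iff)
qed

lemma module_nat_transI:
 assumes M: "linear_functor C Md M" and N: "linear_functor C Md N"
  and lin: "\<And>x. x \<in> Obj C ==> \<theta> x \<in> linear_maps (Fobj M x) (Fobj N x)"
  and nat: "\<And>x y g m. x \<in> Obj C ==> y \<in> Obj C ==> g \<in> Arr C x y ==> m \<in> car M x ==>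
   \<theta> y (Fmap M x y g m) = Fmap N x y g (\<theta> x m)"
 shows "(\<lambda>x\<in>Obj C. restrict (\<theta> x) (car M x)) \<in> nat_trans C Md M N"
 unfolding module_nat_iff[OF M N]
 by (auto simp: nat linear_mapsD(1)[OF module_functorD(3)[OF M]]
   intro!: linear_maps_cong[OF module_functorD(1)[OF M] lin])

lemma module_iso_arrowI:
 assumes M: "linear_functor C Md M" and N: "linear_functor C Md N"
  and \<eta>: "\<eta> \<in> nat_trans C Md M N"
  and bij: "\<And>x. x \<in> Obj C ==> bij_betw (\<eta> x) (car M x) (car N x)"
 shows "iso_arrow (functor_category C Md) M N \<eta>"
proof -
 note \<eta>' = \<eta>[unfolded module_nat_iff[OF M N]]
 let ?\<theta> = "\<lambda>x. inv_into (car M x) (\<eta> x)"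
 have l: "?\<theta> x (\<eta> x m) = m" if "x \<in> Obj C" "m \<in> car M x" for x m
  using bij[OF that(1)] that(2) by (simp add: bij_betw_def)
 have r: "?\<theta> x n \<in> car M x" "\<eta> x (?\<theta> x n) = n" if "x \<in> Obj C" "n \<in> car N x" for x n
  using bij[OF that(1)] that(2) by (auto simp: bij_betw_def inv_into_into f_inv_into_f)
 have \<theta>: "(\<lambda>x\<in>Obj C. restrict (?\<theta> x) (car N x)) \<in> nat_trans C Md N M"
 proof (rule module_nat_transI[OF N M])
  fix x assume "x \<in> Obj C"
  then show "?\<theta> x \<in> linear_maps (Fobj N x) (Fobj M x)"
   using \<eta>' by (intro linear_maps_inv bij module_functorD(1)[OF M]) auto
 next
  fix x y g n assume o: "x \<in> Obj C" "y \<in> Obj C" "g \<in> Arr C x y" "n \<in> car N x"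
  have "Fmap N x y g n = \<eta> y (Fmap M x y g (?\<theta> x n))" using \<eta>' o r[OF o(1,4)] by simp
  then show "?\<theta> y (Fmap N x y g n) = Fmap M x y g (?\<theta> x n)"
   using o r[OF o(1,4)] by (simp add: l linear_mapsD(1)[OF module_functorD(3)[OF M]])
 qed
 have in1: "\<eta> x m \<in> car N x" if "x \<in> Obj C" "m \<in> car M x" for x m
  using bij[OF that(1)] that(2) by (rule bij_betwE[THEN bspec])
 show ?thesis unfolding iso_arrow_def functor_category_simps
  by (intro conjI \<eta> bexI[OF _ \<theta>]) (auto simp: compose_def l r in1 intro!: restrict_ext)
qed

text \<open>A functor whose values live on an arbitrary type \<open>'b\<close> is moved into the
  universe \<open>'u\<close> along injections of its values; it is here that the universe has to be
  large enough.\<close>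

lemma encode_functor:
 fixes P :: "'o => ('k::comm_ring_1, 'b) module" and C :: "('o, 'a, 'k) lincat"
 assumes C: "linear_category C"
  and P: "\<And>x. x \<in> Obj C ==> is_module (P x)"
  and lin: "\<And>x y g. x \<in> Obj C ==> y \<in> Obj C ==> g \<in> Arr C x y ==> act x y g \<in> linear_maps (P x) (P y)"
  and add: "\<And>x y g h m. x \<in> Obj C ==> y \<in> Obj C ==> g \<in> Arr C x y ==> h \<in> Arr C x y ==> m \<in> carrier (P x) ==>
   act x y (g +[Hom C x y] h) m = act x y g m +[P y] act x y h m"
  and scale: "\<And>x y c g m. x \<in> Obj C ==> y \<in> Obj C ==> g \<in> Arr C x y ==> m \<in> carrier (P x) ==>
   act x y (c *[Hom C x y] g) m = c *[P y] act x y g m"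
  and id: "\<And>x m. x \<in> Obj C ==> m \<in> carrier (P x) ==> act x x (Ident C x) m = m"
  and comp: "\<And>x y z g h m. x \<in> Obj C ==> y \<in> Obj C ==> z \<in> Obj C ==> g \<in> Arr C x y ==> h \<in> Arr C y z ==>
   m \<in> carrier (P x) ==> act x z (Comp C x y z h g) m = act y z h (act x y g m)"
  and inj: "\<And>x. x \<in> Obj C ==> \<exists>e::'b => 'u. inj_on e (carrier (P x))"
 shows "\<exists>Q (E::'o => 'b => 'u). linear_functor C Md Q &
  (\<forall>x\<in>Obj C. E x \<in> linear_maps (P x) (Fobj Q x) & bij_betw (E x) (carrier (P x)) (car Q x)) &
  (\<forall>x\<in>Obj C. \<forall>y\<in>Obj C. \<forall>g\<in>Arr C x y. \<forall>m\<in>carrier (P x). Fmap Q x y g (E x m) = E y (act x y g m))"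
proof -
 obtain E :: "'o => 'b => 'u" where E: "\<And>x. x \<in> Obj C ==> inj_on (E x) (carrier (P x))" using inj by metis
 define D where "D x = inv_into (carrier (P x)) (E x)" for x
 have DE: "D x (E x m) = m" if "x \<in> Obj C" "m \<in> carrier (P x)" for x m
  unfolding D_def using E[OF that(1)] that(2) by simp
 define R :: "'o => ('k, 'u) module" where "R x = \<lparr>carrier = E x ` carrier (P x), monoid.mult = undefined, one = undefined,
  zero = E x 0[P x], add = (\<lambda>u v. E x (D x u +[P x] D x v)), module.smult = (\<lambda>c u. E x (c *[P x] D x u))\<rparr>" for x
 have R [simp]: "carrier (R x) = E x ` carrier (P x)" "zero (R x) = E x 0[P x]"
  "u +[R x] v = E x (D x u +[P x] D x v)" "c *[R x] u = E x (c *[P x] D x u)" for x u v c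
  by (simp_all add: R_def)
 have Rm: "is_module (R x)" if "x \<in> Obj C" for x
  by (rule is_moduleI) (auto simp: DE[OF that] module_laws[OF P[OF that]])
 let ?act = "\<lambda>x y g u. E y (act x y g (D x u))"
 have "linear_functor C Md \<lparr>Fobj = R, Fmap = (\<lambda>x y g. restrict (?act x y g) (carrier (R x)))\<rparr>"
  by (rule module_functorI[OF C Rm])
   (auto intro!: linear_mapsI simp: DE module_laws[OF P] linear_mapsD[OF lin] add scale id comp)
 moreover have "E x \<in> linear_maps (P x) (R x)" "bij_betw (E x) (carrier (P x)) (carrier (R x))" if "x \<in> Obj C" for x
  using E[OF that] by (auto intro!: linear_mapsI simp: DE[OF that] bij_betw_def)
 ultimately show ?thesis
  by (intro exI[of _ "\<lparr>Fobj = R, Fmap = (\<lambda>x y g. restrict (?act x y g) (carrier (R x)))\<rparr>"] exI[of _ E])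
   (simp add: DE)
qed

text \<open>An infinite type is in bijection with its square, so its finite powers embed into it by
  induction.\<close>

lemma inj_on_extensional:
 assumes inf: "infinite (UNIV :: 'u set)" and X: "finite X"
 shows "\<exists>e::('x => 'u) => 'u. inj_on e (extensional X)"
proof -
 obtain pair :: "'u \<times> 'u => 'u" where "bij_betw pair (UNIV \<times> UNIV) UNIV"
  using card_of_ordIso[THEN iffD2, OF card_of_Times_same_infinite[OF inf]] by (rule exE)
 then have pair: "inj pair" by (simp add: bij_betw_def)
 show ?thesis using X
 proof induction
  case empty
  show ?case by (auto simp: inj_on_def extensional_def fun_eq_iff)
 next
  case (insert x X)
  then obtain e :: "('x => 'u) => 'u" where e: "inj_on e (extensional X)" by blast
  have "inj_on (\<lambda>f. pair (f x, e (restrict f X))) (extensional (insert x X))"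
  proof (rule inj_onI)
   fix f g :: "'x => 'u"
   assume f: "f \<in> extensional (insert x X)" and g: "g \<in> extensional (insert x X)"
    and "pair (f x, e (restrict f X)) = pair (g x, e (restrict g X))"
   then have fg: "f x = g x" "restrict f X = restrict g X"
    using pair e by (auto simp: inj_eq dest!: inj_onD)
   have "f y = g y" if "y \<in> X" for y using fun_cong[OF fg(2), of y] that by simp
   then show "f = g" using f g fg(1) by (intro extensionalityI[of _ "insert x X"]) auto
  qed
  then show ?case by blast
 qed
qed

section \<open>Modules over the truncated categories\<close>

text \<open>Serves both truncated categories: \<open>X\<close> is the family of diagrams that span
  the hom-modules.\<close>

lemma truncated_functorD:
 assumes C: "Obj C = {q. q \<preceq> r} & Hom C = (\<lambda>p q. free_module (X p q)) & (\<forall>p q. finite (X p q)) &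
   Comp C = bcomp dl & Ident C = (\<lambda>p. bv (id_diagram p))"
  and M: "linear_functor C Md M" and p: "p \<preceq> r"
 shows "is_module (Fobj M p)"
  and "m \<in> car M p ==> Fmap M p p (bv (id_diagram p)) m = m"
  and "q \<preceq> r ==> g \<in> sp (X p q) ==> Fmap M p q g \<in> linear_maps (Fobj M p) (Fobj M q)"
  and "q \<preceq> r ==> m \<in> car M p ==>
   (\<lambda>g. Fmap M p q g m) \<in> linear_maps (free_module (X p q)) (Fobj M q)"
  and "q \<preceq> r ==> s \<preceq> r ==> g \<in> sp (X p q) ==> h \<in> sp (X q s) ==> m \<in> car M p ==>
   Fmap M p s (bcomp dl p q s h g) m = Fmap M q s h (Fmap M p q g m)"
  and "q \<preceq> r ==> g \<in> sp (X p q) ==> m \<in> car M p ==> Fmap M p q g m \<in> car M q"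
proof -
 note s = C carrier_free
 note D = module_functorD[OF M, of p]
 have 3: "Fmap M p q g \<in> linear_maps (Fobj M p) (Fobj M q)" if "q \<preceq> r" "g \<in> sp (X p q)" for q g
  using D(3)[of q g] p that by (simp add: s)
 have 6: "Fmap M p q g m \<in> car M q" if "q \<preceq> r" "g \<in> sp (X p q)" "m \<in> car M p" for q g m
  using linear_mapsD(1)[OF 3[OF that(1,2)] that(3)] .
 show "is_module (Fobj M p)" using D(1) p by (simp add: s)
 show "Fmap M p p (bv (id_diagram p)) m = m" if "m \<in> car M p"
  using D(2)[of m] p that by (simp add: s)
 show "Fmap M p q g \<in> linear_maps (Fobj M p) (Fobj M q)" if "q \<preceq> r" "g \<in> sp (X p q)" by (rule 3[OF that])
 show "Fmap M p q g m \<in> car M q" if "q \<preceq> r" "g \<in> sp (X p q)" "m \<in> car M p" by (rule 6[OF that])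
 show "Fmap M p s (bcomp dl p q s h g) m = Fmap M q s h (Fmap M p q g m)"
  if "q \<preceq> r" "s \<preceq> r" "g \<in> sp (X p q)" "h \<in> sp (X q s)" "m \<in> car M p"
  using D(7)[of q s g h m] p that by (simp add: s)
 show "(\<lambda>g. Fmap M p q g m) \<in> linear_maps (free_module (X p q)) (Fobj M q)"
  if q: "q \<preceq> r" and m: "m \<in> car M p"
  using D(5)[of q _ _ m] D(6)[of q _ m] p q m 6[OF q _ m] by (intro linear_mapsI) (simp_all add: s)
qed

lemma brauer_truncated: "Obj (Bt r dl) = {q. q \<preceq> r} & Hom (Bt r dl) = (\<lambda>p q. free_module (brauer p q)) &
  (\<forall>p q. finite (brauer p q)) & Comp (Bt r dl) = bcomp dl & Ident (Bt r dl) = (\<lambda>p. bv (id_diagram p))"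
 and symmetric_truncated: "Obj (St r dl) = {q. q \<preceq> r} & Hom (St r dl) = (\<lambda>p q. free_module (Lv p q)) &
  (\<forall>p q. finite (Lv p q)) & Comp (St r dl) = bcomp dl & Ident (St r dl) = (\<lambda>p. bv (id_diagram p))"
 by simp_all

lemmas B_modD = truncated_functorD[OF brauer_truncated]
lemmas S_modD = truncated_functorD[OF symmetric_truncated]

lemma linear_maps_finsum:
 assumes M: "is_module M" and N: "is_module N" and f: "f \<in> linear_maps M N"
  and A: "finite A" and a: "\<And>i. i \<in> A ==> a i \<in> carrier M"
 shows "f (finsum M a A) = finsum N (\<lambda>i. f (a i)) A"
proof -
 interpret M: abelian_monoid M by (rule module_laws(18)[OF M])
 interpret N: abelian_monoid N by (rule module_laws(18)[OF N])
 show ?thesis using A a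
 proof induction
  case empty
  show ?case by (simp add: linear_maps_zero[OF M N f])
 next
  case (insert i A)
  then show ?case
   by (simp add: M.finsum_insert N.finsum_insert Pi_def linear_mapsD[OF f] M.finsum_closed)
 qed
qed

lemma linear_maps_free_sum:
 assumes N: "is_module N" and f: "f \<in> linear_maps (free_module X) N" and X: "finite X"
  and A: "finite A" and a: "\<And>i. i \<in> A ==> a i \<in> sp X"
 shows "f (\<lambda>d. \<Sum>i\<in>A. a i d) = finsum N (\<lambda>i. f (a i)) A"
proof -
 interpret N: abelian_monoid N by (rule module_laws(18)[OF N])
 note l = linear_mapsD[OF f, unfolded carrier_free[OF X] free_add]
 show ?thesis using A a
 proof induction
  case empty
  show ?case using linear_maps_zero[OF module_free N f] by simp
 next
  case (insert i A)
  have "f (\<lambda>d. a i d + (\<Sum>i\<in>A. a i d)) = f (a i) +[N] f (\<lambda>d. \<Sum>i\<in>A. a i d)"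
   using insert by (intro l(2) sum_sp) auto
  then show ?case using insert by (simp add: N.finsum_insert Pi_def l(1))
 qed
qed

lemma linear_maps_free_eq:
 assumes N: "is_module N" and f: "f \<in> linear_maps (free_module X) N" and g: "g \<in> linear_maps (free_module X) N"
  and X: "finite X" and eq: "\<And>x. x \<in> X ==> f (bv x) = g (bv x)" and v: "v \<in> sp X"
 shows "f v = g v"
proof -
 interpret N: abelian_monoid N by (rule module_laws(18)[OF N])
 have c: "(\<lambda>d. v x * bv x d) \<in> sp X" if "x \<in> X" for x
  by (intro scale_sp) (simp add: that)
 have b: "bv x \<in> carrier (free_module X)" if "x \<in> X" for x by (simp add: carrier_free[OF X] that)
 have "f (\<lambda>d. v x * bv x d) = g (\<lambda>d. v x * bv x d)" if "x \<in> X" for x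
  using linear_mapsD(3)[OF f b[OF that], of "v x"] linear_mapsD(3)[OF g b[OF that], of "v x"] eq[OF that] by simp
 then have "finsum N (\<lambda>x. f (\<lambda>d. v x * bv x d)) X = finsum N (\<lambda>x. g (\<lambda>d. v x * bv x d)) X"
  using linear_mapsD(1)[OF g] c by (intro N.finsum_cong') (auto simp: carrier_free[OF X])
 then show ?thesis
  using linear_maps_free_sum[OF N f X X, of "\<lambda>x d. v x * bv x d", OF c]
   linear_maps_free_sum[OF N g X X, of "\<lambda>x d. v x * bv x d", OF c]
  by (simp add: sp_expand[OF X v, symmetric])
qed

lemma is_module_restrict:
 assumes P: "is_module P" and H: "H \<subseteq> carrier P" "0[P] \<in> H"
  and add: "\<And>x y. x \<in> H ==> y \<in> H ==> x +[P] y \<in> H" and scale: "\<And>c x. x \<in> H ==> c *[P] x \<in> H"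
 shows "is_module (P\<lparr>carrier := H\<rparr>)"
 using H(2) by (intro is_moduleI) (auto simp: add scale module_laws[OF P] subsetD[OF H(1)])

section \<open>The idempotents acting on modules\<close>

context non_singular
begin

text \<open>Acting on \<open>id_p\<close> shows that \<open>eu p\<close> is the identity diagram
  plus non-downward ones. It kills the latter, whence its idempotence.\<close>

lemma eu_project_down: "p \<preceq> r ==> pd p p (eu p) = bv (id_diagram p)"
 using eu_down[of p "bv (id_diagram p)" p]
 by (simp add: bcomp_id_left eu_sp project_sp id_diagram_down id_diagram_up Lv_def)

lemma eu_idem: "p \<preceq> r ==> bcomp dl p p p (eu p) (eu p) = eu p"
 using eu_kills_nondown[of p "eu p" p] by (simp add: eu_sp eu_project_down bcomp_id_right)

text \<open>Between two of these idempotents only the level part survives: the corners of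
  \<open>B\<close> that they cut out are copies of the hom-modules of the symmetric groups.\<close>

lemma eu_sandwich:
 assumes p: "p \<preceq> r" and s: "s \<preceq> r" and f: "f \<in> sp (brauer p s)"
 shows "bcomp dl p s s (eu s) (bcomp dl p p s f (eu p)) = bcomp dl p p s (pv p s f) (eu p)"
proof -
 have "bcomp dl p s s (eu s) (bcomp dl p p s f (eu p)) = bcomp dl p p s (bcomp dl p s s (eu s) (pd p s f)) (eu p)"
  using f eu_sp[OF p] eu_sp[OF s] by (simp add: bcomp_assoc eu_kills_nondown[OF s f])
 also have "... = bcomp dl p s s (eu s) (bcomp dl p p s (pu p s (pd p s f)) (eu p))"
  using f eu_sp[OF p] eu_sp[OF s] sp_down[of "pd p s f" p s]
  by (simp add: bcomp_assoc eu_kills_nonup[OF p s])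
 also have "pu p s (pd p s f) = pv p s f"
  by (simp add: project_project Lv_def)
 also have "bcomp dl p s s (eu s) (bcomp dl p p s (pv p s f) (eu p))
  = bcomp dl p s s (eu s) (bcomp dl p s s (eu s) (pv p s f))"
  by (simp only: eu_central[OF p s project_in_sp])
 also have "... = bcomp dl p s s (eu s) (pv p s f)"
  using eu_sp[OF s] eu_idem[OF s] by (simp add: bcomp_assoc[symmetric] sp_Lv)
 also have "... = bcomp dl p p s (pv p s f) (eu p)"
  by (rule eu_central[OF p s project_in_sp, symmetric])
 finally show ?thesis .
qed

text \<open>As \<open>eu p\<close> is idempotent, this is the image of its action on
  \<open>M\<close>.\<close>

definition fixed_module :: "(nat, diagram => 'k, ('k, 'u) module, 'u => 'u) linfun => nat => ('k, 'u) module" where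
 "fixed_module M p = (Fobj M p)\<lparr>carrier := {m \<in> car M p. Fmap M p p (eu p) m = m}\<rparr>"

lemma fixed_module_simps [simp]:
 "zero (fixed_module M p) = 0[Fobj M p]" "x +[fixed_module M p] y = x +[Fobj M p] y"
 "c *[fixed_module M p] x = c *[Fobj M p] x"
 "m \<in> carrier (fixed_module M p) \<longleftrightarrow> m \<in> car M p & Fmap M p p (eu p) m = m"
 by (simp_all add: fixed_module_def)

context
 fixes M :: "(nat, diagram => 'k, ('k, 'u) module, 'u => 'u) linfun"
 assumes M: "linear_functor (Bt r dl) Md M"
begin

lemma is_module_fixed: "p \<preceq> r ==> is_module (fixed_module M p)"
 unfolding fixed_module_def using linear_mapsD[OF B_modD(3)[OF M]]
 by (intro is_module_restrict)
  (auto simp: B_modD(1)[OF M] module_laws[OF B_modD(1)[OF M]] eu_sp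
   linear_maps_zero[OF B_modD(1)[OF M] B_modD(1)[OF M] B_modD(3)[OF M]])

lemma fixed_level:
 assumes p: "p \<preceq> r" "q \<preceq> r" and \<sigma>: "\<sigma> \<in> sp (Lv p q)" and m: "m \<in> carrier (fixed_module M p)"
 shows "Fmap M p q \<sigma> m \<in> carrier (fixed_module M q)"
proof -
 have "Fmap M q q (eu q) (Fmap M p q \<sigma> m) = Fmap M p q (bcomp dl p p q \<sigma> (eu p)) m"
  using p \<sigma> m by (simp add: B_modD(5)[OF M] sp_Lv eu_sp eu_central)
 also have "... = Fmap M p q \<sigma> m"
  using p \<sigma> m by (simp add: B_modD(5)[OF M] sp_Lv eu_sp)
 finally show ?thesis using p \<sigma> m by (simp add: B_modD(6)[OF M] sp_Lv)
qed

lemma fixed_act: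
 assumes p: "p \<preceq> r" "s \<preceq> r" and f: "f \<in> sp (brauer p s)" and m: "m \<in> carrier (fixed_module M p)"
 shows "Fmap M s s (eu s) (Fmap M p s f m) = Fmap M p s (pv p s f) m"
proof -
 have "Fmap M s s (eu s) (Fmap M p s f m) = Fmap M s s (eu s) (Fmap M p s f (Fmap M p p (eu p) m))" using m by simp
 also have "... = Fmap M p s (bcomp dl p s s (eu s) (bcomp dl p p s f (eu p))) m"
  using p f m by (simp add: B_modD(5)[OF M] eu_sp B_modD(6)[OF M])
 also have "... = Fmap M p s (pv p s f) (Fmap M p p (eu p) m)"
  unfolding eu_sandwich[OF p f] using p f m by (intro B_modD(5)[OF M]) (simp_all add: sp_Lv eu_sp)
 finally show ?thesis using m by simp
qed

lemma fixed_eu: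
 assumes p: "p \<preceq> r" "q \<preceq> r" and v: "v \<in> sp (brauer q p)" and m: "m \<in> car M q"
 shows "Fmap M q p (bcomp dl q p p (eu p) v) m \<in> carrier (fixed_module M p)"
 using p v m B_modD(5)[OF M, of q p p "bcomp dl q p p (eu p) v" "eu p" m]
 by (simp add: B_modD(6)[OF M] eu_sp bcomp_assoc[symmetric] eu_idem)

abbreviation "resolution_index q \<equiv> Sigma {s. s \<preceq> q} (\<lambda>s. Um s q)"

text \<open>By the resolution of the identity \<open>m\<close> is a sum of images, under the dual
  elements, of the fixed vectors obtained from it by \<open>eu s\<close> composed with
  \<open>flip h\<close>.\<close>

lemma fixed_detect:
 assumes q: "q \<preceq> r" and m: "m \<in> car M q" "m' \<in> car M q"
  and eq: "\<And>p v. p \<preceq> r ==> v \<in> sp (Dn q p) ==>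
   Fmap M q p (bcomp dl q p p (eu p) v) m = Fmap M q p (bcomp dl q p p (eu p) v) m'"
 shows "m = m'"
proof -
 note I = B_modD(1)[OF M q]
 interpret N: abelian_monoid "Fobj M q" by (rule module_laws(18)[OF I])
 let ?w = "\<lambda>i. bcomp dl q (fst i) (fst i) (eu (fst i)) (bv (flip (snd i)))"
 let ?t = "\<lambda>i. bcomp dl q (fst i) q (dual (fst i) q (snd i)) (?w i)"
 have id: "(\<lambda>d. \<Sum>i\<in>resolution_index q. ?t i d) = bv (id_diagram q)"
  using id_resolution[OF q] by (simp add: sum.Sigma case_prod_unfold)
 have R: "s \<preceq> r" if "s \<preceq> q" for s using parity_le_trans[OF that q] .
 have tsp: "?t i \<in> sp (brauer q q)" for i by simp
 have exp: "n = finsum (Fobj M q) (\<lambda>i. Fmap M q q (?t i) n) (resolution_index q)" if n: "n \<in> car M q" for n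
  using linear_maps_free_sum[OF I B_modD(4)[OF M q q n] finite_brauer, of "resolution_index q" ?t, OF _ tsp]
  by (simp add: id B_modD(2)[OF M q n])
 have "Fmap M q q (?t i) m = Fmap M q q (?t i) m'" if i: "i \<in> resolution_index q" for i
 proof -
  obtain s h where sh: "i = (s, h)" "s \<preceq> q" "h \<in> Um s q" using i by blast
  have "Fmap M q q (?t i) n = Fmap M s q (dual s q h) (Fmap M q s (?w i) n)" if "n \<in> car M q" for n
   using that q R[OF sh(2)] dual(1)[OF q sh(3)] unfolding sh(1) by (simp add: B_modD(5)[OF M] sp_up bcomp_sp)
  moreover have "Fmap M q s (?w i) m = Fmap M q s (?w i) m'"
   unfolding sh(1) using eq[OF R[OF sh(2)], of "bv (flip h)"] sh(3) by (simp add: up_monoD)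
  ultimately show ?thesis using m by simp
 qed
 moreover have "Fmap M q q (?t i) m' \<in> car M q" for i
  using B_modD(6)[OF M q q tsp m(2)] .
 ultimately have "finsum (Fobj M q) (\<lambda>i. Fmap M q q (?t i) m) (resolution_index q)
   = finsum (Fobj M q) (\<lambda>i. Fmap M q q (?t i) m') (resolution_index q)"
  by (intro N.finsum_cong') auto
 then show ?thesis using exp[OF m(1)] exp[OF m(2)] by simp
qed

text \<open>\<open>m\<close> is reassembled as the sum of the dual elements applied to the
  prescribed vectors at \<open>flip h\<close>. Acting with \<open>eu p\<close> composed with
  \<open>v\<close> turns the dual elements into pairings with \<open>v\<close>, and
  \<open>down_dual_expand\<close> restores \<open>v\<close>. Together with
  \<open>fixed_detect\<close> this makes \<open>M\<close> at \<open>q\<close> the module of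
  equivariant maps from \<open>B^-(q, -)\<close> to the fixed vectors.\<close>

lemma fixed_extend:
 assumes q: "q \<preceq> r"
  and \<phi>: "\<And>p. p \<preceq> r ==> \<phi> p \<in> linear_maps (free_module (Dn q p)) (fixed_module M p)"
  and eqv: "\<And>p \<sigma> v. p \<preceq> r ==> \<sigma> \<in> sp (Lv p p) ==> v \<in> sp (Dn q p) ==>
   \<phi> p (bcomp dl q p p \<sigma> v) = Fmap M p p \<sigma> (\<phi> p v)"
 shows "\<exists>m\<in>car M q. \<forall>p v. p \<preceq> r --> v \<in> sp (Dn q p) -->
  Fmap M q p (bcomp dl q p p (eu p) v) m = \<phi> p v"
proof -
 interpret N: abelian_monoid "Fobj M q" by (rule module_laws(18)[OF B_modD(1)[OF M q]])
 have R: "s \<preceq> r" if "s \<preceq> q" for s using parity_le_trans[OF that q] .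
 have \<phi>c: "\<phi> p v \<in> carrier (fixed_module M p)" if "p \<preceq> r" "v \<in> sp (Dn q p)" for p v
  using linear_mapsD(1)[OF \<phi>[OF that(1)]] that(2) by (simp add: carrier_free)
 have fl: "bv (flip h) \<in> sp (Dn q s)" if "h \<in> Um s q" for h s using that by (simp add: up_monoD)
 let ?a = "\<lambda>i. Fmap M (fst i) q (dual (fst i) q (snd i)) (\<phi> (fst i) (bv (flip (snd i))))"
 have a: "?a i \<in> car M q" if i: "i \<in> resolution_index q" for i
 proof -
  obtain s h where sh: "i = (s, h)" "s \<preceq> q" "h \<in> Um s q" using i by blast
  show ?thesis unfolding sh(1) using \<phi>c[OF R[OF sh(2)] fl[OF sh(3)]] B_modD(6)[OF M R[OF sh(2)] q sp_up[OF dual(1)[OF q sh(3)]]]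
   by simp
 qed
 define m where "m = finsum (Fobj M q) ?a (resolution_index q)"
 have m: "m \<in> car M q" unfolding m_def using a by (intro N.finsum_closed) auto
 have "Fmap M q p (bcomp dl q p p (eu p) v) m = \<phi> p v" if p: "p \<preceq> r" and v: "v \<in> sp (Dn q p)" for p v
 proof -
  interpret P: abelian_monoid "Fobj M p" by (rule module_laws(18)[OF B_modD(1)[OF M p]])
  let ?x = "bcomp dl q p p (eu p) v"
  \<comment> \<open>The expansion of \<open>v\<close> by \<open>down_dual_expand\<close>, padded
    with zeros at the objects other than \<open>p\<close> so that it runs over the same index set as
    the sum defining \<open>m\<close>.\<close>
  let ?b = "\<lambda>i. if fst i = p then bcomp dl q p p (pr dl p q p v (dual p q (snd i))) (bv (flip (snd i))) else (\<lambda>_. 0)"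
  have b: "?b i \<in> sp (Dn q p)" if i: "i \<in> resolution_index q" for i
   using i bcomp_down_down[OF sp_Lv_down[OF project_in_sp] fl] by (auto simp: zero_sp)
  have vexp: "v = (\<lambda>d. \<Sum>i\<in>resolution_index q. ?b i d)"
  proof -
   have "(\<Sum>i\<in>resolution_index q. ?b i d) = (\<Sum>s | s \<preceq> q. \<Sum>h\<in>Um s q. ?b (s, h) d)" for d
    by (simp add: sum.Sigma case_prod_unfold cong: if_cong)
   also have "... d = (\<Sum>s | s \<preceq> q. if s = p then \<Sum>h\<in>Um p q.
     bcomp dl q p p (pr dl p q p v (dual p q h)) (bv (flip h)) d else 0)" for d
    by (intro sum.cong) auto
   also have "... d = v d" for d
    using fun_cong[OF down_dual_expand[OF q v], of d] sp_down_empty[OF _ v] by (cases "p \<preceq> q") auto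
   finally show ?thesis by auto
  qed
  have "Fmap M q p ?x m = finsum (Fobj M p) (\<lambda>i. Fmap M q p ?x (?a i)) (resolution_index q)"
   unfolding m_def using p q a
   by (intro linear_maps_finsum B_modD(1,3)[OF M]) auto
  also have "... = finsum (Fobj M p) (\<lambda>i. \<phi> p (?b i)) (resolution_index q)"
  proof (rule P.finsum_cong')
   fix i assume i: "i \<in> resolution_index q"
   then obtain s h where sh: "i = (s, h)" "s \<preceq> q" "h \<in> Um s q" by blast
   note s = R[OF sh(2)]
   have \<phi>s: "\<phi> s (bv (flip h)) \<in> carrier (fixed_module M s)" by (rule \<phi>c[OF s fl[OF sh(3)]])
   have "Fmap M q p ?x (?a i) = Fmap M p p (eu p) (Fmap M s p (bcomp dl s q p v (dual s q h)) (\<phi> s (bv (flip h))))"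
    using p q s v \<phi>s dual(1)[OF q sh(3)] unfolding sh(1)
    by (simp add: B_modD(5)[OF M] B_modD(6)[OF M] sp_up sp_down eu_sp)
   also have "... = Fmap M s p (pr dl s q p v (dual s q h)) (\<phi> s (bv (flip h)))"
    by (rule fixed_act[OF s p bcomp_sp \<phi>s])
   also have "... = \<phi> p (?b i)"
   proof (cases "s = p")
    case True
    then show ?thesis unfolding sh(1) using eqv[OF p, of "pr dl p q p v (dual p q h)" "bv (flip h)"] fl[OF sh(3)] by simp
   next
    case False
    have "Fmap M s p (\<lambda>_. 0) (\<phi> s (bv (flip h))) = 0[Fobj M p]"
     using linear_maps_zero[OF module_free B_modD(1)[OF M p] B_modD(4)[OF M s p]] \<phi>s by simp
    moreover have "\<phi> p (\<lambda>_. 0) = 0[Fobj M p]"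
     using linear_maps_zero[OF module_free is_module_fixed[OF p] \<phi>[OF p]] by simp
    ultimately show ?thesis unfolding sh(1) using False by (simp add: project_Lv_diff)
   qed
   finally show "Fmap M q p ?x (?a i) = \<phi> p (?b i)" .
  qed (use \<phi>c[OF p b] in auto)
  also have "... = \<phi> p v"
  proof -
   have "\<phi> p \<in> linear_maps (free_module (Dn q p)) (Fobj M p)"
    using linear_mapsD[OF \<phi>[OF p]] by (intro linear_mapsI) simp_all
   from linear_maps_free_sum[OF B_modD(1)[OF M p] this finite_down, of "resolution_index q" ?b, OF _ b]
   show ?thesis by (simp add: vexp[symmetric])
  qed
  finally show ?thesis .
 qed
 then show ?thesis using m by blast
qed

end

end

lemma linear_category_Bt: "linear_category (Bt r dl)" and linear_category_St: "linear_category (St r dl)"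
 by (intro linear_category_truncate linear_category_brauer linear_category_symmetric)+

lemma brauer_natD:
 assumes M: "linear_functor (Bt r dl) Md M" and N: "linear_functor (Bt r dl) Md N"
  and \<eta>: "\<eta> \<in> nat_trans (Bt r dl) Md M N"
 shows "p \<preceq> r ==> \<eta> p \<in> linear_maps (Fobj M p) (Fobj N p)"
  and "p \<preceq> r ==> q \<preceq> r ==> g \<in> sp (brauer p q) ==> m \<in> car M p ==> \<eta> q (Fmap M p q g m) = Fmap N p q g (\<eta> p m)"
  and "\<eta> \<in> extensional {p. p \<preceq> r}" and "p \<preceq> r ==> \<eta> p \<in> extensional (car M p)"
 using \<eta> unfolding module_nat_iff[OF M N] by (simp_all add: carrier_free)

lemma symmetric_natD:
 assumes M: "linear_functor (St r dl) Md M" and N: "linear_functor (St r dl) Md N"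
  and \<eta>: "\<eta> \<in> nat_trans (St r dl) Md M N"
 shows "p \<preceq> r ==> \<eta> p \<in> linear_maps (Fobj M p) (Fobj N p)"
  and "p \<preceq> r ==> q \<preceq> r ==> g \<in> sp (Lv p q) ==> m \<in> car M p ==> \<eta> q (Fmap M p q g m) = Fmap N p q g (\<eta> p m)"
  and "\<eta> \<in> extensional {p. p \<preceq> r}" and "p \<preceq> r ==> \<eta> p \<in> extensional (car M p)"
 using \<eta> unfolding module_nat_iff[OF M N] by (simp_all add: carrier_free)

context non_singular
begin

section \<open>The functor of fixed points\<close>

definition fixed_functor ::
 "(nat, diagram => 'k, ('k, 'u) module, 'u => 'u) linfun => (nat, diagram => 'k, ('k, 'u) module, 'u => 'u) linfun" where
 "fixed_functor M = \<lparr>Fobj = fixed_module M,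
   Fmap = (\<lambda>p q \<sigma>. restrict (Fmap M p q \<sigma>) (carrier (fixed_module M p)))\<rparr>"

lemma fixed_functor_simps [simp]: "Fobj (fixed_functor M) = fixed_module M"
 "Fmap (fixed_functor M) p q \<sigma> = restrict (Fmap M p q \<sigma>) (carrier (fixed_module M p))"
 by (simp_all add: fixed_functor_def)

lemma linear_functor_fixed:
 assumes M: "linear_functor (Bt r dl) Md M"
 shows "linear_functor (St r dl) Md (fixed_functor M)"
 unfolding fixed_functor_def
proof (rule module_functorI[OF linear_category_St])
 fix p q \<sigma> assume "p \<in> Obj (St r dl)" "q \<in> Obj (St r dl)" "\<sigma> \<in> Arr (St r dl) p q"
 then have a: "p \<preceq> r" "q \<preceq> r" "\<sigma> \<in> sp (Lv p q)" by (simp_all add: carrier_free)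
 show "Fmap M p q \<sigma> \<in> linear_maps (fixed_module M p) (fixed_module M q)"
  using fixed_level[OF M a] linear_mapsD[OF B_modD(3)[OF M a(1,2) sp_Lv[OF a(3)]]]
  by (intro linear_mapsI) simp_all
 fix m assume m: "m \<in> carrier (fixed_module M p)"
 have l: "(\<lambda>g. Fmap M p q g m) \<in> linear_maps (free_module (brauer p q)) (Fobj M q)"
  using m by (intro B_modD(4)[OF M a(1,2)]) simp
 show "Fmap M p q (c *[Hom (St r dl) p q] \<sigma>) m = c *[fixed_module M q] Fmap M p q \<sigma> m" for c
  using linear_mapsD(3)[OF l, of \<sigma> c] a by (simp add: carrier_free sp_Lv)
 show "Fmap M p q (\<sigma> +[Hom (St r dl) p q] \<tau>) m = Fmap M p q \<sigma> m +[fixed_module M q] Fmap M p q \<tau> m"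
  if "\<tau> \<in> Arr (St r dl) p q" for \<tau>
  using linear_mapsD(2)[OF l, of \<sigma> \<tau>] a that by (simp add: carrier_free sp_Lv)
 show "Fmap M p s (Comp (St r dl) p q s \<tau> \<sigma>) m = Fmap M q s \<tau> (Fmap M p q \<sigma> m)"
  if "s \<in> Obj (St r dl)" "\<tau> \<in> Arr (St r dl) q s" for s \<tau>
  using that a m by (simp add: carrier_free B_modD(5)[OF M] sp_Lv)
qed (simp_all add: is_module_fixed[OF M] B_modD(2)[OF M])

definition fixed_points where
 "fixed_points = \<lparr>Fobj = fixed_functor,
   Fmap = (\<lambda>M N \<eta>. \<lambda>p\<in>Obj (St r dl). restrict (\<eta> p) (carrier (fixed_module M p)))\<rparr>"

lemma fixed_nat_in:
 assumes M: "linear_functor (Bt r dl) Md M" and N: "linear_functor (Bt r dl) Md N"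
  and \<eta>: "\<eta> \<in> nat_trans (Bt r dl) Md M N" and p: "p \<preceq> r" and m: "m \<in> carrier (fixed_module M p)"
 shows "\<eta> p m \<in> carrier (fixed_module N p)"
 using brauer_natD(2)[OF M N \<eta> p p eu_sp[OF p], of m] linear_mapsD(1)[OF brauer_natD(1)[OF M N \<eta> p]] m by simp

lemma fixed_nat:
 assumes M: "linear_functor (Bt r dl) Md M" and N: "linear_functor (Bt r dl) Md N"
  and \<eta>: "\<eta> \<in> nat_trans (Bt r dl) Md M N"
 shows "(\<lambda>p\<in>Obj (St r dl). restrict (\<eta> p) (carrier (fixed_module M p)))
  \<in> nat_trans (St r dl) Md (fixed_functor M) (fixed_functor N)"
proof -
 note h = brauer_natD[OF M N \<eta>]
 have l: "\<eta> p \<in> linear_maps (fixed_module M p) (fixed_module N p)" if "p \<preceq> r" for p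
  using fixed_nat_in[OF M N \<eta> that] linear_mapsD[OF h(1)[OF that]] by (intro linear_mapsI) simp_all
 show ?thesis
  using module_nat_transI[OF linear_functor_fixed[OF M] linear_functor_fixed[OF N], of \<eta>] l fixed_nat_in[OF M N \<eta>] h(2)
  by (simp add: carrier_free sp_Lv)
qed

lemma linear_functor_fixed_points:
 "linear_functor (functor_category (Bt r dl) (Md :: (('k, 'u) module, 'u => 'u, 'k) lincat))
  (functor_category (St r dl) Md) fixed_points"
proof (intro linear_functor.intro linear_functor_axioms.intro linear_category_functor_category
   linear_category_module_category linear_category_Bt linear_category_St)
 fix M N L :: "(nat, diagram => 'k, ('k, 'u) module, 'u => 'u) linfun"
 assume "M \<in> Obj (functor_category (Bt r dl) Md)" "N \<in> Obj (functor_category (Bt r dl) Md)"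
 then have M: "linear_functor (Bt r dl) Md M" and N: "linear_functor (Bt r dl) Md N" by simp_all
 show "Fmap fixed_points M N \<in> linear_maps (Hom (functor_category (Bt r dl) Md) M N)
   (Hom (functor_category (St r dl) Md) (Fobj fixed_points M) (Fobj fixed_points N))"
  by (rule linear_mapsI) (simp_all add: fixed_points_def fixed_nat[OF M N, simplified] cong: restrict_cong)
 fix \<eta> \<theta> assume "L \<in> Obj (functor_category (Bt r dl) Md)"
  and "\<eta> \<in> Arr (functor_category (Bt r dl) Md) M N"
 then have "linear_functor (Bt r dl) Md L" and \<eta>: "\<eta> \<in> nat_trans (Bt r dl) Md M N" by simp_all
 then show "Fmap fixed_points M L (Comp (functor_category (Bt r dl) Md) M N L \<theta> \<eta>) =
   Comp (functor_category (St r dl) Md) (Fobj fixed_points M) (Fobj fixed_points N) (Fobj fixed_points L)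
    (Fmap fixed_points N L \<theta>) (Fmap fixed_points M N \<eta>)"
  using fixed_nat_in[OF M N \<eta>] by (simp add: fixed_points_def compose_def cong: restrict_cong)
qed (simp_all add: fixed_points_def linear_functor_fixed cong: restrict_cong)

lemma fixed_points_faithful:
 assumes M: "linear_functor (Bt r dl) Md M" and N: "linear_functor (Bt r dl) Md N"
  and \<eta>: "\<eta> \<in> nat_trans (Bt r dl) Md M N" and \<theta>: "\<theta> \<in> nat_trans (Bt r dl) Md M N"
  and eq: "\<And>p m. p \<preceq> r ==> m \<in> carrier (fixed_module M p) ==> \<eta> p m = \<theta> p m"
 shows "\<eta> = \<theta>"
proof -
 have "\<eta> q m = \<theta> q m" if q: "q \<preceq> r" and m: "m \<in> car M q" for q m
 proof (rule fixed_detect[OF N q])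
  fix p and v :: "diagram => 'k" assume p: "p \<preceq> r" and v: "v \<in> sp (Dn q p)"
  show "Fmap N q p (bcomp dl q p p (eu p) v) (\<eta> q m) = Fmap N q p (bcomp dl q p p (eu p) v) (\<theta> q m)"
   using eq[OF p fixed_eu[OF M p q sp_down[OF v] m]] brauer_natD(2)[OF M N \<eta> q p bcomp_sp m]
    brauer_natD(2)[OF M N \<theta> q p bcomp_sp m] by simp
 qed (use linear_mapsD(1)[OF brauer_natD(1)[OF M N _ q] m] \<eta> \<theta> in auto)
 then have "\<eta> q = \<theta> q" if "q \<preceq> r" for q
  using that brauer_natD(4)[OF M N \<eta> that] brauer_natD(4)[OF M N \<theta> that] by (intro extensionalityI) auto
 then show ?thesis
  using brauer_natD(3)[OF M N \<eta>] brauer_natD(3)[OF M N \<theta>] by (intro extensionalityI[of _ "{p. p \<preceq> r}"]) auto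
qed

text \<open>The extension of \<open>\<eta>\<close> to all of \<open>M\<close> exists by
  \<open>fixed_extend\<close> and is forced by \<open>fixed_detect\<close>. Its linearity, its
  naturality and its agreement with \<open>\<eta>\<close> all follow from this uniqueness.\<close>

lemma fixed_points_full:
 assumes M: "linear_functor (Bt r dl) Md M" and N: "linear_functor (Bt r dl) Md N"
  and \<eta>: "\<eta> \<in> nat_trans (St r dl) Md (fixed_functor M) (fixed_functor N)"
 shows "\<exists>\<theta>\<in>nat_trans (Bt r dl) Md M N. \<forall>p m. p \<preceq> r --> m \<in> carrier (fixed_module M p) --> \<theta> p m = \<eta> p m"
proof -
 note h = symmetric_natD[OF linear_functor_fixed[OF M] linear_functor_fixed[OF N] \<eta>]
 have h1: "\<eta> p \<in> linear_maps (fixed_module M p) (fixed_module N p)" if "p \<preceq> r" for p using h(1)[OF that] by simp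
 have hc: "\<eta> p m \<in> carrier (fixed_module N p)" if "p \<preceq> r" "m \<in> carrier (fixed_module M p)" for p m
  using linear_mapsD(1)[OF h1[OF that(1)] that(2)] .
 have h2: "\<eta> q (Fmap M p q g m) = Fmap N p q g (\<eta> p m)"
  if "p \<preceq> r" "q \<preceq> r" "g \<in> sp (Lv p q)" "m \<in> carrier (fixed_module M p)" for p q g m
  using h(2)[OF that(1-3)] that(4) hc[OF that(1,4)] by simp
 let ?x = "\<lambda>q p v. bcomp dl q p p (eu p) v"
 let ?R = "\<lambda>q m n. n \<in> car N q & (\<forall>p v. p \<preceq> r --> v \<in> sp (Dn q p) -->
  Fmap N q p (?x q p v) n = \<eta> p (Fmap M q p (?x q p v) m))"
 have ex: "\<exists>n. ?R q m n" if q: "q \<preceq> r" and m: "m \<in> car M q" for q m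
 proof -
  have 1: "(\<lambda>v. \<eta> p (Fmap M q p (?x q p v) m)) \<in> linear_maps (free_module (Dn q p)) (fixed_module N p)"
   if p: "p \<preceq> r" for p
  proof -
   have "(\<lambda>v. ?x q p v) \<in> linear_maps (free_module (Dn q p)) (free_module (brauer q p))"
    by (intro lin_linear_maps lin_bcomp_right) auto
   from linear_maps_comp[OF this B_modD(4)[OF M q p m]]
   have "(\<lambda>v. Fmap M q p (?x q p v) m) \<in> linear_maps (free_module (Dn q p)) (fixed_module M p)"
    using fixed_eu[OF M p q _ m] by (auto simp: linear_maps_def carrier_free sp_down)
   from linear_maps_comp[OF this h1[OF p]] show ?thesis .
  qed
  have 2: "\<eta> p (Fmap M q p (?x q p (bcomp dl q p p \<sigma> v)) m) = Fmap N p p \<sigma> (\<eta> p (Fmap M q p (?x q p v) m))"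
   if p: "p \<preceq> r" and \<sigma>: "\<sigma> \<in> sp (Lv p p)" and v: "v \<in> sp (Dn q p)" for p \<sigma> v
  proof -
   have "?x q p (bcomp dl q p p \<sigma> v) = bcomp dl q p p \<sigma> (?x q p v)"
    using v \<sigma> eu_sp[OF p] eu_central[OF p p \<sigma>] by (simp add: bcomp_assoc[symmetric] sp_Lv sp_down)
   then have "Fmap M q p (?x q p (bcomp dl q p p \<sigma> v)) m = Fmap M p p \<sigma> (Fmap M q p (?x q p v) m)"
    using B_modD(5)[OF M q p p bcomp_sp sp_Lv[OF \<sigma>] m] by simp
   then show ?thesis using h2[OF p p \<sigma> fixed_eu[OF M p q sp_down[OF v] m]] by simp
  qed
  show ?thesis using fixed_extend[OF N q 1 2] by blast
 qed
 define \<theta> where "\<theta> q m = (SOME n. ?R q m n)" for q m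
 have \<theta>: "\<theta> q m \<in> car N q"
  "p \<preceq> r ==> v \<in> sp (Dn q p) ==> Fmap N q p (?x q p v) (\<theta> q m) = \<eta> p (Fmap M q p (?x q p v) m)"
  if "q \<preceq> r" "m \<in> car M q" for q m p v
  using someI_ex[OF ex[OF that]] unfolding \<theta>_def by blast+
 have lin\<theta>: "\<theta> q \<in> linear_maps (Fobj M q) (Fobj N q)" if q: "q \<preceq> r" for q
 proof (rule linear_mapsI)
  fix m m' c assume m: "m \<in> car M q"
  show "\<theta> q m \<in> car N q" by (rule \<theta>(1)[OF q m])
  have lM: "Fmap M q p (?x q p v) \<in> linear_maps (Fobj M q) (Fobj M p)"
   and lN: "Fmap N q p (?x q p v) \<in> linear_maps (Fobj N q) (Fobj N p)" if "p \<preceq> r" for p v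
   using B_modD(3)[OF M q that] B_modD(3)[OF N q that] by simp_all
  note L = linear_mapsD(2,3)[OF lM] linear_mapsD(2,3)[OF lN] linear_mapsD(2,3)[OF h1] fixed_eu[OF M _ q sp_down]
   module_laws(2,8)[OF B_modD(1)[OF M q]] module_laws(2,8)[OF B_modD(1)[OF N q]]
  note e = fixed_eu[OF M _ q sp_down, unfolded fixed_module_simps, THEN conjunct1]
   fixed_eu[OF M _ q sp_down, unfolded fixed_module_simps, THEN conjunct2]
  show "\<theta> q (c *[Fobj M q] m) = c *[Fobj N q] \<theta> q m"
   by (rule fixed_detect[OF N q]) (use m q in \<open>simp_all add: L e \<theta> linear_mapsD(3)[OF h1, unfolded fixed_module_simps]\<close>)
  assume m': "m' \<in> car M q"
  show "\<theta> q (m +[Fobj M q] m') = \<theta> q m +[Fobj N q] \<theta> q m'"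
   by (rule fixed_detect[OF N q]) (use m m' q in \<open>simp_all add: L e \<theta> linear_mapsD(2)[OF h1, unfolded fixed_module_simps]\<close>)
 qed
 have nat: "\<theta> q' (Fmap M q q' g m) = Fmap N q q' g (\<theta> q m)"
  if q: "q \<preceq> r" "q' \<preceq> r" and g: "g \<in> sp (brauer q q')" and m: "m \<in> car M q" for q q' g m
 proof (rule fixed_detect[OF N q(2)])
  fix p and v :: "diagram => 'k" assume p: "p \<preceq> r" and v: "v \<in> sp (Dn q' p)"
  let ?v = "pd q p (bcomp dl q q' p v g)"
  \<comment> \<open>\<open>eu p\<close> kills non-downward diagrams, so the composite of
    \<open>v\<close> and \<open>g\<close> may be replaced by its part in \<open>B^-\<close>, where
    \<open>\<theta>\<close> is characterised.\<close>
  have x: "bcomp dl q q' p (?x q' p v) g = ?x q p ?v"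
   using v g eu_sp[OF p] by (simp add: bcomp_assoc sp_down eu_kills_nondown[OF p])
  have "Fmap N q' p (?x q' p v) (\<theta> q' (Fmap M q q' g m)) = \<eta> p (Fmap M q' p (?x q' p v) (Fmap M q q' g m))"
   by (rule \<theta>(2)[OF q(2) B_modD(6)[OF M q g m] p v])
  also have "Fmap M q' p (?x q' p v) (Fmap M q q' g m) = Fmap M q p (?x q p ?v) m"
   using B_modD(5)[where h = "?x q' p v", OF M q p g bcomp_sp m] by (simp add: x)
  also have "\<eta> p (Fmap M q p (?x q p ?v) m) = Fmap N q p (?x q p ?v) (\<theta> q m)"
   by (rule \<theta>(2)[OF q(1) m p project_in_sp, symmetric])
  also have "... = Fmap N q' p (?x q' p v) (Fmap N q q' g (\<theta> q m))"
   using B_modD(5)[where h = "?x q' p v", OF N q p g bcomp_sp \<theta>(1)[OF q(1) m]] by (simp add: x)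
  finally show "Fmap N q' p (?x q' p v) (\<theta> q' (Fmap M q q' g m)) = Fmap N q' p (?x q' p v) (Fmap N q q' g (\<theta> q m))" .
 qed (use \<theta>(1) q g m B_modD(6)[OF M] B_modD(6)[OF N] in auto)
 have agree: "\<theta> q m = \<eta> q m" if q: "q \<preceq> r" and m: "m \<in> carrier (fixed_module M q)" for q m
 proof (rule fixed_detect[OF N q])
  fix p and v :: "diagram => 'k" assume p: "p \<preceq> r" and v: "v \<in> sp (Dn q p)"
  have *: "Fmap T q p (?x q p v) n = Fmap T q p (pv q p v) n"
   if T: "linear_functor (Bt r dl) Md T" and n: "n \<in> carrier (fixed_module T q)" for T n
   using fixed_act[OF T q p sp_down[OF v] n] B_modD(5)[OF T q p p sp_down[OF v] eu_sp[OF p], of n] n by simp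
  show "Fmap N q p (?x q p v) (\<theta> q m) = Fmap N q p (?x q p v) (\<eta> q m)"
   using \<theta>(2)[OF q _ p v, of m] m *[OF M m] *[OF N hc[OF q m]] h2[OF q p project_in_sp m] by simp
 qed (use \<theta>(1)[OF q] hc[OF q m] m in auto)
 have \<theta>n: "(\<lambda>x\<in>Obj (Bt r dl). restrict (\<theta> x) (car M x)) \<in> nat_trans (Bt r dl) Md M N"
  by (rule module_nat_transI[OF M N]) (simp_all add: lin\<theta> nat carrier_free)
 show ?thesis by (rule bexI[OF _ \<theta>n]) (simp add: agree)
qed

text \<open>The coinduced module: maps from \<open>B^-(q, -)\<close> to \<open>N\<close> that are
  equivariant under the symmetric groups. Its elements are determined by finitely many values in
  \<open>'u\<close>, so it can be encoded there. Both arguments are made extensional so that equal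
  maps are equal elements.\<close>

definition coextension ::
 "(nat, diagram => 'k, ('k, 'u) module, 'u => 'u) linfun => nat => ('k, nat => (diagram => 'k) => 'u) module" where
 "coextension N q = \<lparr>carrier = {\<phi> \<in> extensional {p. p \<preceq> r}. \<forall>p. p \<preceq> r -->
    \<phi> p \<in> linear_maps (free_module (Dn q p)) (Fobj N p) \<inter> extensional (sp (Dn q p)) &
    (\<forall>\<sigma>\<in>sp (Lv p p). \<forall>v\<in>sp (Dn q p). \<phi> p (bcomp dl q p p \<sigma> v) = Fmap N p p \<sigma> (\<phi> p v))},
   monoid.mult = undefined, one = undefined,
   zero = (\<lambda>p\<in>{p. p \<preceq> r}. \<lambda>v\<in>sp (Dn q p). 0[Fobj N p]),
   add = (\<lambda>\<phi> \<psi>. \<lambda>p\<in>{p. p \<preceq> r}. \<lambda>v\<in>sp (Dn q p). \<phi> p v +[Fobj N p] \<psi> p v),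
   module.smult = (\<lambda>c \<phi>. \<lambda>p\<in>{p. p \<preceq> r}. \<lambda>v\<in>sp (Dn q p). c *[Fobj N p] \<phi> p v)\<rparr>"

lemma coextension_simps [simp]:
 "zero (coextension N q) = (\<lambda>p\<in>{p. p \<preceq> r}. \<lambda>v\<in>sp (Dn q p). 0[Fobj N p])"
 "\<phi> +[coextension N q] \<psi> = (\<lambda>p\<in>{p. p \<preceq> r}. \<lambda>v\<in>sp (Dn q p). \<phi> p v +[Fobj N p] \<psi> p v)"
 "c *[coextension N q] \<phi> = (\<lambda>p\<in>{p. p \<preceq> r}. \<lambda>v\<in>sp (Dn q p). c *[Fobj N p] \<phi> p v)"
 by (simp_all add: coextension_def)

context
 fixes N :: "(nat, diagram => 'k, ('k, 'u) module, 'u => 'u) linfun"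
 assumes N: "linear_functor (St r dl) Md N"
begin

lemma coextensionD:
 assumes "\<phi> \<in> carrier (coextension N q)" "p \<preceq> r"
 shows "\<phi> p \<in> linear_maps (free_module (Dn q p)) (Fobj N p)"
  and "v \<in> sp (Dn q p) ==> \<phi> p v \<in> car N p"
  and "\<sigma> \<in> sp (Lv p p) ==> v \<in> sp (Dn q p) ==> \<phi> p (bcomp dl q p p \<sigma> v) = Fmap N p p \<sigma> (\<phi> p v)"
  and "\<phi> p \<in> extensional (sp (Dn q p))" and "\<phi> \<in> extensional {p. p \<preceq> r}"
proof -
 show l: "\<phi> p \<in> linear_maps (free_module (Dn q p)) (Fobj N p)" using assms by (simp add: coextension_def)
 show "v \<in> sp (Dn q p) ==> \<phi> p v \<in> car N p"
  using linear_mapsD(1)[OF l] by (simp add: carrier_free)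
qed (use assms in \<open>auto simp: coextension_def\<close>)

lemma coextension_eqI:
 assumes "\<phi> \<in> carrier (coextension N q)" "\<psi> \<in> carrier (coextension N q)"
  and eq: "\<And>p v. p \<preceq> r ==> v \<in> sp (Dn q p) ==> \<phi> p v = \<psi> p v"
 shows "\<phi> = \<psi>"
proof (rule extensionalityI[of _ "{p. p \<preceq> r}"])
 fix p assume "p \<in> {p. p \<preceq> r}"
 then have p: "p \<preceq> r" by simp
 show "\<phi> p = \<psi> p"
  using coextensionD(4)[OF assms(1) p] coextensionD(4)[OF assms(2) p] eq[OF p] by (rule extensionalityI)
qed (use coextensionD(5)[OF assms(1) parity_le_refl] coextensionD(5)[OF assms(2) parity_le_refl] in auto)

lemma coextensionI:
 assumes lin: "\<And>p. p \<preceq> r ==> \<phi> p \<in> linear_maps (free_module (Dn q p)) (Fobj N p)"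
  and eqv: "\<And>p \<sigma> v. p \<preceq> r ==> \<sigma> \<in> sp (Lv p p) ==> v \<in> sp (Dn q p) ==>
   \<phi> p (bcomp dl q p p \<sigma> v) = Fmap N p p \<sigma> (\<phi> p v)"
 shows "(\<lambda>p\<in>{p. p \<preceq> r}. \<lambda>v\<in>sp (Dn q p). \<phi> p v) \<in> carrier (coextension N q)"
proof -
 have "(\<lambda>v\<in>sp (Dn q p). \<phi> p v) \<in> linear_maps (free_module (Dn q p)) (Fobj N p)" if "p \<preceq> r" for p
  by (rule linear_maps_cong[OF module_free lin[OF that]]) (simp add: carrier_free)
 then show ?thesis by (simp add: coextension_def eqv bcomp_down_down sp_Lv_down)
qed

lemma is_module_coextension: "is_module (coextension N q)"
proof -
 note L = module_laws[OF S_modD(1)[OF N]] and F = linear_mapsD[OF S_modD(3)[OF N]]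
 have e: "(\<lambda>p\<in>{p. p \<preceq> r}. restrict (\<phi> p) (sp (Dn q p))) = \<phi>" if "\<phi> \<in> carrier (coextension N q)" for \<phi>
  using coextensionD(5)[OF that parity_le_refl] coextensionD(4)[OF that]
  by (intro extensionalityI[of _ "{p. p \<preceq> r}"]) (auto simp: extensional_restrict)
 show ?thesis
 proof (rule is_moduleI)
  fix \<phi> \<psi> and c :: 'k assume \<phi>: "\<phi> \<in> carrier (coextension N q)" and \<psi>: "\<psi> \<in> carrier (coextension N q)"
  note l = linear_mapsD[OF coextensionD(1)[OF \<phi>], unfolded carrier_free[OF finite_down] free_add free_smult]
   linear_mapsD[OF coextensionD(1)[OF \<psi>], unfolded carrier_free[OF finite_down] free_add free_smult]
   coextensionD(2,3)[OF \<phi>] coextensionD(2,3)[OF \<psi>]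
  show "\<phi> +[coextension N q] \<psi> \<in> carrier (coextension N q)"
   unfolding coextension_simps by (rule coextensionI) (auto intro!: linear_mapsI simp: l L F carrier_free)
 next
  fix \<phi> and c :: 'k assume \<phi>: "\<phi> \<in> carrier (coextension N q)"
  note l = linear_mapsD[OF coextensionD(1)[OF \<phi>], unfolded carrier_free[OF finite_down] free_add free_smult]
   coextensionD(2,3)[OF \<phi>]
  show "c *[coextension N q] \<phi> \<in> carrier (coextension N q)"
   unfolding coextension_simps by (rule coextensionI) (auto intro!: linear_mapsI simp: l L F carrier_free)
 next
  show "0[coextension N q] \<in> carrier (coextension N q)"
   unfolding coextension_simps
   by (rule coextensionI) (auto intro!: linear_mapsI simp: L linear_maps_zero[OF S_modD(1)[OF N] S_modD(1)[OF N] S_modD(3)[OF N]])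
 qed (simp_all add: L coextensionD(2) e cong: restrict_cong)
qed

text \<open>An arrow acts by precomposition with its truncated right action on
  \<open>B^-\<close>.\<close>

definition coaction :: "nat => nat => (diagram => 'k) => (nat => (diagram => 'k) => 'u) => nat => (diagram => 'k) => 'u" where
 "coaction q q' g \<phi> = (\<lambda>p\<in>{p. p \<preceq> r}. \<lambda>v\<in>sp (Dn q' p). \<phi> p (pd q p (bcomp dl q q' p v g)))"

lemma coaction_in:
 assumes g: "g \<in> sp (brauer q q')" and \<phi>: "\<phi> \<in> carrier (coextension N q)"
 shows "coaction q q' g \<phi> \<in> carrier (coextension N q')"
 unfolding coaction_def
proof (rule coextensionI)
 fix p assume p: "p \<preceq> r"
 show "(\<lambda>v. \<phi> p (pd q p (bcomp dl q q' p v g))) \<in> linear_maps (free_module (Dn q' p)) (Fobj N p)"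
  by (intro linear_maps_comp[OF lin_linear_maps coextensionD(1)[OF \<phi> p]] lin_intros) auto
 fix \<sigma> v :: "diagram => 'k" assume \<sigma>: "\<sigma> \<in> sp (Lv p p)" and v: "v \<in> sp (Dn q' p)"
 have "pd q p (bcomp dl q q' p (bcomp dl q' p p \<sigma> v) g) = bcomp dl q p p \<sigma> (pd q p (bcomp dl q q' p v g))"
  using \<sigma> v g by (simp add: bcomp_assoc sp_Lv sp_down project_down_Lv)
 then show "\<phi> p (pd q p (bcomp dl q q' p (bcomp dl q' p p \<sigma> v) g)) = Fmap N p p \<sigma> (\<phi> p (pd q p (bcomp dl q q' p v g)))"
  using coextensionD(3)[OF \<phi> p \<sigma>] by simp
qed

lemma inj_on_coextension:
 assumes "infinite (UNIV :: 'u set)"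
 shows "\<exists>e :: (nat => (diagram => 'k) => 'u) => 'u. inj_on e (carrier (coextension N q))"
proof -
 let ?X = "Sigma {p. p \<preceq> r} (Dn q)"
 obtain e :: "(nat \<times> diagram => 'u) => 'u" where e: "inj_on e (extensional ?X)"
  using inj_on_extensional[OF assms, of ?X] by auto
 have "inj_on (\<lambda>\<phi>. e (\<lambda>x\<in>?X. \<phi> (fst x) (bv (snd x)))) (carrier (coextension N q))"
 proof (rule inj_onI)
  fix \<phi> \<psi> assume \<phi>: "\<phi> \<in> carrier (coextension N q)" and \<psi>: "\<psi> \<in> carrier (coextension N q)"
   and "e (\<lambda>x\<in>?X. \<phi> (fst x) (bv (snd x))) = e (\<lambda>x\<in>?X. \<psi> (fst x) (bv (snd x)))"
  then have eq: "(\<lambda>x\<in>?X. \<phi> (fst x) (bv (snd x))) = (\<lambda>x\<in>?X. \<psi> (fst x) (bv (snd x)))"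
   using e by (auto dest: inj_onD)
  have "\<phi> p (bv d) = \<psi> p (bv d)" if "p \<preceq> r" "d \<in> Dn q p" for p d
   using fun_cong[OF eq, of "(p, d)"] that by simp
  then show "\<phi> = \<psi>"
   using linear_maps_free_eq[OF S_modD(1)[OF N] coextensionD(1)[OF \<phi>] coextensionD(1)[OF \<psi>] finite_down]
   by (intro coextension_eqI[OF \<phi> \<psi>]) simp
 qed
 then show ?thesis by blast
qed

text \<open>The candidate is the coinduced module. Its fixed vectors are the maps that see only the
  level part of their argument; such a map vanishes at objects other than \<open>q\<close> and is
  determined by its value at \<open>id_q\<close>, which can be any element of \<open>N\<close> at
  \<open>q\<close>.\<close>

lemma fixed_points_dense:
 assumes inf: "infinite (UNIV :: 'u set)"
 shows "\<exists>Q. linear_functor (Bt r dl) Md Q &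
  (\<exists>a. iso_arrow (functor_category (St r dl) Md) (fixed_functor Q) N a)"
proof -
 let ?P = "\<lambda>Q (E :: nat => (nat => (diagram => 'k) => 'u) => 'u). linear_functor (Bt r dl) Md Q &
  (\<forall>x\<in>Obj (Bt r dl). E x \<in> linear_maps (coextension N x) (Fobj Q x) & bij_betw (E x) (carrier (coextension N x)) (car Q x)) &
  (\<forall>x\<in>Obj (Bt r dl). \<forall>y\<in>Obj (Bt r dl). \<forall>g\<in>Arr (Bt r dl) x y. \<forall>m\<in>carrier (coextension N x). Fmap Q x y g (E x m) = E y (coaction x y g m))"
 have "\<exists>Q E. ?P Q E"
 proof (rule encode_functor[OF linear_category_Bt is_module_coextension _ _ _ _ _ inj_on_coextension[OF inf]])
  fix q q' g assume "q \<in> Obj (Bt r dl)" "q' \<in> Obj (Bt r dl)" "g \<in> Arr (Bt r dl) q q'"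
  then have o: "q \<preceq> r" "q' \<preceq> r" "g \<in> sp (brauer q q')" by (simp_all add: carrier_free)
  show "coaction q q' g \<in> linear_maps (coextension N q) (coextension N q')"
   by (rule linear_mapsI, erule coaction_in[OF o(3)]) (simp_all add: coaction_def cong: restrict_cong)
  fix \<phi> assume \<phi>: "\<phi> \<in> carrier (coextension N q)"
  note l = linear_mapsD[OF coextensionD(1)[OF \<phi>], unfolded carrier_free[OF finite_down] free_add free_smult]
  show "coaction q q' (c *[Hom (Bt r dl) q q'] g) \<phi> = c *[coextension N q'] coaction q q' g \<phi>" for c
   by (simp add: coaction_def bcomp_scale_right project_scale l cong: restrict_cong)
  show "coaction q q' (g +[Hom (Bt r dl) q q'] h) \<phi> = coaction q q' g \<phi> +[coextension N q'] coaction q q' h \<phi>" for h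
   by (simp add: coaction_def bcomp_add_right lin_add[OF lin_project] l cong: restrict_cong)
  fix q'' h assume "q'' \<in> Obj (Bt r dl)" "h \<in> Arr (Bt r dl) q' q''"
  then have h: "h \<in> sp (brauer q' q'')" by (simp add: carrier_free)
  show "coaction q q'' (Comp (Bt r dl) q q' q'' h g) \<phi> = coaction q' q'' h (coaction q q' g \<phi>)"
   using o h by (simp add: coaction_def down_absorb bcomp_assoc sp_down cong: restrict_cong)
 next
  fix q \<phi> assume \<phi>: "\<phi> \<in> carrier (coextension N q)"
  show "coaction q q (Ident (Bt r dl) q) \<phi> = \<phi>"
   using \<phi> by (intro coextension_eqI[OF coaction_in \<phi>])
    (simp_all add: coaction_def bcomp_id_right sp_down project_sp id_diagram_brauer)
 qed
 then obtain Q E where QE: "?P Q E" by (elim exE)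
 then have Q: "linear_functor (Bt r dl) Md Q" by (rule conjunct1)
 have E: "E q \<in> linear_maps (coextension N q) (Fobj Q q)" "bij_betw (E q) (carrier (coextension N q)) (car Q q)"
  if "q \<preceq> r" for q using QE that by simp_all
 have EQ: "Fmap Q q q' g (E q \<phi>) = E q' (coaction q q' g \<phi>)"
  if "q \<preceq> r" "q' \<preceq> r" "g \<in> sp (brauer q q')" "\<phi> \<in> carrier (coextension N q)" for q q' g \<phi>
  using QE that by (simp add: carrier_free)
 note EI = bij_betw_imp_inj_on[OF E(2), THEN inj_onD]
 \<comment> \<open>The fixed vector belonging to \<open>n\<close>: \<open>v\<close> acts on
   \<open>n\<close> through its level part.\<close>
 define \<psi> where "\<psi> q n = (\<lambda>p\<in>{p. p \<preceq> r}. \<lambda>v\<in>sp (Dn q p). Fmap N q p (pv q p v) n)" for q n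
 have \<psi>_in: "\<psi> q n \<in> carrier (coextension N q)" if q: "q \<preceq> r" and n: "n \<in> car N q" for q n
  unfolding \<psi>_def
 proof (rule coextensionI)
  fix p assume p: "p \<preceq> r"
  show "(\<lambda>v. Fmap N q p (pv q p v) n) \<in> linear_maps (free_module (Dn q p)) (Fobj N p)"
   by (intro linear_maps_comp[OF lin_linear_maps S_modD(4)[OF N q p n]] lin_project) auto
  fix \<sigma> v :: "diagram => 'k" assume "\<sigma> \<in> sp (Lv p p)" "v \<in> sp (Dn q p)"
  then show "Fmap N q p (pv q p (bcomp dl q p p \<sigma> v)) n = Fmap N p p \<sigma> (Fmap N q p (pv q p v) n)"
   using q p n by (simp add: project_Lv_left sp_down S_modD(5)[OF N])
 qed
 have \<psi>_fixed: "coaction q q (eu q) (\<psi> q n) = \<psi> q n" if q: "q \<preceq> r" and n: "n \<in> car N q" for q n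
  by (rule coextension_eqI[OF coaction_in[OF eu_sp[OF q] \<psi>_in[OF q n]] \<psi>_in[OF q n]])
   (simp add: coaction_def \<psi>_def eu_down[OF q] sp_Lv_down project_sp)
 have \<psi>_lin: "\<psi> q \<in> linear_maps (Fobj N q) (coextension N q)" if q: "q \<preceq> r" for q
  by (rule linear_mapsI, erule \<psi>_in[OF q])
   (simp_all add: \<psi>_def linear_mapsD[OF S_modD(3)[OF N q]] cong: restrict_cong)
 let ?b = "\<lambda>q n. E q (\<psi> q n)"
 have b_fixed: "?b q n \<in> carrier (fixed_module Q q)" if q: "q \<preceq> r" and n: "n \<in> car N q" for q n
  using linear_mapsD(1)[OF E(1)[OF q] \<psi>_in[OF q n]] EQ[OF q q eu_sp[OF q] \<psi>_in[OF q n]] \<psi>_fixed[OF q n] by simp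
 have b_lin: "?b q \<in> linear_maps (Fobj N q) (fixed_module Q q)" if q: "q \<preceq> r" for q
  using linear_mapsD[OF linear_maps_comp[OF \<psi>_lin[OF q] E(1)[OF q]]] b_fixed[OF q] by (intro linear_mapsI) simp_all
 have b_nat: "?b q' (Fmap N q q' \<sigma> n) = Fmap Q q q' \<sigma> (?b q n)"
  if q: "q \<preceq> r" "q' \<preceq> r" and \<sigma>: "\<sigma> \<in> sp (Lv q q')" and n: "n \<in> car N q" for q q' \<sigma> n
 proof -
  have n': "Fmap N q q' \<sigma> n \<in> car N q'" by (rule S_modD(6)[OF N q \<sigma> n])
  have "coaction q q' \<sigma> (\<psi> q n) = \<psi> q' (Fmap N q q' \<sigma> n)"
  proof (rule coextension_eqI[OF coaction_in[OF sp_Lv[OF \<sigma>] \<psi>_in[OF q(1) n]] \<psi>_in[OF q(2) n']])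
   fix p and v :: "diagram => 'k" assume p: "p \<preceq> r" and v: "v \<in> sp (Dn q' p)"
   have "pv q p (pd q p (bcomp dl q q' p v \<sigma>)) = bcomp dl q q' p (pv q' p v) \<sigma>"
    using project_Lv_right[OF sp_down[OF v] \<sigma>, of dl] by (simp add: project_project Lv_def inf.absorb1 inf_assoc)
   then show "coaction q q' \<sigma> (\<psi> q n) p v = \<psi> q' (Fmap N q q' \<sigma> n) p v"
    using p v by (simp add: coaction_def \<psi>_def S_modD(5)[OF N q p \<sigma> project_in_sp n])
  qed
  then show ?thesis using EQ[OF q sp_Lv[OF \<sigma>] \<psi>_in[OF q(1) n]] by simp
 qed
 have b_bij: "bij_betw (?b q) (car N q) (carrier (fixed_module Q q))" if q: "q \<preceq> r" for q
  unfolding bij_betw_def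
 proof (intro conjI inj_onI equalityI subsetI)
  have idd: "bv (id_diagram q) \<in> sp (Dn q q)" by (simp add: id_diagram_down)
  have pid: "pv q q (bv (id_diagram q)) = bv (id_diagram q)"
   by (rule project_sp) (simp add: Lv_def id_diagram_down id_diagram_up)
  have \<psi>id: "\<psi> q n q (bv (id_diagram q)) = n" if "n \<in> car N q" for n
   using q that idd by (simp add: \<psi>_def pid S_modD(2)[OF N])
  fix n n' assume n: "n \<in> car N q" "n' \<in> car N q" and "?b q n = ?b q n'"
  then have "\<psi> q n = \<psi> q n'" by (intro EI[OF q] \<psi>_in q)
  then show "n = n'" using \<psi>id n by metis
 next
  fix u assume u: "u \<in> carrier (fixed_module Q q)"
  then obtain \<phi> where \<phi>: "\<phi> \<in> carrier (coextension N q)" and u\<phi>: "u = E q \<phi>"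
   using E(2)[OF q] by (auto simp: bij_betw_def)
  have "coaction q q (eu q) \<phi> = \<phi>"
   by (rule EI[OF q _ coaction_in[OF eu_sp[OF q] \<phi>] \<phi>]) (use EQ[OF q q eu_sp[OF q] \<phi>] u u\<phi> in simp)
  \<comment> \<open>\<open>eu q\<close> acts on a coinduced element by restricting its argument to
    the level part, so a fixed \<open>\<phi>\<close> depends on that part alone.\<close>
  moreover have "coaction q q (eu q) \<phi> p v = \<phi> p (pv q p v)" if "p \<preceq> r" "v \<in> sp (Dn q p)" for p v
   using that by (simp add: coaction_def eu_down[OF q])
  ultimately have fixed: "\<phi> p v = \<phi> p (pv q p v)" if "p \<preceq> r" "v \<in> sp (Dn q p)" for p v
   using that by simp
  let ?n = "\<phi> q (bv (id_diagram q))"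
  have n: "?n \<in> car N q" using coextensionD(2)[OF \<phi> q] by (simp add: id_diagram_down)
  have "\<phi> = \<psi> q ?n"
  proof (rule coextension_eqI[OF \<phi> \<psi>_in[OF q n]])
   fix p and v :: "diagram => 'k" assume p: "p \<preceq> r" and v: "v \<in> sp (Dn q p)"
   show "\<phi> p v = \<psi> q ?n p v"
   proof (cases "q = p")
    case True
    have "\<phi> q (bcomp dl q q q (pv q q v) (bv (id_diagram q))) = Fmap N q q (pv q q v) ?n"
     by (rule coextensionD(3)[OF \<phi> q]) (simp_all add: id_diagram_down)
    then show ?thesis using fixed[OF p v] p v True by (simp add: \<psi>_def bcomp_id_right sp_Lv)
   next
    case False
    have "\<phi> p (\<lambda>_. 0) = 0[Fobj N p]" "Fmap N q p (\<lambda>_. 0) ?n = 0[Fobj N p]"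
     using linear_maps_zero[OF module_free S_modD(1)[OF N p] coextensionD(1)[OF \<phi> p]]
      linear_maps_zero[OF module_free S_modD(1)[OF N p] S_modD(4)[OF N q p n]] by simp_all
    then show ?thesis using fixed[OF p v] p v by (simp add: \<psi>_def project_Lv_diff[OF False])
   qed
  qed
  then have "u = ?b q ?n" using u\<phi> by simp
  then show "u \<in> ?b q ` car N q" using n by blast
 qed (use b_fixed[OF q] in blast)
 have "iso_arrow (functor_category (St r dl) Md) N (fixed_functor Q)
  (\<lambda>q\<in>Obj (St r dl). restrict (?b q) (car N q))"
 proof (rule module_iso_arrowI[OF N linear_functor_fixed[OF Q] module_nat_transI[OF N linear_functor_fixed[OF Q]]])
  show "?b q' (Fmap N q q' \<sigma> n) = Fmap (fixed_functor Q) q q' \<sigma> (?b q n)"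
   if "q \<in> Obj (St r dl)" "q' \<in> Obj (St r dl)" "\<sigma> \<in> Arr (St r dl) q q'" "n \<in> car N q" for q q' \<sigma> n
   using that b_nat[of q q' \<sigma> n] b_fixed[of q n] by (simp add: carrier_free)
 qed (use b_lin b_bij in simp_all)
 then show ?thesis using Q unfolding iso_arrow_def by blast
qed

end

lemma morita_equivalence:
 assumes inf: "infinite (UNIV :: 'u set)"
 shows "morita_equivalent TYPE('u) (Bt r dl) (St r dl)"
 unfolding morita_equivalent_def
proof (rule linearly_equivalent_of_fully_faithful[OF linear_functor_fixed_points])
 fix M N :: "(nat, diagram => 'k, ('k, 'u) module, 'u => 'u) linfun"
 assume "M \<in> Obj (functor_category (Bt r dl) Md)" "N \<in> Obj (functor_category (Bt r dl) Md)"
 then have M: "linear_functor (Bt r dl) Md M" and N: "linear_functor (Bt r dl) Md N" by simp_all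
 let ?F = "\<lambda>\<eta>. \<lambda>p\<in>Obj (St r dl). restrict (\<eta> p) (carrier (fixed_module M p))"
 have F: "Fmap fixed_points M N \<eta> = ?F \<eta>" for \<eta> by (simp add: fixed_points_def)
 {
  fix \<eta> assume "\<eta> \<in> Arr (functor_category (St r dl) Md) (Fobj fixed_points M) (Fobj fixed_points N)"
  then have \<eta>: "\<eta> \<in> nat_trans (St r dl) Md (fixed_functor M) (fixed_functor N)" by (simp add: fixed_points_def)
  obtain \<theta> where \<theta>: "\<theta> \<in> nat_trans (Bt r dl) Md M N"
   and eq: "\<And>p m. p \<preceq> r ==> m \<in> carrier (fixed_module M p) ==> \<theta> p m = \<eta> p m"
   using fixed_points_full[OF M N \<eta>] by blast
  note e = symmetric_natD(3,4)[OF linear_functor_fixed[OF M] linear_functor_fixed[OF N] \<eta>]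
  have "?F \<theta> p = \<eta> p" if "p \<preceq> r" for p
   using that e(2)[OF that] eq[OF that] by (intro extensionalityI[of _ "carrier (fixed_module M p)"]) auto
  then have "?F \<theta> = \<eta>" using e(1) by (intro extensionalityI[of _ "{p. p \<preceq> r}"]) auto
  then show "\<exists>\<theta>\<in>Arr (functor_category (Bt r dl) Md) M N. Fmap fixed_points M N \<theta> = \<eta>"
   using \<theta> F by auto
 }
 fix \<eta> \<theta> assume "\<eta> \<in> Arr (functor_category (Bt r dl) Md) M N" "\<theta> \<in> Arr (functor_category (Bt r dl) Md) M N"
  and eq: "Fmap fixed_points M N \<eta> = Fmap fixed_points M N \<theta>"
 moreover have "\<eta> p m = \<theta> p m" if "p \<preceq> r" "m \<in> carrier (fixed_module M p)" for p m
  using fun_cong[OF fun_cong[OF eq[unfolded F], of p], of m] that by simp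
 ultimately show "\<eta> = \<theta>" by (intro fixed_points_faithful[OF M N]) simp_all
next
 fix N :: "(nat, diagram => 'k, ('k, 'u) module, 'u => 'u) linfun"
 assume "N \<in> Obj (functor_category (St r dl) Md)"
 then show "\<exists>Q\<in>Obj (functor_category (Bt r dl) Md). \<exists>a.
   iso_arrow (functor_category (St r dl) Md) (Fobj fixed_points Q) N a"
  using fixed_points_dense[OF _ inf, of N] by (auto simp: fixed_points_def)
qed

end

section \<open>Regularity\<close>

definition module_subspace :: "('k::comm_ring_1, 'a) module => 'a set => bool" where
 "module_subspace P H \<longleftrightarrow> H \<subseteq> carrier P & 0[P] \<in> H & (\<forall>x\<in>H. \<forall>y\<in>H. x +[P] y \<in> H) & (\<forall>c. \<forall>x\<in>H. c *[P] x \<in> H)"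

text \<open>Zorn's lemma gives a maximal submodule \<open>D\<close> meeting \<open>H\<close>
  trivially. A vector outside the sum of \<open>H\<close> and \<open>D\<close> could still be
  adjoined to \<open>D\<close>, nonzero scalars being invertible.\<close>

lemma complement_exists:
 fixes P :: "('k::field, 'a) module"
 assumes P: "is_module P" and H: "module_subspace P H"
 shows "\<exists>D. module_subspace P D & H \<inter> D \<subseteq> {0[P]} & (\<forall>x\<in>carrier P. \<exists>h\<in>H. \<exists>d\<in>D. x = h +[P] d)"
proof -
 note L = module_laws[OF P]
 let ?A = "{D. module_subspace P D & H \<inter> D \<subseteq> {0[P]}}"
 have "\<exists>D\<in>?A. \<forall>X\<in>?A. D \<subseteq> X --> X = D"
 proof (rule subset_Zorn_nonempty)
  have "{0[P]} \<in> ?A" by (simp add: module_subspace_def L)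
  then show "?A ~= {}" by blast
  fix C assume C: "C ~= {}" "subset.chain ?A C"
  then have sub: "D \<in> ?A" if "D \<in> C" for D using that by (auto simp: subset.chain_def)
  have "x +[P] y \<in> \<Union>C" if xy: "x \<in> \<Union>C" "y \<in> \<Union>C" for x y
  proof -
   obtain D where "D \<in> C" "x \<in> D" "y \<in> D" using xy C(2) unfolding subset_chain_def by blast
   then show ?thesis using sub[of D] unfolding module_subspace_def by blast
  qed
  moreover have "c *[P] x \<in> \<Union>C" if x: "x \<in> \<Union>C" for c x
  proof -
   obtain D where "D \<in> C" "x \<in> D" using x by blast
   then show ?thesis using sub[of D] unfolding module_subspace_def by blast
  qed
  moreover obtain D where "D \<in> C" using C(1) by blast
  then have "0[P] \<in> \<Union>C" using sub[of D] unfolding module_subspace_def by blast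
  moreover have "\<Union>C \<subseteq> carrier P" "H \<inter> \<Union>C \<subseteq> {0[P]}" using sub unfolding module_subspace_def by blast+
  ultimately show "\<Union>C \<in> ?A" unfolding module_subspace_def by simp
 qed
 then obtain D where DA: "D \<in> ?A" and max: "\<forall>X\<in>?A. D \<subseteq> X --> X = D" by (elim bexE)
 have D: "module_subspace P D" "H \<inter> D \<subseteq> {0[P]}" using DA by simp_all
 have Hc: "x \<in> carrier P" if "x \<in> H" for x using H that unfolding module_subspace_def by blast
 have Dc: "x \<in> carrier P" if "x \<in> D" for x using D(1) that unfolding module_subspace_def by blast
 have Dcl: "0[P] \<in> D" "x \<in> D ==> y \<in> D ==> x +[P] y \<in> D" "x \<in> D ==> c *[P] x \<in> D" for x y c
  using D(1) unfolding module_subspace_def by blast+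
 have "\<exists>h\<in>H. \<exists>d\<in>D. n = h +[P] d" if n: "n \<in> carrier P" for n
 proof (rule ccontr)
  assume no: "\<not> (\<exists>h\<in>H. \<exists>d\<in>D. n = h +[P] d)"
  define D' where "D' = {c *[P] n +[P] d | c d. d \<in> D}"
  have "module_subspace P D'"
   unfolding module_subspace_def
  proof (intro conjI ballI allI subsetI)
   show "0[P] \<in> D'" unfolding D'_def using n Dcl(1) by (intro CollectI exI[of _ 0] exI[of _ "0[P]"]) (simp add: L)
   fix x assume "x \<in> D'"
   then obtain c d where x: "x = c *[P] n +[P] d" "d \<in> D" unfolding D'_def by blast
   show "x \<in> carrier P" unfolding x(1) using n Dc[OF x(2)] by (simp add: L)
   show "a *[P] x \<in> D'" for a
    unfolding D'_def using x n Dc Dcl(3)[OF x(2)] by (intro CollectI exI[of _ "a * c"] exI[of _ "a *[P] d"]) (simp add: L)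
   fix y assume "y \<in> D'"
   then obtain c' d' where y: "y = c' *[P] n +[P] d'" "d' \<in> D" unfolding D'_def by blast
   show "x +[P] y \<in> D'"
    unfolding D'_def using x y n Dc Dcl(2)[OF x(2) y(2)]
    by (intro CollectI exI[of _ "c + c'"] exI[of _ "d +[P] d'"]) (simp add: L)
  qed
  moreover have "H \<inter> D' \<subseteq> {0[P]}"
  proof
   fix h assume "h \<in> H \<inter> D'"
   then obtain c d where h: "h \<in> H" "h = c *[P] n +[P] d" "d \<in> D" unfolding D'_def by blast
   have dc: "d \<in> carrier P" using Dc h(3) .
   show "h \<in> {0[P]}"
   proof (cases "c = 0")
    case True
    then have "h = d" using h(2) n dc by (simp add: L)
    then show ?thesis using D(2) h by blast
   next
    case False
    \<comment> \<open>Solving for \<open>n\<close> places it in the sum of \<open>H\<close> and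
      \<open>D\<close>.\<close>
    have "n = (inverse c * c) *[P] n" using False n by (simp add: L)
    also have "... = (inverse c * c) *[P] n +[P] (inverse c *[P] d +[P] (-1) *[P] (inverse c *[P] d))"
     using n dc by (simp add: L(6,8,19))
    also have "... = inverse c *[P] h +[P] (-1) *[P] (inverse c *[P] d)"
     unfolding h(2) using n dc by (simp only: L)
    finally have e: "n = inverse c *[P] h +[P] (-1) *[P] (inverse c *[P] d)" .
    have "inverse c *[P] h \<in> H" using H h(1) unfolding module_subspace_def by blast
    then show ?thesis using no e Dcl(3)[OF Dcl(3)[OF h(3)]] by blast
   qed
  qed
  moreover have "D \<subseteq> D'"
  proof
   fix d assume "d \<in> D"
   then show "d \<in> D'" unfolding D'_def using n Dc by (intro CollectI exI[of _ 0] exI[of _ d]) (simp add: L)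
  qed
  ultimately have "D' = D" using max by simp
  moreover have "n \<in> D'" unfolding D'_def using n Dcl(1) by (intro CollectI exI[of _ 1] exI[of _ "0[P]"]) (simp add: L)
  moreover have "0[P] \<in> H" using H unfolding module_subspace_def by blast
  ultimately show False using no n L(5)[OF n] by force
 qed
 then show ?thesis using D by blast
qed

text \<open>\<open>k\<close> inverts \<open>f\<close> on a complement of its kernel and is zero on a
  complement of its image.\<close>

lemma linear_map_regular:
 fixes M :: "('k::field, 'a) module" and N :: "('k, 'b) module"
 assumes M: "is_module M" and N: "is_module N" and f: "f \<in> linear_maps M N"
 shows "\<exists>k\<in>linear_maps N M. \<forall>x\<in>carrier M. f (k (f x)) = f x"
proof -
 note LM = module_laws[OF M] and LN = module_laws[OF N] and F = linear_mapsD[OF f]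
 let ?K = "{x \<in> carrier M. f x = 0[N]}" and ?I = "f ` carrier M"
 have "module_subspace M ?K" by (auto simp: module_subspace_def LM LN F linear_maps_zero[OF M N f])
 from complement_exists[OF M this] obtain C where C: "module_subspace M C" "?K \<inter> C \<subseteq> {0[M]}"
  "\<forall>x\<in>carrier M. \<exists>h\<in>?K. \<exists>c\<in>C. x = h +[M] c" by (elim exE conjE)
 have "module_subspace N ?I"
  unfolding module_subspace_def
  by (auto simp: F LM LN simp flip: F(2,3) linear_maps_zero[OF M N f])
 from complement_exists[OF N this] obtain D where D: "module_subspace N D" "?I \<inter> D \<subseteq> {0[N]}"
  "\<forall>x\<in>carrier N. \<exists>h\<in>?I. \<exists>d\<in>D. x = h +[N] d" by (elim exE conjE)
 have Cc: "x \<in> carrier M" if "x \<in> C" for x using C(1) that unfolding module_subspace_def by blast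
 have Dc: "x \<in> carrier N" if "x \<in> D" for x using D(1) that unfolding module_subspace_def by blast
 have Ccl: "x \<in> C ==> y \<in> C ==> x +[M] y \<in> C" "x \<in> C ==> c *[M] x \<in> C" for x y c
  using C(1) unfolding module_subspace_def by blast+
 have Dcl: "x \<in> D ==> y \<in> D ==> x +[N] y \<in> D" "x \<in> D ==> c *[N] x \<in> D" for x y c
  using D(1) unfolding module_subspace_def by blast+
 \<comment> \<open>\<open>n\<close> splits as \<open>f c + d\<close> with \<open>c\<close> in the
   complement of the kernel and \<open>d\<close> in that of the image; \<open>k n\<close> will be
   \<open>c\<close>.\<close>
 let ?R = "\<lambda>n c. c \<in> C & (\<exists>d\<in>D. n = f c +[N] d)"
 have ex: "\<exists>c. ?R n c" if n: "n \<in> carrier N" for n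
 proof -
  obtain m d where md: "m \<in> carrier M" "d \<in> D" "n = f m +[N] d" using bspec[OF D(3) n] by blast
  obtain h c where hc: "h \<in> ?K" "c \<in> C" "m = h +[M] c" using bspec[OF C(3) md(1)] by blast
  then have "f m = f c" using Cc[OF hc(2)] by (simp add: F LN)
  then show ?thesis using md hc by auto
 qed
 have uniq: "c = c'" if R: "?R n c" "?R n c'" for n c c'
 proof (rule LM(15)[OF Cc Cc])
  obtain d d' where d: "d \<in> D" "d' \<in> D" "f c +[N] d = f c' +[N] d'" using R by auto
  note cc = Cc[of c] Cc[of c'] R Dc[OF d(1)] Dc[OF d(2)]
  let ?x = "c +[M] (-1) *[M] c'"
  \<comment> \<open>Rearranging puts \<open>f ?x\<close> into \<open>D\<close>. It also lies in the
    image, so it is zero, and \<open>?x\<close> lies both in the kernel and in its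
    complement.\<close>
  have "f ?x = f c +[N] (-1) *[N] f c' +[N] (d +[N] (-1) *[N] d)" using cc by (simp add: F LM LN)
  also have "... = (f c +[N] d) +[N] ((-1) *[N] f c' +[N] (-1) *[N] d)" using cc by (simp add: F LN del: LN(7,19))
  also have "... = (f c' +[N] (-1) *[N] f c') +[N] (d' +[N] (-1) *[N] d)"
   unfolding d(3) using cc by (simp add: F LN del: LN(7,19))
  also have "... = d' +[N] (-1) *[N] d" using cc by (simp add: F LN)
  finally have "f ?x \<in> D" using Dcl(1)[OF d(2) Dcl(2)[OF d(1)]] by simp
  moreover have "f ?x \<in> ?I" using cc by (intro imageI) (simp add: LM)
  ultimately have "f ?x = 0[N]" using D(2) by blast
  then have "?x \<in> ?K \<inter> C" using cc R Ccl by (simp add: LM)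
  then show "?x = 0[M]" using C(2) by blast
 qed (use R in auto)
 define k where "k n = (THE c. ?R n c)" for n
 have k: "?R n (k n)" if "n \<in> carrier N" for n
  unfolding k_def using ex[OF that] uniq[where n = n] by (rule theI'[OF ex_ex1I])
 have k_eq: "k n = c" if "n \<in> carrier N" "?R n c" for n c using uniq[OF k[OF that(1)] that(2)] .
 have "k \<in> linear_maps N M"
 proof (rule linear_mapsI)
  fix n n' a assume n: "n \<in> carrier N"
  obtain d where d: "k n \<in> C" "d \<in> D" "n = f (k n) +[N] d" using k[OF n] by blast
  show kc: "k n \<in> carrier M" by (rule Cc[OF d(1)])
  have e: "a *[N] n = f (a *[M] k n) +[N] a *[N] d" by (subst d(3)) (simp add: F LN kc Dc d(2))
  show "k (a *[N] n) = a *[M] k n"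
  proof (rule k_eq)
   show "?R (a *[N] n) (a *[M] k n)" using e Ccl(2)[OF d(1)] Dcl(2)[OF d(2)] by blast
  qed (simp add: n LN)
  assume n': "n' \<in> carrier N"
  obtain d' where d': "k n' \<in> C" "d' \<in> D" "n' = f (k n') +[N] d'" using k[OF n'] by blast
  have e: "n +[N] n' = f (k n +[M] k n') +[N] (d +[N] d')"
   by (subst d(3), subst d'(3)) (simp add: F LN kc Cc[OF d'(1)] Dc d(2) d'(2))
  show "k (n +[N] n') = k n +[M] k n'"
  proof (rule k_eq)
   show "?R (n +[N] n') (k n +[M] k n')" using e Ccl(1)[OF d(1) d'(1)] Dcl(1)[OF d(2) d'(2)] by blast
  qed (simp add: n n' LN)
 qed
 moreover have "f (k (f x)) = f x" if x: "x \<in> carrier M" for x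
 proof -
  obtain h c where hc: "h \<in> ?K" "c \<in> C" "x = h +[M] c" using bspec[OF C(3) x] by blast
  then have e: "f x = f c" using Cc[OF hc(2)] by (simp add: F LN)
  moreover have "0[N] \<in> D" using D(1) by (simp add: module_subspace_def)
  ultimately have "?R (f x) c" using hc(2) F(1)[OF Cc[OF hc(2)]] by (auto simp: LN intro!: bexI[of _ "0[N]"])
  then show ?thesis using k_eq[OF F(1)[OF x], of c] e by simp
 qed
 ultimately show ?thesis by blast
qed

lemma linear_maps_pointwise_finsum:
 assumes M: "is_module M" and N: "is_module N" and A: "finite A" and g: "\<And>i. i \<in> A ==> g i \<in> linear_maps M N"
 shows "(\<lambda>x. finsum N (\<lambda>i. g i x) A) \<in> linear_maps M N"
proof -
 interpret N: abelian_monoid N by (rule module_laws(18)[OF N])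
 note L = module_laws[OF N] module_laws[OF M]
 show ?thesis using A g
 proof induction
  case empty
  show ?case by (rule linear_mapsI) (simp_all add: L)
 next
  case (insert i A)
  then have i: "g i \<in> linear_maps M N" and l: "(\<lambda>x. finsum N (\<lambda>i. g i x) A) \<in> linear_maps M N" by simp_all
  have "(\<lambda>x. g i x +[N] finsum N (\<lambda>i. g i x) A) \<in> linear_maps M N"
   by (rule linear_mapsI) (simp_all add: L linear_mapsD[OF i] linear_mapsD[OF l])
  then show ?case
   by (rule linear_maps_cong[OF M]) (use insert linear_mapsD(1)[OF insert.prems] in \<open>simp add: N.finsum_insert Pi_def\<close>)
 qed
qed

lemma finsum_constant:
 fixes N :: "('k::comm_ring_1, 'a) module"
 assumes N: "is_module N" and a: "a \<in> carrier N" and A: "finite A"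
 shows "finsum N (\<lambda>_. a) A = of_nat (card A) *[N] a"
proof -
 interpret N: abelian_monoid N by (rule module_laws(18)[OF N])
 show ?thesis using A
  by induction (use a in \<open>simp_all add: N.finsum_insert module_laws[OF N]\<close>)
qed

text \<open>Averaging a pointwise pseudo-inverse over the symmetric groups makes it equivariant.\<close>

lemma symmetric_regular:
 fixes \<epsilon> :: "'f::field_char_0"
 assumes M: "linear_functor (St r \<epsilon>) Md M" and N: "linear_functor (St r \<epsilon>) Md N"
  and \<eta>: "\<eta> \<in> nat_trans (St r \<epsilon>) Md M N"
 shows "\<exists>\<theta>\<in>nat_trans (St r \<epsilon>) Md N M. \<forall>p m. p \<preceq> r --> m \<in> car M p --> \<eta> p (\<theta> p (\<eta> p m)) = \<eta> p m"
proof -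
 note Mm = S_modD(1)[OF M] and Nm = S_modD(1)[OF N] and h = symmetric_natD(1,2)[OF M N \<eta>]
 have "\<forall>p\<in>{p. p \<preceq> r}. \<exists>k. k \<in> linear_maps (Fobj N p) (Fobj M p) & (\<forall>x\<in>car M p. \<eta> p (k (\<eta> p x)) = \<eta> p x)"
  using linear_map_regular[OF Mm Nm h(1)] by blast
 from bchoice[OF this] obtain k where k: "\<And>p. p \<preceq> r ==> k p \<in> linear_maps (Fobj N p) (Fobj M p)"
  and \<eta>k: "\<And>p x. p \<preceq> r ==> x \<in> car M p ==> \<eta> p (k p (\<eta> p x)) = \<eta> p x" by auto
 let ?G = "\<lambda>p. brauer_level p p"
 let ?b = "bv :: diagram => diagram => 'f"
 have bs: "?b \<sigma> \<in> sp (Lv p p)" if "\<sigma> \<in> ?G p" for \<sigma> p using that by (simp add: Lv_self)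
 have mult: "bcomp \<epsilon> p p p (?b \<sigma>) (?b \<tau>) = ?b (dcomp \<sigma> \<tau>)" if "\<sigma> \<in> ?G p" "\<tau> \<in> ?G p" for \<sigma> \<tau> p
  using that by (intro bcomp_basis_up) (simp_all add: level_iff upD)
 have Gm: "dcomp \<sigma> \<tau> \<in> ?G p" if "\<sigma> \<in> ?G p" "\<tau> \<in> ?G p" for \<sigma> \<tau> p
  using that by (simp add: level_eq(1) dcomp_up_up)
 \<comment> \<open>The pseudo-inverse conjugated by a permutation; \<open>flip \<sigma>\<close> is
   the inverse of \<open>\<sigma>\<close>.\<close>
 define t where "t p \<sigma> n = Fmap M p p (?b (flip \<sigma>)) (k p (Fmap N p p (?b \<sigma>) n))" for p \<sigma> n
 have t: "t p \<sigma> \<in> linear_maps (Fobj N p) (Fobj M p)" if p: "p \<preceq> r" and \<sigma>: "\<sigma> \<in> ?G p" for p \<sigma>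
  using linear_maps_comp[OF linear_maps_comp[OF S_modD(3)[OF N p p bs[OF \<sigma>]] k[OF p]] S_modD(3)[OF M p p bs[of "flip \<sigma>" p]]] \<sigma>
  by (simp add: t_def[abs_def])
 \<comment> \<open>Dividing by the group order is possible in characteristic 0.\<close>
 define \<theta> where "\<theta> p n = (1 / of_nat (card (?G p)) :: 'f) *[Fobj M p] finsum (Fobj M p) (\<lambda>\<sigma>. t p \<sigma> n) (?G p)" for p n
 have s: "(\<lambda>n. finsum (Fobj M p) (\<lambda>\<sigma>. t p \<sigma> n) (?G p)) \<in> linear_maps (Fobj N p) (Fobj M p)" if "p \<preceq> r" for p
  by (rule linear_maps_pointwise_finsum[OF Nm[OF that] Mm[OF that] _ t[OF that]]) simp_all
 have \<theta>: "\<theta> p \<in> linear_maps (Fobj N p) (Fobj M p)" if p: "p \<preceq> r" for p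
  unfolding \<theta>_def by (rule linear_mapsI) (simp_all add: linear_mapsD[OF s[OF p]] module_laws[OF Mm[OF p]])
 have nat: "\<theta> p (Fmap N p p \<tau> n) = Fmap M p p \<tau> (\<theta> p n)"
  if p: "p \<preceq> r" and n: "n \<in> car N p" and \<tau>: "\<tau> \<in> sp (Lv p p)" for p n \<tau>
 proof (rule linear_maps_free_eq[OF Mm[OF p] _ _ finite_Lv _ \<tau>])
  show "(\<lambda>\<tau>. \<theta> p (Fmap N p p \<tau> n)) \<in> linear_maps (free_module (Lv p p)) (Fobj M p)"
   by (rule linear_maps_comp[OF S_modD(4)[OF N p p n] \<theta>[OF p]])
  show "(\<lambda>\<tau>. Fmap M p p \<tau> (\<theta> p n)) \<in> linear_maps (free_module (Lv p p)) (Fobj M p)"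
   by (rule S_modD(4)[OF M p p linear_mapsD(1)[OF \<theta>[OF p] n]])
  fix \<tau> assume "\<tau> \<in> Lv p p"
  then have \<tau>: "\<tau> \<in> ?G p" by (simp add: Lv_self)
  then have \<tau>b: "\<tau> \<in> brauer p p" by (simp add: level_iff upD)
  interpret P: abelian_monoid "Fobj M p" by (rule module_laws(18)[OF Mm[OF p]])
  \<comment> \<open>Right translation permutes the group, so composing with \<open>\<tau>\<close>
    only reorders the sum.\<close>
  let ?h = "\<lambda>\<sigma>. dcomp \<sigma> \<tau>"
  have inj: "inj_on ?h (?G p)"
   by (rule inj_on_inverseI[of _ "\<lambda>\<sigma>. dcomp \<sigma> (flip \<tau>)"]) (simp add: dcomp_level_cancel_right[OF \<tau>, where q = p] level_iff upD)
  have im: "?h ` ?G p = ?G p" by (rule endo_inj_surj[OF _ _ inj]) (auto simp: Gm[OF _ \<tau>])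
  have tc: "t p \<sigma> n \<in> car M p" if "\<sigma> \<in> ?G p" for \<sigma> using linear_mapsD(1)[OF t[OF p that] n] .
  note M\<tau> = S_modD(3)[OF M p p bs[OF \<tau>]]
  have "t p \<sigma> (Fmap N p p (?b \<tau>) n) = Fmap M p p (?b \<tau>) (t p (?h \<sigma>) n)" if \<sigma>: "\<sigma> \<in> ?G p" for \<sigma>
  proof -
   have "dcomp \<tau> (flip (?h \<sigma>)) = flip \<sigma>"
    using \<sigma> \<tau> dcomp_flip(1)[of \<sigma> p p \<tau> p] dcomp_level_cancel_left[of "flip \<tau>" p "flip \<sigma>" p]
    by (simp add: level_iff upD)
   then have 1: "?b (flip \<sigma>) = bcomp \<epsilon> p p p (?b \<tau>) (?b (flip (?h \<sigma>)))"
    using mult[OF \<tau>, of "flip (?h \<sigma>)"] Gm[OF \<sigma> \<tau>] by simp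
   have 2: "Fmap N p p (?b \<sigma>) (Fmap N p p (?b \<tau>) n) = Fmap N p p (?b (?h \<sigma>)) n"
    using S_modD(5)[OF N p p p bs[OF \<tau>] bs[OF \<sigma>] n] mult[OF \<sigma> \<tau>] by simp
   have "k p (Fmap N p p (?b (?h \<sigma>)) n) \<in> car M p"
    using linear_mapsD(1)[OF k[OF p] S_modD(6)[OF N p p bs[OF Gm[OF \<sigma> \<tau>]] n]] .
   then show ?thesis unfolding t_def 1 2
    using S_modD(5)[OF M p p p bs[of "flip (?h \<sigma>)" p] bs[OF \<tau>]] Gm[OF \<sigma> \<tau>] by simp
  qed
  then have "finsum (Fobj M p) (\<lambda>\<sigma>. t p \<sigma> (Fmap N p p (?b \<tau>) n)) (?G p) = finsum (Fobj M p) (\<lambda>\<sigma>. Fmap M p p (?b \<tau>) (t p (?h \<sigma>) n)) (?G p)"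
   using tc Gm[OF _ \<tau>] linear_mapsD(1)[OF M\<tau>] by (intro P.finsum_cong') auto
  also have "... = Fmap M p p (?b \<tau>) (finsum (Fobj M p) (\<lambda>\<sigma>. t p (?h \<sigma>) n) (?G p))"
   using tc Gm[OF _ \<tau>] by (intro linear_maps_finsum[OF Mm[OF p] Mm[OF p] M\<tau>, symmetric]) auto
  also have "finsum (Fobj M p) (\<lambda>\<sigma>. t p (?h \<sigma>) n) (?G p) = finsum (Fobj M p) (\<lambda>\<sigma>. t p \<sigma> n) (?G p)"
   using P.finsum_reindex[of "\<lambda>\<sigma>. t p \<sigma> n" ?h "?G p"] inj im tc by (simp add: Pi_def)
  finally show "\<theta> p (Fmap N p p (?b \<tau>) n) = Fmap M p p (?b \<tau>) (\<theta> p n)"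
   unfolding \<theta>_def by (simp add: linear_mapsD(3)[OF M\<tau>] linear_mapsD(1)[OF s[OF p]] n)
 qed
 have reg: "\<eta> p (\<theta> p (\<eta> p m)) = \<eta> p m" if p: "p \<preceq> r" and m: "m \<in> car M p" for p m
 proof -
  interpret P: abelian_monoid "Fobj N p" by (rule module_laws(18)[OF Nm[OF p]])
  note H = linear_mapsD[OF h(1)[OF p]]
  have \<eta>m: "\<eta> p m \<in> car N p" by (rule H(1)[OF m])
  \<comment> \<open>Since \<open>\<eta>\<close> commutes with permutations, each conjugate is again
    a pseudo-inverse of \<open>\<eta> p\<close>; the condition is then inherited by the
    average.\<close>
  have \<eta>t: "\<eta> p (t p \<sigma> (\<eta> p m)) = \<eta> p m" if \<sigma>: "\<sigma> \<in> ?G p" for \<sigma>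
  proof -
   have f: "flip \<sigma> \<in> ?G p" using \<sigma> by simp
   have Mc: "Fmap M p p (?b \<sigma>) m \<in> car M p" by (rule S_modD(6)[OF M p p bs[OF \<sigma>] m])
   have "\<eta> p (t p \<sigma> (\<eta> p m)) = Fmap N p p (?b (flip \<sigma>)) (\<eta> p (k p (\<eta> p (Fmap M p p (?b \<sigma>) m))))"
    unfolding t_def using h(2)[OF p p bs[OF \<sigma>] m] h(2)[OF p p bs[OF f]] linear_mapsD(1)[OF k[OF p] H(1)[OF Mc]] by simp
   also have "... = \<eta> p (Fmap M p p (?b (flip \<sigma>)) (Fmap M p p (?b \<sigma>) m))"
    using \<eta>k[OF p Mc] h(2)[OF p p bs[OF f] Mc] by simp
   also have "Fmap M p p (?b (flip \<sigma>)) (Fmap M p p (?b \<sigma>) m) = m"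
    using S_modD(5)[OF M p p p bs[OF \<sigma>] bs[OF f] m] mult[OF f \<sigma>] S_modD(2)[OF M p m]
    by (simp add: dcomp_flip_level[OF \<sigma>])
   finally show ?thesis .
  qed
  have c: "card (?G p) ~= 0"
  proof -
   have "id_diagram p \<in> ?G p" by (simp add: level_eq(1) id_diagram_up)
   then show ?thesis by (auto simp: card_eq_0_iff)
  qed
  have "\<eta> p (finsum (Fobj M p) (\<lambda>\<sigma>. t p \<sigma> (\<eta> p m)) (?G p)) = finsum (Fobj N p) (\<lambda>\<sigma>. \<eta> p (t p \<sigma> (\<eta> p m))) (?G p)"
   using linear_mapsD(1)[OF t[OF p] \<eta>m] by (intro linear_maps_finsum[OF Mm[OF p] Nm[OF p] h(1)[OF p]]) auto
  also have "... = finsum (Fobj N p) (\<lambda>_. \<eta> p m) (?G p)" using \<eta>t \<eta>m by (intro P.finsum_cong') auto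
  also have "... = of_nat (card (?G p)) *[Fobj N p] \<eta> p m" by (rule finsum_constant[OF Nm[OF p] \<eta>m]) simp
  finally show ?thesis
   unfolding \<theta>_def using c \<eta>m
   by (simp add: H(3) linear_mapsD(1)[OF s[OF p]] module_laws[OF Nm[OF p]] flip: module_laws(11)[OF Nm[OF p]])
 qed
 have "(\<lambda>p\<in>Obj (St r \<epsilon>). restrict (\<theta> p) (car N p)) \<in> nat_trans (St r \<epsilon>) Md N M"
 proof (rule module_nat_transI[OF N M])
  fix p q g n assume "p \<in> Obj (St r \<epsilon>)" "q \<in> Obj (St r \<epsilon>)" "g \<in> Arr (St r \<epsilon>) p q" "n \<in> car N p"
  then have a: "p \<preceq> r" "q \<preceq> r" "g \<in> sp (Lv p q)" "n \<in> car N p" by (simp_all add: carrier_free)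
  show "\<theta> q (Fmap N p q g n) = Fmap M p q g (\<theta> p n)"
  proof (cases "p = q")
   case True
   then show ?thesis using nat a by simp
  next
   case False
   then have g: "g = (\<lambda>_. 0)" using project_Lv_diff[OF False, of g] project_sp[OF a(3)] by simp
   have "Fmap N p q g n = 0[Fobj N q]" "Fmap M p q g (\<theta> p n) = 0[Fobj M q]"
    unfolding g using linear_maps_zero[OF module_free Nm[OF a(2)] S_modD(4)[OF N a(1,2,4)]]
     linear_maps_zero[OF module_free Mm[OF a(2)] S_modD(4)[OF M a(1,2) linear_mapsD(1)[OF \<theta>[OF a(1)] a(4)]]] by simp_all
   then show ?thesis using linear_maps_zero[OF Nm Mm \<theta>] a by simp
  qed
 qed (simp add: \<theta>)
 then show ?thesis
  by (rule bexI[rotated]) (simp add: reg linear_mapsD(1)[OF h(1)])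
qed

section \<open>From an abstract Morita equivalence back to non-singularity\<close>

lemma inj_on_sp:
 fixes \<iota> :: "'k::comm_ring_1 => 'u"
 assumes \<iota>: "inj \<iota>" and inf: "infinite (UNIV :: 'u set)" and X: "finite X"
 shows "\<exists>e :: ('x => 'k) => 'u. inj_on e (sp X)"
proof -
 obtain e :: "('x => 'u) => 'u" where e: "inj_on e (extensional X)" using inj_on_extensional[OF inf X] by blast
 have "inj_on (\<lambda>f. e (\<lambda>x\<in>X. \<iota> (f x))) (sp X)"
 proof (rule inj_onI)
  fix f g :: "'x => 'k" assume f: "f \<in> sp X" and g: "g \<in> sp X" and "e (\<lambda>x\<in>X. \<iota> (f x)) = e (\<lambda>x\<in>X. \<iota> (g x))"
  then have eq: "(\<lambda>x\<in>X. \<iota> (f x)) = (\<lambda>x\<in>X. \<iota> (g x))" using e by (auto dest: inj_onD)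
  have "f x = g x" if "x \<in> X" for x using fun_cong[OF eq, of x] that \<iota> by (simp add: inj_eq)
  then show "f = g" using f g by (auto simp: sp_def fun_eq_iff) metis
 qed
 then show ?thesis by blast
qed

text \<open>The radical of the pairing is a submodule of \<open>B\<^sup>+(p, -)\<close>.  A retraction onto it kills the generator
 \<open>id\<^sub>p\<close>, because the radical vanishes at \<open>p\<close>; hence the radical is zero.\<close>

lemma non_singular_of_morita:
 fixes \<epsilon> :: "'f::field_char_0" and \<iota> :: "'f => 'u"
 assumes \<iota>: "inj \<iota>" and eq: "morita_equivalent TYPE('u) (Bt r \<epsilon>) (St r \<epsilon>)"
 shows "non_singular_upto \<epsilon> r"
 unfolding non_singular_upto_def
proof (intro allI impI)
 fix p q assume pq: "p \<preceq> q & q \<preceq> r"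
 then have p: "p \<preceq> r" and q: "q \<preceq> r" using parity_le_trans by blast+
 have inf: "infinite (UNIV :: 'u set)"
  using finite_imageD[of \<iota> UNIV] \<iota> infinite_UNIV_char_0[where 'a = 'f] finite_subset[of "range \<iota>" UNIV] by auto
 define act where "act s s' g x = pu p s' (bcomp \<epsilon> p s s' g x)" for s s' and g x :: "diagram => 'f"
 \<comment> \<open>The radical at \<open>s\<close>. It is stable under \<open>act\<close> because
   the truncated actions on \<open>B^+\<close> and \<open>B^-\<close> are adjoint for the
   pairing.\<close>
 define X where "X s = {x \<in> sp (Up p s). \<forall>y\<in>sp (Dn s p). pr \<epsilon> p s p y x = (\<lambda>_. 0)}" for s
 let ?V = "\<lambda>s. free_module (Up p s) :: ('f, diagram => 'f) module"
 let ?R = "\<lambda>s. (?V s)\<lparr>carrier := X s\<rparr>"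
 have Xsub: "x \<in> sp (Up p s)" if "x \<in> X s" for x s using that by (simp add: X_def)
 have act_sp: "act s s' g x \<in> sp (Up p s')" for s s' g x by (simp add: act_def)
 have act_X: "act s s' g x \<in> X s'" if g: "g \<in> sp (brauer s s')" and x: "x \<in> X s" for s s' g x
 proof -
  have "pr \<epsilon> p s' p y (act s s' g x) = (\<lambda>_. 0)" if y: "y \<in> sp (Dn s' p)" for y
  proof -
   have "pr \<epsilon> p s' p y (act s s' g x) = pr \<epsilon> p s p (pd s p (bcomp \<epsilon> s s' p y g)) x"
    using y g Xsub[OF x] by (simp add: act_def Lv_absorb_left Lv_absorb_right bcomp_assoc sp_up sp_down)
   then show ?thesis using x by (simp add: X_def)
  qed
  then show ?thesis using act_sp by (simp add: X_def)
 qed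
 have act_add: "act s s' g (\<lambda>d. x d + y d) = (\<lambda>d. act s s' g x d + act s s' g y d)"
  and act_scale: "act s s' g (\<lambda>d. c * x d) = (\<lambda>d. c * act s s' g x d)"
  and act_add': "act s s' (\<lambda>d. g d + g' d) x = (\<lambda>d. act s s' g x d + act s s' g' x d)"
  and act_scale': "act s s' (\<lambda>d. c * g d) x = (\<lambda>d. c * act s s' g x d)" for s s' g g' x y c
  by (simp_all add: act_def bcomp_add_left bcomp_add_right bcomp_scale_left bcomp_scale_right lin_add[OF lin_project] project_scale)
 have act_id: "act s s (bv (id_diagram s)) x = x" if "x \<in> sp (Up p s)" for s x
  using that by (simp add: act_def bcomp_id_left sp_up project_sp)
 have act_comp: "act s s'' (bcomp \<epsilon> s s' s'' h g) x = act s' s'' h (act s s' g x)"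
  if "g \<in> sp (brauer s s')" "h \<in> sp (brauer s' s'')" "x \<in> sp (Up p s)" for s s' s'' g h x
  using that by (simp add: act_def up_absorb bcomp_assoc sp_up)
 have Rm: "is_module (?R s)" for s
  by (rule is_module_restrict[OF module_free])
   (auto simp: X_def carrier_free add_sp scale_sp zero_sp bcomp_add_right bcomp_scale_right lin_add[OF lin_project] project_scale
    lin_zero[OF lin_project'[OF lin_bcomp_right]])
 let ?enc = "\<lambda>P Q (E :: nat => (diagram => 'f) => 'u). linear_functor (Bt r \<epsilon>) Md Q &
  (\<forall>x\<in>Obj (Bt r \<epsilon>). E x \<in> linear_maps (P x) (Fobj Q x) & bij_betw (E x) (carrier (P x)) (car Q x)) &
  (\<forall>x\<in>Obj (Bt r \<epsilon>). \<forall>y\<in>Obj (Bt r \<epsilon>). \<forall>g\<in>Arr (Bt r \<epsilon>) x y. \<forall>m\<in>carrier (P x). Fmap Q x y g (E x m) = E y (act x y g m))"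
 have inj: "\<exists>e :: (diagram => 'f) => 'u. inj_on e (sp (Up p s))" for s
  by (rule inj_on_sp[OF \<iota> inf]) simp
 have "\<exists>Q E. ?enc ?V Q E"
  by (rule encode_functor[OF linear_category_Bt module_free])
   (use inj in \<open>auto intro!: linear_mapsI simp: carrier_free act_sp act_add act_scale act_add' act_scale' act_id act_comp\<close>)
 then obtain V EV where VE: "?enc ?V V EV" by (elim exE)
 then have V: "linear_functor (Bt r \<epsilon>) Md V" by (rule conjunct1)
 have EV: "EV s \<in> linear_maps (?V s) (Fobj V s)" "bij_betw (EV s) (sp (Up p s)) (car V s)"
  if "s \<preceq> r" for s using VE that by (simp_all add: carrier_free)
 have VA: "Fmap V s s' g (EV s x) = EV s' (act s s' g x)"
  if "s \<preceq> r" "s' \<preceq> r" "g \<in> sp (brauer s s')" "x \<in> sp (Up p s)" for s s' g x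
  using VE that by (simp add: carrier_free)
 have injX: "\<exists>e :: (diagram => 'f) => 'u. inj_on e (X s)" for s
  using inj[of s] inj_on_subset[OF _ subsetI[OF Xsub]] by blast
 have "\<exists>Q E. ?enc ?R Q E"
  by (rule encode_functor[OF linear_category_Bt Rm])
   (use injX in \<open>auto intro!: linear_mapsI simp: carrier_free act_X act_add act_scale act_add' act_scale' act_id act_comp Xsub\<close>)
 then obtain R ER where RE: "?enc ?R R ER" by (elim exE)
 then have R: "linear_functor (Bt r \<epsilon>) Md R" by (rule conjunct1)
 have ER: "ER s \<in> linear_maps (?R s) (Fobj R s)" "bij_betw (ER s) (X s) (car R s)"
  if "s \<preceq> r" for s using RE that by simp_all
 have RA: "Fmap R s s' g (ER s x) = ER s' (act s s' g x)"
  if "s \<preceq> r" "s' \<preceq> r" "g \<in> sp (brauer s s')" "x \<in> X s" for s s' g x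
  using RE that by (simp add: carrier_free)
 define D where "D s = inv_into (X s) (ER s)" for s
 have DE: "D s (ER s x) = x" if "s \<preceq> r" "x \<in> X s" for s x
  using bij_betw_imp_inj_on[OF ER(2)[OF that(1)]] that(2) by (simp add: D_def)
 have Dlin: "D s \<in> linear_maps (Fobj R s) (?R s)" if "s \<preceq> r" for s
  using linear_maps_inv[OF Rm ER(1)[OF that]] ER(2)[OF that] by (simp add: D_def)
 let ?i = "\<lambda>s u. EV s (D s u)"
 let ?\<eta> = "\<lambda>s\<in>Obj (Bt r \<epsilon>). restrict (?i s) (car R s)"
 have onto: "\<exists>x\<in>X s. u = ER s x" if "s \<preceq> r" "u \<in> car R s" for s u
  using ER(2)[OF that(1)] that(2) by (auto simp: bij_betw_def)
 have i: "?\<eta> \<in> nat_trans (Bt r \<epsilon>) Md R V"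
 proof (rule module_nat_transI[OF R V])
  fix s assume "s \<in> Obj (Bt r \<epsilon>)"
  then have s: "s \<preceq> r" by simp
  have "(\<lambda>x. x) \<in> linear_maps (?R s) (?V s)" using Xsub by (auto intro!: linear_mapsI simp: carrier_free)
  from linear_maps_comp[OF linear_maps_comp[OF Dlin[OF s] this] EV(1)[OF s]]
  show "?i s \<in> linear_maps (Fobj R s) (Fobj V s)" .
 next
  fix s s' g u assume "s \<in> Obj (Bt r \<epsilon>)" "s' \<in> Obj (Bt r \<epsilon>)" "g \<in> Arr (Bt r \<epsilon>) s s'" "u \<in> car R s"
  then have a: "s \<preceq> r" "s' \<preceq> r" "g \<in> sp (brauer s s')" "u \<in> car R s" by (simp_all add: carrier_free)
  then obtain x where x: "x \<in> X s" "u = ER s x" using onto by blast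
  show "?i s' (Fmap R s s' g u) = Fmap V s s' g (?i s u)"
   using a x by (simp add: RA DE VA act_X Xsub)
 qed
 \<comment> \<open>Over the symmetric groups every morphism has a pseudo-inverse by averaging; the
   equivalence hands this on to the inclusion of the radical.\<close>
 have "\<exists>j\<in>Arr (functor_category (Bt r \<epsilon>) Md) V R.
   Comp (functor_category (Bt r \<epsilon>) Md) R V V (Comp (functor_category (Bt r \<epsilon>) Md) V R V ?\<eta> j) ?\<eta> = ?\<eta>"
 proof (rule regular_of_linearly_equivalent[OF eq[unfolded morita_equivalent_def]])
  fix M N :: "(nat, diagram => 'f, ('f, 'u) module, 'u => 'u) linfun" and \<eta>
  let ?S = "functor_category (St r \<epsilon>) (Md :: (('f, 'u) module, 'u => 'u, 'f) lincat)"
  assume "M \<in> Obj ?S" "N \<in> Obj ?S" "\<eta> \<in> Arr ?S M N"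
  then have M: "linear_functor (St r \<epsilon>) Md M" and N: "linear_functor (St r \<epsilon>) Md N"
   and \<eta>: "\<eta> \<in> nat_trans (St r \<epsilon>) Md M N" by simp_all
  note h = symmetric_natD[OF M N \<eta>]
  obtain \<theta> where \<theta>: "\<theta> \<in> nat_trans (St r \<epsilon>) Md N M"
   and reg: "\<And>p m. p \<preceq> r ==> m \<in> car M p ==> \<eta> p (\<theta> p (\<eta> p m)) = \<eta> p m"
   using symmetric_regular[OF M N \<eta>] by blast
  have "compose (car M p) (compose (car N p) (\<eta> p) (\<theta> p)) (\<eta> p) = \<eta> p" if "p \<preceq> r" for p
   using reg[OF that] h(4)[OF that] linear_mapsD(1)[OF h(1)[OF that]]
   by (intro extensionalityI[of _ "car M p"]) (auto simp: compose_def)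
  then have "Comp ?S M N N (Comp ?S N M N \<eta> \<theta>) \<eta> = \<eta>"
   using h(3) by (intro extensionalityI[of _ "{p. p \<preceq> r}"]) auto
  then show "\<exists>\<theta>\<in>Arr ?S N M. Comp ?S M N N (Comp ?S N M N \<eta> \<theta>) \<eta> = \<eta>" using \<theta> by auto
 qed (use R V i in simp_all)
 then obtain j where j: "j \<in> nat_trans (Bt r \<epsilon>) Md V R"
  and iji: "Comp (functor_category (Bt r \<epsilon>) Md) R V V (Comp (functor_category (Bt r \<epsilon>) Md) V R V ?\<eta> j) ?\<eta> = ?\<eta>"
  by auto
 note J = brauer_natD[OF V R j]
 let ?id = "bv (id_diagram p) :: diagram => 'f"
 let ?z = "EV p ?id"
 have idu: "?id \<in> sp (Up p p)" by (simp add: id_diagram_up)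
 have z: "?z \<in> car V p" using bij_betwE[OF EV(2)[OF p]] idu by blast
 \<comment> \<open>At \<open>p\<close> the identity diagram itself belongs to \<open>B^-\<close>,
   and pairing with it returns \<open>x\<close>.\<close>
 have Xp: "x = (\<lambda>_. 0)" if x: "x \<in> X p" for x
 proof -
  have "?id \<in> sp (Dn p p)" by (simp add: id_diagram_down)
  then have "pr \<epsilon> p p p ?id x = (\<lambda>_. 0)" using x by (simp add: X_def)
  moreover have "x \<in> sp (Lv p p)" using Xsub[OF x] by (simp add: Lv_self level_eq(1))
  ultimately show ?thesis by (simp add: bcomp_id_left sp_Lv project_sp)
 qed
 have zX: "(\<lambda>_. 0) \<in> X s" for s by (simp add: X_def zero_sp lin_zero[OF lin_project'[OF lin_bcomp_right]])
 have ER0: "ER s (\<lambda>_. 0) = 0[Fobj R s]" if "s \<preceq> r" for s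
  using linear_maps_zero[OF Rm B_modD(1)[OF R that] ER(1)[OF that]] by simp
 obtain x0 where "x0 \<in> X p" "j p ?z = ER p x0" using onto[OF p linear_mapsD(1)[OF J(1)[OF p] z]] by blast
 then have jz: "j p ?z = ER p (\<lambda>_. 0)" using Xp by simp
 have radical: "x = (\<lambda>_. 0)" if x: "x \<in> X q" for x
 proof -
  have xs: "x \<in> sp (brauer p q)" using Xsub[OF x] by (rule sp_up)
  \<comment> \<open>\<open>x\<close> is obtained from the generator \<open>id_p\<close> by acting
    with the arrow \<open>x\<close>, so \<open>j\<close> of it is obtained from \<open>j\<close> of
    the generator, which is zero.\<close>
  have "act p q x ?id = x" using Xsub[OF x] by (simp add: act_def bcomp_id_right sp_up project_sp)
  then have "EV q x = Fmap V p q x ?z" using VA[OF p q xs idu] by simp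
  then have "j q (EV q x) = Fmap R p q x (ER p (\<lambda>_. 0))" using J(2)[OF p q xs z] jz by simp
  also have "... = ER q (\<lambda>_. 0)"
   using RA[OF p q xs zX] act_scale[of p q x 0 "\<lambda>_. 0"] by simp
  finally have jx: "j q (EV q x) = ER q (\<lambda>_. 0)" .
  have xR: "ER q x \<in> car R q" using bij_betwE[OF ER(2)[OF q]] x by blast
  have xV: "EV q x \<in> car V q" using bij_betwE[OF EV(2)[OF q]] Xsub[OF x] by blast
  have R0: "ER q (\<lambda>_. 0) \<in> car R q" using bij_betwE[OF ER(2)[OF q]] zX by blast
  \<comment> \<open>For the inclusion \<open>i\<close> the relation \<open>i j i = i\<close>,
    evaluated at \<open>x\<close>, identifies \<open>x\<close> with its image under
    \<open>j\<close>, and this image is zero.\<close>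
  have "EV q (\<lambda>_. 0) = EV q x"
   using fun_cong[OF fun_cong[OF iji, of q], of "ER q x"] q xR xV R0
   by (simp add: compose_def DE[OF q x] DE[OF q zX] jx)
  then show ?thesis
   using bij_betw_imp_inj_on[OF EV(2)[OF q]] Xsub[OF x] by (auto dest: inj_onD simp: zero_sp)
 qed
 show "non_singular_at \<epsilon> p q"
 proof (rule non_singular_of_injective)
  fix x assume x: "x \<in> sp (Up p q)" and h0: "\<And>h. h \<in> Um p q ==> pr \<epsilon> p q p (bv (flip h)) x = (\<lambda>_. 0)"
  \<comment> \<open>The radical tests against all of \<open>B^-(q, p)\<close>; by left linearity
    over level diagrams the elements \<open>flip h\<close> decide.\<close>
  have "pr \<epsilon> p q p y x = (\<lambda>_. 0)" if y: "y \<in> sp (Dn q p)" for y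
  proof (rule lin_ext[where T = "\<lambda>y. pr \<epsilon> p q p y x" and T' = "\<lambda>_ _. 0", OF _ _ finite_down y])
   fix d assume "d \<in> Dn q p"
   then obtain k \<sigma> where k: "k \<in> Um p q" and \<sigma>: "\<sigma> \<in> brauer_level p p" and d: "d = dcomp \<sigma> (flip k)"
    using down_factor_exists by blast
   have fk: "flip k \<in> Dn q p" using k by (simp add: up_monoD)
   have "\<sigma> \<in> Lv p p" using \<sigma> by (simp add: Lv_self)
   then have b: "bv d = bcomp \<epsilon> q p p (bv \<sigma>) (bv (flip k))" and \<sigma>s: "bv \<sigma> \<in> sp (Lv p p)"
    unfolding d using bcomp_basis_down[OF _ fk, of \<sigma> p \<epsilon>] Lv_sub(3)[of p p] by auto
   show "pr \<epsilon> p q p (bv d) x = (\<lambda>_. 0)"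
    unfolding b using Lv_pr_left[OF \<sigma>s, of "bv (flip k)" q x p \<epsilon>] fk x h0[OF k]
    by (simp add: downD sp_up lin_zero[OF lin_bcomp_right])
  qed (intro lin_intros lin_const)+
  then show "x = (\<lambda>_. 0)" using x by (intro radical) (simp add: X_def)
 qed
qed

text \<open>An injective \<open>\<iota>\<close> makes the universe at least as large as the field.
  It is then infinite, as the encoding of coinduced modules requires, and it has room for the spaces
  \<open>B^+(p, s)\<close> and their radicals, on which the converse relies.\<close>

theorem theorem2:
  fixes \<delta> :: "'k::comm_ring_1" and \<epsilon> :: "'f::field_char_0" and r :: nat
    and \<iota> :: "'f \<Rightarrow> 'u"
  shows
    "(non_singular_upto \<delta> r \<longleftrightarrow>
        gives_morita_equivalence (truncate r (brauer_category \<delta>)) (truncate r (symmetric_category \<delta>))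
          (up_bimodule \<delta>) (down_bimodule \<delta>)) \<and>
     (non_singular_upto \<delta> r \<longleftrightarrow>
        category_isomorphism (truncate r (brauer_category \<delta>)) (truncate r matrix_brauer_category)
          (L_functor \<delta>)) \<and>
     (inj \<iota> \<longrightarrow>
       (non_singular_upto \<epsilon> r \<longleftrightarrow>
          morita_equivalent TYPE('u)
            (truncate r (brauer_category \<epsilon>)) (truncate r (symmetric_category \<epsilon>))))"
proof (intro conjI impI iffI)
 assume "non_singular_upto \<delta> r"
 then interpret non_singular \<delta> r by unfold_locales
 show "gives_morita_equivalence (Bt r \<delta>) (St r \<delta>) (up_bimodule \<delta>) (down_bimodule \<delta>)" by (rule morita_bimodules)
 show "category_isomorphism (Bt r \<delta>) (truncate r matrix_brauer_category) (L_functor \<delta>)" by (rule L_isomorphism)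
next
 assume "gives_morita_equivalence (Bt r \<delta>) (St r \<delta>) (up_bimodule \<delta>) (down_bimodule \<delta>)"
 then show "non_singular_upto \<delta> r" unfolding gives_morita_equivalence_def by (intro non_singular_of_bimodules) blast
next
 assume "category_isomorphism (Bt r \<delta>) (truncate r matrix_brauer_category) (L_functor \<delta>)"
 then show "non_singular_upto \<delta> r" by (rule non_singular_of_L_isomorphism)
next
 assume \<iota>: "inj \<iota>" and "non_singular_upto \<epsilon> r"
 then interpret non_singular \<epsilon> r by unfold_locales
 have "infinite (UNIV :: 'u set)"
  using finite_imageD[of \<iota> UNIV] \<iota> infinite_UNIV_char_0[where 'a = 'f] finite_subset[of "range \<iota>" UNIV] by auto
 then show "morita_equivalent TYPE('u) (Bt r \<epsilon>) (St r \<epsilon>)" by (rule morita_equivalence)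
next
 assume "inj \<iota>" "morita_equivalent TYPE('u) (Bt r \<epsilon>) (St r \<epsilon>)"
 then show "non_singular_upto \<epsilon> r" by (rule non_singular_of_morita)
qed

end
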